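(* Assume (Y2) and let $c \in L^1(U)$ with $c \geq 0$ in $U$. Let $K_1\ge1$ be the constant described in the context. Then: (i) If $v \in H^{1,2}_0(U)$ with $cv \in L^1(U)$ satisfies $\int_U \big(\langle A \nabla v, \nabla \psi \rangle + \langle \mathbf{H}, \nabla v \rangle \psi + cv \psi\big) dx=0$ for all $\psi \in C_0^{\infty}(U)$, then $v=0$ a.e. in $U$. (ii) If $c \in L^{\frac{2d}{d+2}}(U)$ and $f \in L^{\frac{2d}{d+2}}(U)$, then there exists $u \in H^{1,2}_0(U)$ such that $\int_U \big(\langle A \nabla u, \nabla \psi \rangle + \langle \mathbf{H}, \nabla u \rangle \psi + cu \psi\big) dx = \int_U f \psi \, dx$ for all $\psi \in C_0^{\infty}(U)$, and $$\| \nabla u \|_{L^2(U)} \leq \tilde{C}_1 \|f\|_{L^{\frac{2d}{d+2}}(U)}, \qquad \|u\|_{L^{\frac{2d}{d-2}}(U)} \leq C_1 \|f\|_{L^{\frac{2d}{d+2}}(U)},$$ where $\tilde C_1>0$ depends only on $d$, $\lambda$, $M$, $K_1$, and $C_1:=\frac{2(d-1)}{d-2}\tilde C_1$. (iii) If $f \in L^{\frac{\hat{p}d}{d+\hat{p}}}(U)$ for some $\hat{p} \in (d, \infty)$ (with only $c\in L^1(U)$, $c\ge0$), then there exists $u \in H^{1,2}_0(U) \cap L^{\infty}(U)$ satisfying the same weak formulation and the two estimates of (ii), and moreover $$\| u \|_{L^\infty(U)} \leq C_2 \|f\|_{L^{\frac{\hat{p}d}{d+\hat{p}}}(U)},$$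 where $C_2>0$ depends only on $d$, $\lambda$, $M$, $\hat{p}$, $|U|$ and $K_1$.
   Context: Condition (Y2): $U$ is a bounded open subset of $\mathbb{R}^d$ with $d \ge 3$, $\mathbf{H} \in L^{p}(U, \mathbb{R}^d)$ for some $p \in (d, \infty)$, and $A = (a_{ij})_{1 \le i,j \le d}$ is a (possibly non-symmetric) matrix of measurable functions on $\mathbb{R}^d$ for which there exist constants $M>0$, $\lambda>0$ with $\langle A(x) \xi, \xi \rangle \geq \lambda \| \xi \|^2$ and $\max_{i,j} |a_{ij}(x)| \leq M$ for a.e. $x \in \mathbb{R}^d$ and all $\xi \in \mathbb{R}^d$. The constant $K_1\ge 1$: under (Y2) there exist $\rho\in H^{1,2}(U)\cap C(\overline U)$ with $\rho>0$ on $\overline U$, $\max_{\overline U}\rho\ge1$, and $\int_U\langle A^T\nabla\rho+\rho\mathbf H,\nabla\varphi\rangle dx=0$ for all $\varphi\in C_0^\infty(U)$, together with a constant $K_1\ge1$ depending only on $d,\lambda,M,U,p,\|\mathbf H\|_{L^p(U)}$ such that $1\le\max_{\overline U}\rho\le K_1\min_{\overline U}\rho\le K_1$. $|U|$ denotes the Lebesgue measure of $U$. *)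

theory Defs
  imports "HOL-Analysis.Analysis"
begin

text \<open>Functions on R^d are modelled as functions on the type real^'n, d = CARD('n).\<close>

definition dpart :: "'n::finite \<Rightarrow> (real^'n \<Rightarrow> real) \<Rightarrow> real^'n \<Rightarrow> real" where
  "dpart i f x = frechet_derivative f (at x) (axis i 1)"

fun iter_dpart :: "'n::finite list \<Rightarrow> (real^'n \<Rightarrow> real) \<Rightarrow> real^'n \<Rightarrow> real" where
  "iter_dpart [] f = f"
| "iter_dpart (i # is) f = dpart i (iter_dpart is f)"

definition smooth_fun :: "(real^'n::finite \<Rightarrow> real) \<Rightarrow> bool" where
  "smooth_fun f \<longleftrightarrow> (\<forall>is x. iter_dpart is f differentiable (at x))"

definition grad :: "(real^'n::finite \<Rightarrow> real) \<Rightarrow> real^'n \<Rightarrow> real^'n" where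
  "grad f x = (\<chi> i. dpart i f x)"

definition tsupport :: "(real^'n::finite \<Rightarrow> real) \<Rightarrow> (real^'n) set" where
  "tsupport f = closure {x. f x \<noteq> 0}"

definition test_fun :: "(real^'n::finite) set \<Rightarrow> (real^'n \<Rightarrow> real) \<Rightarrow> bool" where
  "test_fun U \<phi> \<longleftrightarrow> smooth_fun \<phi> \<and> compact (tsupport \<phi>) \<and> tsupport \<phi> \<subseteq> U"

definition Lp :: "(real^'n::finite) set \<Rightarrow> real \<Rightarrow> (real^'n \<Rightarrow> real) \<Rightarrow> bool" where
  "Lp U p f \<longleftrightarrow> f \<in> borel_measurable (lebesgue_on U) \<and>
     integrable (lebesgue_on U) (\<lambda>x. \<bar>f x\<bar> powr p)"

definition LpV :: "(real^'n::finite) set \<Rightarrow> real \<Rightarrow> (real^'n \<Rightarrow> real^'n) \<Rightarrow> bool" where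
  "LpV U p F \<longleftrightarrow> F \<in> borel_measurable (lebesgue_on U) \<and>
     integrable (lebesgue_on U) (\<lambda>x. norm (F x) powr p)"

definition Lp_norm :: "(real^'n::finite) set \<Rightarrow> real \<Rightarrow> (real^'n \<Rightarrow> real) \<Rightarrow> real" where
  "Lp_norm U p f = (\<integral>x. \<bar>f x\<bar> powr p \<partial>lebesgue_on U) powr (1 / p)"

definition LpV_norm :: "(real^'n::finite) set \<Rightarrow> real \<Rightarrow> (real^'n \<Rightarrow> real^'n) \<Rightarrow> real" where
  "LpV_norm U p F = (\<integral>x. norm (F x) powr p \<partial>lebesgue_on U) powr (1 / p)"

definition Linf :: "(real^'n::finite) set \<Rightarrow> (real^'n \<Rightarrow> real) \<Rightarrow> bool" where
  "Linf U f \<longleftrightarrow> f \<in> borel_measurable (lebesgue_on U) \<and>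
     (\<exists>C. AE x in lebesgue_on U. \<bar>f x\<bar> \<le> C)"

definition Linf_norm :: "(real^'n::finite) set \<Rightarrow> (real^'n \<Rightarrow> real) \<Rightarrow> real" where
  "Linf_norm U f = Inf {C. 0 \<le> C \<and> (AE x in lebesgue_on U. \<bar>f x\<bar> \<le> C)}"

definition H12 :: "(real^'n::finite) set \<Rightarrow> (real^'n \<Rightarrow> real) \<Rightarrow> (real^'n \<Rightarrow> real^'n) \<Rightarrow> bool" where
  "H12 U v g \<longleftrightarrow> Lp U 2 v \<and> LpV U 2 g \<and>
     (\<forall>\<phi> i. test_fun U \<phi> \<longrightarrow>
        (\<integral>x. v x * dpart i \<phi> x \<partial>lebesgue_on U) = - (\<integral>x. g x $ i * \<phi> x \<partial>lebesgue_on U))"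

definition H012 :: "(real^'n::finite) set \<Rightarrow> (real^'n \<Rightarrow> real) \<Rightarrow> (real^'n \<Rightarrow> real^'n) \<Rightarrow> bool" where
  "H012 U v g \<longleftrightarrow> H12 U v g \<and>
     (\<exists>\<phi> :: nat \<Rightarrow> real^'n \<Rightarrow> real. (\<forall>k. test_fun U (\<phi> k)) \<and>
        ((\<lambda>k. \<integral>x. (\<phi> k x - v x)\<^sup>2 \<partial>lebesgue_on U) \<longlonglongrightarrow> 0) \<and>
        ((\<lambda>k. \<integral>x. (norm (grad (\<phi> k) x - g x))\<^sup>2 \<partial>lebesgue_on U) \<longlonglongrightarrow> 0))"

definition Y2 :: "(real^'n::finite) set \<Rightarrow> (real^'n \<Rightarrow> real^'n^'n) \<Rightarrow> (real^'n \<Rightarrow> real^'n)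
    \<Rightarrow> real \<Rightarrow> real \<Rightarrow> real \<Rightarrow> bool" where
  "Y2 U A H p lam M \<longleftrightarrow> CARD('n) \<ge> 3 \<and> bounded U \<and> open U \<and>
     real CARD('n) < p \<and> LpV U p H \<and>
     (\<forall>i j. (\<lambda>x. A x $ i $ j) \<in> borel_measurable lebesgue) \<and>
     M > 0 \<and> lam > 0 \<and>
     (AE x in lebesgue. (\<forall>\<xi>. (A x *v \<xi>) \<bullet> \<xi> \<ge> lam * (norm \<xi>)\<^sup>2) \<and>
                        (\<forall>i j. \<bar>A x $ i $ j\<bar> \<le> M))"

definition rho_K1 :: "(real^'n::finite) set \<Rightarrow> (real^'n \<Rightarrow> real^'n^'n) \<Rightarrow> (real^'n \<Rightarrow> real^'n)
    \<Rightarrow> (real^'n \<Rightarrow> real) \<Rightarrow> real \<Rightarrow> bool" where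
  "rho_K1 U A H \<rho> K1 \<longleftrightarrow> K1 \<ge> 1 \<and>
     continuous_on (closure U) \<rho> \<and> (\<forall>x\<in>closure U. \<rho> x > 0) \<and>
     (\<exists>g\<rho>. H12 U \<rho> g\<rho> \<and>
        (\<forall>\<phi>. test_fun U \<phi> \<longrightarrow>
           (\<integral>x. (transpose (A x) *v g\<rho> x + \<rho> x *\<^sub>R H x) \<bullet> grad \<phi> x \<partial>lebesgue_on U) = 0)) \<and>
     1 \<le> Sup (\<rho> ` closure U) \<and>
     Sup (\<rho> ` closure U) \<le> K1 * Inf (\<rho> ` closure U) \<and>
     K1 * Inf (\<rho> ` closure U) \<le> K1"

definition bform :: "(real^'n::finite) set \<Rightarrow> (real^'n \<Rightarrow> real^'n^'n) \<Rightarrow> (real^'n \<Rightarrow> real^'n)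
    \<Rightarrow> (real^'n \<Rightarrow> real) \<Rightarrow> (real^'n \<Rightarrow> real) \<Rightarrow> (real^'n \<Rightarrow> real^'n) \<Rightarrow> (real^'n \<Rightarrow> real) \<Rightarrow> real" where
  "bform U A H c v g \<psi> =
     (\<integral>x. (A x *v g x) \<bullet> grad \<psi> x + (H x \<bullet> g x) * \<psi> x + c x * v x * \<psi> x \<partial>lebesgue_on U)"

end

theory Submission
  imports Defs
begin

text \<open>
  Testing the equation with \<open>\<rho> \<phi>\<close> turns it into a form with principal part \<open>\<rho> A\<close> and drift
  \<open>F = A\<^sup>T \<nabla>\<rho> + \<rho> H\<close>, which is divergence free and in \<open>L\<^sup>2\<close>. Hence the drift contributes nothing
  when the equation is tested with a function of the solution, and the form is coercive.
  As \<open>F\<close> is merely in \<open>L\<^sup>2\<close>, the form is continuous only in its first argument, so existence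
  comes from Lions' theorem, in the completion of the test functions under
  \<open>\<integral> |\<nabla>\<phi>|\<^sup>2 + \<integral> c \<phi>\<^sup>2\<close>; this needs no more than \<open>c \<in> L\<^sup>1\<close>, so parts (ii) and (iii) use the same
  solution. Mollifying \<open>\<rho>\<close> to \<open>\<rho>\<^sub>k\<close> and testing with \<open>\<rho>\<^sub>k \<phi>\<close> and \<open>\<phi> / \<rho>\<^sub>k\<close> passes between the two
  weak formulations.

  Testing with smooth truncations \<open>T u\<close>, \<open>0 \<le> T' \<le> 1\<close>, bounds the square of the \<open>L\<^bsup>2d/(d-2)\<^esup>\<close>
  norm of \<open>T u\<close> by a multiple of \<open>\<integral> |f| |T u|\<close>. For \<open>f = 0\<close> this is uniqueness, and truncating at
  growing levels gives the sup bound by Stampacchia's iteration. The Sobolev constant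
  \<open>2 (d - 1) / (d - 2)\<close> is that of Gagliardo's proof from the Loomis--Whitney inequality.
\<close>

section \<open>The Loomis--Whitney inequality\<close>

text \<open>The drift term drops out because \<open>T(u) * grad u\<close> is the gradient of
  \<open>P(u)\<close> for a primitive \<open>P\<close> of \<open>T\<close>; applied to a test
  function, \<open>P\<close> gives a test function again, so the divergence condition is available
  as it stands. The truncation \<open>T\<close> has to be bounded, since F . grad u is a product of
  two L^2 functions and hence merely integrable, and smooth to every order, since test functions
  are. Truncations are therefore built from exp(-1/t) and carried along as the sequence of all their
  derivatives. Only the ratio of the maximum to the minimum of \<rho>, at most \<open>K1\<close>,
  survives in the estimates: the weight costs a factor max \<rho> on the right-hand side and yields
  min \<rho> on the left. The factor \<open>min lam 1\<close> in the gradient bound is the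
  coercivity constant in an energy norm that gives the potential term weight one. The exponent ph *
  d / (d + ph) of the sup bound exceeds d/2 exactly when ph > d, and d/2 is the threshold above
  which Stampacchia's recursion is superlinear.\<close>

definition epow :: "ennreal \<Rightarrow> real \<Rightarrow> ennreal" where
  "epow x a = (if x = \<infinity> then \<infinity> else ennreal (enn2real x powr a))"

lemma epow_ennreal [simp]: "0 \<le> r \<Longrightarrow> epow (ennreal r) a = ennreal (r powr a)"
  by (simp add: epow_def)

lemma epow_0 [simp]: "epow 0 a = 0"
  by (simp add: epow_def)

lemma epow_top [simp]: "epow \<infinity> a = \<infinity>" "epow top a = top"
  by (simp_all add: epow_def)

lemma epow_1 [simp]: "epow x 1 = x"
  by (cases x) (simp_all add: epow_def)

text \<open>Valid for every real exponent, zero and negative ones included, because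
  \<open>0 powr a = 0\<close> and infinity is always mapped to itself.\<close>

lemma epow_eq_0_iff [simp]: "epow x a = 0 \<longleftrightarrow> x = 0"
  by (cases x) (auto simp: epow_def ennreal_eq_0_iff)

lemma epow_measurable [measurable]:
  assumes [measurable]: "f \<in> borel_measurable M"
  shows "(\<lambda>x. epow (f x) a) \<in> borel_measurable M"
  unfolding epow_def by measurable

lemma epow_mono: "0 \<le> a \<Longrightarrow> x \<le> y \<Longrightarrow> epow x a \<le> epow y a"
  by (cases x; cases y) (auto simp: powr_mono2 ennreal_leI top_unique)

lemma epow_mult: "0 < a \<Longrightarrow> epow (x * y) a = epow x a * epow y a"
  by (cases x; cases y)
    (auto simp: powr_mult simp flip: ennreal_mult' simp: ennreal_mult_top ennreal_top_mult ennreal_eq_0_iff)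

lemma epow_epow: "epow (epow x a) b = epow x (a * b)"
  by (cases x) (auto simp: powr_powr)

lemma epow_prod: "0 < a \<Longrightarrow> epow (\<Prod>i\<in>I. f i) a = (\<Prod>i\<in>I. epow (f i) a)"
proof (induction I rule: infinite_finite_induct)
  case empty
  have "epow (ennreal 1) a = 1" by (subst epow_ennreal) auto
  then show ?case by simp
next
  case (infinite A)
  have "epow (ennreal 1) a = 1" by (subst epow_ennreal) auto
  then show ?case using infinite by simp
qed (simp add: epow_mult)

section \<open>Weighted means and Hoelder's inequality for finitely many factors\<close>

text \<open>Jensen's inequality for the convex function exp at the points \<open>ln (x i)\<close>. A
  vanishing \<open>x i\<close> has no such logarithm, but makes the left side zero.\<close>

lemma weighted_am_gm:
  fixes x a :: "'i \<Rightarrow> real"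
  assumes "finite I" "I \<noteq> {}" and a: "\<And>i. i \<in> I \<Longrightarrow> 0 < a i" "(\<Sum>i\<in>I. a i) = 1"
    and x: "\<And>i. i \<in> I \<Longrightarrow> 0 \<le> x i"
  shows "(\<Prod>i\<in>I. x i powr a i) \<le> (\<Sum>i\<in>I. a i * x i)"
proof (cases "\<exists>i\<in>I. x i = 0")
  case True
  then have "(\<Prod>i\<in>I. x i powr a i) = 0" using assms(1) by (auto intro!: prod_zero)
  moreover have "0 \<le> (\<Sum>i\<in>I. a i * x i)" using a x by (intro sum_nonneg) (simp add: less_imp_le)
  ultimately show ?thesis by simp
next
  case False
  then have xp: "\<And>i. i \<in> I \<Longrightarrow> 0 < x i" using x by force
  have "(\<Prod>i\<in>I. x i powr a i) = exp (\<Sum>i\<in>I. a i * ln (x i))"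
    unfolding exp_sum[OF assms(1)] using xp by (intro prod.cong) (force simp: powr_def)+
  also have "\<dots> \<le> (\<Sum>i\<in>I. a i * exp (ln (x i)))"
    using convex_on_sum[OF assms(1,2) exp_convex, of a "\<lambda>i. ln (x i)"] a by (simp add: less_imp_le)
  also have "\<dots> = (\<Sum>i\<in>I. a i * x i)" using xp by (intro sum.cong) auto
  finally show ?thesis .
qed

lemma epow_am_gm:
  fixes x :: "'i \<Rightarrow> ennreal" and a :: "'i \<Rightarrow> real"
  assumes I: "finite I" "I \<noteq> {}" and a: "\<And>i. i \<in> I \<Longrightarrow> 0 < a i" "(\<Sum>i\<in>I. a i) = 1"
  shows "(\<Prod>i\<in>I. epow (x i) (a i)) \<le> (\<Sum>i\<in>I. ennreal (a i) * x i)"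
proof (cases "\<exists>i\<in>I. x i = \<infinity>")
  case True
  then obtain i where i: "i \<in> I" "x i = \<infinity>" by auto
  have "\<infinity> = ennreal (a i) * x i" using i a by (simp add: ennreal_mult_top ennreal_eq_0_iff not_le)
  also have "\<dots> \<le> (\<Sum>i\<in>I. ennreal (a i) * x i)"
    using i I by (intro member_le_sum) auto
  finally show ?thesis by (simp add: top_unique)
next
  case False
  then have xe: "\<And>i. i \<in> I \<Longrightarrow> x i = ennreal (enn2real (x i))" by (simp add: less_top)
  have "(\<Prod>i\<in>I. epow (x i) (a i)) = (\<Prod>i\<in>I. ennreal (enn2real (x i) powr a i))"
    using False by (intro prod.cong) (auto simp: epow_def)
  also have "\<dots> = ennreal (\<Prod>i\<in>I. enn2real (x i) powr a i)" by (simp add: prod_ennreal)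
  also have "\<dots> \<le> ennreal (\<Sum>i\<in>I. a i * enn2real (x i))"
    using weighted_am_gm[OF I a, of "\<lambda>i. enn2real (x i)"] by (intro ennreal_leI) auto
  also have "\<dots> = (\<Sum>i\<in>I. ennreal (a i * enn2real (x i)))"
    using a by (subst sum_ennreal) (auto simp: less_imp_le)
  also have "\<dots> = (\<Sum>i\<in>I. ennreal (a i) * x i)"
    using a xe by (intro sum.cong) (auto simp: ennreal_mult less_imp_le)
  finally show ?thesis .
qed

text \<open>After each factor is divided by its integral, the pointwise mean inequality integrates
  to at most one. The normalisation fails only in degenerate cases: a zero integral makes the
  product vanish almost everywhere, and otherwise an infinite integral makes the right side
  infinite.\<close>

lemma nn_integral_Holder:
  fixes g :: "'i \<Rightarrow> 'a \<Rightarrow> ennreal"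
  assumes I: "finite I" "I \<noteq> {}" and a: "\<And>i. i \<in> I \<Longrightarrow> 0 < a i" "(\<Sum>i\<in>I. a i) = 1"
    and g[measurable]: "\<And>i. i \<in> I \<Longrightarrow> g i \<in> borel_measurable M"
  shows "(\<integral>\<^sup>+x. (\<Prod>i\<in>I. epow (g i x) (a i)) \<partial>M) \<le> (\<Prod>i\<in>I. epow (\<integral>\<^sup>+x. g i x \<partial>M) (a i))"
proof -
  let ?G = "\<lambda>i. \<integral>\<^sup>+x. g i x \<partial>M"
  consider (zero) i where "i \<in> I" "?G i = 0" | (top) i where "i \<in> I" "?G i = \<infinity>" "\<And>j. j \<in> I \<Longrightarrow> ?G j \<noteq> 0"
    | (fin) "\<And>j. j \<in> I \<Longrightarrow> ?G j \<noteq> 0 \<and> ?G j \<noteq> \<infinity>" by blast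
  then show ?thesis
  proof cases
    case zero
    then have "AE x in M. g i x = 0" by (subst nn_integral_0_iff_AE[symmetric]) auto
    then have "AE x in M. (\<Prod>i\<in>I. epow (g i x) (a i)) = 0"
      by eventually_elim (use zero I in \<open>auto intro!: prod_zero\<close>)
    then have "(\<integral>\<^sup>+x. (\<Prod>i\<in>I. epow (g i x) (a i)) \<partial>M) = 0"
      by (subst nn_integral_0_iff_AE) auto
    then show ?thesis by simp
  next
    case top
    have "(\<Prod>j\<in>I. epow (?G j) (a j)) = epow (?G i) (a i) * (\<Prod>j\<in>I - {i}. epow (?G j) (a j))"
      using top I by (simp add: prod.remove)
    also have "\<dots> = \<infinity>" using top I by (simp add: ennreal_top_mult)
    finally show ?thesis by (metis ennreal_top_neq_zero infinity_ennreal_def top_greatest)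
  next
    case fin
    define N where "N i = enn2real (?G i)" for i
    have N: "?G i = ennreal (N i)" "N i > 0" if "i \<in> I" for i
      using fin[OF that] by (auto simp: N_def less_top enn2real_positive_iff not_gr_zero zero_less_iff_neq_zero)
    define P where "P = (\<Prod>i\<in>I. N i powr a i)"
    have P: "P > 0" unfolding P_def using N by (intro prod_pos) (auto intro: powr_gt_zero[THEN iffD2] simp: less_imp_neq[symmetric])
    have eq: "epow (g i x) (a i) = ennreal (N i powr a i) * epow (g i x / N i) (a i)" if "i \<in> I" for i x
    proof -
      have "g i x = ennreal (N i) * (g i x / ennreal (N i))"
        using N(2)[OF that] by (metis ennreal_eq_0_iff ennreal_less_top ennreal_times_divide mult.commute mult_divide_eq_ennreal not_le less_irrefl)
      then have "epow (g i x) (a i) = epow (ennreal (N i)) (a i) * epow (g i x / N i) (a i)"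
        using a that by (metis epow_mult)
      then show ?thesis using N(2)[OF that] by simp
    qed
    have "(\<integral>\<^sup>+x. (\<Prod>i\<in>I. epow (g i x) (a i)) \<partial>M)
        = (\<integral>\<^sup>+x. ennreal P * (\<Prod>i\<in>I. epow (g i x / N i) (a i)) \<partial>M)"
      by (intro nn_integral_cong) (simp add: eq P_def prod.distrib prod_ennreal cong: prod.cong)
    also have "\<dots> \<le> (\<integral>\<^sup>+x. ennreal P * (\<Sum>i\<in>I. ennreal (a i) * (g i x / N i)) \<partial>M)"
      by (intro nn_integral_mono mult_left_mono epow_am_gm I a) auto
    also have "\<dots> = ennreal P * (\<Sum>i\<in>I. ennreal (a i) * (?G i / N i))"
      by (simp add: nn_integral_cmult nn_integral_sum nn_integral_divide)
    also have "(\<Sum>i\<in>I. ennreal (a i) * (?G i / N i)) = (\<Sum>i\<in>I. ennreal (a i))"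
      using N by (intro sum.cong refl) (auto simp: divide_ennreal less_imp_neq[symmetric])
    also have "\<dots> = 1" using a by (subst sum_ennreal) (auto simp: less_imp_le)
    also have "ennreal P * 1 = (\<Prod>i\<in>I. epow (?G i) (a i))"
      unfolding P_def using N by (auto simp: prod_ennreal[symmetric] less_imp_le intro!: prod.cong)
    finally show ?thesis .
  qed
qed

lemma nn_integral_Holder2:
  assumes [measurable]: "f \<in> borel_measurable M" "g \<in> borel_measurable M"
    and "0 < a" "0 < b" "a + b = 1"
  shows "(\<integral>\<^sup>+x. epow (f x) a * epow (g x) b \<partial>M) \<le> epow (\<integral>\<^sup>+x. f x \<partial>M) a * epow (\<integral>\<^sup>+x. g x \<partial>M) b"
  using nn_integral_Holder[of "UNIV::bool set" "\<lambda>i. if i then a else b" "\<lambda>i. if i then f else g" M] assms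
  by (simp add: UNIV_bool mult.commute add.commute)

section \<open>Line integrals and the induction on the dimension\<close>

context product_sigma_finite
begin

lemma measurable_line_integral [measurable (raw)]:
  assumes "i \<in> I" and f[measurable]: "f \<in> borel_measurable (PiM I M)"
  shows "(\<lambda>x. \<integral>\<^sup>+t. f (x(i := t)) \<partial>M i) \<in> borel_measurable (PiM I M)"
proof -
  have [measurable]: "(\<lambda>(x, t). x(i := t)) \<in> PiM I M \<Otimes>\<^sub>M M i \<rightarrow>\<^sub>M PiM I M"
    using measurable_add_dim[of i I M] assms(1) by (simp add: insert_absorb)
  show ?thesis
    by (rule sigma_finite_measure.borel_measurable_nn_integral[OF sigma_finite_measures]) measurable
qed

text \<open>For a fixed value \<open>y\<close> of the coordinate \<open>j\<close>, the line integral
  in direction \<open>j\<close> no longer depends on \<open>y\<close> and takes the place of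
  \<open>F\<close> in \<open>IH\<close>, while the other factors are line integrals of slices.
  Hoelder's inequality in \<open>y\<close> with \<open>card I\<close> equal exponents then
  reassembles the slices. \<open>IH\<close> is a premise so that the induction and its last
  application share this argument.\<close>

lemma loomis_whitney_step:
  fixes I :: "'i set"
  assumes I: "finite I" "I \<noteq> {}" "j \<notin> I"
    and IH: "\<And>F f. F \<in> borel_measurable (PiM I M) \<Longrightarrow> (\<And>i. i \<in> I \<Longrightarrow> f i \<in> borel_measurable (PiM I M)) \<Longrightarrow>
      (\<integral>\<^sup>+x. epow (F x) (1 / card I) * (\<Prod>i\<in>I. epow (\<integral>\<^sup>+t. f i (x(i := t)) \<partial>M i) (1 / card I)) \<partial>PiM I M)
       \<le> epow (\<integral>\<^sup>+x. F x \<partial>PiM I M) (1 / card I) * (\<Prod>i\<in>I. epow (\<integral>\<^sup>+x. f i x \<partial>PiM I M) (1 / card I))"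
    and f[measurable]: "\<And>i. i \<in> insert j I \<Longrightarrow> f i \<in> borel_measurable (PiM (insert j I) M)"
  shows "(\<integral>\<^sup>+x. (\<Prod>i\<in>insert j I. epow (\<integral>\<^sup>+t. f i (x(i := t)) \<partial>M i) (1 / card I)) \<partial>PiM (insert j I) M)
       \<le> (\<Prod>i\<in>insert j I. epow (\<integral>\<^sup>+x. f i x \<partial>PiM (insert j I) M) (1 / card I))"
proof -
  let ?n = "real (card I)"
  have n: "?n > 0" using I by (simp add: card_gt_0_iff)
  have [measurable]: "(\<lambda>x. \<integral>\<^sup>+t. f i (x(i := t)) \<partial>M i) \<in> borel_measurable (PiM (insert j I) M)" if "i \<in> insert j I" for i
    using that by (intro measurable_line_integral) auto
  have up: "(\<lambda>x. x(j := y)) \<in> PiM I M \<rightarrow>\<^sub>M PiM (insert j I) M" if "y \<in> space (M j)" for y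
    using that by (intro measurable_fun_upd[where J=I]) auto
  have fy: "(\<lambda>x. f i (x(j := y))) \<in> borel_measurable (PiM I M)" if "i \<in> insert j I" "y \<in> space (M j)" for i y
    using measurable_compose[OF up[OF that(2)] f[OF that(1)]] .
  interpret PI: sigma_finite_measure "PiM I M" using I by (intro sigma_finite)
  have fub: "(\<lambda>y. \<integral>\<^sup>+x. f i (x(j := y)) \<partial>PiM I M) \<in> borel_measurable (M j)" if "i \<in> insert j I" for i
  proof (rule PI.borel_measurable_nn_integral)
    have "(\<lambda>(y, x). x(j := y)) \<in> M j \<Otimes>\<^sub>M PiM I M \<rightarrow>\<^sub>M PiM (insert j I) M"
      by measurable
    from measurable_compose[OF this f[OF that]]
    show "(\<lambda>(y, x). f i (x(j := y))) \<in> borel_measurable (M j \<Otimes>\<^sub>M PiM I M)" by (simp add: case_prod_beta')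
  qed
  have "(\<integral>\<^sup>+x. (\<Prod>i\<in>insert j I. epow (\<integral>\<^sup>+t. f i (x(i := t)) \<partial>M i) (1 / ?n)) \<partial>PiM (insert j I) M)
    = (\<integral>\<^sup>+y. \<integral>\<^sup>+x. (\<Prod>i\<in>insert j I. epow (\<integral>\<^sup>+t. f i ((x(j := y))(i := t)) \<partial>M i) (1 / ?n)) \<partial>PiM I M \<partial>M j)"
    using I by (intro product_nn_integral_insert_rev) auto
  also have "\<dots> \<le> (\<integral>\<^sup>+y. epow (\<integral>\<^sup>+x. f j x \<partial>PiM (insert j I) M) (1 / ?n) *
      (\<Prod>i\<in>I. epow (\<integral>\<^sup>+x. f i (x(j := y)) \<partial>PiM I M) (1 / ?n)) \<partial>M j)"
  proof (rule nn_integral_mono)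
    fix y assume y: "y \<in> space (M j)"
    let ?F = "\<lambda>x. \<integral>\<^sup>+t. f j (x(j := t)) \<partial>M j"
    have Fm: "?F \<in> borel_measurable (PiM I M)"
    proof (rule sigma_finite_measure.borel_measurable_nn_integral[OF sigma_finite_measures])
      show "(\<lambda>(x, t). f j (x(j := t))) \<in> borel_measurable (PiM I M \<Otimes>\<^sub>M M j)"
        using measurable_compose[OF measurable_add_dim f[of j]] by (simp add: case_prod_beta')
    qed
    have "(\<integral>\<^sup>+x. (\<Prod>i\<in>insert j I. epow (\<integral>\<^sup>+t. f i ((x(j := y))(i := t)) \<partial>M i) (1 / ?n)) \<partial>PiM I M)
      = (\<integral>\<^sup>+x. epow (?F x) (1 / ?n) *
          (\<Prod>i\<in>I. epow (\<integral>\<^sup>+t. f i ((x(i := t))(j := y)) \<partial>M i) (1 / ?n)) \<partial>PiM I M)"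
    proof (intro nn_integral_cong)
      fix x
      have "(\<Prod>i\<in>I. epow (\<integral>\<^sup>+t. f i ((x(j := y))(i := t)) \<partial>M i) (1 / ?n))
        = (\<Prod>i\<in>I. epow (\<integral>\<^sup>+t. f i ((x(i := t))(j := y)) \<partial>M i) (1 / ?n))"
        using I by (intro prod.cong refl arg_cong2[where f=epow] nn_integral_cong) (metis fun_upd_twist)
      then show "(\<Prod>i\<in>insert j I. epow (\<integral>\<^sup>+t. f i ((x(j := y))(i := t)) \<partial>M i) (1 / ?n))
        = epow (?F x) (1 / ?n) * (\<Prod>i\<in>I. epow (\<integral>\<^sup>+t. f i ((x(i := t))(j := y)) \<partial>M i) (1 / ?n))"
        using I by (simp del: fun_upd_apply)
    qed
    also have "\<dots> \<le> epow (\<integral>\<^sup>+x. ?F x \<partial>PiM I M) (1 / ?n) *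
        (\<Prod>i\<in>I. epow (\<integral>\<^sup>+x. f i (x(j := y)) \<partial>PiM I M) (1 / ?n))"
      by (rule IH[OF Fm]) (use fy y in auto)
    also have "(\<integral>\<^sup>+x. ?F x \<partial>PiM I M) = (\<integral>\<^sup>+x. f j x \<partial>PiM (insert j I) M)"
      using I by (subst product_nn_integral_insert) auto
    finally show "(\<integral>\<^sup>+x. (\<Prod>i\<in>insert j I. epow (\<integral>\<^sup>+t. f i ((x(j := y))(i := t)) \<partial>M i) (1 / ?n)) \<partial>PiM I M)
      \<le> epow (\<integral>\<^sup>+x. f j x \<partial>PiM (insert j I) M) (1 / ?n) *
        (\<Prod>i\<in>I. epow (\<integral>\<^sup>+x. f i (x(j := y)) \<partial>PiM I M) (1 / ?n))" .
  qed
  also have "\<dots> = epow (\<integral>\<^sup>+x. f j x \<partial>PiM (insert j I) M) (1 / ?n) *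
      (\<integral>\<^sup>+y. (\<Prod>i\<in>I. epow (\<integral>\<^sup>+x. f i (x(j := y)) \<partial>PiM I M) (1 / ?n)) \<partial>M j)"
    using fub by (intro nn_integral_cmult) measurable
  also have "\<dots> \<le> epow (\<integral>\<^sup>+x. f j x \<partial>PiM (insert j I) M) (1 / ?n) *
      (\<Prod>i\<in>I. epow (\<integral>\<^sup>+y. \<integral>\<^sup>+x. f i (x(j := y)) \<partial>PiM I M \<partial>M j) (1 / ?n))"
    using I n fub by (intro mult_left_mono nn_integral_Holder) auto
  also have "\<dots> = (\<Prod>i\<in>insert j I. epow (\<integral>\<^sup>+x. f i x \<partial>PiM (insert j I) M) (1 / ?n))"
    using I by (auto simp: product_nn_integral_insert_rev intro!: prod.cong)
  finally show ?thesis .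
qed

text \<open>The additional factor \<open>F\<close> is what makes the induction close: it absorbs the
  line integral that becomes constant on slices. In the inductive step, Hoelder with exponents
  \<open>1 / ?m\<close> and \<open>?n / ?m\<close> splits \<open>F\<close> off, and what remains is
  the integral of \<open>loomis_whitney_step\<close>.\<close>

lemma loomis_whitney_aux:
  fixes I :: "'i set"
  assumes "finite I" "I \<noteq> {}"
    and "F \<in> borel_measurable (PiM I M)" "\<And>i. i \<in> I \<Longrightarrow> f i \<in> borel_measurable (PiM I M)"
  shows "(\<integral>\<^sup>+x. epow (F x) (1 / card I) * (\<Prod>i\<in>I. epow (\<integral>\<^sup>+t. f i (x(i := t)) \<partial>M i) (1 / card I)) \<partial>PiM I M)
       \<le> epow (\<integral>\<^sup>+x. F x \<partial>PiM I M) (1 / card I) * (\<Prod>i\<in>I. epow (\<integral>\<^sup>+x. f i x \<partial>PiM I M) (1 / card I))"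
  using assms
proof (induction I arbitrary: F f rule: finite_ne_induct)
  case (singleton j)
  note [measurable] = singleton
  \<comment> \<open>In dimension one the integral along the only direction is the integral over the
    whole space, so the inequality is an equality.\<close>
  have *: "(\<integral>\<^sup>+t. f j (x(j := t)) \<partial>M j) = (\<integral>\<^sup>+x. f j x \<partial>PiM {j} M)" if "x \<in> space (PiM {j} M)" for x
  proof -
    have "(\<integral>\<^sup>+x. f j x \<partial>PiM {j} M) = (\<integral>\<^sup>+y. f j ((\<lambda>k. undefined)(j := y)) \<partial>M j)"
      by (subst product_nn_integral_insert_rev[where I="{}"]) (auto simp: nn_integral_empty singleton)
    also have "\<dots> = (\<integral>\<^sup>+t. f j (x(j := t)) \<partial>M j)"
    proof (intro nn_integral_cong arg_cong[where f="f j"] ext)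
      fix y k show "((\<lambda>k. undefined)(j := y)) k = (x(j := y)) k"
        using that by (auto simp: space_PiM PiE_def extensional_def)
    qed
    finally show ?thesis by simp
  qed
  have "(\<integral>\<^sup>+x. F x * (\<integral>\<^sup>+t. f j (x(j := t)) \<partial>M j) \<partial>PiM {j} M) = (\<integral>\<^sup>+x. F x * (\<integral>\<^sup>+x. f j x \<partial>PiM {j} M) \<partial>PiM {j} M)"
    by (intro nn_integral_cong) (simp add: *)
  also have "\<dots> = (\<integral>\<^sup>+x. F x \<partial>PiM {j} M) * (\<integral>\<^sup>+x. f j x \<partial>PiM {j} M)"
    using singleton by (intro nn_integral_multc) auto
  finally show ?case by (simp del: fun_upd_apply)
next
  case (insert j I)
  note [measurable] = insert.prems
  let ?n = "real (card I)" and ?m = "real (card (insert j I))"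
  have n: "?n > 0" and m: "?m = ?n + 1" using insert by (auto simp: card_gt_0_iff)
  let ?G = "\<lambda>x. \<Prod>i\<in>insert j I. epow (\<integral>\<^sup>+t. f i (x(i := t)) \<partial>M i) (1 / ?n)"
  have [measurable]: "(\<lambda>x. \<integral>\<^sup>+t. f i (x(i := t)) \<partial>M i) \<in> borel_measurable (PiM (insert j I) M)" if "i \<in> insert j I" for i
    using that insert.prems by (intro measurable_line_integral) auto
  have e: "epow x (1 / ?m) = epow (epow x (1 / ?n)) (?n / ?m)" for x
    using n by (simp add: epow_epow)
  have *: "(\<Prod>i\<in>insert j I. epow (h i) (1 / ?m)) = epow (\<Prod>i\<in>insert j I. epow (h i) (1 / ?n)) (?n / ?m)" for h :: "'i \<Rightarrow> ennreal"
    unfolding e using n m by (intro epow_prod[symmetric]) auto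
  have "(\<integral>\<^sup>+x. epow (F x) (1 / ?m) * (\<Prod>i\<in>insert j I. epow (\<integral>\<^sup>+t. f i (x(i := t)) \<partial>M i) (1 / ?m)) \<partial>PiM (insert j I) M)
     = (\<integral>\<^sup>+x. epow (F x) (1 / ?m) * epow (?G x) (?n / ?m) \<partial>PiM (insert j I) M)"
    unfolding * ..
  also have "\<dots> \<le> epow (\<integral>\<^sup>+x. F x \<partial>PiM (insert j I) M) (1 / ?m) * epow (\<integral>\<^sup>+x. ?G x \<partial>PiM (insert j I) M) (?n / ?m)"
    using n m insert.prems by (intro nn_integral_Holder2) (auto simp: field_simps)
  also have "\<dots> \<le> epow (\<integral>\<^sup>+x. F x \<partial>PiM (insert j I) M) (1 / ?m) *
      epow (\<Prod>i\<in>insert j I. epow (\<integral>\<^sup>+x. f i x \<partial>PiM (insert j I) M) (1 / ?n)) (?n / ?m)"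
    using insert.hyps insert.prems by (intro mult_left_mono epow_mono loomis_whitney_step insert.IH) auto
  finally show ?case unfolding * .
qed

lemma loomis_whitney:
  fixes I :: "'i set"
  assumes I: "finite I" "card I \<ge> 2"
    and f: "\<And>i. i \<in> I \<Longrightarrow> f i \<in> borel_measurable (PiM I M)"
  shows "(\<integral>\<^sup>+x. (\<Prod>i\<in>I. epow (\<integral>\<^sup>+t. f i (x(i := t)) \<partial>M i) (1 / (card I - 1))) \<partial>PiM I M)
       \<le> (\<Prod>i\<in>I. epow (\<integral>\<^sup>+x. f i x \<partial>PiM I M) (1 / (card I - 1)))"
proof -
  \<comment> \<open>Any index serves: the auxiliary inequality on \<open>I - {j}\<close> is the
    hypothesis of the step that adds \<open>j\<close> back.\<close>
  obtain j where j: "j \<in> I" using I by fastforce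
  have "I - {j} \<noteq> {}" using I j by (metis Diff_cancel card.empty card.insert_remove finite.emptyI insert_Diff insert_absorb le_antisym not_less_eq_eq numeral_2_eq_2 Suc_n_not_le_n card_Diff_singleton)
  then show ?thesis
    using loomis_whitney_step[of "I - {j}" j f] loomis_whitney_aux[of "I - {j}"] I j f
    by (simp add: insert_absorb of_nat_diff)
qed

end

section \<open>Smooth functions and test functions\<close>

lemma dpart_eqI: "(f has_derivative f') (at x) \<Longrightarrow> dpart i f x = f' (axis i 1)"
  by (simp add: dpart_def frechet_derivative_at[symmetric])

lemma has_derivative_grad:
  assumes "f differentiable (at x)"
  shows "(f has_derivative (\<lambda>h. grad f x \<bullet> h)) (at x)"
proof -
  obtain f' where f': "(f has_derivative f') (at x)" using assms by (auto simp: differentiable_def)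
  have lin: "linear f'" using f' by (rule has_derivative_linear)
  have "f' h = grad f x \<bullet> h" for h
  proof -
    have "f' h = f' (\<Sum>i\<in>UNIV. h $ i *\<^sub>R axis i 1)"
      by (metis basis_expansion scalar_mult_eq_scaleR)
    also have "\<dots> = (\<Sum>i\<in>UNIV. h $ i * f' (axis i 1))"
      by (simp add: linear_sum[OF lin] linear_cmul[OF lin])
    also have "\<dots> = grad f x \<bullet> h"
      by (simp add: inner_vec_def grad_def dpart_eqI[OF f'] mult.commute)
    finally show ?thesis .
  qed
  then show ?thesis using f' by presburger
qed

section \<open>Smoothness through finite orders of differentiability\<close>

lemma grad_eqI:
  assumes "(f has_derivative (\<lambda>h. v \<bullet> h)) (at x)"
  shows "grad f x = v"
  by (simp add: grad_def vec_eq_iff dpart_eqI[OF assms] inner_axis)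

lemma iter_dpart_snoc: "iter_dpart (is @ [i]) f = iter_dpart is (dpart i f)"
  by (induction "is") auto

text \<open>The recursion peels off the innermost derivative, whereas \<open>iter_dpart\<close>
  peels off the outermost. In this form closure under sums, products and compositions is an
  induction on the order, with the product and chain rule as inductive step.\<close>

primrec kdiff :: "nat \<Rightarrow> (real^'n::finite \<Rightarrow> real) \<Rightarrow> bool" where
  "kdiff 0 f = True"
| "kdiff (Suc n) f = ((\<forall>x. f differentiable (at x)) \<and> (\<forall>i. kdiff n (dpart i f)))"

lemma smooth_fun_differentiable: "smooth_fun f \<Longrightarrow> f differentiable (at x)"
  unfolding smooth_fun_def by (metis iter_dpart.simps(1))

lemma smooth_fun_dpart: "smooth_fun f \<Longrightarrow> smooth_fun (dpart i f)"
  unfolding smooth_fun_def iter_dpart_snoc[symmetric] by auto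

lemma smooth_fun_iff_kdiff: "smooth_fun f \<longleftrightarrow> (\<forall>n. kdiff n f)"
proof
  show "\<forall>n. kdiff n f" if "smooth_fun f"
  proof
    show "kdiff n f" for n
      using that by (induction n arbitrary: f) (auto simp: smooth_fun_dpart smooth_fun_differentiable)
  qed
  show "smooth_fun f" if *: "\<forall>n. kdiff n f"
    unfolding smooth_fun_def
  proof (intro allI)
    fix "is" :: "'a list" and x
    have "kdiff (Suc (length is)) f" using * by blast
    then show "iter_dpart is f differentiable (at x)"
      by (induction "is" arbitrary: f rule: rev_induct) (auto simp: iter_dpart_snoc)
  qed
qed

lemma kdiff_Suc_D: "kdiff (Suc n) f \<Longrightarrow> kdiff n f"
  by (induction n arbitrary: f) auto

lemma kdiff_const [simp]: "kdiff n (\<lambda>x. c)"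
proof (induction n arbitrary: c)
  case (Suc n)
  have "dpart i (\<lambda>x. c) = (\<lambda>x::real^'a. 0)" for i :: 'a
    by (rule ext, subst dpart_eqI) (auto intro: derivative_eq_intros)
  then show ?case using Suc by simp
qed auto

lemma kdiff_add: "kdiff n f \<Longrightarrow> kdiff n g \<Longrightarrow> kdiff n (\<lambda>x. f x + g x)"
proof (induction n arbitrary: f g)
  case (Suc n)
  have "dpart i (\<lambda>x. f x + g x) = (\<lambda>x. dpart i f x + dpart i g x)" for i
  proof
    fix x
    have "((\<lambda>x. f x + g x) has_derivative (\<lambda>h. grad f x \<bullet> h + grad g x \<bullet> h)) (at x)"
      using Suc.prems by (intro derivative_intros has_derivative_grad) auto
    from dpart_eqI[OF this] show "dpart i (\<lambda>x. f x + g x) x = dpart i f x + dpart i g x"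
      by (simp add: inner_axis grad_def)
  qed
  then show ?case using Suc by (auto intro: differentiable_add)
qed auto

lemma kdiff_mult: "kdiff n f \<Longrightarrow> kdiff n g \<Longrightarrow> kdiff n (\<lambda>x. f x * g x)"
proof (induction n arbitrary: f g)
  case (Suc n)
  have "dpart i (\<lambda>x. f x * g x) = (\<lambda>x. f x * dpart i g x + dpart i f x * g x)" for i
  proof
    fix x
    have "((\<lambda>x. f x * g x) has_derivative (\<lambda>h. f x * (grad g x \<bullet> h) + (grad f x \<bullet> h) * g x)) (at x)"
      using Suc.prems by (intro derivative_intros has_derivative_grad) auto
    from dpart_eqI[OF this] show "dpart i (\<lambda>x. f x * g x) x = f x * dpart i g x + dpart i f x * g x"
      by (simp add: inner_axis grad_def)
  qed
  moreover have "kdiff n f" "kdiff n g" using Suc.prems kdiff_Suc_D by blast+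
  ultimately show ?case using Suc by (auto intro!: differentiable_mult kdiff_add)
qed auto

lemma kdiff_comp:
  assumes D: "\<And>k x. (D k has_real_derivative D (Suc k) (f x)) (at (f x))"
  shows "kdiff n f \<Longrightarrow> kdiff n (\<lambda>x. D k (f x))"
proof (induction n arbitrary: k)
  case (Suc n)
  have *: "((\<lambda>x. D k (f x)) has_derivative (\<lambda>h. (grad f x \<bullet> h) * D (Suc k) (f x))) (at x)" for x
  proof -
    have "f differentiable (at x)" using Suc.prems by simp
    from has_derivative_compose[OF has_derivative_grad[OF this] D[unfolded has_field_derivative_def]]
    show ?thesis by (simp add: mult.commute)
  qed
  have "dpart i (\<lambda>x. D k (f x)) = (\<lambda>x. dpart i f x * D (Suc k) (f x))" for i
    by (rule ext, subst dpart_eqI[OF *]) (simp add: inner_axis grad_def)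
  moreover have "kdiff n f" using Suc.prems kdiff_Suc_D by blast
  ultimately show ?case using Suc * by (auto simp: differentiable_def intro!: kdiff_mult)
qed auto

lemma kdiff_affine: "kdiff n f \<Longrightarrow> kdiff n (\<lambda>x. f (a + r *\<^sub>R x))"
proof (induction n arbitrary: f)
  case (Suc n)
  have *: "((\<lambda>x. f (a + r *\<^sub>R x)) has_derivative (\<lambda>h. grad f (a + r *\<^sub>R x) \<bullet> (r *\<^sub>R h))) (at x)" for x
    by (rule has_derivative_compose[where g=f]) (use Suc.prems in \<open>auto intro!: derivative_eq_intros has_derivative_grad\<close>)
  have "dpart i (\<lambda>x. f (a + r *\<^sub>R x)) = (\<lambda>x. r * dpart i f (a + r *\<^sub>R x))" for i
    by (rule ext, subst dpart_eqI[OF *]) (simp add: inner_axis grad_def)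
  then show ?case using Suc * by (auto simp: differentiable_def intro!: kdiff_mult)
qed auto

lemma kdiff_coord [simp]: "kdiff n (\<lambda>x. x $ i)"
proof (cases n)
  case (Suc m)
  have *: "((\<lambda>x::real^'a. x $ i) has_derivative (\<lambda>h. h $ i)) (at x)" for x
    by (intro bounded_linear_imp_has_derivative bounded_linear_vec_nth)
  have "dpart j (\<lambda>x::real^'a. x $ i) = (\<lambda>x. axis j 1 $ i)" for j
    by (rule ext, subst dpart_eqI[OF *]) simp
  then show ?thesis using * Suc by (auto simp: differentiable_def)
qed auto

lemma smooth_fun_const [simp]: "smooth_fun (\<lambda>x. c)"
  and smooth_fun_coord [simp]: "smooth_fun (\<lambda>x. x $ i)"
  and smooth_fun_add: "smooth_fun f \<Longrightarrow> smooth_fun g \<Longrightarrow> smooth_fun (\<lambda>x. f x + g x)"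
  and smooth_fun_mult: "smooth_fun f \<Longrightarrow> smooth_fun g \<Longrightarrow> smooth_fun (\<lambda>x. f x * g x)"
  and smooth_fun_affine: "smooth_fun f \<Longrightarrow> smooth_fun (\<lambda>x. f (a + r *\<^sub>R x))"
  by (simp_all add: smooth_fun_iff_kdiff kdiff_add kdiff_mult kdiff_affine)

lemma smooth_fun_comp:
  assumes "\<And>k x. (D k has_real_derivative D (Suc k) (f x)) (at (f x))" and "smooth_fun f"
  shows "smooth_fun (\<lambda>x. D k (f x))"
proof -
  have "kdiff n (\<lambda>x. D k (f x))" for n
    by (rule kdiff_comp[of D]) (use assms in \<open>auto simp: smooth_fun_iff_kdiff\<close>)
  then show ?thesis by (simp add: smooth_fun_iff_kdiff)
qed

lemma smooth_fun_sum: "(\<And>i. i \<in> I \<Longrightarrow> smooth_fun (f i)) \<Longrightarrow> smooth_fun (\<lambda>x. \<Sum>i\<in>I. f i x)"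
  by (induction I rule: infinite_finite_induct) (auto intro: smooth_fun_add)

lemma smooth_fun_inner_self: "smooth_fun (\<lambda>x::real^'n::finite. x \<bullet> x)"
  unfolding inner_vec_def by (auto intro!: smooth_fun_sum smooth_fun_mult)

section \<open>Gradient rules, supports and test functions\<close>

lemma grad_comp:
  assumes "(T has_real_derivative d) (at (f x))" "f differentiable (at x)"
  shows "grad (\<lambda>x. T (f x)) x = d *\<^sub>R grad f x"
proof (rule grad_eqI)
  show "((\<lambda>x. T (f x)) has_derivative (\<lambda>h. (d *\<^sub>R grad f x) \<bullet> h)) (at x)"
    using has_derivative_compose[OF has_derivative_grad[OF assms(2)] assms(1)[unfolded has_field_derivative_def]]
    by simp
qed

lemma grad_mult:
  assumes "f differentiable (at x)" "g differentiable (at x)"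
  shows "grad (\<lambda>x. f x * g x) x = f x *\<^sub>R grad g x + g x *\<^sub>R grad f x"
proof (rule grad_eqI)
  have "((\<lambda>x. f x * g x) has_derivative (\<lambda>h. f x * (grad g x \<bullet> h) + (grad f x \<bullet> h) * g x)) (at x)"
    using assms by (intro derivative_intros has_derivative_grad) auto
  then show "((\<lambda>x. f x * g x) has_derivative (\<lambda>h. (f x *\<^sub>R grad g x + g x *\<^sub>R grad f x) \<bullet> h)) (at x)"
    by (simp add: inner_add_left mult.commute)
qed

lemma grad_lincomb:
  assumes "f differentiable (at x)" "g differentiable (at x)"
  shows "grad (\<lambda>x. a * f x + b * g x) x = a *\<^sub>R grad f x + b *\<^sub>R grad g x"
proof (rule grad_eqI)
  have "((\<lambda>x. a * f x + b * g x) has_derivative (\<lambda>h. a * (grad f x \<bullet> h) + b * (grad g x \<bullet> h))) (at x)"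
    using assms by (intro has_derivative_add has_derivative_mult_right has_derivative_grad) auto
  then show "((\<lambda>x. a * f x + b * g x) has_derivative (\<lambda>h. (a *\<^sub>R grad f x + b *\<^sub>R grad g x) \<bullet> h)) (at x)"
    by (simp add: inner_add_left)
qed

lemma continuous_on_smooth: "smooth_fun f \<Longrightarrow> continuous_on S f"
  by (meson continuous_at_imp_continuous_on differentiable_imp_continuous_within smooth_fun_differentiable)

lemma continuous_on_grad: "smooth_fun f \<Longrightarrow> continuous_on S (grad f)"
  unfolding grad_def by (intro continuous_on_vec_lambda continuous_on_smooth smooth_fun_dpart)

lemma tsupportD: "x \<notin> tsupport f \<Longrightarrow> f x = 0"
  unfolding tsupport_def using subsetD[OF closure_subset, of x "{x. f x \<noteq> 0}"] by blast

lemma grad_outside_tsupport: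
  assumes "x \<notin> tsupport f"
  shows "grad f x = 0"
proof (rule grad_eqI)
  have "open (- tsupport f)" by (simp add: tsupport_def open_Compl)
  moreover have "((\<lambda>x. 0::real) has_derivative (\<lambda>h. 0 \<bullet> h)) (at x)" by (simp add: has_derivative_const)
  ultimately show "(f has_derivative (\<lambda>h. 0 \<bullet> h)) (at x)"
    using assms has_derivative_transform_within_open[of "\<lambda>x. 0::real" "\<lambda>h. 0 \<bullet> h" x UNIV "- tsupport f" f]
    by (auto simp: tsupportD)
qed

lemma compact_tsupport:
  assumes "compact K" "tsupport f \<subseteq> K"
  shows "compact (tsupport f)"
proof -
  have "compact (K \<inter> tsupport f)"
    by (intro compact_Int_closed assms) (simp add: tsupport_def)
  moreover have "K \<inter> tsupport f = tsupport f" using assms by blast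
  ultimately show ?thesis by simp
qed

lemma test_funI:
  assumes "smooth_fun f" "compact K" "K \<subseteq> U" "\<And>x. x \<notin> K \<Longrightarrow> f x = 0"
  shows "test_fun U f"
proof -
  have "tsupport f \<subseteq> K"
    unfolding tsupport_def using assms by (intro closure_minimal compact_imp_closed) auto
  then show ?thesis using assms compact_tsupport unfolding test_fun_def by blast
qed

lemma test_fun_dominated:
  assumes "test_fun U \<phi>" "smooth_fun f" "\<And>x. \<phi> x = 0 \<Longrightarrow> f x = 0"
  shows "test_fun U f"
  by (rule test_funI[of f "tsupport \<phi>"]) (use assms tsupportD in \<open>auto simp: test_fun_def\<close>)

lemma test_fun_lincomb:
  assumes "test_fun U \<phi>" "test_fun U \<psi>"
  shows "test_fun U (\<lambda>x. a * \<phi> x + b * \<psi> x)"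
  by (rule test_funI[of _ "tsupport \<phi> \<union> tsupport \<psi>"])
    (use assms in \<open>auto simp: test_fun_def tsupportD intro!: smooth_fun_add smooth_fun_mult\<close>)

lemma test_fun_mult: "test_fun U \<phi> \<Longrightarrow> smooth_fun f \<Longrightarrow> test_fun U (\<lambda>x. \<phi> x * f x)"
  by (rule test_fun_dominated[of U \<phi>]) (auto simp: test_fun_def intro: smooth_fun_mult)

lemma test_fun_comp:
  assumes "test_fun U \<phi>" "\<And>k s. (D k has_real_derivative D (Suc k) s) (at s)" "D 0 0 = 0"
  shows "test_fun U (\<lambda>x. D 0 (\<phi> x))"
proof (rule test_fun_dominated[OF assms(1)])
  show "smooth_fun (\<lambda>x. D 0 (\<phi> x))"
    by (rule smooth_fun_comp[of D]) (use assms in \<open>auto simp: test_fun_def\<close>)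
qed (use assms in auto)

lemma test_funD:
  assumes "test_fun U \<phi>"
  shows "smooth_fun \<phi>" "\<phi> differentiable (at x)" "continuous_on S \<phi>" "continuous_on S (grad \<phi>)"
    "x \<notin> U \<Longrightarrow> \<phi> x = 0" "x \<notin> U \<Longrightarrow> grad \<phi> x = 0"
  using assms grad_outside_tsupport[of x \<phi>] tsupportD[of x \<phi>]
  by (auto simp: test_fun_def smooth_fun_differentiable continuous_on_smooth continuous_on_grad)

lemma continuous_compact_support_bounded:
  fixes f :: "'a::topological_space \<Rightarrow> 'b::real_normed_vector"
  assumes "continuous_on UNIV f" "compact K" "\<And>x. x \<notin> K \<Longrightarrow> f x = 0"
  obtains B where "B > 0" "\<And>x. norm (f x) \<le> B"
proof -
  have "compact (f ` K)" using assms by (meson compact_continuous_image continuous_on_subset top_greatest)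
  then obtain B where B: "B > 0" "\<And>y. y \<in> f ` K \<Longrightarrow> norm y \<le> B"
    using compact_imp_bounded bounded_pos by metis
  have "norm (f x) \<le> B" for x using B assms(3)[of x] by (cases "x \<in> K") auto
  with B that show ?thesis by blast
qed

lemma test_fun_bounded:
  assumes "test_fun U \<phi>"
  obtains B where "B > 0" "\<And>x. \<bar>\<phi> x\<bar> \<le> B" "\<And>x. norm (grad \<phi> x) \<le> B"
proof -
  have K: "compact (tsupport \<phi>)" using assms by (simp add: test_fun_def)
  obtain B1 where B1: "B1 > 0" "\<And>x. norm (\<phi> x) \<le> B1"
    by (rule continuous_compact_support_bounded[OF test_funD(3)[OF assms] K]) (auto simp: tsupportD)
  obtain B2 where B2: "B2 > 0" "\<And>x. norm (grad \<phi> x) \<le> B2"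
    by (rule continuous_compact_support_bounded[OF test_funD(4)[OF assms] K]) (auto simp: grad_outside_tsupport)
  show ?thesis by (rule that[of "max B1 B2"]) (use B1 B2 in \<open>auto simp: le_max_iff_disj\<close>)
qed

lemma test_fun_borel:
  assumes "test_fun U \<phi>"
  shows "\<phi> \<in> borel_measurable borel" "grad \<phi> \<in> borel_measurable borel"
  using test_funD(3,4)[OF assms] by (auto intro: borel_measurable_continuous_onI)

section \<open>The Sobolev inequality for test functions\<close>

text \<open>The point \<open>x + (t - x \<bullet> b) *\<^sub>R b\<close> is \<open>x\<close> with
  its \<open>b\<close>-coordinate replaced by \<open>t\<close>, so the hypothesis bounds
  \<open>W\<close> by a line integral of \<open>G\<close> in every coordinate direction. Writing
  Lebesgue measure as a product measure, the product of these bounds is the left side of the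
  Loomis-Whitney inequality.\<close>

lemma gagliardo:
  fixes W G :: "'a::euclidean_space \<Rightarrow> ennreal"
  assumes dim: "DIM('a) \<ge> 2" and [measurable]: "W \<in> borel_measurable borel" "G \<in> borel_measurable borel"
    and le: "\<And>x b. b \<in> Basis \<Longrightarrow> W x \<le> (\<integral>\<^sup>+t. G (x + (t - x \<bullet> b) *\<^sub>R b) \<partial>lborel)"
  shows "(\<integral>\<^sup>+x. epow (W x) (real DIM('a) / (real DIM('a) - 1)) \<partial>lborel) \<le> epow (\<integral>\<^sup>+x. G x \<partial>lborel) (real DIM('a) / (real DIM('a) - 1))"
proof -
  let ?d = "real DIM('a)" and ?P = "PiM Basis (\<lambda>_. lborel) :: ('a \<Rightarrow> real) measure"
  let ?s = "\<lambda>f::'a \<Rightarrow> real. \<Sum>b\<in>Basis. f b *\<^sub>R b"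
  interpret product_sigma_finite "\<lambda>_::'a. lborel :: real measure" by standard
  have d: "?d > 1" using dim by simp
  have [measurable]: "?s \<in> ?P \<rightarrow>\<^sub>M borel" by measurable
  \<comment> \<open>The power d/(d-1) is split into d equal factors, one for each coordinate
    direction.\<close>
  have ep: "epow x (?d / (?d - 1)) = (\<Prod>b\<in>(Basis::'a set). epow x (1 / (?d - 1)))" for x
  proof (cases x)
    case (real r)
    then show ?thesis using d by (cases "r = 0") (auto simp: powr_realpow[symmetric] powr_powr ennreal_power)
  qed (use dim in auto)
  have "(\<integral>\<^sup>+x. epow (W x) (?d / (?d - 1)) \<partial>lborel) = (\<integral>\<^sup>+f. epow (W (?s f)) (?d / (?d - 1)) \<partial>?P)"
    by (subst lborel_eq, subst nn_integral_distr) auto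
  also have "\<dots> = (\<integral>\<^sup>+f. (\<Prod>b\<in>(Basis::'a set). epow (W (?s f)) (1 / (?d - 1))) \<partial>?P)"
    unfolding ep ..
  also have "\<dots> \<le> (\<integral>\<^sup>+f. (\<Prod>b\<in>Basis. epow (\<integral>\<^sup>+t. G (?s (f(b := t))) \<partial>lborel) (1 / (?d - 1))) \<partial>?P)"
  proof (intro nn_integral_mono prod_mono_ennreal epow_mono)
    fix f :: "'a \<Rightarrow> real" and b :: 'a assume b: "b \<in> Basis"
    have "?s f + (t - ?s f \<bullet> b) *\<^sub>R b = ?s (f(b := t))" for t
    proof -
      have "?s (f(b := t)) = t *\<^sub>R b + (\<Sum>b\<in>Basis - {b}. f b *\<^sub>R b)"
        using b by (subst sum.remove[of _ b]) (auto intro!: sum.cong)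
      moreover have "?s f = f b *\<^sub>R b + (\<Sum>b\<in>Basis - {b}. f b *\<^sub>R b)"
        using b by (subst sum.remove[of _ b]) auto
      moreover have "?s f \<bullet> b = f b" using b by simp
      ultimately show ?thesis by (simp add: algebra_simps)
    qed
    with le[OF b, of "?s f"] show "W (?s f) \<le> (\<integral>\<^sup>+t. G (?s (f(b := t))) \<partial>lborel)" by simp
  qed (use d in auto)
  also have "\<dots> \<le> (\<Prod>b\<in>(Basis::'a set). epow (\<integral>\<^sup>+f. G (?s f) \<partial>?P) (1 / (?d - 1)))"
    using loomis_whitney[of "Basis :: 'a set" "\<lambda>_ f. G (?s f)"] dim by simp
  also have "\<dots> = epow (\<integral>\<^sup>+f. G (?s f) \<partial>?P) (?d / (?d - 1))" unfolding ep ..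
  also have "(\<integral>\<^sup>+f. G (?s f) \<partial>?P) = (\<integral>\<^sup>+x. G x \<partial>lborel)"
    by (subst (2) lborel_eq, subst nn_integral_distr) auto
  finally show ?thesis .
qed

text \<open>The odd power sgn(y) |y|^a, up to a factor the derivative of |y|^(a+1). The two maxima
  make its continuity at zero immediate.\<close>

definition signed_powr :: "real \<Rightarrow> real \<Rightarrow> real" where
  "signed_powr y a = max y 0 powr a - max (- y) 0 powr a"

lemma continuous_signed_powr:
  assumes "a > 0" shows "continuous_on S (\<lambda>y. signed_powr y a)"
  unfolding signed_powr_def using assms
  by (intro continuous_intros continuous_on_powr') auto

lemma abs_signed_powr: "\<bar>signed_powr y a\<bar> = \<bar>y\<bar> powr a"
  by (cases "y \<ge> 0") (auto simp: signed_powr_def max_def)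

lemma has_real_derivative_abs_powr:
  assumes "p > 1"
  shows "((\<lambda>y. \<bar>y\<bar> powr p) has_real_derivative p * signed_powr y (p - 1)) (at y)"
proof -
  consider "y > 0" | "y < 0" | "y = 0" by linarith
  then show ?thesis
  proof cases
    case 1
    have "((\<lambda>y. y powr p) has_real_derivative p * y powr (p - 1)) (at y)"
      using 1 by (rule has_real_derivative_powr)
    then have "((\<lambda>y. \<bar>y\<bar> powr p) has_real_derivative p * y powr (p - 1)) (at y)"
      by (rule has_field_derivative_transform_within_open[of _ _ _ "{0<..}"]) (use 1 in auto)
    then show ?thesis using 1 by (simp add: signed_powr_def max_def)
  next
    case 2
    have "((\<lambda>y. (- y) powr p) has_real_derivative (p * (- y) powr (p - 1)) * - 1) (at y)"
      by (rule DERIV_chain2[of "\<lambda>y. y powr p"]) (use 2 in \<open>auto intro!: derivative_eq_intros has_real_derivative_powr\<close>)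
    then have "((\<lambda>y. \<bar>y\<bar> powr p) has_real_derivative (p * (- y) powr (p - 1)) * - 1) (at y)"
      by (rule has_field_derivative_transform_within_open[of _ _ _ "{..<0}"]) (use 2 in auto)
    then show ?thesis using 2 by (simp add: signed_powr_def max_def)
  next
    case 3
    have "((\<lambda>h. \<bar>h\<bar> powr (p - 1)) \<longlongrightarrow> 0) (at (0::real))"
    proof -
      have "continuous_on UNIV (\<lambda>h::real. \<bar>h\<bar> powr (p - 1))"
        using assms by (intro continuous_intros continuous_on_powr') auto
      then have "isCont (\<lambda>h::real. \<bar>h\<bar> powr (p - 1)) 0" by (simp add: continuous_on_eq_continuous_at)
      then show ?thesis using assms by (simp add: isCont_def)
    qed
    then have "((\<lambda>h. (\<bar>0 + h\<bar> powr p - \<bar>0\<bar> powr p) / h) \<longlongrightarrow> 0) (at (0::real))"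
    proof (rule Lim_null_comparison[rotated])
      have "norm ((\<bar>0 + h\<bar> powr p - \<bar>0\<bar> powr p) / h) \<le> \<bar>h\<bar> powr (p - 1)" for h :: real
        by (cases "h = 0") (auto simp: powr_diff abs_divide)
      then show "\<forall>\<^sub>F h in at 0. norm ((\<bar>0 + h\<bar> powr p - \<bar>0\<bar> powr p) / h) \<le> \<bar>h\<bar> powr (p - 1)" by simp
    qed
    then show ?thesis using 3 by (simp add: DERIV_def signed_powr_def)
  qed
qed

lemma compact_support_integral:
  fixes f :: "'a::euclidean_space \<Rightarrow> real"
  assumes f: "continuous_on UNIV f" "compact K" "K \<subseteq> U" "U \<in> sets lebesgue" "\<And>x. x \<notin> K \<Longrightarrow> f x = 0" "\<And>x. 0 \<le> f x"
  shows "integrable (lebesgue_on U) f" "(\<integral>\<^sup>+x. ennreal (f x) \<partial>lborel) = ennreal (\<integral>x. f x \<partial>lebesgue_on U)"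
proof -
  have fK: "f = (\<lambda>x. indicator K x *\<^sub>R f x)" using f by (auto simp: indicator_def fun_eq_iff)
  have "integrable lborel (\<lambda>x. indicator K x *\<^sub>R f x)"
    using f by (intro borel_integrable_compact) (auto intro: continuous_on_subset)
  then have i: "integrable lborel f" using fK by simp
  then have i': "integrable lebesgue f" by (simp add: integrable_completion borel_measurable_integrable)
  have fU: "f = (\<lambda>x. indicator U x *\<^sub>R f x)" using f by (fastforce simp: indicator_def fun_eq_iff)
  show iU: "integrable (lebesgue_on U) f"
    using i' fU f(4) by (subst integrable_restrict_space) auto
  have "(\<integral>x. f x \<partial>lebesgue_on U) = (\<integral>x. indicator U x *\<^sub>R f x \<partial>lebesgue)"
    using f(4) by (subst integral_restrict_space) auto
  also have "\<dots> = (\<integral>x. f x \<partial>lebesgue)" using fU by simp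
  also have "\<dots> = (\<integral>x. f x \<partial>lborel)" using i by (simp add: integral_completion borel_measurable_integrable)
  finally show "(\<integral>\<^sup>+x. ennreal (f x) \<partial>lborel) = ennreal (\<integral>x. f x \<partial>lebesgue_on U)"
    using i f by (simp add: nn_integral_eq_integral)
qed

text \<open>Fundamental theorem of calculus on the line through \<open>x\<close> in direction
  \<open>b\<close>, started at a point outside the support. The condition \<open>p > 1\<close> makes
  |\<phi>|^p continuously differentiable across the zeros of \<phi>.\<close>

lemma abs_powr_le_line_integral:
  fixes \<phi> :: "real^'n::finite \<Rightarrow> real"
  assumes \<phi>: "smooth_fun \<phi>" "compact (tsupport \<phi>)" and p: "p > 1" and b: "norm b = 1"
  shows "ennreal (\<bar>\<phi> x\<bar> powr p)
    \<le> (\<integral>\<^sup>+t. ennreal (p * (\<bar>\<phi> (x + (t - x \<bullet> b) *\<^sub>R b)\<bar> powr (p - 1) * norm (grad \<phi> (x + (t - x \<bullet> b) *\<^sub>R b)))) \<partial>lborel)"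
proof -
  define \<gamma> where "\<gamma> t = x + (t - x \<bullet> b) *\<^sub>R b" for t
  have d\<gamma>: "(\<gamma> has_derivative (\<lambda>h. h *\<^sub>R b)) (at t)" for t
    unfolding \<gamma>_def by (auto intro!: derivative_eq_intros)
  have d: "((\<lambda>t. \<phi> (\<gamma> t)) has_real_derivative grad \<phi> (\<gamma> t) \<bullet> b) (at t)" for t
  proof -
    have "(\<lambda>h. grad \<phi> (\<gamma> t) \<bullet> (h *\<^sub>R b)) = (*) (grad \<phi> (\<gamma> t) \<bullet> b)" by (auto simp: fun_eq_iff)
    then show ?thesis
      using has_derivative_compose[OF d\<gamma> has_derivative_grad[OF smooth_fun_differentiable[OF \<phi>(1)]], of t]
      by (simp only: has_field_derivative_def)
  qed
  define f where "f t = p * signed_powr (\<phi> (\<gamma> t)) (p - 1) * (grad \<phi> (\<gamma> t) \<bullet> b)" for t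
  have dF: "((\<lambda>t. \<bar>\<phi> (\<gamma> t)\<bar> powr p) has_real_derivative f t) (at t)" for t
    unfolding f_def by (rule DERIV_chain2[OF has_real_derivative_abs_powr[OF p] d])
  have c\<gamma>: "continuous_on UNIV \<gamma>" unfolding \<gamma>_def by (intro continuous_intros)
  have cf: "continuous_on UNIV f"
    unfolding f_def using p \<phi>
    by (intro continuous_intros continuous_on_compose2[OF continuous_signed_powr[of "p - 1" UNIV]]
        continuous_on_compose2[OF continuous_on_smooth[of \<phi> UNIV] c\<gamma>]
        continuous_on_compose2[OF continuous_on_grad[of \<phi> UNIV] c\<gamma>]) auto
  obtain R where R: "\<And>y. y \<in> tsupport \<phi> \<Longrightarrow> norm y \<le> R" 
    using compact_imp_bounded[OF \<phi>(2)] by (auto simp: bounded_iff)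
  \<comment> \<open>Moving back from \<open>x\<close> by \<open>r\<close> leaves the support, since
    the norm of \<open>x - r *\<^sub>R b\<close> is at least \<open>r - norm x\<close>. The absolute
    value covers an empty support, where \<open>R\<close> may be negative.\<close>
  define r where "r = \<bar>R\<bar> + norm x + 1"
  have g0: "\<gamma> (x \<bullet> b) = x" by (simp add: \<gamma>_def)
  have z: "\<phi> (\<gamma> (x \<bullet> b - r)) = 0"
  proof (rule tsupportD, rule notI)
    assume "\<gamma> (x \<bullet> b - r) \<in> tsupport \<phi>"
    then have "norm (x - r *\<^sub>R b) \<le> R" using R by (auto simp: \<gamma>_def)
    moreover have "norm (r *\<^sub>R b) \<le> norm (x - r *\<^sub>R b) + norm x" 
      using norm_triangle_ineq[of "r *\<^sub>R b - x" x] by (simp add: norm_minus_commute)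
    ultimately show False using b by (auto simp: r_def)
  qed
  have r: "r \<ge> 0" by (simp add: r_def)
  have hb: "has_bochner_integral lborel (\<lambda>t. f t * indicator {x \<bullet> b - r .. x \<bullet> b} t)
     (\<bar>\<phi> (\<gamma> (x \<bullet> b))\<bar> powr p - \<bar>\<phi> (\<gamma> (x \<bullet> b - r))\<bar> powr p)"
    using r dF cf by (intro has_bochner_integral_FTC_Icc_real) (auto simp: continuous_on_eq_continuous_at)
  then have i: "integrable lborel (\<lambda>t. f t * indicator {x \<bullet> b - r .. x \<bullet> b} t)" by (rule integrable.intros)
  have "\<bar>\<phi> x\<bar> powr p = (\<integral>t. f t * indicator {x \<bullet> b - r .. x \<bullet> b} t \<partial>lborel)"
    using has_bochner_integral_integral_eq[OF hb] z p by (simp add: g0)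
  also have "\<dots> \<le> (\<integral>t. norm (f t * indicator {x \<bullet> b - r .. x \<bullet> b} t) \<partial>lborel)"
    by (rule integral_mono[OF i integrable_norm[OF i]]) auto
  finally have "ennreal (\<bar>\<phi> x\<bar> powr p) \<le> ennreal (\<integral>t. norm (f t * indicator {x \<bullet> b - r .. x \<bullet> b} t) \<partial>lborel)"
    by (rule ennreal_leI)
  also have "\<dots> = (\<integral>\<^sup>+t. ennreal (norm (f t * indicator {x \<bullet> b - r .. x \<bullet> b} t)) \<partial>lborel)"
    using i by (intro nn_integral_eq_integral[symmetric] integrable_norm) auto
  also have "\<dots> \<le> (\<integral>\<^sup>+t. ennreal (p * (\<bar>\<phi> (\<gamma> t)\<bar> powr (p - 1) * norm (grad \<phi> (\<gamma> t)))) \<partial>lborel)"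
  proof (intro nn_integral_mono ennreal_leI)
    fix t
    have "\<bar>grad \<phi> (\<gamma> t) \<bullet> b\<bar> \<le> norm (grad \<phi> (\<gamma> t))"
      using Cauchy_Schwarz_ineq2[of "grad \<phi> (\<gamma> t)" b] b by simp
    then have "\<bar>f t\<bar> \<le> p * (\<bar>\<phi> (\<gamma> t)\<bar> powr (p - 1) * norm (grad \<phi> (\<gamma> t)))"
      using p unfolding f_def by (simp add: abs_mult abs_signed_powr mult.assoc mult_left_mono)
    then show "norm (f t * indicator {x \<bullet> b - r .. x \<bullet> b} t) \<le> p * (\<bar>\<phi> (\<gamma> t)\<bar> powr (p - 1) * norm (grad \<phi> (\<gamma> t)))"
      using p by (auto simp: indicator_def)
  qed
  finally show ?thesis by (simp add: \<gamma>_def)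
qed

text \<open>Gagliardo's inequality is applied to |\<phi>|^\<gamma>. The exponent \<gamma> is the one
  for which the power \<gamma> d/(d-1) on the left and the power 2(\<gamma>-1) left by
  Cauchy-Schwarz on the right are both equal to \<open>q\<close>. With \<open>?N\<close> the
  integral of |\<phi>|^q, this gives \<open>?N\<close> to the power (d-1)/d at most \<gamma> sqrt
  \<open>?N\<close> times the gradient norm, and sqrt \<open>?N\<close> cancels.\<close>

lemma sobolev_test_fun:
  fixes \<phi> :: "real^'n::finite \<Rightarrow> real" and U
  assumes d: "CARD('n) \<ge> 3" and \<phi>: "test_fun U \<phi>" and U: "U \<in> sets lebesgue"
  defines "d \<equiv> real CARD('n)"
  shows "(\<integral>x. \<bar>\<phi> x\<bar> powr (2 * d / (d - 2)) \<partial>lebesgue_on U) powr ((d - 2) / (2 * d))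
    \<le> 2 * (d - 1) / (d - 2) * sqrt (\<integral>x. (norm (grad \<phi> x))\<^sup>2 \<partial>lebesgue_on U)"
proof -
  define \<gamma> where "\<gamma> = 2 * (d - 1) / (d - 2)"
  define q where "q = 2 * d / (d - 2)"
  have d3: "d \<ge> 3" using d by (simp add: d_def)
  have \<gamma>1: "\<gamma> > 1" using d3 by (simp add: \<gamma>_def field_simps)
  have "d - 1 \<noteq> 0" "d - 2 \<noteq> 0" using d3 by auto
  then have q: "\<gamma> * (d / (d - 1)) = q" "(\<gamma> - 1) * 2 = q" "q > 0"
    using d3 by (simp_all add: \<gamma>_def q_def divide_simps)
  have q2: "q * (1 / 2) = \<gamma> - 1" using q(2) by simp
  have \<phi>': "smooth_fun \<phi>" "compact (tsupport \<phi>)" "tsupport \<phi> \<subseteq> U" using \<phi> by (auto simp: test_fun_def)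
  note [measurable] = test_fun_borel[OF \<phi>]
  let ?N = "\<integral>x. \<bar>\<phi> x\<bar> powr q \<partial>lebesgue_on U" and ?D = "\<integral>x. (norm (grad \<phi> x))\<^sup>2 \<partial>lebesgue_on U"
  have N0: "?N \<ge> 0" and D0: "?D \<ge> 0" by simp_all
  have N: "(\<integral>\<^sup>+x. ennreal (\<bar>\<phi> x\<bar> powr q) \<partial>lborel) = ennreal ?N"
    using \<phi>' U q test_funD(3)[OF \<phi>]
    by (intro compact_support_integral[of _ "tsupport \<phi>"] continuous_on_powr' continuous_intros) (auto simp: tsupportD)
  have D: "(\<integral>\<^sup>+x. ennreal ((norm (grad \<phi> x))\<^sup>2) \<partial>lborel) = ennreal ?D"
    using \<phi>' U test_funD(4)[OF \<phi>]
    by (intro compact_support_integral[of _ "tsupport \<phi>"] continuous_intros) (auto simp: grad_outside_tsupport)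
  have e1: "d / (d - 1) > 0" using d3 by simp
  have "ennreal ?N = (\<integral>\<^sup>+x. epow (ennreal (\<bar>\<phi> x\<bar> powr \<gamma>)) (d / (d - 1)) \<partial>lborel)"
    unfolding N[symmetric] using q by (simp add: powr_powr)
  also have "\<dots> \<le> epow (\<integral>\<^sup>+x. ennreal (\<gamma> * (\<bar>\<phi> x\<bar> powr (\<gamma> - 1) * norm (grad \<phi> x))) \<partial>lborel) (d / (d - 1))"
    using gagliardo[where W="\<lambda>x. ennreal (\<bar>\<phi> x\<bar> powr \<gamma>)" and G="\<lambda>x. ennreal (\<gamma> * (\<bar>\<phi> x\<bar> powr (\<gamma> - 1) * norm (grad \<phi> x)))"]
      abs_powr_le_line_integral[OF \<phi>'(1,2) \<gamma>1] d
    by (simp add: d_def)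
  also have "(\<integral>\<^sup>+x. ennreal (\<gamma> * (\<bar>\<phi> x\<bar> powr (\<gamma> - 1) * norm (grad \<phi> x))) \<partial>lborel)
     = ennreal \<gamma> * (\<integral>\<^sup>+x. ennreal (\<bar>\<phi> x\<bar> powr (\<gamma> - 1) * norm (grad \<phi> x)) \<partial>lborel)"
    using \<gamma>1 by (subst nn_integral_cmult[symmetric]) (auto simp: ennreal_mult)
  also have "(\<integral>\<^sup>+x. ennreal (\<bar>\<phi> x\<bar> powr (\<gamma> - 1) * norm (grad \<phi> x)) \<partial>lborel)
     = (\<integral>\<^sup>+x. epow (ennreal (\<bar>\<phi> x\<bar> powr q)) (1/2) * epow (ennreal ((norm (grad \<phi> x))\<^sup>2)) (1/2) \<partial>lborel)"
  proof (intro nn_integral_cong)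
    fix x
    have "(\<bar>\<phi> x\<bar> powr q) powr (1/2) = \<bar>\<phi> x\<bar> powr (\<gamma> - 1)" by (simp only: powr_powr q2)
    moreover have "((norm (grad \<phi> x))\<^sup>2) powr (1/2) = norm (grad \<phi> x)" by (simp add: powr_half_sqrt)
    ultimately show "ennreal (\<bar>\<phi> x\<bar> powr (\<gamma> - 1) * norm (grad \<phi> x))
      = epow (ennreal (\<bar>\<phi> x\<bar> powr q)) (1/2) * epow (ennreal ((norm (grad \<phi> x))\<^sup>2)) (1/2)"
      by (simp only: epow_ennreal powr_ge_zero zero_le_power2 ennreal_mult norm_ge_zero)
  qed
  finally have "ennreal ?N \<le> epow (ennreal \<gamma> * \<dots>) (d / (d - 1))" .
  also have "\<dots> \<le> epow (ennreal \<gamma> * (epow (ennreal ?N) (1/2) * epow (ennreal ?D) (1/2))) (d / (d - 1))"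
    unfolding N[symmetric] D[symmetric] using e1
    by (intro epow_mono mult_left_mono nn_integral_Holder2) auto
  also have "\<dots> = ennreal ((\<gamma> * (sqrt ?N * sqrt ?D)) powr (d / (d - 1)))"
    using \<gamma>1 N0 D0 by (simp add: powr_half_sqrt flip: ennreal_mult')
  finally have le: "?N \<le> (\<gamma> * (sqrt ?N * sqrt ?D)) powr (d / (d - 1))" by (simp add: ennreal_le_iff)
  have "?N powr ((d - 2) / (2 * d)) \<le> \<gamma> * sqrt ?D"
  proof (cases "?N = 0")
    case False
    then have Np: "?N > 0" using N0 by linarith
    have "?N powr ((d - 1) / d) \<le> ((\<gamma> * (sqrt ?N * sqrt ?D)) powr (d / (d - 1))) powr ((d - 1) / d)"
      using le N0 d3 by (intro powr_mono2) auto
    also have "\<dots> = \<gamma> * (sqrt ?N * sqrt ?D)" using d3 \<gamma>1 N0 D0 by (simp add: powr_powr)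
    finally have *: "?N powr ((d - 1) / d) \<le> sqrt ?N * (\<gamma> * sqrt ?D)" by (simp add: ac_simps)
    have "?N powr ((d - 1) / d) = ?N powr (1/2) * ?N powr ((d - 2) / (2 * d))"
    proof -
      have "(d - 1) / d = 1/2 + (d - 2) / (2 * d)" using d3 by (simp add: field_simps)
      then show ?thesis by (simp only: powr_add)
    qed
    also have "?N powr (1/2) = sqrt ?N" using N0 by (simp add: powr_half_sqrt)
    finally show ?thesis using * Np by (simp add: mult_le_cancel_left_pos)
  qed (use \<gamma>1 D0 in simp)
  then show ?thesis unfolding \<gamma>_def q_def .
qed

section \<open>Square-integrable functions and Lions' theorem\<close>

text \<open>Values in an arbitrary inner product space are allowed, so that a gradient paired with a
  zero-order term, or a function paired with its gradient, is again one square-integrable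
  function.\<close>

definition L2 :: "'a measure \<Rightarrow> ('a \<Rightarrow> 'b::{real_inner,banach,second_countable_topology}) \<Rightarrow> bool" where
  "L2 M f \<longleftrightarrow> f \<in> borel_measurable M \<and> integrable M (\<lambda>x. (norm (f x))\<^sup>2)"

lemma L2_measurable: "L2 M f \<Longrightarrow> f \<in> borel_measurable M"
  and L2_integrable: "L2 M f \<Longrightarrow> integrable M (\<lambda>x. (norm (f x))\<^sup>2)"
  by (simp_all add: L2_def)

lemma L2_bound:
  fixes f :: "'a \<Rightarrow> 'b::{real_inner,banach,second_countable_topology}"
    and g :: "'a \<Rightarrow> 'c::{real_inner,banach,second_countable_topology}"
  assumes "L2 M g" "f \<in> borel_measurable M" "AE x in M. norm (f x) \<le> norm (g x)"
  shows "L2 M f"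
  unfolding L2_def
proof (intro conjI assms Bochner_Integration.integrable_bound[OF L2_integrable[OF assms(1)]])
  show "(\<lambda>x. (norm (f x))\<^sup>2) \<in> borel_measurable M" using assms(2) by measurable
  show "AE x in M. norm ((norm (f x))\<^sup>2) \<le> norm ((norm (g x))\<^sup>2)"
    using assms(3) by eventually_elim (auto intro: power_mono)
qed

lemma L2_scaleR: "L2 M f \<Longrightarrow> L2 M (\<lambda>x. c *\<^sub>R f x)"
  by (auto simp: L2_def power_mult_distrib)

lemma L2_norm: "L2 M f \<Longrightarrow> L2 M (\<lambda>x. norm (f x))"
  by (auto simp: L2_def)

lemma L2_add:
  assumes "L2 M f" "L2 M g"
  shows "L2 M (\<lambda>x. f x + g x)"
  unfolding L2_def
proof (intro conjI)
  note [measurable] = L2_measurable[OF assms(1)] L2_measurable[OF assms(2)]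
  show "(\<lambda>x. f x + g x) \<in> borel_measurable M" by measurable
  show "integrable M (\<lambda>x. (norm (f x + g x))\<^sup>2)"
  proof (rule Bochner_Integration.integrable_bound)
    show "integrable M (\<lambda>x. 2 * (norm (f x))\<^sup>2 + 2 * (norm (g x))\<^sup>2)"
      using assms by (intro Bochner_Integration.integrable_add integrable_mult_right) (auto simp: L2_def)
    have "(norm (f x + g x))\<^sup>2 \<le> 2 * (norm (f x))\<^sup>2 + 2 * (norm (g x))\<^sup>2" for x
    proof -
      have "(norm (f x + g x))\<^sup>2 \<le> (norm (f x) + norm (g x))\<^sup>2" by (intro power_mono norm_triangle_ineq) auto
      also have "\<dots> \<le> 2 * (norm (f x))\<^sup>2 + 2 * (norm (g x))\<^sup>2"
        using zero_le_power2[of "norm (f x) - norm (g x)"] by (simp add: power2_eq_square algebra_simps)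
      finally show ?thesis .
    qed
    then show "AE x in M. norm ((norm (f x + g x))\<^sup>2) \<le> norm (2 * (norm (f x))\<^sup>2 + 2 * (norm (g x))\<^sup>2)"
      by (intro AE_I2) auto
  qed measurable
qed

lemma L2_diff: "L2 M f \<Longrightarrow> L2 M g \<Longrightarrow> L2 M (\<lambda>x. f x - g x)"
  using L2_add[of M f "\<lambda>x. (-1) *\<^sub>R g x"] L2_scaleR[of M g "-1"] by simp

lemma L2_norm_mult_integrable:
  assumes "L2 M f" "L2 M g"
  shows "integrable M (\<lambda>x. norm (f x) * norm (g x))"
proof (rule Bochner_Integration.integrable_bound)
  note [measurable] = L2_measurable[OF assms(1)] L2_measurable[OF assms(2)]
  show "integrable M (\<lambda>x. (norm (f x))\<^sup>2 + (norm (g x))\<^sup>2)"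
    using assms by (intro Bochner_Integration.integrable_add) (auto simp: L2_def)
  have "norm (f x) * norm (g x) \<le> (norm (f x))\<^sup>2 + (norm (g x))\<^sup>2" for x
    using sum_squares_bound[of "norm (f x)" "norm (g x)"] mult_nonneg_nonneg[OF norm_ge_zero[of "f x"] norm_ge_zero[of "g x"]]
    by linarith
  then show "AE x in M. norm (norm (f x) * norm (g x)) \<le> norm ((norm (f x))\<^sup>2 + (norm (g x))\<^sup>2)"
    by (intro AE_I2) auto
  show "(\<lambda>x. norm (f x) * norm (g x)) \<in> borel_measurable M" by measurable
qed

lemma L2_inner_integrable:
  assumes "L2 M f" "L2 M g"
  shows "integrable M (\<lambda>x. f x \<bullet> g x)"
proof (rule Bochner_Integration.integrable_bound[OF L2_norm_mult_integrable[OF assms]])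
  note [measurable] = L2_measurable[OF assms(1)] L2_measurable[OF assms(2)]
  show "(\<lambda>x. f x \<bullet> g x) \<in> borel_measurable M" by measurable
qed (auto intro!: AE_I2 simp: Cauchy_Schwarz_ineq2)

lemma L2_mult_integrable:
  fixes f g :: "'a \<Rightarrow> real"
  shows "L2 M f \<Longrightarrow> L2 M g \<Longrightarrow> integrable M (\<lambda>x. f x * g x)"
  using L2_inner_integrable[of M f g] by simp

text \<open>The discriminant inequality, read off at the minimiser -c/b. For b = 0 the polynomial is
  affine in t, and a nonzero slope would make it negative somewhere.\<close>

lemma quadratic_nonneg_imp:
  fixes a b c :: real
  assumes "\<And>t. 0 \<le> a + 2 * t * c + t\<^sup>2 * b" "0 \<le> b"
  shows "c\<^sup>2 \<le> a * b"
proof (cases "b = 0")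
  case True
  have "c = 0"
  proof (rule ccontr)
    assume "c \<noteq> 0"
    then have "2 * (- (a + 1) / (2 * c)) * c = - (a + 1)" by simp
    then show False using assms(1)[of "- (a + 1) / (2 * c)"] True by simp
  qed
  then show ?thesis using True by simp
next
  case False
  then have "b > 0" using assms by simp
  then have "2 * (- c / b) * c + (- c / b)\<^sup>2 * b = - (c\<^sup>2 / b)"
    by (simp add: power2_eq_square)
  then have "c\<^sup>2 / b \<le> a" using assms(1)[of "- c / b"] by linarith
  then show ?thesis using \<open>b > 0\<close> by (simp add: pos_divide_le_eq)
qed

lemma L2_Cauchy_Schwarz:
  assumes "L2 M f" "L2 M g"
  shows "(\<integral>x. f x \<bullet> g x \<partial>M)\<^sup>2 \<le> (\<integral>x. (norm (f x))\<^sup>2 \<partial>M) * (\<integral>x. (norm (g x))\<^sup>2 \<partial>M)"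
proof (rule quadratic_nonneg_imp)
  fix t
  have i: "integrable M (\<lambda>x. f x \<bullet> g x)" by (rule L2_inner_integrable[OF assms])
  have "0 \<le> (\<integral>x. (norm (f x + t *\<^sub>R g x))\<^sup>2 \<partial>M)" by simp
  also have "\<dots> = (\<integral>x. (norm (f x))\<^sup>2 + 2 * t * (f x \<bullet> g x) + t\<^sup>2 * (norm (g x))\<^sup>2 \<partial>M)"
  proof (intro Bochner_Integration.integral_cong refl)
    fix x
    have "(norm (f x + t *\<^sub>R g x))\<^sup>2 = (norm (f x))\<^sup>2 + 2 * (f x \<bullet> (t *\<^sub>R g x)) + (norm (t *\<^sub>R g x))\<^sup>2"
      unfolding power2_norm_eq_inner by (simp add: inner_add inner_commute)
    then show "(norm (f x + t *\<^sub>R g x))\<^sup>2 = (norm (f x))\<^sup>2 + 2 * t * (f x \<bullet> g x) + t\<^sup>2 * (norm (g x))\<^sup>2"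
      by (simp add: power_mult_distrib)
  qed
  also have "\<dots> = (\<integral>x. (norm (f x))\<^sup>2 \<partial>M) + 2 * t * (\<integral>x. f x \<bullet> g x \<partial>M) + t\<^sup>2 * (\<integral>x. (norm (g x))\<^sup>2 \<partial>M)"
    using assms i by (simp add: L2_def)
  finally show "0 \<le> \<dots>" .
qed simp

lemma L2_dist_sq_triangle:
  assumes "L2 M f" "L2 M g" "L2 M h"
  shows "(\<integral>x. (norm (f x - h x))\<^sup>2 \<partial>M) \<le> 2 * (\<integral>x. (norm (f x - g x))\<^sup>2 \<partial>M) + 2 * (\<integral>x. (norm (g x - h x))\<^sup>2 \<partial>M)"
proof -
  have i: "integrable M (\<lambda>x. (norm (f x - g x))\<^sup>2)" "integrable M (\<lambda>x. (norm (g x - h x))\<^sup>2)"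
    "integrable M (\<lambda>x. (norm (f x - h x))\<^sup>2)"
    using L2_integrable[OF L2_diff] assms by blast+
  have "(\<integral>x. (norm (f x - h x))\<^sup>2 \<partial>M) \<le> (\<integral>x. 2 * (norm (f x - g x))\<^sup>2 + 2 * (norm (g x - h x))\<^sup>2 \<partial>M)"
  proof (rule integral_mono)
    show "(norm (f x - h x))\<^sup>2 \<le> 2 * (norm (f x - g x))\<^sup>2 + 2 * (norm (g x - h x))\<^sup>2" for x
    proof -
      have "norm (f x - h x) \<le> norm (f x - g x) + norm (g x - h x)"
        using norm_triangle_ineq[of "f x - g x" "g x - h x"] by simp
      then have "(norm (f x - h x))\<^sup>2 \<le> (norm (f x - g x) + norm (g x - h x))\<^sup>2" by (intro power_mono) auto
      then show ?thesis
        using zero_le_power2[of "norm (f x - g x) - norm (g x - h x)"] by (simp add: power2_eq_square algebra_simps)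
    qed
  qed (use i in auto)
  also have "\<dots> = 2 * (\<integral>x. (norm (f x - g x))\<^sup>2 \<partial>M) + 2 * (\<integral>x. (norm (g x - h x))\<^sup>2 \<partial>M)"
    using i by simp
  finally show ?thesis .
qed

section \<open>Majorants, subsequences and completeness\<close>

text \<open>\<open>W\<close> is the sum of \<open>2^m * (b m x)\<^sup>2\<close>: the weight gives
  away half of the geometric decay of the integrals, which keeps the sum integrable and turns the
  rest into a pointwise rate.\<close>

lemma geometric_L2_majorant:
  fixes b :: "nat \<Rightarrow> 'a \<Rightarrow> real"
  assumes b: "\<And>m. integrable M (\<lambda>x. (b m x)\<^sup>2)" "\<And>m. (\<integral>x. (b m x)\<^sup>2 \<partial>M) \<le> (1/4)^m"
  obtains W where "integrable M W" "\<And>x. 0 \<le> W x" "AE x in M. \<forall>m. (b m x)\<^sup>2 \<le> W x * (1/2)^m"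
proof -
  let ?F = "\<lambda>m x. ennreal (2^m * (b m x)\<^sup>2)"
  let ?S = "\<lambda>x. \<Sum>m. ?F m x"
  have m: "?F m \<in> borel_measurable M" for m
    using borel_measurable_integrable[OF integrable_mult_right[OF b(1)[of m], of "2^m"]]
    by (rule measurable_compose[OF _ measurable_ennreal])
  have "(\<integral>\<^sup>+x. ?S x \<partial>M) = (\<Sum>m. \<integral>\<^sup>+x. ?F m x \<partial>M)" by (intro nn_integral_suminf m)
  also have "\<dots> \<le> (\<Sum>m. ennreal ((1/2)^m))"
  proof (intro suminf_le summableI)
    fix m
    have "(\<integral>\<^sup>+x. ?F m x \<partial>M) = ennreal (\<integral>x. 2^m * (b m x)\<^sup>2 \<partial>M)"
      using b(1) by (intro nn_integral_eq_integral) auto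
    also have "\<dots> \<le> ennreal ((1/2)^m)"
    proof (rule ennreal_leI)
      have "(\<integral>x. 2^m * (b m x)\<^sup>2 \<partial>M) = 2^m * (\<integral>x. (b m x)\<^sup>2 \<partial>M)" by simp
      also have "\<dots> \<le> 2^m * (1/4)^m" by (intro mult_left_mono b) auto
      also have "\<dots> = (2 * (1/4))^m" by (rule power_mult_distrib[symmetric])
      finally show "(\<integral>x. 2^m * (b m x)\<^sup>2 \<partial>M) \<le> (1/2)^m" by simp
    qed
    finally show "(\<integral>\<^sup>+x. ?F m x \<partial>M) \<le> ennreal ((1/2)^m)" .
  qed
  also have "\<dots> = ennreal (\<Sum>m. (1/2)^m)" by (intro suminf_ennreal2) auto
  finally have "(\<integral>\<^sup>+x. ?S x \<partial>M) \<le> ennreal (\<Sum>m. (1/2)^m)" .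
  then have fin: "(\<integral>\<^sup>+x. ?S x \<partial>M) < \<infinity>" by (rule order_le_less_trans) simp
  have Sm[measurable]: "?S \<in> borel_measurable M" by (rule borel_measurable_suminf_order[OF m])
  have AEfin: "AE x in M. ?S x \<noteq> \<infinity>" by (rule nn_integral_noteq_infinite[OF Sm]) (use fin in auto)
  define W where "W x = enn2real (?S x)" for x
  have "integrable M W"
  proof (rule integrableI_bounded)
    show "W \<in> borel_measurable M" unfolding W_def by (rule borel_measurable_enn2real[OF Sm])
    have "(\<integral>\<^sup>+x. ennreal (norm (W x)) \<partial>M) \<le> (\<integral>\<^sup>+x. ?S x \<partial>M)"
    proof (intro nn_integral_mono)
      show "ennreal (norm (W x)) \<le> ?S x" for x
        unfolding W_def by (cases "?S x" rule: ennreal_cases) (simp_all only: enn2real_ennreal enn2real_top real_norm_def abs_of_nonneg order_refl top_greatest)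
    qed
    then show "(\<integral>\<^sup>+x. ennreal (norm (W x)) \<partial>M) < \<infinity>" using fin by (rule order_le_less_trans)
  qed
  moreover have "AE x in M. \<forall>m. (b m x)\<^sup>2 \<le> W x * (1/2)^m"
    using AEfin
  proof eventually_elim
    case (elim x)
    show ?case
    proof
      fix m
      have "sum (\<lambda>m. ?F m x) {m} \<le> ?S x" by (rule sum_le_suminf[OF summableI]) auto
      then have "enn2real (?F m x) \<le> W x"
        unfolding W_def using elim by (intro enn2real_mono) (auto simp: top.not_eq_extremum)
      then have "2^m * (b m x)\<^sup>2 \<le> W x" by (simp only: enn2real_ennreal zero_le_mult_iff zero_le_power2 zero_le_power zero_le_numeral simp_thms)
      then show "(b m x)\<^sup>2 \<le> W x * (1/2)^m"
        by (simp add: power_one_over pos_le_divide_eq mult.commute)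
    qed
  qed
  ultimately show ?thesis by (intro that[of W]) (auto simp: W_def)
qed

text \<open>A subsequence with squared distances below 4^(-k) has a geometric majorant, which yields
  both the pointwise limit and the dominating function. It prepares dominated convergence wherever
  the sequence enters an expression nonlinearly or next to another L^2 factor.\<close>

lemma L2_dominated_subsequence:
  assumes f: "\<And>m. L2 M (f m)" "L2 M g" and lim: "(\<lambda>m. \<integral>x. (norm (f m x - g x))\<^sup>2 \<partial>M) \<longlonglongrightarrow> 0"
  obtains r h where "strict_mono (r :: nat \<Rightarrow> nat)" "L2 M (h :: 'a \<Rightarrow> real)"
    "AE x in M. (\<lambda>m. f (r m) x) \<longlonglongrightarrow> g x" "AE x in M. \<forall>m. norm (f (r m) x) \<le> h x"
proof -
  let ?D = "\<lambda>m. \<integral>x. (norm (f m x - g x))\<^sup>2 \<partial>M"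
  have ev: "\<forall>\<^sub>F m in sequentially. ?D m < (1/4)^k" for k :: nat
    using order_tendstoD(2)[OF lim, of "(1/4)^k"] by simp
  obtain r :: "nat \<Rightarrow> nat" where r: "strict_mono r" "\<And>k. ?D (r k) < (1/4)^k"
  proof -
    have "\<exists>m. m > n \<and> ?D m < (1/4)^k" for n k :: nat
    proof -
      have "\<forall>\<^sub>F m in sequentially. m > n \<and> ?D m < (1/4)^k"
        using ev[of k] eventually_gt_at_top[of n] by eventually_elim auto
      then show ?thesis by (auto simp: eventually_sequentially)
    qed
    then obtain nx where nx: "\<And>n k. nx n k > n" "\<And>n k. ?D (nx n k) < (1/4)^k" by metis
    define r where "r = rec_nat (nx 0 0) (\<lambda>k n. nx n (Suc k))"
    have "r (Suc k) > r k" for k by (simp add: r_def nx)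
    moreover have "?D (r k) < (1/4)^k" for k
    proof (cases k)
      case 0 then show ?thesis using nx(2)[of 0 0] by (simp add: r_def)
    next
      case (Suc j)
      then have "r k = nx (r j) k" by (simp add: r_def)
      then show ?thesis using nx(2)[of "r j" k] by simp
    qed
    ultimately show ?thesis using that by (auto simp: strict_mono_Suc_iff)
  qed
  have d: "L2 M (\<lambda>x. f (r k) x - g x)" for k using f by (intro L2_diff)
  obtain W where W: "integrable M W" "\<And>x. 0 \<le> W x" "AE x in M. \<forall>m. (norm (f (r m) x - g x))\<^sup>2 \<le> W x * (1/2)^m"
    using geometric_L2_majorant[of M "\<lambda>m x. norm (f (r m) x - g x)"] d r(2) by (auto simp: L2_def less_imp_le)
  show ?thesis
  proof (rule that[of r "\<lambda>x. norm (g x) + sqrt (W x)"])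
    have "L2 M (\<lambda>x. sqrt (W x))" unfolding L2_def using W by (auto intro: borel_measurable_integrable)
    then show "L2 M (\<lambda>x. norm (g x) + sqrt (W x))" by (intro L2_add L2_norm f)
    show "AE x in M. (\<lambda>m. f (r m) x) \<longlonglongrightarrow> g x" using W(3)
    proof eventually_elim
      case (elim x)
      have "(\<lambda>m. W x * (1/2)^m) \<longlonglongrightarrow> W x * 0" by (intro tendsto_intros) auto
      then have W0: "(\<lambda>m. W x * (1/2)^m) \<longlonglongrightarrow> 0" by simp
      have "(\<lambda>m. (norm (f (r m) x - g x))\<^sup>2) \<longlonglongrightarrow> 0"
        by (rule Lim_null_comparison[OF _ W0]) (use elim in auto)
      then have "(\<lambda>m. sqrt ((norm (f (r m) x - g x))\<^sup>2)) \<longlonglongrightarrow> sqrt 0" by (intro tendsto_real_sqrt)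
      then show ?case by (simp add: tendsto_norm_zero_iff LIM_zero_iff)
    qed
    show "AE x in M. \<forall>m. norm (f (r m) x) \<le> norm (g x) + sqrt (W x)" using W(3)
    proof eventually_elim
      case (elim x)
      show ?case
      proof
        fix m
        have "(norm (f (r m) x - g x))\<^sup>2 \<le> W x * (1/2)^m" using elim by blast
        also have "\<dots> \<le> W x * 1" by (intro mult_left_mono W power_le_one) auto
        finally have "norm (f (r m) x - g x) \<le> sqrt (W x)" by (intro real_le_rsqrt) simp
        then show "norm (f (r m) x) \<le> norm (g x) + sqrt (W x)"
          using norm_triangle_sub[of "f (r m) x" "g x"] by linarith
      qed
    qed
  qed (use r in auto)
qed

text \<open>The Riesz-Fischer argument: along a fast subsequence the increments have a common
  geometric majorant, so the sequence converges almost everywhere with an explicit square-integrable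
  bound on the error.\<close>

lemma L2_complete:
  fixes f :: "nat \<Rightarrow> 'a \<Rightarrow> 'b::{real_inner,banach,second_countable_topology}"
  assumes f: "\<And>m. L2 M (f m)"
    and C: "\<And>e. e > 0 \<Longrightarrow> \<exists>N. \<forall>m\<ge>N. \<forall>n\<ge>N. (\<integral>x. (norm (f m x - f n x))\<^sup>2 \<partial>M) < e"
  obtains g where "L2 M g" "(\<lambda>m. \<integral>x. (norm (f m x - g x))\<^sup>2 \<partial>M) \<longlonglongrightarrow> 0"
proof -
  let ?D = "\<lambda>m n. \<integral>x. (norm (f m x - f n x))\<^sup>2 \<partial>M"
  have "\<exists>N. \<forall>m\<ge>N. \<forall>n\<ge>N. ?D m n < (1/4)^k" for k :: nat by (rule C) simp
  then obtain N where N: "\<And>k m n. m \<ge> N k \<Longrightarrow> n \<ge> N k \<Longrightarrow> ?D m n < (1/4)^k" by metis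
  define r where "r = rec_nat (N 0) (\<lambda>k n. max (n + 1) (N (Suc k)))"
  have rS: "r (Suc k) > r k" for k by (simp add: r_def)
  have rN: "r k \<ge> N k" for k by (cases k) (auto simp: r_def)
  have Dr: "?D (r (Suc k)) (r k) \<le> (1/4)^k" for k
    using N[of k "r (Suc k)" "r k"] rN[of k] rS[of k] by simp
  have d: "L2 M (\<lambda>x. f m x - f n x)" for m n using f by (intro L2_diff)
  obtain W where W: "integrable M W" "\<And>x. 0 \<le> W x"
      "AE x in M. \<forall>m. (norm (f (r (Suc m)) x - f (r m) x))\<^sup>2 \<le> W x * (1/2)^m"
    using geometric_L2_majorant[of M "\<lambda>m x. norm (f (r (Suc m)) x - f (r m) x)"] d Dr by (auto simp: L2_def)
  \<comment> \<open>On the null set where the subsequence diverges the value is arbitrary;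
    measurability holds regardless, because \<open>lim\<close> of measurable functions is
    measurable.\<close>
  define g where "g x = lim (\<lambda>m. f (r m) x)" for x
  \<comment> \<open>Squared increments decay like (1/2)^m, hence the increments themselves like
    \<open>q^m\<close>, with tails summing to \<open>q^m / (1 - q)\<close>.\<close>
  define q where "q = sqrt (1/2)"
  have q: "0 < q" "q < 1" "(1/2)^m = (q^m)\<^sup>2" for m
  proof -
    have "(q^m)\<^sup>2 = (q\<^sup>2)^m" by (simp only: power_mult[symmetric] mult.commute)
    then show "(1/2)^m = (q^m)\<^sup>2" by (simp add: q_def)
  qed (simp_all add: q_def)
  have key: "(\<lambda>m. f (r m) x) \<longlonglongrightarrow> g x \<and> (\<forall>m. norm (g x - f (r m) x) \<le> sqrt (W x) * (q^m / (1 - q)))"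
    if el: "\<forall>m. (norm (f (r (Suc m)) x - f (r m) x))\<^sup>2 \<le> W x * (1/2)^m" for x
  proof -
    have st: "norm (f (r (Suc m)) x - f (r m) x) \<le> sqrt (W x) * q^m" for m
    proof (rule power2_le_imp_le)
      show "(norm (f (r (Suc m)) x - f (r m) x))\<^sup>2 \<le> (sqrt (W x) * q^m)\<^sup>2"
        using el[rule_format, of m] W(2)[of x] q(3)[of m] by (simp add: power_mult_distrib)
    qed (use W(2)[of x] q in auto)
    have dist: "norm (f (r (m + k)) x - f (r m) x) \<le> sqrt (W x) * (q^m / (1 - q)) * (1 - q^k)" for m k
    proof (induction k)
      case (Suc k)
      have "norm (f (r (m + Suc k)) x - f (r m) x) \<le> norm (f (r (Suc (m + k))) x - f (r (m + k)) x) + norm (f (r (m + k)) x - f (r m) x)"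
        using norm_triangle_ineq[of "f (r (Suc (m + k))) x - f (r (m + k)) x" "f (r (m + k)) x - f (r m) x"] by simp
      also have "\<dots> \<le> sqrt (W x) * q^(m + k) + sqrt (W x) * (q^m / (1 - q)) * (1 - q^k)"
        using st[of "m + k"] Suc by linarith
      also have "\<dots> = sqrt (W x) * (q^m / (1 - q)) * (1 - q^Suc k)"
        using q by (simp add: field_simps power_add)
      finally show ?case .
    qed simp
    have dist': "norm (f (r (m + k)) x - f (r m) x) \<le> sqrt (W x) * (q^m / (1 - q))" for m k
    proof -
      have "sqrt (W x) * (q^m / (1 - q)) * (1 - q^k) \<le> sqrt (W x) * (q^m / (1 - q)) * 1"
        using q W(2)[of x] by (intro mult_left_mono) auto
      then show ?thesis using dist[of m k] by simp
    qed
    have lim0: "(\<lambda>m. sqrt (W x) * (q^m / (1 - q))) \<longlonglongrightarrow> 0"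
    proof -
      have "(\<lambda>m. sqrt (W x) * (q^m / (1 - q))) \<longlonglongrightarrow> sqrt (W x) * (0 / (1 - q))"
        using q by (intro tendsto_intros LIMSEQ_power_zero) auto
      then show ?thesis by simp
    qed
    have "Cauchy (\<lambda>m. f (r m) x)"
    proof (rule CauchyI)
      fix e :: real assume "e > 0"
      then obtain M0 where M0: "\<And>m. m \<ge> M0 \<Longrightarrow> sqrt (W x) * (q^m / (1 - q)) < e / 2"
        using order_tendstoD(2)[OF lim0, of "e/2"] by (auto simp: eventually_sequentially)
      have that_m: "norm (f (r m) x - f (r M0) x) < e / 2" if "m \<ge> M0" for m
        using le_less_trans[OF dist'[of M0 "m - M0"] M0[OF order_refl]] that by simp
      then have "norm (f (r m) x - f (r n) x) < e" if "m \<ge> M0" "n \<ge> M0" for m n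
        using norm_triangle_ineq4[of "f (r m) x - f (r M0) x" "f (r n) x - f (r M0) x"] that(1)[THEN that_m] that(2)[THEN that_m]
        by simp
      then show "\<exists>M0. \<forall>m\<ge>M0. \<forall>n\<ge>M0. norm (f (r m) x - f (r n) x) < e" by blast
    qed
    then have L: "(\<lambda>m. f (r m) x) \<longlonglongrightarrow> g x"
      unfolding g_def by (simp add: Cauchy_convergent convergent_LIMSEQ_iff[symmetric])
    have "norm (g x - f (r m) x) \<le> sqrt (W x) * (q^m / (1 - q))" for m
    proof (rule LIMSEQ_le_const2)
      have "(\<lambda>k. f (r (k + m)) x) \<longlonglongrightarrow> g x" using LIMSEQ_ignore_initial_segment[OF L] .
      then show "(\<lambda>k. norm (f (r (k + m)) x - f (r m) x)) \<longlonglongrightarrow> norm (g x - f (r m) x)"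
        by (intro tendsto_intros)
      show "\<exists>N. \<forall>n\<ge>N. norm (f (r (n + m)) x - f (r m) x) \<le> sqrt (W x) * (q^m / (1 - q))"
        using dist'[of m] by (auto simp: add.commute)
    qed
    with L show ?thesis by blast
  qed
  have AEk: "AE x in M. (\<lambda>m. f (r m) x) \<longlonglongrightarrow> g x \<and> (\<forall>m. norm (g x - f (r m) x) \<le> sqrt (W x) * (q^m / (1 - q)))"
    using W(3) by eventually_elim (rule key)
  have gm: "g \<in> borel_measurable M" unfolding g_def
    using f by (intro borel_measurable_lim_metric) (auto simp: L2_def)
  have sW: "L2 M (\<lambda>x. sqrt (W x) * (q^m / (1 - q)))" for m
  proof -
    have "(norm (sqrt (W x) * (q^m / (1 - q))))\<^sup>2 = W x * (q^m / (1 - q))\<^sup>2" for x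
      using W(2)[of x] unfolding real_norm_def power2_abs power_mult_distrib by simp
    then show ?thesis
      unfolding L2_def using W(1) borel_measurable_integrable[OF W(1)] by simp
  qed
  have dg: "L2 M (\<lambda>x. g x - f (r m) x)" for m
  proof (rule L2_bound[OF sW[of m]])
    show "(\<lambda>x. g x - f (r m) x) \<in> borel_measurable M"
      using gm L2_measurable[OF f] by measurable
    show "AE x in M. norm (g x - f (r m) x) \<le> norm (sqrt (W x) * (q^m / (1 - q)))"
      using AEk by eventually_elim (use W q in \<open>auto simp: abs_of_nonneg\<close>)
  qed
  have g: "L2 M g" using L2_add[OF dg[of 0] f[of "r 0"]] by simp
  have b: "(\<integral>x. (norm (g x - f (r m) x))\<^sup>2 \<partial>M) \<le> (\<integral>x. W x \<partial>M) * ((1/2)^m / (1 - q)\<^sup>2)" for m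
  proof -
    have "(\<integral>x. (norm (g x - f (r m) x))\<^sup>2 \<partial>M) \<le> (\<integral>x. W x * ((1/2)^m / (1 - q)\<^sup>2) \<partial>M)"
    proof (rule integral_mono_AE)
      show "AE x in M. (norm (g x - f (r m) x))\<^sup>2 \<le> W x * ((1/2)^m / (1 - q)\<^sup>2)"
        using AEk
      proof eventually_elim
        case (elim x)
        then have "(norm (g x - f (r m) x))\<^sup>2 \<le> (sqrt (W x) * (q^m / (1 - q)))\<^sup>2" by (intro power_mono) auto
        also have "\<dots> = W x * ((1/2)^m / (1 - q)\<^sup>2)" using W(2)[of x] q(3)[of m] by (simp add: power_mult_distrib power_divide)
        finally show ?case .
      qed
    qed (use dg W in \<open>auto simp: L2_def\<close>)
    then show ?thesis by simp
  qed
  have lim_r: "(\<lambda>m. \<integral>x. (norm (g x - f (r m) x))\<^sup>2 \<partial>M) \<longlonglongrightarrow> 0"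
  proof (rule Lim_null_comparison[OF always_eventually])
    show "\<forall>m. norm (\<integral>x. (norm (g x - f (r m) x))\<^sup>2 \<partial>M) \<le> (\<integral>x. W x \<partial>M) * ((1/2)^m / (1 - q)\<^sup>2)" using b by simp
    have "(\<lambda>m. (\<integral>x. W x \<partial>M) * ((1/2)^m / (1 - q)\<^sup>2)) \<longlonglongrightarrow> (\<integral>x. W x \<partial>M) * (0 / (1 - q)\<^sup>2)"
      using q by (intro tendsto_intros) auto
    then show "(\<lambda>m. (\<integral>x. W x \<partial>M) * ((1/2)^m / (1 - q)\<^sup>2)) \<longlonglongrightarrow> 0" by simp
  qed
  have "strict_mono r" using rS by (simp add: strict_mono_Suc_iff)
  \<comment> \<open>The Cauchy property carries the convergence from the subsequence over to the
    whole sequence.\<close>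
  have "(\<lambda>m. \<integral>x. (norm (f m x - g x))\<^sup>2 \<partial>M) \<longlonglongrightarrow> 0"
  proof (rule LIMSEQ_I)
    fix e :: real assume e: "e > 0"
    obtain N1 where N1: "\<And>m n. m \<ge> N1 \<Longrightarrow> n \<ge> N1 \<Longrightarrow> ?D m n < e / 4" using C[of "e/4"] e by auto
    obtain N2 where N2: "\<And>m. m \<ge> N2 \<Longrightarrow> (\<integral>x. (norm (g x - f (r m) x))\<^sup>2 \<partial>M) < e / 4"
      using order_tendstoD(2)[OF lim_r, of "e/4"] e by (auto simp: eventually_sequentially)
    have "(\<integral>x. (norm (f m x - g x))\<^sup>2 \<partial>M) < e" if "m \<ge> N1" for m
    proof -
      let ?k = "max N1 N2"
      have "r ?k \<ge> N1" using seq_suble[OF \<open>strict_mono r\<close>, of ?k] by simp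
      then have "?D m (r ?k) < e / 4" using N1 that by blast
      moreover have "(\<integral>x. (norm (f (r ?k) x - g x))\<^sup>2 \<partial>M) < e / 4"
        using N2[of ?k] by (simp add: norm_minus_commute)
      moreover have "(\<integral>x. (norm (f m x - g x))\<^sup>2 \<partial>M) \<le> 2 * ?D m (r ?k) + 2 * (\<integral>x. (norm (f (r ?k) x - g x))\<^sup>2 \<partial>M)"
        by (intro L2_dist_sq_triangle f g)
      ultimately show ?thesis by linarith
    qed
    then show "\<exists>no. \<forall>n\<ge>no. norm ((\<integral>x. (norm (f n x - g x))\<^sup>2 \<partial>M) - 0) < e" by auto
  qed
  then show ?thesis using that g by blast
qed

lemma L2_inner_tendsto:
  assumes "\<And>m. L2 M (f m)" "L2 M g" "L2 M h" "(\<lambda>m. \<integral>x. (norm (f m x - g x))\<^sup>2 \<partial>M) \<longlonglongrightarrow> 0"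
  shows "(\<lambda>m. \<integral>x. f m x \<bullet> h x \<partial>M) \<longlonglongrightarrow> (\<integral>x. g x \<bullet> h x \<partial>M)"
proof -
  have eq: "(\<integral>x. (f m x - g x) \<bullet> h x \<partial>M) = (\<integral>x. f m x \<bullet> h x \<partial>M) - (\<integral>x. g x \<bullet> h x \<partial>M)" for m
    unfolding inner_diff_left using assms by (intro Bochner_Integration.integral_diff L2_inner_integrable)
  have "(\<lambda>m. (\<integral>x. (f m x - g x) \<bullet> h x \<partial>M)\<^sup>2) \<longlonglongrightarrow> 0"
  proof (rule Lim_null_comparison[OF always_eventually])
    show "\<forall>m. norm ((\<integral>x. (f m x - g x) \<bullet> h x \<partial>M)\<^sup>2) \<le> (\<integral>x. (norm (f m x - g x))\<^sup>2 \<partial>M) * (\<integral>x. (norm (h x))\<^sup>2 \<partial>M)"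
      using assms by (auto intro!: L2_Cauchy_Schwarz L2_diff)
    show "(\<lambda>m. (\<integral>x. (norm (f m x - g x))\<^sup>2 \<partial>M) * (\<integral>x. (norm (h x))\<^sup>2 \<partial>M)) \<longlonglongrightarrow> 0"
      using tendsto_mult_right[OF assms(4)] by simp
  qed
  then have "(\<lambda>m. \<integral>x. (f m x - g x) \<bullet> h x \<partial>M) \<longlonglongrightarrow> 0" 
    using tendsto_real_sqrt[of "\<lambda>m. (\<integral>x. (f m x - g x) \<bullet> h x \<partial>M)\<^sup>2"] by (simp add: tendsto_rabs_zero_iff)
  then show ?thesis unfolding eq by (simp add: LIM_zero_iff)
qed

lemma L2_norm_sq_tendsto:
  assumes "\<And>m. L2 M (f m)" "L2 M g" "(\<lambda>m. \<integral>x. (norm (f m x - g x))\<^sup>2 \<partial>M) \<longlonglongrightarrow> 0"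
  shows "(\<lambda>m. \<integral>x. (norm (f m x))\<^sup>2 \<partial>M) \<longlonglongrightarrow> (\<integral>x. (norm (g x))\<^sup>2 \<partial>M)"
proof -
  have eq: "(\<integral>x. (norm (f m x))\<^sup>2 \<partial>M) = (\<integral>x. (norm (f m x - g x))\<^sup>2 \<partial>M) + 2 * (\<integral>x. f m x \<bullet> g x \<partial>M) - (\<integral>x. (norm (g x))\<^sup>2 \<partial>M)" for m
  proof -
    have "(\<integral>x. (norm (f m x))\<^sup>2 \<partial>M) = (\<integral>x. (norm (f m x - g x))\<^sup>2 + 2 * (f m x \<bullet> g x) - (norm (g x))\<^sup>2 \<partial>M)"
      by (simp add: power2_norm_eq_inner inner_diff inner_commute)
    also have "\<dots> = (\<integral>x. (norm (f m x - g x))\<^sup>2 \<partial>M) + 2 * (\<integral>x. f m x \<bullet> g x \<partial>M) - (\<integral>x. (norm (g x))\<^sup>2 \<partial>M)"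
      using L2_integrable[OF L2_diff[OF assms(1)[of m] assms(2)]] L2_inner_integrable[OF assms(1)[of m] assms(2)] L2_integrable[OF assms(2)]
      by simp
    finally show ?thesis .
  qed
  have "(\<lambda>m. (\<integral>x. (norm (f m x - g x))\<^sup>2 \<partial>M) + 2 * (\<integral>x. f m x \<bullet> g x \<partial>M) - (\<integral>x. (norm (g x))\<^sup>2 \<partial>M))
     \<longlonglongrightarrow> 0 + 2 * (\<integral>x. g x \<bullet> g x \<partial>M) - (\<integral>x. (norm (g x))\<^sup>2 \<partial>M)"
    by (intro tendsto_intros assms L2_inner_tendsto)
  then show ?thesis unfolding eq by (simp add: power2_norm_eq_inner)
qed

section \<open>The representation theorems of Riesz and Lions\<close>

text \<open>The sequence minimises the quadratic functional q(\<phi>, \<phi>) - 2 l(\<phi>), bounded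
  below by -K. No completeness is used: near-minimality gives the Euler equation up to a vanishing
  error, and the parallelogram identity gives the Cauchy property. \<open>comb\<close> stands for
  linear combination, as \<open>S\<close> is only a set of indices.\<close>

lemma minimizing_sequence_represents:
  fixes q :: "'i \<Rightarrow> 'i \<Rightarrow> real" and l :: "'i \<Rightarrow> real"
  assumes S: "S \<noteq> {}" "\<And>a b \<phi> \<psi>. \<phi> \<in> S \<Longrightarrow> \<psi> \<in> S \<Longrightarrow> comb a \<phi> b \<psi> \<in> S"
    and lin: "\<And>a b \<phi> \<psi> \<eta>. \<phi> \<in> S \<Longrightarrow> \<psi> \<in> S \<Longrightarrow> \<eta> \<in> S \<Longrightarrow> q (comb a \<phi> b \<psi>) \<eta> = a * q \<phi> \<eta> + b * q \<psi> \<eta>"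
    and sym: "\<And>\<phi> \<psi>. \<phi> \<in> S \<Longrightarrow> \<psi> \<in> S \<Longrightarrow> q \<phi> \<psi> = q \<psi> \<phi>"
    and nonneg: "\<And>\<phi>. \<phi> \<in> S \<Longrightarrow> 0 \<le> q \<phi> \<phi>"
    and l: "\<And>a b \<phi> \<psi>. \<phi> \<in> S \<Longrightarrow> \<psi> \<in> S \<Longrightarrow> l (comb a \<phi> b \<psi>) = a * l \<phi> + b * l \<psi>"
    and K: "0 \<le> K" "\<And>\<phi>. \<phi> \<in> S \<Longrightarrow> (l \<phi>)\<^sup>2 \<le> K * q \<phi> \<phi>"
  obtains f where "\<And>m. f m \<in> S" "\<And>\<psi>. \<psi> \<in> S \<Longrightarrow> (\<lambda>m. q (f m) \<psi>) \<longlonglongrightarrow> l \<psi>"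
    "\<And>e. e > 0 \<Longrightarrow> \<exists>N. \<forall>m\<ge>N. \<forall>n\<ge>N. q (f m) (f m) - 2 * q (f m) (f n) + q (f n) (f n) < e"
proof -
  define J where "J \<phi> = q \<phi> \<phi> - 2 * l \<phi>" for \<phi>
  have qq: "q (comb a \<phi> b \<psi>) (comb a \<phi> b \<psi>) = a\<^sup>2 * q \<phi> \<phi> + 2 * a * b * q \<phi> \<psi> + b\<^sup>2 * q \<psi> \<psi>"
    if "\<phi> \<in> S" "\<psi> \<in> S" for a b \<phi> \<psi>
  proof -
    note c = S(2)[OF that, of a b]
    have "q (comb a \<phi> b \<psi>) (comb a \<phi> b \<psi>) = a * q (comb a \<phi> b \<psi>) \<phi> + b * q (comb a \<phi> b \<psi>) \<psi>"
      using lin[OF that c] sym[OF that(1) c] sym[OF that(2) c] by simp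
    also have "\<dots> = a * (a * q \<phi> \<phi> + b * q \<phi> \<psi>) + b * (a * q \<phi> \<psi> + b * q \<psi> \<psi>)"
      using lin[OF that that(1)] lin[OF that that(2)] sym[OF that] by simp
    finally show ?thesis by (simp add: power2_eq_square algebra_simps)
  qed
  have Jlow: "J \<phi> \<ge> - K" if "\<phi> \<in> S" for \<phi>
  proof -
    have "(2 * l \<phi>)\<^sup>2 \<le> 4 * (K * q \<phi> \<phi>)" using K(2)[OF that] by (simp add: power_mult_distrib)
    also have "\<dots> \<le> (q \<phi> \<phi> + K)\<^sup>2"
      using zero_le_power2[of "q \<phi> \<phi> - K"] by (simp add: power2_eq_square algebra_simps)
    finally have "\<bar>2 * l \<phi>\<bar> \<le> \<bar>q \<phi> \<phi> + K\<bar>" by (simp add: abs_le_square_iff)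
    then show ?thesis using nonneg[OF that] K(1) unfolding J_def by linarith
  qed
  define I where "I = Inf (J ` S)"
  have bdd: "bdd_below (J ` S)" by (rule bdd_belowI2[of _ "- K"]) (rule Jlow)
  have I: "I \<le> J \<phi>" if "\<phi> \<in> S" for \<phi> unfolding I_def by (rule cInf_lower[OF _ bdd]) (use that in auto)
  have "\<exists>\<phi>\<in>S. J \<phi> < I + 1 / (real m + 1)" for m :: nat
  proof -
    have "I < I + 1 / (real m + 1)" by simp
    then show ?thesis unfolding I_def using cInf_lessD[of "J ` S"] S(1) by blast
  qed
  then obtain f where f: "\<And>m. f m \<in> S" "\<And>m. J (f m) < I + 1 / (real m + 1)" by metis
  have e0: "(\<lambda>m. 1 / (real m + 1)) \<longlonglongrightarrow> 0"
    using LIMSEQ_inverse_real_of_nat by (simp add: inverse_eq_divide add.commute)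
  show ?thesis
  proof (rule that[of f])
    fix \<psi> assume \<psi>: "\<psi> \<in> S"
    define Q where "Q = q \<psi> \<psi>"
    have Q: "Q \<ge> 0" unfolding Q_def by (rule nonneg[OF \<psi>])
    \<comment> \<open>Moving from \<open>f m\<close> by \<open>t\<close> times \<psi> lowers the
      functional by at most 1/(m+1), so a quadratic polynomial in \<open>t\<close> is nonnegative;
      its discriminant gives the estimate.\<close>
    have d: "(q (f m) \<psi> - l \<psi>)\<^sup>2 \<le> 1 / (real m + 1) * Q" for m
    proof (rule quadratic_nonneg_imp[OF _ Q])
      fix t
      have "I \<le> J (comb 1 (f m) t \<psi>)" by (intro I S f \<psi>)
      also have "\<dots> = J (f m) + 2 * t * (q (f m) \<psi> - l \<psi>) + t\<^sup>2 * Q"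
        unfolding J_def qq[OF f(1) \<psi>] l[OF f(1) \<psi>] Q_def by (simp add: algebra_simps)
      finally show "0 \<le> 1 / (real m + 1) + 2 * t * (q (f m) \<psi> - l \<psi>) + t\<^sup>2 * Q"
        using f(2)[of m] by linarith
    qed
    have "(\<lambda>m. (q (f m) \<psi> - l \<psi>)\<^sup>2) \<longlonglongrightarrow> 0"
    proof (rule Lim_null_comparison[OF always_eventually])
      show "\<forall>m. norm ((q (f m) \<psi> - l \<psi>)\<^sup>2) \<le> 1 / (real m + 1) * Q" using d by simp
      show "(\<lambda>m. 1 / (real m + 1) * Q) \<longlonglongrightarrow> 0" using tendsto_mult_right[OF e0, of Q] by simp
    qed
    from tendsto_real_sqrt[OF this] have "(\<lambda>m. q (f m) \<psi> - l \<psi>) \<longlonglongrightarrow> 0" by (simp add: tendsto_rabs_zero_iff)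
    then show "(\<lambda>m. q (f m) \<psi>) \<longlonglongrightarrow> l \<psi>" by (simp add: LIM_zero_iff)
  next
    fix e :: real assume e: "e > 0"
    then obtain N where N: "\<And>m. m \<ge> N \<Longrightarrow> 1 / (real m + 1) < e / 4"
      using order_tendstoD(2)[OF e0, of "e/4"] by (auto simp: eventually_sequentially)
    have "q (f m) (f m) - 2 * q (f m) (f n) + q (f n) (f n) < e" if "m \<ge> N" "n \<ge> N" for m n
    proof -
      \<comment> \<open>The midpoint of two near-minimisers cannot fall below the infimum, which
        bounds their distance by their excesses.\<close>
      have "I \<le> J (comb (1/2) (f m) (1/2) (f n))" by (intro I S f)
      also have "\<dots> = (1/4) * (q (f m) (f m) + 2 * q (f m) (f n) + q (f n) (f n)) - (l (f m) + l (f n))"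
        unfolding J_def qq[OF f(1) f(1)] l[OF f(1) f(1)] by (simp add: power2_eq_square algebra_simps)
      finally have "q (f m) (f m) - 2 * q (f m) (f n) + q (f n) (f n) \<le> 2 * J (f m) + 2 * J (f n) - 4 * I"
        unfolding J_def by (simp add: algebra_simps)
      then show ?thesis using f(2)[of m] f(2)[of n] N[OF that(1)] N[OF that(2)] by linarith
    qed
    then show "\<exists>N. \<forall>m\<ge>N. \<forall>n\<ge>N. q (f m) (f m) - 2 * q (f m) (f n) + q (f n) (f n) < e" by blast
  qed (rule f)
qed

lemma L2_dist_sq:
  assumes "L2 M f" "L2 M g"
  shows "(\<integral>x. (norm (f x - g x))\<^sup>2 \<partial>M) = (\<integral>x. f x \<bullet> f x \<partial>M) - 2 * (\<integral>x. f x \<bullet> g x \<partial>M) + (\<integral>x. g x \<bullet> g x \<partial>M)"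
proof -
  have "(\<integral>x. (norm (f x - g x))\<^sup>2 \<partial>M) = (\<integral>x. f x \<bullet> f x - 2 * (f x \<bullet> g x) + g x \<bullet> g x \<partial>M)"
    by (intro Bochner_Integration.integral_cong refl) (simp add: power2_norm_eq_inner inner_diff inner_commute)
  also have "\<dots> = (\<integral>x. f x \<bullet> f x \<partial>M) - 2 * (\<integral>x. f x \<bullet> g x \<partial>M) + (\<integral>x. g x \<bullet> g x \<partial>M)"
    using L2_inner_integrable[OF assms] L2_inner_integrable[OF assms(1,1)] L2_inner_integrable[OF assms(2,2)] by simp
  finally show ?thesis .
qed

text \<open>Riesz' theorem in the closure of the range of \<open>w\<close>, where \<open>z\<close>
  comes with a sequence from the range converging to it. The norm bound follows by letting m tend to
  infinity in the bound for l(f m): the left side tends to the square of the squared norm of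
  \<open>z\<close>, the right side to \<open>K\<close> times that squared norm.\<close>

lemma L2_riesz:
  fixes w :: "'i \<Rightarrow> 'a \<Rightarrow> 'b::{real_inner,banach,second_countable_topology}"
  assumes S: "S \<noteq> {}" "\<And>a b \<phi> \<psi>. \<phi> \<in> S \<Longrightarrow> \<psi> \<in> S \<Longrightarrow> comb a \<phi> b \<psi> \<in> S"
    and w: "\<And>\<phi>. \<phi> \<in> S \<Longrightarrow> L2 M (w \<phi>)"
    and lin: "\<And>a b \<phi> \<psi> \<eta>. \<phi> \<in> S \<Longrightarrow> \<psi> \<in> S \<Longrightarrow> \<eta> \<in> S \<Longrightarrow>
      (\<integral>x. w (comb a \<phi> b \<psi>) x \<bullet> w \<eta> x \<partial>M) = a * (\<integral>x. w \<phi> x \<bullet> w \<eta> x \<partial>M) + b * (\<integral>x. w \<psi> x \<bullet> w \<eta> x \<partial>M)"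
    and l: "\<And>a b \<phi> \<psi>. \<phi> \<in> S \<Longrightarrow> \<psi> \<in> S \<Longrightarrow> l (comb a \<phi> b \<psi>) = a * l \<phi> + b * l \<psi>"
    and K: "0 \<le> K" "\<And>\<phi>. \<phi> \<in> S \<Longrightarrow> (l \<phi>)\<^sup>2 \<le> K * (\<integral>x. (norm (w \<phi> x))\<^sup>2 \<partial>M)"
  obtains z f where "L2 M z" "\<And>m. f m \<in> S" "(\<lambda>m. \<integral>x. (norm (w (f m) x - z x))\<^sup>2 \<partial>M) \<longlonglongrightarrow> 0"
    "\<And>\<psi>. \<psi> \<in> S \<Longrightarrow> (\<integral>x. z x \<bullet> w \<psi> x \<partial>M) = l \<psi>" "(\<integral>x. (norm (z x))\<^sup>2 \<partial>M) \<le> K"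
proof -
  let ?q = "\<lambda>\<phi> \<psi>. \<integral>x. w \<phi> x \<bullet> w \<psi> x \<partial>M"
  obtain f where f: "\<And>m. f m \<in> S" "\<And>\<psi>. \<psi> \<in> S \<Longrightarrow> (\<lambda>m. ?q (f m) \<psi>) \<longlonglongrightarrow> l \<psi>"
    "\<And>e. e > 0 \<Longrightarrow> \<exists>N. \<forall>m\<ge>N. \<forall>n\<ge>N. ?q (f m) (f m) - 2 * ?q (f m) (f n) + ?q (f n) (f n) < e"
    by (rule minimizing_sequence_represents[where S=S and comb=comb and q="?q" and l=l and K=K])
      (use assms in \<open>auto simp: inner_commute power2_norm_eq_inner\<close>)
  have wf: "L2 M (w (f m))" for m using f w by blast
  obtain z where z: "L2 M z" "(\<lambda>m. \<integral>x. (norm (w (f m) x - z x))\<^sup>2 \<partial>M) \<longlonglongrightarrow> 0"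
  proof (rule L2_complete[where f="\<lambda>m. w (f m)" and M=M])
    show "\<exists>N. \<forall>m\<ge>N. \<forall>n\<ge>N. (\<integral>x. (norm (w (f m) x - w (f n) x))\<^sup>2 \<partial>M) < e" if "e > 0" for e
      using f(3)[OF that] by (simp add: L2_dist_sq[OF wf wf])
  qed (use wf in auto)
  have rep: "(\<integral>x. z x \<bullet> w \<psi> x \<partial>M) = l \<psi>" if "\<psi> \<in> S" for \<psi>
    using LIMSEQ_unique[OF L2_inner_tendsto[OF wf z(1) w[OF that] z(2)] f(2)[OF that]] .
  have "(\<integral>x. (norm (z x))\<^sup>2 \<partial>M) \<le> K"
  proof -
    let ?Z = "\<integral>x. (norm (z x))\<^sup>2 \<partial>M"
    have "(\<lambda>m. \<integral>x. w (f m) x \<bullet> z x \<partial>M) \<longlonglongrightarrow> (\<integral>x. z x \<bullet> z x \<partial>M)" by (rule L2_inner_tendsto[OF wf z(1) z(1) z(2)])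
    then have 1: "(\<lambda>m. (l (f m))\<^sup>2) \<longlonglongrightarrow> ?Z\<^sup>2"
      using rep[OF f(1)] by (intro tendsto_power) (simp add: inner_commute power2_norm_eq_inner)
    have 2: "(\<lambda>m. K * (\<integral>x. (norm (w (f m) x))\<^sup>2 \<partial>M)) \<longlonglongrightarrow> K * ?Z"
      by (intro tendsto_mult_left L2_norm_sq_tendsto wf z)
    have "?Z\<^sup>2 \<le> K * ?Z" by (rule LIMSEQ_le[OF 1 2]) (use K f in auto)
    moreover have "?Z \<ge> 0" by simp
    ultimately show ?thesis
      using K(1) mult_right_le_imp_le[of ?Z ?Z K] unfolding power2_eq_square[of ?Z] by (cases "?Z = 0") linarith+
  qed
  then show ?thesis using that z f rep by blast
qed

lemma L2_inner_lincomb: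
  assumes "L2 M f" "L2 M g" "L2 M h"
  shows "(\<integral>x. (a *\<^sub>R f x + b *\<^sub>R g x) \<bullet> h x \<partial>M) = a * (\<integral>x. f x \<bullet> h x \<partial>M) + b * (\<integral>x. g x \<bullet> h x \<partial>M)"
  using L2_inner_integrable[OF assms(1,3)] L2_inner_integrable[OF assms(2,3)] by (simp add: inner_add_left)

text \<open>Lions' theorem: the form \<open>(z, \<psi>) \<mapsto> \<integral> z \<bullet> G \<psi>\<close> is only required to be continuous in \<open>z\<close>.
  Riesz' theorem on the projections of the \<open>G \<psi>\<close> to the closure of the range of \<open>w\<close> yields the solution.\<close>

lemma lions:
  fixes w G :: "'i \<Rightarrow> 'a \<Rightarrow> 'b::{real_inner,banach,second_countable_topology}"
  assumes S: "S \<noteq> {}" "\<And>a b \<phi> \<psi>. \<phi> \<in> S \<Longrightarrow> \<psi> \<in> S \<Longrightarrow> comb a \<phi> b \<psi> \<in> S"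
    and w: "\<And>\<phi>. \<phi> \<in> S \<Longrightarrow> L2 M (w \<phi>)" "\<And>\<phi>. \<phi> \<in> S \<Longrightarrow> L2 M (G \<phi>)"
    and lin: "\<And>a b \<phi> \<psi>. \<phi> \<in> S \<Longrightarrow> \<psi> \<in> S \<Longrightarrow> w (comb a \<phi> b \<psi>) = (\<lambda>x. a *\<^sub>R w \<phi> x + b *\<^sub>R w \<psi> x)"
      "\<And>a b \<phi> \<psi>. \<phi> \<in> S \<Longrightarrow> \<psi> \<in> S \<Longrightarrow> G (comb a \<phi> b \<psi>) = (\<lambda>x. a *\<^sub>R G \<phi> x + b *\<^sub>R G \<psi> x)"
    and l: "\<And>a b \<phi> \<psi>. \<phi> \<in> S \<Longrightarrow> \<psi> \<in> S \<Longrightarrow> l (comb a \<phi> b \<psi>) = a * l \<phi> + b * l \<psi>"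
    and C: "\<And>\<phi>. \<phi> \<in> S \<Longrightarrow> (l \<phi>)\<^sup>2 \<le> C\<^sup>2 * (\<integral>x. (norm (w \<phi> x))\<^sup>2 \<partial>M)"
    and coercive: "\<alpha> > 0" "\<And>\<phi>. \<phi> \<in> S \<Longrightarrow> \<alpha> * (\<integral>x. (norm (w \<phi> x))\<^sup>2 \<partial>M) \<le> (\<integral>x. w \<phi> x \<bullet> G \<phi> x \<partial>M)"
  obtains z f where "L2 M z" "\<And>m. f m \<in> S" "(\<lambda>m. \<integral>x. (norm (w (f m) x - z x))\<^sup>2 \<partial>M) \<longlonglongrightarrow> 0"
    "\<And>\<psi>. \<psi> \<in> S \<Longrightarrow> (\<integral>x. z x \<bullet> G \<psi> x \<partial>M) = l \<psi>" "(\<integral>x. (norm (z x))\<^sup>2 \<partial>M) \<le> (C / \<alpha>)\<^sup>2"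
proof -
  let ?n = "\<lambda>u. \<integral>x. (norm (u x))\<^sup>2 \<partial>M"
  have wlin: "(\<integral>x. w (comb a \<phi> b \<psi>) x \<bullet> h x \<partial>M) = a * (\<integral>x. w \<phi> x \<bullet> h x \<partial>M) + b * (\<integral>x. w \<psi> x \<bullet> h x \<partial>M)"
    if "\<phi> \<in> S" "\<psi> \<in> S" "L2 M h" for a b \<phi> \<psi> h
    using that w by (simp add: lin L2_inner_lincomb)
  \<comment> \<open>\<open>P\<close> is the orthogonal projection of \<open>G \<psi>\<close> onto
    the closure of the range of \<open>w\<close>, described by its inner products with the
    \<open>w \<phi>\<close>, and \<open>f\<close> is a sequence in \<open>S\<close> whose images
    approach it.\<close>
  define Q where "Q \<psi> P f \<longleftrightarrow> L2 M P \<and> (\<forall>m. f m \<in> S) \<and> ((\<lambda>m. ?n (\<lambda>x. w (f m) x - P x)) \<longlonglongrightarrow> 0) \<and>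
      (\<forall>\<phi>\<in>S. (\<integral>x. P x \<bullet> w \<phi> x \<partial>M) = (\<integral>x. w \<phi> x \<bullet> G \<psi> x \<partial>M))" for \<psi> P f
  have ex: "\<exists>P f. Q \<psi> P f" if "\<psi> \<in> S" for \<psi>
  proof -
    have b: "(\<integral>x. w \<phi> x \<bullet> G \<psi> x \<partial>M)\<^sup>2 \<le> ?n (G \<psi>) * ?n (w \<phi>)" if "\<phi> \<in> S" for \<phi>
      using L2_Cauchy_Schwarz[OF w(1)[OF that] w(2)[OF \<open>\<psi> \<in> S\<close>]] by (simp add: mult.commute)
    have wl1: "(\<integral>x. w (comb a \<phi> b \<phi>') x \<bullet> w \<eta> x \<partial>M) = a * (\<integral>x. w \<phi> x \<bullet> w \<eta> x \<partial>M) + b * (\<integral>x. w \<phi>' x \<bullet> w \<eta> x \<partial>M)"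
      if "\<phi> \<in> S" "\<phi>' \<in> S" "\<eta> \<in> S" for a b \<phi> \<phi>' \<eta> by (rule wlin[OF that(1,2) w(1)[OF that(3)]])
    have wl2: "(\<integral>x. w (comb a \<phi> b \<phi>') x \<bullet> G \<psi> x \<partial>M) = a * (\<integral>x. w \<phi> x \<bullet> G \<psi> x \<partial>M) + b * (\<integral>x. w \<phi>' x \<bullet> G \<psi> x \<partial>M)"
      if "\<phi> \<in> S" "\<phi>' \<in> S" for a b \<phi> \<phi>' by (rule wlin[OF that w(2)[OF \<open>\<psi> \<in> S\<close>]])
    have K0: "0 \<le> ?n (G \<psi>)" by simp
    obtain z f where "L2 M z" "\<And>m. f m \<in> S" "(\<lambda>m. ?n (\<lambda>x. w (f m) x - z x)) \<longlonglongrightarrow> 0"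
      "\<And>\<phi>. \<phi> \<in> S \<Longrightarrow> (\<integral>x. z x \<bullet> w \<phi> x \<partial>M) = (\<integral>x. w \<phi> x \<bullet> G \<psi> x \<partial>M)" "?n z \<le> ?n (G \<psi>)"
      by (rule L2_riesz[where S=S and comb=comb and M=M and w=w and l="\<lambda>\<phi>. \<integral>x. w \<phi> x \<bullet> G \<psi> x \<partial>M" and K="?n (G \<psi>)",
            OF S w(1) wl1 wl2 K0 b]) ((assumption | rule that)+)
    then show ?thesis unfolding Q_def by blast
  qed
  define P where "P \<psi> = (SOME P. \<exists>f. Q \<psi> P f)" for \<psi>
  define f where "f \<psi> = (SOME f. Q \<psi> (P \<psi>) f)" for \<psi>
  have Q: "Q \<psi> (P \<psi>) (f \<psi>)" if "\<psi> \<in> S" for \<psi>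
  proof -
    have "\<exists>f. Q \<psi> (P \<psi>) f" unfolding P_def by (rule someI_ex[OF ex[OF that]])
    then show ?thesis unfolding f_def by (rule someI_ex)
  qed
  have P: "\<And>\<psi>. \<psi> \<in> S \<Longrightarrow> L2 M (P \<psi>)" and f: "\<And>\<psi> m. \<psi> \<in> S \<Longrightarrow> f \<psi> m \<in> S"
    and fP: "\<And>\<psi>. \<psi> \<in> S \<Longrightarrow> (\<lambda>m. ?n (\<lambda>x. w (f \<psi> m) x - P \<psi> x)) \<longlonglongrightarrow> 0"
    and Pw: "\<And>\<psi> \<phi>. \<psi> \<in> S \<Longrightarrow> \<phi> \<in> S \<Longrightarrow> (\<integral>x. P \<psi> x \<bullet> w \<phi> x \<partial>M) = (\<integral>x. w \<phi> x \<bullet> G \<psi> x \<partial>M)"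
    using Q unfolding Q_def by blast+
  have PG: "(\<integral>x. P \<psi> x \<bullet> v x \<partial>M) = (\<integral>x. v x \<bullet> G \<psi> x \<partial>M)"
    if "\<psi> \<in> S" "L2 M v" "\<And>m. g m \<in> S" "(\<lambda>m. ?n (\<lambda>x. w (g m) x - v x)) \<longlonglongrightarrow> 0" for \<psi> v g
  proof -
    have "(\<lambda>m. \<integral>x. w (g m) x \<bullet> P \<psi> x \<partial>M) \<longlonglongrightarrow> (\<integral>x. v x \<bullet> P \<psi> x \<partial>M)"
      by (rule L2_inner_tendsto) (use that w P in auto)
    moreover have "(\<lambda>m. \<integral>x. w (g m) x \<bullet> G \<psi> x \<partial>M) \<longlonglongrightarrow> (\<integral>x. v x \<bullet> G \<psi> x \<partial>M)"
      by (rule L2_inner_tendsto) (use that w in auto)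
    ultimately show ?thesis
      using Pw[OF that(1) that(3)] LIMSEQ_unique by (simp add: inner_commute)
  qed
  \<comment> \<open>As \<open>P\<close> is obtained by choice, linearity is available only in inner
    products with other projections. That is the form in which \<open>L2_riesz\<close> asks for
    it.\<close>
  have Plin: "(\<integral>x. P (comb a \<phi> b \<psi>) x \<bullet> P \<eta> x \<partial>M) = a * (\<integral>x. P \<phi> x \<bullet> P \<eta> x \<partial>M) + b * (\<integral>x. P \<psi> x \<bullet> P \<eta> x \<partial>M)"
    if s: "\<phi> \<in> S" "\<psi> \<in> S" "\<eta> \<in> S" for a b \<phi> \<psi> \<eta>
  proof -
    have *: "(\<integral>x. P \<phi> x \<bullet> P \<eta> x \<partial>M) = (\<integral>x. P \<eta> x \<bullet> G \<phi> x \<partial>M)" if "\<phi> \<in> S" for \<phi>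
      by (rule PG[OF that P[OF s(3)] f[OF s(3)] fP[OF s(3)]])
    have "(\<integral>x. G (comb a \<phi> b \<psi>) x \<bullet> P \<eta> x \<partial>M) = a * (\<integral>x. G \<phi> x \<bullet> P \<eta> x \<partial>M) + b * (\<integral>x. G \<psi> x \<bullet> P \<eta> x \<partial>M)"
      unfolding lin(2)[OF s(1,2)] by (rule L2_inner_lincomb) (use s w P in auto)
    then show ?thesis using *[OF s(1)] *[OF s(2)] *[OF S(2)[OF s(1,2)]] by (simp add: inner_commute)
  qed
  \<comment> \<open>Coercivity bounds \<alpha> times the squared norm of \<open>w \<psi>\<close> by
    the inner product of \<open>P \<psi>\<close> and \<open>w \<psi>\<close>, so Cauchy-Schwarz
    bounds \<alpha> times the norm of \<open>w \<psi>\<close> by the norm of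
    \<open>P \<psi>\<close>. Hence \<open>l\<close> is bounded in terms of the projections.\<close>
  have bound: "(l \<psi>)\<^sup>2 \<le> (C / \<alpha>)\<^sup>2 * ?n (P \<psi>)" if "\<psi> \<in> S" for \<psi>
  proof -
    let ?X = "?n (w \<psi>)" and ?Y = "?n (P \<psi>)"
    have "\<alpha> * ?X \<le> (\<integral>x. P \<psi> x \<bullet> w \<psi> x \<partial>M)" using coercive(2)[OF that] Pw[OF that that] by simp
    then have "(\<alpha> * ?X)\<^sup>2 \<le> (\<integral>x. P \<psi> x \<bullet> w \<psi> x \<partial>M)\<^sup>2" using coercive(1) by (intro power_mono) auto
    also have "\<dots> \<le> ?Y * ?X" by (rule L2_Cauchy_Schwarz) (use that P w in auto)
    finally have "\<alpha>\<^sup>2 * ?X * ?X \<le> ?Y * ?X" by (simp add: power2_eq_square algebra_simps)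
    moreover have "?X \<ge> 0" by simp
    ultimately have "\<alpha>\<^sup>2 * ?X \<le> ?Y" by (cases "?X = 0") (auto simp: mult_le_cancel_right)
    then have "?X \<le> ?Y / \<alpha>\<^sup>2" using coercive(1) by (simp add: pos_le_divide_eq mult.commute)
    then have "C\<^sup>2 * ?X \<le> C\<^sup>2 * (?Y / \<alpha>\<^sup>2)" by (intro mult_left_mono) auto
    then show ?thesis using C[OF that] by (simp add: power_divide)
  qed
  obtain z g where z: "L2 M z" "\<And>m. g m \<in> S" "(\<lambda>m. ?n (\<lambda>x. P (g m) x - z x)) \<longlonglongrightarrow> 0"
    "\<And>\<psi>. \<psi> \<in> S \<Longrightarrow> (\<integral>x. z x \<bullet> P \<psi> x \<partial>M) = l \<psi>" "?n z \<le> (C / \<alpha>)\<^sup>2"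
    by (rule L2_riesz[where S=S and comb=comb and M=M and w=P and l=l and K="(C / \<alpha>)\<^sup>2",
          OF S P Plin l zero_le_power2 bound]) ((assumption | rule that)+)
  \<comment> \<open>\<open>z\<close> is a limit of projections, each of which is a limit of elements
    of the range of \<open>w\<close>; a diagonal choice approximates \<open>z\<close> by the range
    directly.\<close>
  have "\<exists>\<phi>\<in>S. ?n (\<lambda>x. w \<phi> x - P (g m) x) < 1 / (real m + 1)" for m
  proof -
    have "\<forall>\<^sub>F k in sequentially. ?n (\<lambda>x. w (f (g m) k) x - P (g m) x) < 1 / (real m + 1)"
      using order_tendstoD(2)[OF fP[OF z(2)[of m]]] by simp
    then show ?thesis using f[OF z(2)] by (auto simp: eventually_sequentially)
  qed
  then obtain h where h: "\<And>m. h m \<in> S" "\<And>m. ?n (\<lambda>x. w (h m) x - P (g m) x) < 1 / (real m + 1)" by metis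
  have hz: "(\<lambda>m. ?n (\<lambda>x. w (h m) x - z x)) \<longlonglongrightarrow> 0"
  proof (rule Lim_null_comparison[OF always_eventually])
    show "\<forall>m. norm (?n (\<lambda>x. w (h m) x - z x)) \<le> 2 * (1 / (real m + 1)) + 2 * ?n (\<lambda>x. P (g m) x - z x)"
    proof
      fix m
      have "?n (\<lambda>x. w (h m) x - z x) \<le> 2 * ?n (\<lambda>x. w (h m) x - P (g m) x) + 2 * ?n (\<lambda>x. P (g m) x - z x)"
        by (rule L2_dist_sq_triangle) (use h z P w in auto)
      then show "norm (?n (\<lambda>x. w (h m) x - z x)) \<le> 2 * (1 / (real m + 1)) + 2 * ?n (\<lambda>x. P (g m) x - z x)"
        using h(2)[of m] by simp
    qed
    have e0: "(\<lambda>m. 1 / (real m + 1)) \<longlonglongrightarrow> 0"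
      using LIMSEQ_inverse_real_of_nat by (simp add: inverse_eq_divide add.commute)
    show "(\<lambda>m. 2 * (1 / (real m + 1)) + 2 * ?n (\<lambda>x. P (g m) x - z x)) \<longlonglongrightarrow> 0"
      using tendsto_add[OF tendsto_mult_left[OF e0, of 2] tendsto_mult_left[OF z(3), of 2]] by simp
  qed
  have "(\<integral>x. z x \<bullet> G \<psi> x \<partial>M) = l \<psi>" if "\<psi> \<in> S" for \<psi>
    using PG[OF that z(1) h(1) hz] z(4)[OF that] by (simp add: inner_commute)
  then show ?thesis using that z(1,5) h(1) hz by blast
qed

section \<open>Mollification\<close>

text \<open>A class closed under differentiation: the derivative belongs to the polynomial X^2 (p -
  p'). This yields exp(-1/t) and all its derivatives at once, including at t = 0.\<close>

definition flat_exp :: "real poly \<Rightarrow> real \<Rightarrow> real" where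
  "flat_exp p t = (if t > 0 then poly p (1 / t) * exp (- (1 / t)) else 0)"

lemma poly_times_exp_minus_tendsto_0:
  fixes p :: "real poly"
  shows "((\<lambda>x. poly p x * exp (- x)) \<longlongrightarrow> 0) at_top"
proof -
  have "((\<lambda>x. \<Sum>i\<le>degree p. coeff p i * (x ^ i / exp x)) \<longlongrightarrow> (\<Sum>i\<le>degree p. coeff p i * 0)) at_top"
    by (intro tendsto_sum tendsto_mult_left tendsto_power_div_exp_0)
  then show ?thesis
    by (simp add: poly_altdef sum_distrib_right exp_minus divide_inverse mult.assoc)
qed

lemma flat_exp_div_tendsto_0: "((\<lambda>h. flat_exp p h / h) \<longlongrightarrow> 0) (at 0)"
proof -
  have "((\<lambda>h. poly ([:0, 1:] * p) (inverse h) * exp (- inverse h)) \<longlongrightarrow> 0) (at_right (0::real))"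
    by (rule filterlim_compose[OF poly_times_exp_minus_tendsto_0 filterlim_inverse_at_top_right])
  moreover have "\<forall>\<^sub>F h in at_right (0::real). poly ([:0, 1:] * p) (inverse h) * exp (- inverse h) = flat_exp p h / h"
    using eventually_at_right_less[of "0::real"]
    by eventually_elim (simp add: flat_exp_def inverse_eq_divide)
  ultimately have R: "((\<lambda>h. flat_exp p h / h) \<longlongrightarrow> 0) (at_right 0)" by (rule Lim_transform_eventually)
  have "\<forall>\<^sub>F h in at_left (0::real). 0 = flat_exp p h / h"
    by (auto simp: eventually_at_filter flat_exp_def)
  then have L: "((\<lambda>h. flat_exp p h / h) \<longlongrightarrow> 0) (at_left 0)"
    by (rule Lim_transform_eventually[OF tendsto_const])
  from filterlim_split_at[OF L R] show ?thesis .
qed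

lemma flat_exp_deriv:
  "(flat_exp p has_real_derivative flat_exp ([:0, 0, 1:] * (p - pderiv p)) t) (at t)"
proof -
  consider "t > 0" | "t < 0" | "t = 0" by linarith
  then show ?thesis
  proof cases
    case 1
    have "((\<lambda>t. poly p (1 / t) * exp (- (1 / t))) has_real_derivative
        poly p (1 / t) * (exp (- (1 / t)) * (1 / t\<^sup>2)) + (poly (pderiv p) (1 / t) * - (1 / t\<^sup>2)) * exp (- (1 / t))) (at t)"
      using 1 by (auto intro!: derivative_eq_intros DERIV_chain2[OF poly_DERIV] simp: power2_eq_square divide_simps)
    also have "poly p (1 / t) * (exp (- (1 / t)) * (1 / t\<^sup>2)) + (poly (pderiv p) (1 / t) * - (1 / t\<^sup>2)) * exp (- (1 / t))
      = flat_exp ([:0, 0, 1:] * (p - pderiv p)) t"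
      using 1 by (simp add: flat_exp_def power2_eq_square algebra_simps)
    finally show ?thesis
      by (rule has_field_derivative_transform_within_open[of _ _ _ "{0<..}"]) (use 1 in \<open>auto simp: flat_exp_def\<close>)
  next
    case 2
    have "((\<lambda>t. 0) has_real_derivative flat_exp ([:0, 0, 1:] * (p - pderiv p)) t) (at t)"
      using 2 by (simp add: flat_exp_def)
    then show ?thesis
      by (rule has_field_derivative_transform_within_open[of _ _ _ "{..<0}"]) (use 2 in \<open>auto simp: flat_exp_def\<close>)
  next
    case 3
    then show ?thesis using flat_exp_div_tendsto_0[of p] by (simp add: DERIV_def flat_exp_def)
  qed
qed

text \<open>The k-th derivative of exp(-1/t), extended by zero to t \<le> 0. The sequence has the
  shape required by \<open>kdiff_comp\<close> and serves both the mollifier and the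
  truncations.\<close>

definition flat_deriv :: "nat \<Rightarrow> real \<Rightarrow> real" where
  "flat_deriv k = flat_exp (((\<lambda>p. [:0, 0, 1:] * (p - pderiv p)) ^^ k) 1)"

lemma flat_deriv: "(flat_deriv k has_real_derivative flat_deriv (Suc k) t) (at t)"
  unfolding flat_deriv_def using flat_exp_deriv by simp

lemma flat_deriv_0: "flat_deriv 0 t = (if t > 0 then exp (- (1 / t)) else 0)"
  by (simp add: flat_deriv_def flat_exp_def)

definition bump :: "real^'n::finite \<Rightarrow> real" where
  "bump x = flat_deriv 0 (1 - x \<bullet> x)"

lemma smooth_bump: "smooth_fun (bump :: real^'n::finite \<Rightarrow> real)"
proof -
  have s: "smooth_fun (\<lambda>x::real^'n. 1 + (- 1) * (x \<bullet> x))"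
    by (intro smooth_fun_add smooth_fun_mult smooth_fun_inner_self smooth_fun_const)
  have "smooth_fun (\<lambda>x::real^'n. flat_deriv 0 (1 + (- 1) * (x \<bullet> x)))"
    by (rule smooth_fun_comp[of flat_deriv, OF flat_deriv s])
  then show ?thesis unfolding bump_def[abs_def] by simp
qed

lemma bump_nonneg: "bump x \<ge> 0"
  and bump_minus: "bump (- x) = bump x"
  and bump_eq_0: "norm x \<ge> 1 \<Longrightarrow> bump x = 0"
  and bump_0_pos: "bump 0 > 0"
  by (auto simp: bump_def flat_deriv_0 dot_square_norm power2_eq_square not_less mult_ge1_I one_le_power
      intro: order_trans[of 1 "norm x * norm x"])

section \<open>Mollifiers and the smoothness of convolutions\<close>

text \<open>The parameter is an inverse length: for \<open>r > 0\<close> the function has mass one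
  and vanishes outside the ball of radius \<open>1 / r\<close>, so mollification improves as
  \<open>r\<close> grows.\<close>

definition moll :: "real \<Rightarrow> real^'n::finite \<Rightarrow> real" where
  "moll r x = bump (r *\<^sub>R x) / (\<integral>y. bump (r *\<^sub>R y) \<partial>(lborel :: (real^'n) measure))"

lemma moll_eq_0:
  assumes "r > 0" "norm x \<ge> 1 / r" shows "moll r x = 0"
proof -
  have "norm (r *\<^sub>R x) \<ge> 1" using assms by (simp add: field_simps)
  then show ?thesis by (simp add: moll_def bump_eq_0)
qed

lemma continuous_on_bump_scaled: "continuous_on S (\<lambda>x. bump (r *\<^sub>R x))"
  by (rule continuous_on_compose2[OF continuous_on_smooth[OF smooth_bump, of UNIV]]) (auto intro!: continuous_intros)

lemma moll_nonneg: "moll r x \<ge> 0"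
  unfolding moll_def by (intro divide_nonneg_nonneg bump_nonneg integral_nonneg_AE AE_I2)

lemma moll_minus: "moll r (- x) = moll r x"
  by (simp add: moll_def bump_minus)

lemma smooth_moll: "smooth_fun (moll r :: real^'n::finite \<Rightarrow> real)"
proof -
  have "smooth_fun (\<lambda>x::real^'n. bump (0 + r *\<^sub>R x) * inverse (\<integral>y. bump (r *\<^sub>R y) \<partial>(lborel :: (real^'n) measure)))"
    by (rule smooth_fun_mult[OF smooth_fun_affine[OF smooth_bump] smooth_fun_const])
  then show ?thesis unfolding moll_def[abs_def] divide_inverse by simp
qed

lemma integrable_bump_scaled:
  assumes "r > 0" shows "integrable lborel (\<lambda>y::real^'n::finite. bump (r *\<^sub>R y))"
proof -
  have "integrable lborel (\<lambda>y::real^'n. indicator (cball 0 (1 / r)) y *\<^sub>R bump (r *\<^sub>R y))"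
    by (intro borel_integrable_compact compact_cball continuous_on_bump_scaled)
  also have "(\<lambda>y::real^'n. indicator (cball 0 (1 / r)) y *\<^sub>R bump (r *\<^sub>R y)) = (\<lambda>y. bump (r *\<^sub>R y))"
  proof
    fix y :: "real^'n"
    show "indicator (cball 0 (1 / r)) y *\<^sub>R bump (r *\<^sub>R y) = bump (r *\<^sub>R y)"
      using assms bump_eq_0[of "r *\<^sub>R y"] by (auto simp: indicator_def field_simps)
  qed
  finally show ?thesis .
qed

lemma nn_integral_moll:
  assumes r: "r > 0"
  shows "(\<integral>\<^sup>+x. ennreal (moll r (x - a)) \<partial>(lborel :: (real^'n::finite) measure)) = 1"
proof -
  let ?c = "\<integral>y. bump (r *\<^sub>R y) \<partial>(lborel :: (real^'n) measure)"
  have m[measurable]: "(moll r :: real^'n \<Rightarrow> real) \<in> borel_measurable borel"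
    by (intro borel_measurable_continuous_onI continuous_on_smooth smooth_moll)
  have op: "open {y::real^'n. bump (r *\<^sub>R y) \<noteq> 0}"
    by (intro open_Collect_neq continuous_on_bump_scaled continuous_on_const)
  have bump_pos: "bump (0::real^'n) > 0" by (rule bump_0_pos)
  \<comment> \<open>A vanishing normalising constant would make the open set where the bump is
    nonzero a null set and therefore empty, although it contains the origin.\<close>
  have "?c \<noteq> 0"
  proof
    assume "?c = 0"
    then have "AE y in lborel. bump (r *\<^sub>R (y::real^'n)) = 0"
      using integrable_bump_scaled[OF r] by (subst (asm) integral_nonneg_eq_0_iff_AE) (auto simp: bump_nonneg)
    then have "{y \<in> space lborel. \<not> bump (r *\<^sub>R (y::real^'n)) = 0} \<in> null_sets lborel"
      by (subst (asm) AE_iff_null) (auto intro!: borel_open op)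
    then have nl: "{y::real^'n. bump (r *\<^sub>R y) \<noteq> 0} \<in> null_sets lebesgue" by (auto intro: null_sets_completionI)
    have "{y::real^'n. bump (r *\<^sub>R y) \<noteq> 0} = {}"
      using open_not_negligible[OF op] nl negligible_iff_null_sets by blast
    then have "bump (r *\<^sub>R (0::real^'n)) = 0" by blast
    then show False using bump_pos by simp
  qed
  have "(\<integral>\<^sup>+x. ennreal (moll r (x - a)) \<partial>(lborel :: (real^'n) measure)) = (\<integral>\<^sup>+x. ennreal (moll r (x - a)) \<partial>distr lborel borel ((+) a))"
    by (simp add: lborel_distr_plus)
  also have "\<dots> = (\<integral>\<^sup>+x. ennreal (moll r x) \<partial>(lborel :: (real^'n) measure))"
    by (subst nn_integral_distr) auto
  also have "\<dots> = ennreal (\<integral>x. moll r x \<partial>(lborel :: (real^'n) measure))"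
    using integrable_bump_scaled[OF r] by (intro nn_integral_eq_integral) (auto simp: moll_def[abs_def] moll_nonneg[unfolded moll_def])
  also have "(\<integral>x. moll r x \<partial>(lborel :: (real^'n) measure)) = 1"
    using \<open>?c \<noteq> 0\<close> by (simp add: moll_def)
  finally show ?thesis by simp
qed

lemma borel_measurable_lebesgue_onI:
  "f \<in> borel_measurable borel \<Longrightarrow> f \<in> borel_measurable (lebesgue_on U)"
  by (simp add: measurable_completion measurable_restrict_space1)

lemma integral_moll_ball:
  fixes x :: "real^'n::finite"
  assumes r: "r > 0" and U: "U \<in> sets lebesgue" "cball x (1 / r) \<subseteq> U"
  shows "integrable (lebesgue_on U) (\<lambda>y. moll r (x - y))" "(\<integral>y. moll r (x - y) \<partial>lebesgue_on U) = 1"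
proof -
  have c: "continuous_on UNIV (\<lambda>y. moll r (x - y))"
    by (rule continuous_on_compose2[OF continuous_on_smooth[OF smooth_moll, of UNIV]]) (auto intro!: continuous_intros)
  have z: "moll r (x - y) = 0" if "y \<notin> cball x (1 / r)" for y
    using that r by (intro moll_eq_0) (auto simp: dist_norm)
  note * = compact_support_integral[OF c compact_cball U(2,1) z moll_nonneg]
  show "integrable (lebesgue_on U) (\<lambda>y. moll r (x - y))" by (rule *(1))
  have "(\<integral>\<^sup>+y. ennreal (moll r (x - y)) \<partial>lborel) = (\<integral>\<^sup>+y. ennreal (moll r (y - x)) \<partial>lborel)"
  proof -
    have "moll r (x - y) = moll r (y - x)" for y using moll_minus[of r "y - x"] by simp
    then show ?thesis by (simp only:)
  qed
  then show "(\<integral>y. moll r (x - y) \<partial>lebesgue_on U) = 1"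
    using *(2) nn_integral_moll[OF r, of x] moll_nonneg by (simp add: integral_nonneg_AE)
qed

text \<open>Second derivatives are bounded because of the compact support, so the gradient is
  Lipschitz. That the quadratic remainder is uniform in \<open>z\<close> is what permits
  differentiation under an integral over translates.\<close>

lemma has_derivative_grad_remainder:
  fixes f :: "real^'n::finite \<Rightarrow> real"
  assumes f: "smooth_fun f" "compact (tsupport f)"
  obtains L where "L \<ge> 0" "\<And>z h. \<bar>f (z + h) - f z - grad f z \<bullet> h\<bar> \<le> L * (norm h)\<^sup>2"
proof -
  have bd: "\<exists>B\<ge>0. \<forall>x. norm (grad (dpart i f) x) \<le> B" for i
  proof -
    have z: "grad (dpart i f) x = 0" if "x \<notin> tsupport f" for x
    proof (rule grad_outside_tsupport)
      have "dpart i f y = 0" if "y \<notin> tsupport f" for y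
        using grad_outside_tsupport[OF that] by (simp add: grad_def vec_eq_iff)
      then have "tsupport (dpart i f) \<subseteq> tsupport f"
        unfolding tsupport_def[of "dpart i f"] by (intro closure_minimal compact_imp_closed f) auto
      then show "x \<notin> tsupport (dpart i f)" using that by blast
    qed
    obtain B where "B > 0" "\<And>x. norm (grad (dpart i f) x) \<le> B"
      by (rule continuous_compact_support_bounded[OF continuous_on_grad[OF smooth_fun_dpart[OF f(1)]] f(2)])
        (use z in auto)
    then show ?thesis by (auto intro: exI[of _ B])
  qed
  then obtain B where B: "\<And>i. B i \<ge> 0" "\<And>i x. norm (grad (dpart i f) x) \<le> B i" by metis
  define L where "L = (\<Sum>i\<in>UNIV. B i)"
  have L0: "L \<ge> 0" unfolding L_def by (intro sum_nonneg B)
  have lip: "norm (grad f x - grad f y) \<le> L * norm (x - y)" for x y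
  proof -
    have "\<bar>dpart i f x - dpart i f y\<bar> \<le> B i * norm (x - y)" for i
    proof -
      have "norm (dpart i f x - dpart i f y) \<le> B i * norm (x - y)"
      proof (rule differentiable_bound[of UNIV _ "\<lambda>z h. grad (dpart i f) z \<bullet> h"])
        show "(dpart i f has_derivative (\<lambda>h. grad (dpart i f) z \<bullet> h)) (at z within UNIV)" for z
          using has_derivative_grad[OF smooth_fun_differentiable[OF smooth_fun_dpart[OF f(1)]]] by simp
        show "onorm (\<lambda>h. grad (dpart i f) z \<bullet> h) \<le> B i" for z
          using B(1)[of i] order_trans[OF Cauchy_Schwarz_ineq2 mult_right_mono[OF B(2)[of i z]]] by (intro onorm_bound) auto
      qed auto
      then show ?thesis by simp
    qed
    then have "(\<Sum>i\<in>UNIV. \<bar>(grad f x - grad f y) $ i\<bar>) \<le> (\<Sum>i\<in>UNIV. B i * norm (x - y))"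
      by (intro sum_mono) (simp add: grad_def)
    then show ?thesis using norm_le_l1_cart[of "grad f x - grad f y"] by (simp add: L_def sum_distrib_right)
  qed
  have "\<bar>f (z + h) - f z - grad f z \<bullet> h\<bar> \<le> L * (norm h)\<^sup>2" for z h
  proof -
    have "norm (f (z + h) - f z - (\<lambda>k. grad f z \<bullet> k) (z + h - z)) \<le> norm (z + h - z) * (L * norm h)"
    proof (rule differentiable_bound_linearization[where S="cball z (norm h)" and f'="\<lambda>x k. grad f x \<bullet> k"])
      show "z + t *\<^sub>R (z + h - z) \<in> cball z (norm h)" if "t \<in> {0..1}" for t
        using that mult_right_mono[of t 1 "norm h"] by (auto simp: dist_norm)
      show "(f has_derivative (\<lambda>k. grad f x \<bullet> k)) (at x within cball z (norm h))" for x
        by (rule has_derivative_at_withinI[OF has_derivative_grad[OF smooth_fun_differentiable[OF f(1)]]])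
      show "onorm ((\<lambda>k. grad f x \<bullet> k) - (\<lambda>k. grad f z \<bullet> k)) \<le> L * norm h" if "x \<in> cball z (norm h)" for x
        unfolding fun_diff_def
      proof (rule onorm_bound)
        have "norm (grad f x - grad f z) \<le> L * norm h"
          using lip[of x z] mult_left_mono[OF _ L0, of "norm (x - z)" "norm h"] that by (auto simp: dist_norm norm_minus_commute)
        then show "norm (grad f x \<bullet> k - grad f z \<bullet> k) \<le> L * norm h * norm k" for k
          using order_trans[OF Cauchy_Schwarz_ineq2[of "grad f x - grad f z" k] mult_right_mono] by (auto simp: inner_diff_left)
      qed (use L0 in auto)
    qed auto
    then show ?thesis by (simp add: power2_eq_square ac_simps)
  qed
  with L0 that show ?thesis by blast
qed

lemma measurable_convolution_integrand:
  fixes g :: "real^'n::finite \<Rightarrow> 'b::{second_countable_topology,real_normed_vector}"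
  assumes "continuous_on UNIV g"
  shows "(\<lambda>y. g (x - y)) \<in> borel_measurable (lebesgue_on U)"
  by (intro borel_measurable_lebesgue_onI borel_measurable_continuous_onI continuous_on_compose2[OF assms])
    (auto intro!: continuous_intros)

lemma integrable_convolution:
  fixes g :: "real^'n::finite \<Rightarrow> real" and f :: "real^'n \<Rightarrow> 'b::euclidean_space"
  assumes g: "continuous_on UNIV g" "\<And>x. \<bar>g x\<bar> \<le> B" and f: "integrable (lebesgue_on U) f"
  shows "integrable (lebesgue_on U) (\<lambda>y. g (x - y) *\<^sub>R f y)"
proof (rule Bochner_Integration.integrable_bound)
  show "integrable (lebesgue_on U) (\<lambda>y. B *\<^sub>R f y)" using f by simp
  show "(\<lambda>y. g (x - y) *\<^sub>R f y) \<in> borel_measurable (lebesgue_on U)"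
    using measurable_convolution_integrand[OF g(1)] f by (intro borel_measurable_scaleR) auto
  have "B \<ge> 0" using g(2)[of 0] by linarith
  then show "AE y in lebesgue_on U. norm (g (x - y) *\<^sub>R f y) \<le> norm (B *\<^sub>R f y)"
    using g(2) by (intro AE_I2) (auto intro!: mult_right_mono)
qed

text \<open>The uniform quadratic remainder of \<eta>, integrated against |f|, is a remainder of
  order |h|^2 for the convolution.\<close>

lemma convolution_has_derivative:
  fixes \<eta> :: "real^'n::finite \<Rightarrow> real"
  assumes \<eta>: "smooth_fun \<eta>" "compact (tsupport \<eta>)" and f: "integrable (lebesgue_on U) f"
  shows "((\<lambda>x. \<integral>y. \<eta> (x - y) * f y \<partial>lebesgue_on U) has_derivative
      (\<lambda>h. (\<chi> i. \<integral>y. dpart i \<eta> (x - y) * f y \<partial>lebesgue_on U) \<bullet> h)) (at x)"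
proof -
  let ?M = "lebesgue_on U"
  obtain L where L: "L \<ge> 0" "\<And>z h. \<bar>\<eta> (z + h) - \<eta> z - grad \<eta> z \<bullet> h\<bar> \<le> L * (norm h)\<^sup>2"
    by (rule has_derivative_grad_remainder[OF \<eta>]) blast
  have td: "test_fun UNIV \<eta>" using \<eta> by (simp add: test_fun_def)
  obtain B where B: "\<And>x. \<bar>\<eta> x\<bar> \<le> B" "\<And>x. norm (grad \<eta> x) \<le> B" using test_fun_bounded[OF td] by metis
  have dB: "\<bar>dpart i \<eta> x\<bar> \<le> B" for i x
    using component_le_norm_cart[of "grad \<eta> x" i] B(2)[of x] by (simp add: grad_def)
  have i1: "integrable ?M (\<lambda>y. \<eta> (x - y) * f y)" for x
    using integrable_convolution[OF continuous_on_smooth[OF \<eta>(1)] B(1) f] by simp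
  have i2: "integrable ?M (\<lambda>y. dpart i \<eta> (x - y) * f y)" for x i
    using integrable_convolution[OF continuous_on_smooth[OF smooth_fun_dpart[OF \<eta>(1)]] dB f] by simp
  define A where "A = L * (\<integral>y. \<bar>f y\<bar> \<partial>?M)"
  have A0: "A \<ge> 0" unfolding A_def using L by (intro mult_nonneg_nonneg integral_nonneg_AE) auto
  have est: "\<bar>(\<integral>y. \<eta> (x + h - y) * f y \<partial>?M) - (\<integral>y. \<eta> (x - y) * f y \<partial>?M) - (\<chi> i. \<integral>y. dpart i \<eta> (x - y) * f y \<partial>?M) \<bullet> h\<bar>
      \<le> A * (norm h)\<^sup>2" for h
  proof -
    have gi: "(grad \<eta> (x - y) \<bullet> h) * f y = (\<Sum>i\<in>UNIV. h $ i * (dpart i \<eta> (x - y) * f y))" for y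
      by (simp add: inner_vec_def grad_def sum_distrib_right sum_distrib_left ac_simps)
    have i3: "integrable ?M (\<lambda>y. (grad \<eta> (x - y) \<bullet> h) * f y)"
      unfolding gi using i2 by (intro Bochner_Integration.integrable_sum integrable_mult_right)
    have "(\<integral>y. (grad \<eta> (x - y) \<bullet> h) * f y \<partial>?M) = (\<chi> i. \<integral>y. dpart i \<eta> (x - y) * f y \<partial>?M) \<bullet> h"
    proof -
      have "(\<integral>y. (grad \<eta> (x - y) \<bullet> h) * f y \<partial>?M) = (\<Sum>i\<in>UNIV. h $ i * (\<integral>y. dpart i \<eta> (x - y) * f y \<partial>?M))"
        unfolding gi using i2 by (subst Bochner_Integration.integral_sum) auto
      then show ?thesis by (simp add: inner_vec_def mult.commute)
    qed
    then have "(\<integral>y. \<eta> (x + h - y) * f y \<partial>?M) - (\<integral>y. \<eta> (x - y) * f y \<partial>?M) - (\<chi> i. \<integral>y. dpart i \<eta> (x - y) * f y \<partial>?M) \<bullet> h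
      = (\<integral>y. \<eta> (x + h - y) * f y - \<eta> (x - y) * f y - (grad \<eta> (x - y) \<bullet> h) * f y \<partial>?M)"
      using i1[of "x + h"] i1[of x] i3 by simp
    also have "\<bar>\<dots>\<bar> \<le> (\<integral>y. L * (norm h)\<^sup>2 * \<bar>f y\<bar> \<partial>?M)"
    proof -
      have "norm (\<integral>y. \<eta> (x + h - y) * f y - \<eta> (x - y) * f y - (grad \<eta> (x - y) \<bullet> h) * f y \<partial>?M)
        \<le> (\<integral>y. norm (\<eta> (x + h - y) * f y - \<eta> (x - y) * f y - (grad \<eta> (x - y) \<bullet> h) * f y) \<partial>?M)"
        by (rule integral_norm_bound)
      also have "\<dots> \<le> (\<integral>y. L * (norm h)\<^sup>2 * \<bar>f y\<bar> \<partial>?M)"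
      proof (rule integral_mono)
        show "norm (\<eta> (x + h - y) * f y - \<eta> (x - y) * f y - (grad \<eta> (x - y) \<bullet> h) * f y) \<le> L * (norm h)\<^sup>2 * \<bar>f y\<bar>" for y
        proof -
          have "\<eta> (x + h - y) * f y - \<eta> (x - y) * f y - (grad \<eta> (x - y) \<bullet> h) * f y
            = (\<eta> ((x - y) + h) - \<eta> (x - y) - grad \<eta> (x - y) \<bullet> h) * f y"
            by (simp add: algebra_simps)
          then show ?thesis using mult_right_mono[OF L(2)[of "x - y" h], of "\<bar>f y\<bar>"] by (simp add: abs_mult)
        qed
      qed (use i1 i3 f in auto)
      finally show ?thesis by simp
    qed
    also have "\<dots> = A * (norm h)\<^sup>2" by (simp add: A_def)
    finally show ?thesis .
  qed
  show ?thesis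
    unfolding has_derivative_at
  proof (intro conjI)
    show "bounded_linear (\<lambda>h. (\<chi> i. \<integral>y. dpart i \<eta> (x - y) * f y \<partial>?M) \<bullet> h)" by (rule bounded_linear_inner_right)
    show "(\<lambda>h. norm ((\<integral>y. \<eta> (x + h - y) * f y \<partial>?M) - (\<integral>y. \<eta> (x - y) * f y \<partial>?M) -
        (\<chi> i. \<integral>y. dpart i \<eta> (x - y) * f y \<partial>?M) \<bullet> h) / norm h) \<midarrow>0\<rightarrow> 0"
    proof (rule Lim_null_comparison[OF always_eventually])
      show "\<forall>h. norm (norm ((\<integral>y. \<eta> (x + h - y) * f y \<partial>?M) - (\<integral>y. \<eta> (x - y) * f y \<partial>?M) -
          (\<chi> i. \<integral>y. dpart i \<eta> (x - y) * f y \<partial>?M) \<bullet> h) / norm h) \<le> A * norm h"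
      proof
        fix h
        show "norm (norm ((\<integral>y. \<eta> (x + h - y) * f y \<partial>?M) - (\<integral>y. \<eta> (x - y) * f y \<partial>?M) -
          (\<chi> i. \<integral>y. dpart i \<eta> (x - y) * f y \<partial>?M) \<bullet> h) / norm h) \<le> A * norm h"
          using est[of h] by (cases "h = 0") (auto simp: divide_le_eq power2_eq_square mult.assoc)
      qed
      show "((\<lambda>h::real^'n. A * norm h) \<longlongrightarrow> 0) (at 0)"
        using tendsto_mult_left[OF tendsto_norm_zero[OF tendsto_ident_at[of "0::real^'n" UNIV]], of A] by simp
    qed
  qed
qed

lemma smooth_convolution:
  fixes \<eta> :: "real^'n::finite \<Rightarrow> real"
  assumes "smooth_fun \<eta>" "compact (tsupport \<eta>)" and f: "integrable (lebesgue_on U) f"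
  shows "smooth_fun (\<lambda>x. \<integral>y. \<eta> (x - y) * f y \<partial>lebesgue_on U)"
proof -
  have "kdiff n (\<lambda>x. \<integral>y. \<eta> (x - y) * f y \<partial>lebesgue_on U)" for n
    using assms(1,2)
  proof (induction n arbitrary: \<eta>)
    case (Suc n)
    note D = convolution_has_derivative[OF Suc.prems f]
    have "dpart i (\<lambda>x. \<integral>y. \<eta> (x - y) * f y \<partial>lebesgue_on U) = (\<lambda>x. \<integral>y. dpart i \<eta> (x - y) * f y \<partial>lebesgue_on U)" for i
      by (rule ext, subst dpart_eqI[OF D]) (simp add: inner_axis)
    moreover have "compact (tsupport (dpart i \<eta>))" for i
    proof (rule compact_tsupport[OF Suc.prems(2)])
      have "dpart i \<eta> y = 0" if "y \<notin> tsupport \<eta>" for y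
        using grad_outside_tsupport[OF that] by (simp add: grad_def vec_eq_iff)
      then show "tsupport (dpart i \<eta>) \<subseteq> tsupport \<eta>"
        unfolding tsupport_def[of "dpart i \<eta>"] by (intro closure_minimal compact_imp_closed Suc.prems) auto
    qed
    ultimately show ?case using D Suc.IH smooth_fun_dpart[OF Suc.prems(1)] by (auto simp: differentiable_def)
  qed simp
  then show ?thesis by (simp add: smooth_fun_iff_kdiff)
qed

lemma finite_measure_lebesgue_on_bounded:
  assumes "bounded U" "U \<in> sets lebesgue"
  shows "finite_measure (lebesgue_on U)"
  by (rule finite_measure_lebesgue_on[OF bounded_set_imp_lmeasurable[OF assms]])

section \<open>Approximation and mollification in L^2\<close>

text \<open>The radial projection onto the ball of radius \<open>R\<close>. With \<open>max\<close>
  in the denominator it is continuous without a case distinction.\<close>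

definition clamp_norm :: "real \<Rightarrow> 'a::real_normed_vector \<Rightarrow> 'a" where
  "clamp_norm R v = (R / max R (norm v)) *\<^sub>R v"

lemma norm_clamp: "R > 0 \<Longrightarrow> norm (clamp_norm R v) \<le> R"
  and clamp_norm_id: "R > 0 \<Longrightarrow> norm v \<le> R \<Longrightarrow> clamp_norm R v = v"
  and norm_clamp_diff: "R > 0 \<Longrightarrow> norm (clamp_norm R v - v) \<le> norm v"
proof -
  assume R: "R > 0"
  show "norm (clamp_norm R v) \<le> R"
  proof -
    have m: "max R (norm v) > 0" using R by simp
    have "R * norm v \<le> R * max R (norm v)" using R by (intro mult_left_mono) auto
    then show ?thesis using R m by (simp add: clamp_norm_def pos_divide_le_eq)
  qed
  show "clamp_norm R v = v" if "norm v \<le> R" using R that by (simp add: clamp_norm_def max_def)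
  have "clamp_norm R v - v = (R / max R (norm v) - 1) *\<^sub>R v" by (simp add: clamp_norm_def scaleR_diff_left)
  moreover have "\<bar>R / max R (norm v) - 1\<bar> \<le> 1" 
  proof -
    have "0 \<le> R / max R (norm v)" "R / max R (norm v) \<le> 1" using R by (auto simp: divide_le_eq)
    then show ?thesis by linarith
  qed
  ultimately show "norm (clamp_norm R v - v) \<le> norm v"
    using mult_right_mono[of "\<bar>R / max R (norm v) - 1\<bar>" 1 "norm v"] by simp
qed

lemma continuous_on_clamp_norm: "R > 0 \<Longrightarrow> continuous_on S (clamp_norm R)"
  unfolding clamp_norm_def[abs_def] by (intro continuous_intros) auto

text \<open>The function is first cut off at a large level, then the bounded function is
  approximated by continuous ones under the same cut-off; bounded convergence applies because
  \<open>U\<close> has finite measure.\<close>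

lemma L2_approx_continuous:
  fixes g :: "real^'n::finite \<Rightarrow> 'b::euclidean_space"
  assumes U: "bounded U" "U \<in> sets lebesgue" and g: "L2 (lebesgue_on U) g" and e: "e > 0"
  obtains h where "continuous_on UNIV h" "L2 (lebesgue_on U) h" "(\<integral>x. (norm (g x - h x))\<^sup>2 \<partial>lebesgue_on U) < e"
proof -
  let ?M = "lebesgue_on U"
  interpret finite_measure ?M by (rule finite_measure_lebesgue_on_bounded[OF U])
  have gm[measurable]: "g \<in> borel_measurable ?M" using g by (rule L2_measurable)
  have cl[measurable]: "clamp_norm (real (Suc R)) \<in> borel_measurable borel" for R
    by (intro borel_measurable_continuous_onI continuous_on_clamp_norm) simp
  have l1: "(\<lambda>R. \<integral>x. (norm (clamp_norm (real (Suc R)) (g x) - g x))\<^sup>2 \<partial>?M) \<longlonglongrightarrow> (\<integral>x. 0 \<partial>?M)"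
  proof (rule integral_dominated_convergence[where w="\<lambda>x. (norm (g x))\<^sup>2"])
    show "AE x in ?M. (\<lambda>R. (norm (clamp_norm (real (Suc R)) (g x) - g x))\<^sup>2) \<longlonglongrightarrow> 0"
    proof (rule AE_I2)
      fix x
      obtain N :: nat where N: "norm (g x) \<le> real N" using real_arch_simple by blast
      have "\<forall>\<^sub>F R in sequentially. 0 = (norm (clamp_norm (real (Suc R)) (g x) - g x))\<^sup>2"
        using eventually_ge_at_top[of N]
      proof eventually_elim
        case (elim R)
        then have "norm (g x) \<le> real (Suc R)" using N by simp
        then show ?case by (subst clamp_norm_id) auto
      qed
      then show "(\<lambda>R. (norm (clamp_norm (real (Suc R)) (g x) - g x))\<^sup>2) \<longlonglongrightarrow> 0"
        by (rule Lim_transform_eventually[OF tendsto_const])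
    qed
    show "AE x in ?M. norm ((norm (clamp_norm (real (Suc R)) (g x) - g x))\<^sup>2) \<le> (norm (g x))\<^sup>2" for R
      by (intro AE_I2) (auto intro!: power_mono norm_clamp_diff)
    show "(\<lambda>x. (norm (clamp_norm (real (Suc R)) (g x) - g x))\<^sup>2) \<in> borel_measurable ?M" for R
      using measurable_compose[OF gm cl[of R]] by measurable
  qed (use g in \<open>auto simp: L2_def\<close>)
  then obtain R where R: "(\<integral>x. (norm (clamp_norm (real (Suc R)) (g x) - g x))\<^sup>2 \<partial>?M) < e / 4"
    using order_tendstoD(2)[OF l1, of "e / 4"] e by (auto simp: eventually_sequentially)
  let ?R = "real (Suc R)"
  \<comment> \<open>This notion of measurability supplies continuous functions converging to
    \<open>g\<close> off a negligible set.\<close>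
  have "g measurable_on U" using measurable_on_iff_borel_measurable[OF U(2)] gm by blast
  then obtain N gn where N: "negligible N" "\<And>n. continuous_on UNIV (gn n)"
     "\<And>x. x \<notin> N \<Longrightarrow> (\<lambda>n. gn n x) \<longlonglongrightarrow> (if x \<in> U then g x else 0)"
    unfolding measurable_on_def by blast
  have AEN: "AE x in ?M. x \<in> U - N"
  proof -
    have "AE x in lebesgue. x \<notin> N" using N(1) by (simp add: negligible_iff_null_sets AE_not_in)
    then have "AE x in ?M. x \<notin> N" using U(2) by (subst AE_restrict_space_iff) auto
    moreover have "AE x in ?M. x \<in> U" by (rule AE_I2) simp
    ultimately show ?thesis by eventually_elim auto
  qed
  have gnm[measurable]: "gn n \<in> borel_measurable ?M" for n
    by (intro borel_measurable_lebesgue_onI borel_measurable_continuous_onI N)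
  have l2: "(\<lambda>n. \<integral>x. (norm (clamp_norm ?R (gn n x) - clamp_norm ?R (g x)))\<^sup>2 \<partial>?M) \<longlonglongrightarrow> (\<integral>x. 0 \<partial>?M)"
  proof (rule integral_dominated_convergence[where w="\<lambda>x. (2 * ?R)\<^sup>2"])
    show "AE x in ?M. (\<lambda>n. (norm (clamp_norm ?R (gn n x) - clamp_norm ?R (g x)))\<^sup>2) \<longlonglongrightarrow> 0"
      using AEN
    proof eventually_elim
      case (elim x)
      then have "(\<lambda>n. gn n x) \<longlonglongrightarrow> g x" using N(3)[of x] by simp
      then have "(\<lambda>n. clamp_norm ?R (gn n x)) \<longlonglongrightarrow> clamp_norm ?R (g x)"
        using continuous_on_clamp_norm[of ?R UNIV] by (intro continuous_on_tendsto_compose[of UNIV "clamp_norm ?R"]) auto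
      from tendsto_power[OF tendsto_norm[OF LIM_zero[OF this]], of 2] show ?case by simp
    qed
    show "AE x in ?M. norm ((norm (clamp_norm ?R (gn n x) - clamp_norm ?R (g x)))\<^sup>2) \<le> (2 * ?R)\<^sup>2" for n
    proof (rule AE_I2)
      fix x
      have "norm (clamp_norm ?R (gn n x) - clamp_norm ?R (g x)) \<le> 2 * ?R"
        using norm_triangle_ineq4[of "clamp_norm ?R (gn n x)" "clamp_norm ?R (g x)"]
          norm_clamp[of ?R "gn n x"] norm_clamp[of ?R "g x"] by simp
      then have "(norm (clamp_norm ?R (gn n x) - clamp_norm ?R (g x)))\<^sup>2 \<le> (2 * ?R)\<^sup>2" by (intro power_mono) auto
      then show "norm ((norm (clamp_norm ?R (gn n x) - clamp_norm ?R (g x)))\<^sup>2) \<le> (2 * ?R)\<^sup>2" by simp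
    qed
    show "(\<lambda>x. (norm (clamp_norm ?R (gn n x) - clamp_norm ?R (g x)))\<^sup>2) \<in> borel_measurable ?M" for n
      using measurable_compose[OF gm cl[of R]] measurable_compose[OF gnm cl[of R]] by measurable
  qed auto
  then obtain n where n: "(\<integral>x. (norm (clamp_norm ?R (gn n x) - clamp_norm ?R (g x)))\<^sup>2 \<partial>?M) < e / 4"
    using order_tendstoD(2)[OF l2, of "e / 4"] e by (auto simp: eventually_sequentially)
  let ?h = "\<lambda>x. clamp_norm ?R (gn n x)"
  have L2c: "L2 ?M (\<lambda>x. clamp_norm ?R (f x))" if [measurable]: "f \<in> borel_measurable ?M" for f
  proof (rule L2_bound[of ?M "\<lambda>x. ?R"])
    show "L2 ?M (\<lambda>x. ?R)" by (simp add: L2_def)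
    show "AE x in ?M. norm (clamp_norm ?R (f x)) \<le> norm ?R" using norm_clamp[of ?R] by (intro AE_I2) simp
    show "(\<lambda>x. clamp_norm ?R (f x)) \<in> borel_measurable ?M" by (rule measurable_compose[OF that cl])
  qed
  show ?thesis
  proof (rule that[of ?h])
    show "continuous_on UNIV ?h"
      by (rule continuous_on_compose2[OF continuous_on_clamp_norm[of ?R UNIV] N(2)]) auto
    show h: "L2 ?M ?h" by (rule L2c[OF gnm])
    have "(\<integral>x. (norm (g x - ?h x))\<^sup>2 \<partial>?M) \<le> 2 * (\<integral>x. (norm (g x - clamp_norm ?R (g x)))\<^sup>2 \<partial>?M)
       + 2 * (\<integral>x. (norm (clamp_norm ?R (g x) - ?h x))\<^sup>2 \<partial>?M)"
      by (rule L2_dist_sq_triangle[OF g L2c[OF gm] h])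
    also have "(\<lambda>x. (norm (g x - clamp_norm ?R (g x)))\<^sup>2) = (\<lambda>x. (norm (clamp_norm ?R (g x) - g x))\<^sup>2)"
      by (intro ext arg_cong[where f="\<lambda>t. t\<^sup>2"] norm_minus_commute)
    also have "(\<lambda>x. (norm (clamp_norm ?R (g x) - ?h x))\<^sup>2) = (\<lambda>x. (norm (?h x - clamp_norm ?R (g x)))\<^sup>2)"
      by (intro ext arg_cong[where f="\<lambda>t. t\<^sup>2"] norm_minus_commute)
    finally show "(\<integral>x. (norm (g x - ?h x))\<^sup>2 \<partial>?M) < e" using R n e by linarith
  qed
qed

lemma L2_imp_integrable:
  assumes "finite_measure M" "L2 M f"
  shows "integrable M f"
proof -
  interpret finite_measure M by fact
  have "L2 M (\<lambda>x. 1::real)" by (simp add: L2_def)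
  from L2_norm_mult_integrable[OF assms(2) this] have "integrable M (\<lambda>x. norm (f x))" by simp
  then show ?thesis using L2_measurable[OF assms(2)] by (simp add: integrable_norm_iff)
qed

lemma moll_bounded:
  obtains B where "\<And>x::real^'n::finite. \<bar>moll r x\<bar> \<le> B"
proof (cases "r > 0")
  case True
  have z: "moll r x = 0" if "x \<notin> cball 0 (1/r)" for x :: "real^'n"
    using moll_eq_0[OF True, of x] that by simp
  obtain B where "B > 0" "\<And>x::real^'n. norm (moll r x) \<le> B"
    by (rule continuous_compact_support_bounded[OF continuous_on_smooth[OF smooth_moll] compact_cball z]) blast+
  then show ?thesis using that[of B] by simp
next
  case False
  show ?thesis
  proof (rule that[of "inverse (\<integral>y. bump (r *\<^sub>R y) \<partial>(lborel :: (real^'n) measure))"])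
    fix x :: "real^'n"
    have "bump z \<le> 1" for z :: "real^'n" by (auto simp: bump_def flat_deriv_0)
    moreover have "0 \<le> (\<integral>y. bump (r *\<^sub>R y) \<partial>(lborel :: (real^'n) measure))" by (intro integral_nonneg_AE AE_I2 bump_nonneg)
    ultimately have "moll r x \<le> 1 * inverse (\<integral>y. bump (r *\<^sub>R y) \<partial>(lborel :: (real^'n) measure))"
      unfolding moll_def divide_inverse by (intro mult_right_mono) auto
    then show "\<bar>moll r x\<bar> \<le> inverse (\<integral>y. bump (r *\<^sub>R y) \<partial>(lborel :: (real^'n) measure))"
      using moll_nonneg[of r x] by simp
  qed
qed

lemma moll_convolution_integrable:
  fixes f :: "real^'n::finite \<Rightarrow> 'b::euclidean_space"
  assumes "integrable (lebesgue_on U) f"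
  shows "integrable (lebesgue_on U) (\<lambda>y. moll r (x - y) *\<^sub>R f y)"
proof -
  obtain B where "\<And>x::real^'n. \<bar>moll r x\<bar> \<le> B" by (rule moll_bounded[of r]) blast
  then show ?thesis using integrable_convolution[OF continuous_on_smooth[OF smooth_moll] _ assms] by blast
qed

text \<open>Points of \<open>K\<close> keep the whole ball of radius \<open>1 / r\<close> inside
  \<open>U\<close>, so the mollifier has mass one there, and Cauchy-Schwarz with its square root as
  weight bounds the square of the convolution by the convolution of the square. Interchanging the
  integrals leaves a mass of at most one in \<open>x\<close>.\<close>

lemma moll_young:
  fixes F :: "real^'n::finite \<Rightarrow> 'b::euclidean_space"
  assumes U: "bounded U" "U \<in> sets lebesgue" and K: "bounded K" "K \<in> sets lebesgue" and r: "r > 0"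
    and sub: "\<And>x. x \<in> K \<Longrightarrow> cball x (1 / r) \<subseteq> U" and F: "L2 (lebesgue_on U) F"
  shows "(\<integral>\<^sup>+x. ennreal ((norm (\<integral>y. moll r (x - y) *\<^sub>R F y \<partial>lebesgue_on U))\<^sup>2) \<partial>lebesgue_on K)
    \<le> ennreal (\<integral>y. (norm (F y))\<^sup>2 \<partial>lebesgue_on U)"
proof -
  let ?M = "lebesgue_on U" and ?N = "lebesgue_on K"
  interpret U: finite_measure ?M by (rule finite_measure_lebesgue_on_bounded[OF U])
  interpret K: finite_measure ?N by (rule finite_measure_lebesgue_on_bounded[OF K])
  interpret P: pair_sigma_finite ?N ?M by standard
  have Fm[measurable]: "F \<in> borel_measurable ?M" using F by (rule L2_measurable)
  have mb[measurable]: "(moll r :: real^'n \<Rightarrow> real) \<in> borel_measurable borel"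
    by (intro borel_measurable_continuous_onI continuous_on_smooth smooth_moll)
  have idm[measurable]: "(\<lambda>x. x) \<in> lebesgue_on S \<rightarrow>\<^sub>M borel" for S :: "(real^'n) set"
    by (rule borel_measurable_lebesgue_onI) simp
  have fs[measurable]: "fst \<in> borel_measurable (?N \<Otimes>\<^sub>M ?M)" "snd \<in> borel_measurable (?N \<Otimes>\<^sub>M ?M)"
    using measurable_compose[OF measurable_fst idm] measurable_compose[OF measurable_snd idm] by simp_all
  have mm: "(\<lambda>(x, y). ennreal (moll r (x - y) * (norm (F y))\<^sup>2)) \<in> borel_measurable (?N \<Otimes>\<^sub>M ?M)"
  proof -
    have [measurable]: "(\<lambda>p. F (snd p)) \<in> borel_measurable (?N \<Otimes>\<^sub>M ?M)"
      by (rule measurable_compose[OF measurable_snd Fm])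
    have [measurable]: "(\<lambda>p. moll r (fst p - snd p)) \<in> borel_measurable (?N \<Otimes>\<^sub>M ?M)"
      by (rule measurable_compose[OF borel_measurable_diff[OF fs] mb])
    show ?thesis unfolding case_prod_beta' by measurable
  qed
  have jensen: "(norm (\<integral>y. moll r (x - y) *\<^sub>R F y \<partial>?M))\<^sup>2 \<le> (\<integral>y. moll r (x - y) * (norm (F y))\<^sup>2 \<partial>?M)"
    and ji: "integrable ?M (\<lambda>y. moll r (x - y) * (norm (F y))\<^sup>2)" if "x \<in> K" for x
  proof -
    have mx: "(\<lambda>y. moll r (x - y)) \<in> borel_measurable ?M"
      by (rule measurable_convolution_integrand[OF continuous_on_smooth[OF smooth_moll]])
    let ?a = "\<lambda>y. sqrt (moll r (x - y))" and ?b = "\<lambda>y. sqrt (moll r (x - y)) * norm (F y)"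
    have a: "L2 ?M ?a"
      using integral_moll_ball(1)[OF r U(2) sub[OF that]] mx by (auto simp: L2_def moll_nonneg)
    show i: "integrable ?M (\<lambda>y. moll r (x - y) * (norm (F y))\<^sup>2)"
      using moll_convolution_integrable[of U "\<lambda>y. (norm (F y))\<^sup>2" r x] F by (simp add: L2_def)
    have b: "L2 ?M ?b" using i mx by (auto simp: L2_def moll_nonneg power_mult_distrib)
    have "norm (\<integral>y. moll r (x - y) *\<^sub>R F y \<partial>?M) \<le> (\<integral>y. norm (moll r (x - y) *\<^sub>R F y) \<partial>?M)"
      by (rule integral_norm_bound)
    also have "\<dots> = (\<integral>y. ?a y \<bullet> ?b y \<partial>?M)"
      by (intro Bochner_Integration.integral_cong refl) (simp add: moll_nonneg flip: mult.assoc)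
    finally have "(norm (\<integral>y. moll r (x - y) *\<^sub>R F y \<partial>?M))\<^sup>2 \<le> (\<integral>y. ?a y \<bullet> ?b y \<partial>?M)\<^sup>2"
      by (intro power_mono) auto
    also have "\<dots> \<le> (\<integral>y. (norm (?a y))\<^sup>2 \<partial>?M) * (\<integral>y. (norm (?b y))\<^sup>2 \<partial>?M)"
      by (rule L2_Cauchy_Schwarz[OF a b])
    also have "\<dots> = (\<integral>y. moll r (x - y) * (norm (F y))\<^sup>2 \<partial>?M)"
      using integral_moll_ball(2)[OF r U(2) sub[OF that]] by (simp add: moll_nonneg power_mult_distrib)
    finally show "(norm (\<integral>y. moll r (x - y) *\<^sub>R F y \<partial>?M))\<^sup>2 \<le> (\<integral>y. moll r (x - y) * (norm (F y))\<^sup>2 \<partial>?M)" .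
  qed
  have "(\<integral>\<^sup>+x. ennreal ((norm (\<integral>y. moll r (x - y) *\<^sub>R F y \<partial>?M))\<^sup>2) \<partial>?N)
    \<le> (\<integral>\<^sup>+x. \<integral>\<^sup>+y. ennreal (moll r (x - y) * (norm (F y))\<^sup>2) \<partial>?M \<partial>?N)"
  proof (rule nn_integral_mono)
    fix x assume "x \<in> space ?N"
    then have x: "x \<in> K" by simp
    show "ennreal ((norm (\<integral>y. moll r (x - y) *\<^sub>R F y \<partial>?M))\<^sup>2) \<le> (\<integral>\<^sup>+y. ennreal (moll r (x - y) * (norm (F y))\<^sup>2) \<partial>?M)"
      by (subst nn_integral_eq_integral[OF ji[OF x]]) (auto intro!: ennreal_leI jensen x simp: moll_nonneg)
  qed
  also have "\<dots> = (\<integral>\<^sup>+y. \<integral>\<^sup>+x. ennreal (moll r (x - y) * (norm (F y))\<^sup>2) \<partial>?N \<partial>?M)"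
    by (rule P.Fubini'[symmetric, OF mm])
  also have "\<dots> \<le> (\<integral>\<^sup>+y. ennreal ((norm (F y))\<^sup>2) \<partial>?M)"
  proof (rule nn_integral_mono)
    fix y :: "real^'n"
    have mk: "(\<lambda>x. moll r (x - y)) \<in> borel_measurable borel"
      by (rule measurable_compose[where f="\<lambda>x. x - y", OF _ mb]) simp
    have "(\<integral>\<^sup>+x. ennreal (moll r (x - y) * (norm (F y))\<^sup>2) \<partial>?N) = (\<integral>\<^sup>+x. ennreal (moll r (x - y)) \<partial>?N) * ennreal ((norm (F y))\<^sup>2)"
      using borel_measurable_lebesgue_onI[OF mk, of K] by (subst nn_integral_multc[symmetric]) (auto simp: ennreal_mult moll_nonneg)
    also have "\<dots> \<le> 1 * ennreal ((norm (F y))\<^sup>2)"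
    proof (rule mult_right_mono)
      have "(\<integral>\<^sup>+x. ennreal (moll r (x - y)) \<partial>?N) = (\<integral>\<^sup>+x. ennreal (moll r (x - y)) * indicator K x \<partial>lebesgue)"
        using K(2) by (subst nn_integral_restrict_space) auto
      also have "\<dots> \<le> (\<integral>\<^sup>+x. ennreal (moll r (x - y)) \<partial>lebesgue)"
        by (intro nn_integral_mono) (auto simp: indicator_def)
      also have "\<dots> = (\<integral>\<^sup>+x. ennreal (moll r (x - y)) \<partial>lborel)"
        using mk by (intro nn_integral_completion) measurable
      also have "\<dots> = 1" by (rule nn_integral_moll[OF r])
      finally show "(\<integral>\<^sup>+x. ennreal (moll r (x - y)) \<partial>?N) \<le> 1" .
    qed simp
    finally show "(\<integral>\<^sup>+x. ennreal (moll r (x - y) * (norm (F y))\<^sup>2) \<partial>?N) \<le> ennreal ((norm (F y))\<^sup>2)" by simp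
  qed
  also have "\<dots> = ennreal (\<integral>y. (norm (F y))\<^sup>2 \<partial>?M)"
    using F by (intro nn_integral_eq_integral) (auto simp: L2_def)
  finally show ?thesis .
qed

lemma integrable_lebesgue_on_iff:
  fixes f :: "'a::euclidean_space \<Rightarrow> 'b::{banach,second_countable_topology}"
  assumes "U \<in> sets lebesgue"
  shows "integrable (lebesgue_on U) f \<longleftrightarrow> integrable lebesgue (\<lambda>x. indicator U x *\<^sub>R f x)"
  by (rule integrable_restrict_space) (use assms in simp)

lemma integral_lebesgue_on_eq:
  fixes f :: "'a::euclidean_space \<Rightarrow> 'b::{banach,second_countable_topology}"
  assumes "U \<in> sets lebesgue"
  shows "(\<integral>x. f x \<partial>lebesgue_on U) = (\<integral>x. indicator U x *\<^sub>R f x \<partial>lebesgue)"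
  by (rule integral_restrict_space) (use assms in simp)

lemma integrable_lebesgue_on_subset:
  fixes f :: "'a::euclidean_space \<Rightarrow> 'b::{banach,second_countable_topology}"
  assumes "integrable (lebesgue_on U) f" "K \<subseteq> U" "K \<in> sets lebesgue" "U \<in> sets lebesgue"
  shows "integrable (lebesgue_on K) f"
proof -
  have "set_integrable lebesgue U f"
    using assms(1) unfolding set_integrable_def integrable_lebesgue_on_iff[OF assms(4)] .
  then have "set_integrable lebesgue K f" by (rule set_integrable_subset[OF _ assms(3,2)])
  then show ?thesis unfolding set_integrable_def integrable_lebesgue_on_iff[OF assms(3)] .
qed

lemma integral_lebesgue_on_subset_mono:
  fixes f :: "'a::euclidean_space \<Rightarrow> real"
  assumes "integrable (lebesgue_on U) f" "K \<subseteq> U" "K \<in> sets lebesgue" "U \<in> sets lebesgue" "\<And>x. 0 \<le> f x"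
  shows "(\<integral>x. f x \<partial>lebesgue_on K) \<le> (\<integral>x. f x \<partial>lebesgue_on U)"
  unfolding integral_lebesgue_on_eq[OF assms(3)] integral_lebesgue_on_eq[OF assms(4)]
proof (rule integral_mono)
  show "integrable lebesgue (\<lambda>x. indicator U x *\<^sub>R f x)"
    using assms(1) unfolding integrable_lebesgue_on_iff[OF assms(4)] .
  show "integrable lebesgue (\<lambda>x. indicator K x *\<^sub>R f x)"
    using integrable_lebesgue_on_subset[OF assms(1-4)] unfolding integrable_lebesgue_on_iff[OF assms(3)] .
  show "indicator K x *\<^sub>R f x \<le> indicator U x *\<^sub>R f x" for x
    using assms(2,5) by (auto simp: indicator_def)
qed

lemma L2_lebesgue_on_subset:
  assumes "L2 (lebesgue_on U) f" "K \<subseteq> U" "K \<in> sets lebesgue" "U \<in> sets lebesgue"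
  shows "L2 (lebesgue_on K) f"
  unfolding L2_def
proof (intro conjI)
  show "f \<in> borel_measurable (lebesgue_on K)"
    by (rule measurable_restrict_mono[OF L2_measurable[OF assms(1)] assms(2)])
  show "integrable (lebesgue_on K) (\<lambda>x. (norm (f x))\<^sup>2)"
    using integrable_lebesgue_on_subset[OF L2_integrable[OF assms(1)] assms(2-4)] .
qed

lemma L2_bounded_continuous_on_compact:
  fixes f :: "real^'n::finite \<Rightarrow> 'b::euclidean_space"
  assumes "continuous_on UNIV f" "compact K"
  shows "L2 (lebesgue_on K) f"
proof -
  have K: "bounded K" "K \<in> sets lebesgue"
    using compact_imp_bounded[OF assms(2)] fmeasurableD[OF lmeasurable_compact[OF assms(2)]] by auto
  interpret finite_measure "lebesgue_on K" by (rule finite_measure_lebesgue_on_bounded[OF K])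
  have "bounded (f ` K)" 
    by (rule compact_imp_bounded[OF compact_continuous_image[OF continuous_on_subset[OF assms(1) subset_UNIV] assms(2)]])
  then obtain B where B: "\<And>x. x \<in> K \<Longrightarrow> norm (f x) \<le> B" by (auto simp: bounded_iff)
  show ?thesis
  proof (rule L2_bound[of _ "\<lambda>x. B"])
    show "L2 (lebesgue_on K) (\<lambda>x. B)" by (simp add: L2_def)
    show "f \<in> borel_measurable (lebesgue_on K)"
      by (intro borel_measurable_lebesgue_onI borel_measurable_continuous_onI assms)
    show "AE x in lebesgue_on K. norm (f x) \<le> norm B" 
    proof (rule AE_I2)
      fix x assume "x \<in> space (lebesgue_on K)"
      then have "norm (f x) \<le> B" using B by simp
      then show "norm (f x) \<le> norm B" by simp
    qed
  qed
qed

lemma compact_tsupport_moll: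
  assumes "r > 0" shows "compact (tsupport (moll r :: real^'n::finite \<Rightarrow> real))"
proof (rule compact_tsupport[OF compact_cball[of 0 "1 / r"]])
  have "x \<in> cball 0 (1 / r)" if "moll r x \<noteq> 0" for x :: "real^'n"
    using moll_eq_0[OF assms, of x] that by (cases "norm x \<ge> 1 / r") auto
  then show "tsupport (moll r :: real^'n \<Rightarrow> real) \<subseteq> cball 0 (1 / r)"
    unfolding tsupport_def by (intro closure_minimal) auto
qed

lemma moll_convolution_component:
  fixes g :: "real^'n::finite \<Rightarrow> real^'n"
  assumes "integrable (lebesgue_on U) g"
  shows "(\<integral>y. moll r (x - y) *\<^sub>R g y \<partial>lebesgue_on U) $ i = (\<integral>y. moll r (x - y) * g y $ i \<partial>lebesgue_on U)"
  using integral_bounded_linear[OF bounded_linear_vec_nth moll_convolution_integrable[OF assms, of r x], of i] by simp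

lemma continuous_moll_convolution:
  fixes g :: "real^'n::finite \<Rightarrow> real^'n"
  assumes "r > 0" "integrable (lebesgue_on U) g"
  shows "continuous_on UNIV (\<lambda>x. \<integral>y. moll r (x - y) *\<^sub>R g y \<partial>lebesgue_on U)"
proof -
  have "continuous_on UNIV (\<lambda>x. \<integral>y. moll r (x - y) * g y $ i \<partial>lebesgue_on U)" for i
    by (intro continuous_on_smooth smooth_convolution smooth_moll compact_tsupport_moll assms
        integrable_bounded_linear[OF bounded_linear_vec_nth])
  then have "continuous_on UNIV (\<lambda>x. \<chi> i. (\<integral>y. moll r (x - y) *\<^sub>R g y \<partial>lebesgue_on U) $ i)"
    unfolding moll_convolution_component[OF assms(2)] by (intro continuous_on_vec_lambda)
  then show ?thesis by simp
qed

text \<open>A continuous function \<open>h\<close> close to \<open>g\<close> in L^2 is inserted.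
  Young's estimate controls the mollification of \<open>g - h\<close>, and uniform continuity
  controls that of \<open>h\<close>.\<close>

lemma moll_L2_approx:
  fixes g :: "real^'n::finite \<Rightarrow> real^'n"
  assumes U: "bounded U" "open U" and K: "compact K" "K \<subseteq> U" and g: "L2 (lebesgue_on U) g" and e: "e > 0"
  shows "\<exists>R>0. \<forall>r\<ge>R. (\<integral>x. (norm ((\<integral>y. moll r (x - y) *\<^sub>R g y \<partial>lebesgue_on U) - g x))\<^sup>2 \<partial>lebesgue_on K) < e"
proof -
  let ?U = "lebesgue_on U" and ?K = "lebesgue_on K"
  have Us: "U \<in> sets lebesgue" using U by (auto intro: borel_open)
  have Ks: "K \<in> sets lebesgue" by (rule fmeasurableD[OF lmeasurable_compact[OF K(1)]])
  note Kb = compact_imp_bounded[OF K(1)]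
  interpret U: finite_measure ?U by (rule finite_measure_lebesgue_on_bounded[OF U(1) Us])
  interpret K: finite_measure ?K by (rule finite_measure_lebesgue_on_bounded[OF Kb Ks])
  \<comment> \<open>The two uses of the triangle inequality produce the weights 2, 4 and 4, so the
    bounds e/12, e/16 and e/12 add up to 3e/4.\<close>
  obtain h where h: "continuous_on UNIV h" "L2 ?U h" "(\<integral>x. (norm (g x - h x))\<^sup>2 \<partial>?U) < e / 12"
    by (rule L2_approx_continuous[OF U(1) Us g, of "e / 12"]) (use e in auto)
  obtain \<delta> where \<delta>: "\<delta> > 0" "(\<Union>x\<in>K. cball x \<delta>) \<subseteq> U"
    using compact_subset_open_imp_cball_epsilon_subset[OF K(1) U(2) K(2)] by metis
  define vK where "vK = measure ?K (space ?K)"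
  have vK: "vK \<ge> 0" by (simp add: vK_def)
  \<comment> \<open>Pointwise accuracy whose square, integrated over \<open>K\<close>, is at most
    e/16; adding one to \<open>vK\<close> covers a null set \<open>K\<close>.\<close>
  define s where "s = sqrt (e / (16 * (vK + 1)))"
  have s: "s > 0" "s\<^sup>2 = e / (16 * (vK + 1))" using e vK by (auto simp: s_def)
  obtain R0 where R0: "\<And>x. x \<in> K \<Longrightarrow> norm x \<le> R0" using Kb by (auto simp: bounded_iff)
  have "uniformly_continuous_on (cball 0 (R0 + 1)) h"
    by (intro compact_uniformly_continuous compact_cball continuous_on_subset[OF h(1)]) auto
  then obtain \<beta> where \<beta>: "\<beta> > 0" "\<And>x y. x \<in> cball 0 (R0 + 1) \<Longrightarrow> y \<in> cball 0 (R0 + 1) \<Longrightarrow> dist y x < \<beta> \<Longrightarrow> dist (h y) (h x) < s"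
    unfolding uniformly_continuous_on_def using s(1) by metis
  \<comment> \<open>Each entry has one task: \<delta> keeps balls around points of \<open>K\<close>
    inside \<open>U\<close>, \<beta>/2 makes \<open>t\<close> strictly smaller than \<beta>, and 1
    keeps these balls in the larger ball on which \<open>h\<close> is uniformly continuous.\<close>
  define t where "t = min \<delta> (min (\<beta> / 2) 1)"
  have t: "t > 0" "t \<le> \<delta>" "t < \<beta>" "t \<le> 1" using \<delta> \<beta> by (auto simp: t_def)
  have "(\<integral>x. (norm ((\<integral>y. moll r (x - y) *\<^sub>R g y \<partial>?U) - g x))\<^sup>2 \<partial>?K) < e" if rt: "r \<ge> 1 / t" for r
  proof -
    have r: "r > 0" using rt t less_le_trans[of 0 "1 / t" r] by simp
    have rt': "1 / r \<le> t" using rt t r by (simp add: field_simps)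
    have sub: "cball x (1 / r) \<subseteq> U" if "x \<in> K" for x
      using \<delta>(2) that rt' t(2) by (fastforce simp: subset_iff)
    let ?c = "\<lambda>f x. \<integral>y. moll r (x - y) *\<^sub>R f y \<partial>?U"
    have gi: "integrable ?U g" and hi: "integrable ?U h" using L2_imp_integrable g h U.finite_measure_axioms by blast+
    have gh: "L2 ?U (\<lambda>x. g x - h x)" by (rule L2_diff[OF g h(2)])
    have LK: "L2 ?K (?c g)" "L2 ?K (?c h)" "L2 ?K g" "L2 ?K h"
      by (auto intro!: L2_bounded_continuous_on_compact continuous_moll_convolution r gi hi K h(1)
          L2_lebesgue_on_subset[OF g K(2) Ks Us])
    have 1: "(\<integral>x. (norm (?c g x - ?c h x))\<^sup>2 \<partial>?K) \<le> (\<integral>x. (norm (g x - h x))\<^sup>2 \<partial>?U)"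
    proof -
      have eq: "?c g x - ?c h x = ?c (\<lambda>x. g x - h x) x" for x
        using moll_convolution_integrable[OF gi, of r x] moll_convolution_integrable[OF hi, of r x]
        by (simp add: scaleR_diff_right)
      have "ennreal (\<integral>x. (norm (?c g x - ?c h x))\<^sup>2 \<partial>?K) = (\<integral>\<^sup>+x. ennreal ((norm (?c g x - ?c h x))\<^sup>2) \<partial>?K)"
        using L2_integrable[OF L2_diff[OF LK(1,2)]] by (intro nn_integral_eq_integral[symmetric]) auto
      also have "\<dots> \<le> ennreal (\<integral>x. (norm (g x - h x))\<^sup>2 \<partial>?U)"
        unfolding eq by (rule moll_young[OF U(1) Us Kb Ks r sub gh])
      finally show ?thesis by (simp add: ennreal_le_iff)
    qed
    have 2: "(\<integral>x. (norm (?c h x - h x))\<^sup>2 \<partial>?K) \<le> s\<^sup>2 * vK"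
    proof -
      have "(norm (?c h x - h x))\<^sup>2 \<le> s\<^sup>2" if x: "x \<in> K" for x
      proof -
        note m1 = integral_moll_ball[OF r Us sub[OF x]]
        have i: "integrable ?U (\<lambda>y. moll r (x - y) *\<^sub>R (h y - h x))"
          using moll_convolution_integrable[OF hi, of r x] m1(1) by (simp add: scaleR_diff_right)
        have "?c h x - h x = ?c h x - (\<integral>y. moll r (x - y) *\<^sub>R h x \<partial>?U)"
          using m1 by simp
        also have "\<dots> = (\<integral>y. moll r (x - y) *\<^sub>R (h y - h x) \<partial>?U)"
          using moll_convolution_integrable[OF hi, of r x] m1(1) by (simp add: scaleR_diff_right)
        finally have "norm (?c h x - h x) \<le> (\<integral>y. norm (moll r (x - y) *\<^sub>R (h y - h x)) \<partial>?U)"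
          by (simp only: integral_norm_bound)
        also have "\<dots> \<le> (\<integral>y. moll r (x - y) * s \<partial>?U)"
        proof (rule integral_mono)
          show "norm (moll r (x - y) *\<^sub>R (h y - h x)) \<le> moll r (x - y) * s" for y
          proof (cases "norm (x - y) \<ge> 1 / r")
            case True
            then show ?thesis by (simp add: moll_eq_0[OF r True])
          next
            case False
            then have "dist y x < t" using rt' by (simp add: dist_norm norm_minus_commute)
            then have d: "dist y x < \<beta>" "dist y x < 1" using t by auto
            have "norm y \<le> norm x + norm (y - x)" using norm_triangle_ineq[of x "y - x"] by simp
            then have "dist (h y) (h x) < s" using \<beta>(2)[of x y] d R0[OF x] by (simp add: dist_norm)
            then show ?thesis using moll_nonneg[of r "x - y"] by (auto simp: dist_norm intro!: mult_left_mono)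
          qed
        qed (use integrable_norm[OF i] m1 in simp_all)
        also have "\<dots> = s" using m1 by simp
        finally show ?thesis using s by (intro power_mono) auto
      qed
      then have "(\<integral>x. (norm (?c h x - h x))\<^sup>2 \<partial>?K) \<le> (\<integral>x. s\<^sup>2 \<partial>?K)"
        by (intro integral_mono) (use L2_integrable[OF L2_diff[OF LK(2,4)]] in auto)
      then show ?thesis by (simp add: vK_def mult.commute)
    qed
    have 3: "(\<integral>x. (norm (h x - g x))\<^sup>2 \<partial>?K) \<le> (\<integral>x. (norm (g x - h x))\<^sup>2 \<partial>?U)"
      using integral_lebesgue_on_subset_mono[OF L2_integrable[OF gh] K(2) Ks Us]
      by (simp add: norm_minus_commute[of "h _" "g _"])
    have "(\<integral>x. (norm (?c g x - g x))\<^sup>2 \<partial>?K) \<le> 2 * (\<integral>x. (norm (?c g x - ?c h x))\<^sup>2 \<partial>?K) + 2 * (\<integral>x. (norm (?c h x - g x))\<^sup>2 \<partial>?K)"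
      by (rule L2_dist_sq_triangle[OF LK(1,2,3)])
    moreover have "(\<integral>x. (norm (?c h x - g x))\<^sup>2 \<partial>?K) \<le> 2 * (\<integral>x. (norm (?c h x - h x))\<^sup>2 \<partial>?K) + 2 * (\<integral>x. (norm (h x - g x))\<^sup>2 \<partial>?K)"
      by (rule L2_dist_sq_triangle[OF LK(2,4,3)])
    moreover have "s\<^sup>2 * vK \<le> e / 16"
    proof -
      have "e / (16 * (vK + 1)) * vK = e / 16 * (vK / (vK + 1))" by simp
      also have "\<dots> \<le> e / 16 * 1" using vK e by (intro mult_left_mono) auto
      finally show ?thesis using s by simp
    qed
    ultimately show ?thesis using 1 2 3 h(3) e by linarith
  qed
  then show ?thesis using t(1) by (intro exI[of _ "1 / t"]) auto
qed

text \<open>Admits the reflected mollifier as test function in the definition of the weak gradient,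
  so that the gradient of the mollified \<rho> is the mollification of the weak gradient.\<close>

lemma test_fun_moll_reflected:
  fixes x :: "real^'n::finite"
  assumes r: "r > 0" and sub: "cball x (1 / r) \<subseteq> U"
  shows "test_fun U (\<lambda>y. moll r (x - y))" "dpart i (\<lambda>y. moll r (x - y)) y = - dpart i (moll r) (x - y)"
proof -
  have "smooth_fun (\<lambda>y. moll r (x + (- 1) *\<^sub>R y))" by (rule smooth_fun_affine[OF smooth_moll])
  then have s: "smooth_fun (\<lambda>y. moll r (x - y))" by simp
  show "test_fun U (\<lambda>y. moll r (x - y))"
  proof (rule test_funI[OF s compact_cball sub])
    show "moll r (x - y) = 0" if "y \<notin> cball x (1 / r)" for y
      using that r by (intro moll_eq_0) (auto simp: dist_norm)
  qed
  have "((\<lambda>y. moll r (x - y)) has_derivative (\<lambda>h. grad (moll r) (x - y) \<bullet> (- h))) (at y)"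
    by (rule has_derivative_compose[where g="moll r"])
      (auto intro!: derivative_eq_intros has_derivative_grad smooth_fun_differentiable[OF smooth_moll])
  from dpart_eqI[OF this] show "dpart i (\<lambda>y. moll r (x - y)) y = - dpart i (moll r) (x - y)"
    by (simp add: inner_axis grad_def)
qed

text \<open>Supplies the smooth substitutes for the weight \<rho>. On \<open>K\<close> they inherit
  its bounds and converge pointwise by continuity, while their gradients converge to the weak
  gradient almost everywhere under an L^2 majorant, after passing to a subsequence.\<close>

lemma smooth_approximation:
  fixes \<rho> :: "real^'n::finite \<Rightarrow> real"
  assumes U: "bounded U" "open U" and K: "compact K" "K \<subseteq> U"
    and \<rho>: "continuous_on U \<rho>" "\<And>x. x \<in> U \<Longrightarrow> m \<le> \<rho> x \<and> \<rho> x \<le> Mx" "0 < m" and H: "H12 U \<rho> g"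
  obtains q h where "\<And>k::nat. smooth_fun (q k)" "\<And>k x. 0 < q k x" "\<And>k x. x \<in> K \<Longrightarrow> m \<le> q k x \<and> q k x \<le> Mx + 1"
    "\<And>x. x \<in> K \<Longrightarrow> (\<lambda>k. q k x) \<longlonglongrightarrow> \<rho> x" "L2 (lebesgue_on K) (h :: real^'n \<Rightarrow> real)"
    "AE x in lebesgue_on K. (\<lambda>k. grad (q k) x) \<longlonglongrightarrow> g x" "AE x in lebesgue_on K. \<forall>k. norm (grad (q k) x) \<le> h x"
proof -
  let ?U = "lebesgue_on U" and ?K = "lebesgue_on K"
  have Us: "U \<in> sets lebesgue" using U by (auto intro: borel_open)
  have Ks: "K \<in> sets lebesgue" by (rule fmeasurableD[OF lmeasurable_compact[OF K(1)]])
  interpret U: finite_measure ?U by (rule finite_measure_lebesgue_on_bounded[OF U(1) Us])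
  have L2g: "L2 ?U g" and L2\<rho>: "L2 ?U \<rho>"
    using H by (auto simp: H12_def Lp_def LpV_def L2_def)
  have gi: "integrable ?U g" and \<rho>i: "integrable ?U \<rho>"
    using L2_imp_integrable L2g L2\<rho> U.finite_measure_axioms by blast+
  obtain \<delta> where \<delta>: "\<delta> > 0" "(\<Union>x\<in>K. cball x \<delta>) \<subseteq> U"
    using compact_subset_open_imp_cball_epsilon_subset[OF K(1) U(2) K(2)] by metis
  \<comment> \<open>Starting the radii at an index beyond 1/\<delta> keeps every mollification ball
    around a point of \<open>K\<close> inside \<open>U\<close>.\<close>
  obtain N where N: "real N > 1 / \<delta>" using reals_Archimedean2 by blast
  define r where "r k = real (N + k + 1)" for k
  have r: "r k > 0" "1 / r k \<le> \<delta>" for k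
  proof -
    show "r k > 0" by (simp add: r_def)
    have "1 / \<delta> \<le> r k" using N by (simp add: r_def)
    then show "1 / r k \<le> \<delta>" using \<delta>(1) \<open>r k > 0\<close> by (simp add: field_simps)
  qed
  have sub: "cball x (1 / r k) \<subseteq> U" if "x \<in> K" for x k
    using \<delta>(2) that r(2)[of k] by (fastforce simp: subset_iff)
  define c where "c k x = (\<integral>y. moll (r k) (x - y) * \<rho> y \<partial>?U)" for k x
  have c_smooth: "smooth_fun (c k)" for k
    unfolding c_def by (intro smooth_convolution smooth_moll compact_tsupport_moll r \<rho>i)
  have ci: "integrable ?U (\<lambda>y. moll (r k) (x - y) * \<rho> y)" for k x
    using moll_convolution_integrable[OF \<rho>i, of "r k" x] by simp
  have c_nonneg: "c k x \<ge> 0" for k x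
    unfolding c_def
  proof (intro integral_nonneg_AE AE_I2)
    fix y assume "y \<in> space ?U"
    then show "0 \<le> moll (r k) (x - y) * \<rho> y" using \<rho>(2)[of y] \<rho>(3) by (intro mult_nonneg_nonneg moll_nonneg) auto
  qed
  have c_bounds: "m \<le> c k x \<and> c k x \<le> Mx" if x: "x \<in> K" for k x
  proof -
    note m1 = integral_moll_ball[OF r(1) Us sub[OF x], of k]
    have "(\<integral>y. moll (r k) (x - y) * m \<partial>?U) \<le> c k x"
      unfolding c_def by (rule integral_mono[OF _ ci]) (use m1 \<rho> in \<open>auto intro!: mult_left_mono moll_nonneg\<close>)
    moreover have "c k x \<le> (\<integral>y. moll (r k) (x - y) * Mx \<partial>?U)"
      unfolding c_def by (rule integral_mono[OF ci]) (use m1 \<rho> in \<open>auto intro!: mult_left_mono moll_nonneg\<close>)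
    ultimately show ?thesis using m1 by simp
  qed
  have inv_r: "(\<lambda>k. 1 / r k) \<longlonglongrightarrow> 0"
  proof -
    have "(\<lambda>k. 1 / real (k + (N + 1))) \<longlonglongrightarrow> 0" by (rule LIMSEQ_ignore_initial_segment[OF lim_1_over_n])
    then show ?thesis by (simp add: r_def ac_simps)
  qed
  have c_tendsto: "(\<lambda>k. c k x) \<longlonglongrightarrow> \<rho> x" if x: "x \<in> K" for x
  proof (rule LIMSEQ_I)
    fix e :: real assume e: "e > 0"
    have "continuous (at x) \<rho>" using \<rho>(1) U(2) K(2) x by (simp add: continuous_on_eq_continuous_at subset_iff)
    then obtain d where d: "d > 0" "\<And>y. dist y x < d \<Longrightarrow> dist (\<rho> y) (\<rho> x) < e / 2"
      using e half_gt_zero[OF e] unfolding continuous_at_eps_delta dist_norm real_norm_def by metis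
    obtain M where M: "\<And>k. k \<ge> M \<Longrightarrow> 1 / r k < d"
      using order_tendstoD(2)[OF inv_r d(1)] by (auto simp: eventually_sequentially)
    have "norm (c k x - \<rho> x) < e" if "k \<ge> M" for k
    proof -
      note m1 = integral_moll_ball[OF r(1) Us sub[OF x], of k]
      have i: "integrable ?U (\<lambda>y. moll (r k) (x - y) * (\<rho> y - \<rho> x))"
        using ci[of k x] m1(1) by (simp add: right_diff_distrib)
      have "c k x - \<rho> x = c k x - (\<integral>y. moll (r k) (x - y) * \<rho> x \<partial>?U)" using m1 by simp
      also have "\<dots> = (\<integral>y. moll (r k) (x - y) * (\<rho> y - \<rho> x) \<partial>?U)"
        unfolding c_def using ci[of k x] m1(1) by (simp add: right_diff_distrib)
      finally have "norm (c k x - \<rho> x) \<le> (\<integral>y. norm (moll (r k) (x - y) * (\<rho> y - \<rho> x)) \<partial>?U)"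
        by (simp only: integral_norm_bound)
      also have "\<dots> \<le> (\<integral>y. moll (r k) (x - y) * (e / 2) \<partial>?U)"
      proof (rule integral_mono)
        show "norm (moll (r k) (x - y) * (\<rho> y - \<rho> x)) \<le> moll (r k) (x - y) * (e / 2)" for y
        proof (cases "norm (x - y) \<ge> 1 / r k")
          case True
          then show ?thesis by (simp add: moll_eq_0[OF r(1) True])
        next
          case False
          then have "dist y x < d" using M[OF that] by (simp add: dist_norm norm_minus_commute)
          then have "\<bar>\<rho> y - \<rho> x\<bar> \<le> e / 2" using d(2)[of y] by (simp add: dist_real_def)
          then have "moll (r k) (x - y) * \<bar>\<rho> y - \<rho> x\<bar> \<le> moll (r k) (x - y) * (e / 2)"
            by (rule mult_left_mono[OF _ moll_nonneg])
          then show ?thesis using moll_nonneg[of "r k" "x - y"] by (simp only: real_norm_def abs_mult abs_of_nonneg)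
        qed
      qed (use i m1 in auto)
      also have "\<dots> = e / 2" using m1 by simp
      finally show ?thesis using e by simp
    qed
    then show "\<exists>no. \<forall>n\<ge>no. norm (c n x - \<rho> x) < e" by blast
  qed
  have grad_c: "grad (c k) x = (\<integral>y. moll (r k) (x - y) *\<^sub>R g y \<partial>?U)" if x: "x \<in> K" for k x
  proof -
    have "grad (c k) x $ i = (\<integral>y. moll (r k) (x - y) *\<^sub>R g y \<partial>?U) $ i" for i
    proof -
      have "grad (c k) x = (\<chi> i. \<integral>y. dpart i (moll (r k)) (x - y) * \<rho> y \<partial>?U)"
        unfolding c_def[abs_def]
        by (rule grad_eqI[OF convolution_has_derivative[OF smooth_moll compact_tsupport_moll[OF r(1)] \<rho>i]])
      then have "grad (c k) x $ i = - (\<integral>y. \<rho> y * dpart i (\<lambda>y. moll (r k) (x - y)) y \<partial>?U)"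
        unfolding test_fun_moll_reflected(2)[OF r(1) sub[OF x]] by (simp add: mult.commute)
      also have "\<dots> = (\<integral>y. g y $ i * moll (r k) (x - y) \<partial>?U)"
        using H test_fun_moll_reflected(1)[OF r(1) sub[OF x]] unfolding H12_def by simp
      also have "\<dots> = (\<integral>y. moll (r k) (x - y) *\<^sub>R g y \<partial>?U) $ i"
        unfolding moll_convolution_component[OF gi] by (simp add: mult.commute)
      finally show ?thesis .
    qed
    then show ?thesis by (simp add: vec_eq_iff)
  qed
  have lim: "(\<lambda>k. \<integral>x. (norm (grad (c k) x - g x))\<^sup>2 \<partial>?K) \<longlonglongrightarrow> 0"
  proof (rule LIMSEQ_I)
    fix e :: real assume e: "e > 0"
    obtain R where R: "\<And>r. r \<ge> R \<Longrightarrow> (\<integral>x. (norm ((\<integral>y. moll r (x - y) *\<^sub>R g y \<partial>?U) - g x))\<^sup>2 \<partial>?K) < e"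
      using moll_L2_approx[OF U K L2g e] by blast
    obtain n :: nat where n: "R \<le> real n" using real_arch_simple by blast
    have "(\<integral>x. (norm (grad (c k) x - g x))\<^sup>2 \<partial>?K) < e" if "k \<ge> n" for k
    proof -
      have "R \<le> r k" using n that by (simp add: r_def)
      moreover have "(\<integral>x. (norm (grad (c k) x - g x))\<^sup>2 \<partial>?K) = (\<integral>x. (norm ((\<integral>y. moll (r k) (x - y) *\<^sub>R g y \<partial>?U) - g x))\<^sup>2 \<partial>?K)"
        by (rule Bochner_Integration.integral_cong) (auto simp: grad_c)
      ultimately show ?thesis using R by simp
    qed
    then show "\<exists>no. \<forall>k\<ge>no. norm ((\<integral>x. (norm (grad (c k) x - g x))\<^sup>2 \<partial>?K) - 0) < e" by auto
  qed
  obtain \<sigma> h where \<sigma>: "strict_mono (\<sigma> :: nat \<Rightarrow> nat)" "L2 ?K (h :: real^'n \<Rightarrow> real)"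
    "AE x in ?K. (\<lambda>k. grad (c (\<sigma> k)) x) \<longlonglongrightarrow> g x" "AE x in ?K. \<forall>k. norm (grad (c (\<sigma> k)) x) \<le> h x"
  proof (rule L2_dominated_subsequence[OF _ _ lim])
    show "L2 ?K (grad (c k))" for k
      by (intro L2_bounded_continuous_on_compact continuous_on_grad c_smooth K)
    show "L2 ?K g" by (rule L2_lebesgue_on_subset[OF L2g K(2) Ks Us])
  qed blast
  \<comment> \<open>The mollified weight is only nonnegative away from \<open>K\<close>. The added
    positive constant, at most one, makes \<open>1 / q k\<close> smooth on the whole space and
    accounts for the upper bound \<open>Mx + 1\<close>.\<close>
  define q where "q k x = c (\<sigma> k) x + 1 / (real k + 1)" for k x
  have gq: "grad (q k) x = grad (c (\<sigma> k)) x" for k x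
  proof (rule grad_eqI)
    have "(c (\<sigma> k) has_derivative (\<lambda>h. grad (c (\<sigma> k)) x \<bullet> h)) (at x)"
      by (rule has_derivative_grad[OF smooth_fun_differentiable[OF c_smooth]])
    then show "(q k has_derivative (\<lambda>h. grad (c (\<sigma> k)) x \<bullet> h)) (at x)"
      unfolding q_def[abs_def] by (rule has_derivative_add_const)
  qed
  show ?thesis
  proof (rule that[of q h])
    show "smooth_fun (q k)" for k unfolding q_def[abs_def] by (rule smooth_fun_add[OF c_smooth smooth_fun_const])
    show "0 < q k x" for k x using c_nonneg[of "\<sigma> k" x] by (simp add: q_def add_nonneg_pos)
    show "m \<le> q k x \<and> q k x \<le> Mx + 1" if "x \<in> K" for k x
    proof -
      have "0 \<le> 1 / (real k + 1)" "1 / (real k + 1) \<le> 1" by auto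
      then show ?thesis using c_bounds[OF that, of "\<sigma> k"] unfolding q_def by linarith
    qed
    show "(\<lambda>k. q k x) \<longlonglongrightarrow> \<rho> x" if "x \<in> K" for x
    proof -
      have "(\<lambda>k. c (\<sigma> k) x) \<longlonglongrightarrow> \<rho> x" using LIMSEQ_subseq_LIMSEQ[OF c_tendsto[OF that] \<sigma>(1)] by (simp add: o_def)
      moreover have "(\<lambda>k. 1 / (real k + 1)) \<longlonglongrightarrow> 0"
        using LIMSEQ_inverse_real_of_nat by (simp add: inverse_eq_divide add.commute)
      ultimately show ?thesis unfolding q_def using tendsto_add by fastforce
    qed
    show "AE x in ?K. (\<lambda>k. grad (q k) x) \<longlonglongrightarrow> g x" "AE x in ?K. \<forall>k. norm (grad (q k) x) \<le> h x"
      unfolding gq by fact+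
  qed fact
qed

section \<open>The divergence-free form\<close>

lemma borel_measurable_vecI:
  fixes f :: "'a \<Rightarrow> real^'n::finite"
  assumes "\<And>i. (\<lambda>x. f x $ i) \<in> borel_measurable M"
  shows "f \<in> borel_measurable M"
  using assms by (subst borel_measurable_euclidean_space) (auto simp: Basis_vec_def inner_axis)

lemma measurable_matrix_vector_mult:
  fixes A :: "'a \<Rightarrow> real^'n::finite^'n" and g :: "'a \<Rightarrow> real^'n"
  assumes "\<And>i j. (\<lambda>x. A x $ i $ j) \<in> borel_measurable M" and g: "g \<in> borel_measurable M"
  shows "(\<lambda>x. A x *v g x) \<in> borel_measurable M"
proof (rule borel_measurable_vecI)
  have "(\<lambda>x. g x $ j) \<in> borel_measurable M" for j
    using measurable_compose[OF g borel_measurable_nth] by simp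
  then show "(\<lambda>x. (A x *v g x) $ i) \<in> borel_measurable M" for i
    unfolding matrix_vector_mult_def using assms(1) by simp
qed

lemma norm_matrix_vector_le:
  fixes A :: "real^'n::finite^'n"
  assumes "\<And>i j. \<bar>A $ i $ j\<bar> \<le> M"
  shows "norm (A *v v) \<le> (real CARD('n))\<^sup>2 * M * norm v"
proof -
  have "\<bar>(A *v v) $ i\<bar> \<le> real CARD('n) * (M * norm v)" for i
  proof -
    have "\<bar>(A *v v) $ i\<bar> \<le> (\<Sum>j\<in>UNIV. \<bar>A $ i $ j * v $ j\<bar>)" unfolding matrix_vector_mult_def by (simp add: sum_abs)
    also have "\<dots> \<le> (\<Sum>j\<in>(UNIV::'n set). M * norm v)"
      unfolding abs_mult using assms order_trans[OF abs_ge_zero assms]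
      by (intro sum_mono mult_mono component_le_norm_cart) auto
    finally show ?thesis by simp
  qed
  then have "(\<Sum>i\<in>UNIV. \<bar>(A *v v) $ i\<bar>) \<le> (\<Sum>i\<in>(UNIV::'n set). real CARD('n) * (M * norm v))" by (intro sum_mono)
  then show ?thesis using norm_le_l1_cart[of "A *v v"] by (simp add: power2_eq_square mult.assoc)
qed

lemma transpose_vector_inner: "(transpose A *v w) \<bullet> v = w \<bullet> (A *v v)" for A :: "real^'n::finite^'n"
  by (simp add: dot_lmul_matrix)

lemma norm_transpose_le:
  fixes A :: "real^'n::finite^'n"
  assumes "\<And>v. norm (A *v v) \<le> C * norm v"
  shows "norm (transpose A *v w) \<le> C * norm w"
proof (cases "transpose A *v w = 0")
  case True
  have "0 \<le> C * norm w" using assms[of w] norm_ge_zero order_trans by blast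
  then show ?thesis using True by simp
next
  case False
  let ?t = "transpose A *v w"
  have "norm ?t * norm ?t = w \<bullet> (A *v ?t)"
    using transpose_vector_inner[of A w ?t] by (simp add: dot_square_norm power2_eq_square)
  also have "\<dots> \<le> norm w * norm (A *v ?t)" by (rule norm_cauchy_schwarz)
  also have "\<dots> \<le> norm w * (C * norm ?t)" by (intro mult_left_mono assms) simp
  finally have "norm ?t * norm ?t \<le> (C * norm w) * norm ?t" by (simp add: ac_simps)
  then show ?thesis using False by (simp add: mult_le_cancel_right)
qed

lemma smooth_fun_inverse:
  assumes "smooth_fun q" "\<And>x. 0 < q x"
  shows "smooth_fun (\<lambda>x. 1 / q x)"
proof -
  define D :: "nat \<Rightarrow> real \<Rightarrow> real" where "D k s = (-1)^k * fact k * s powr (- (real k + 1))" for k s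
  have D: "(D k has_real_derivative D (Suc k) s) (at s)" if s: "s > 0" for k s
  proof -
    have "((\<lambda>s. (-1)^k * fact k * s powr (- (real k + 1))) has_real_derivative
        (-1)^k * fact k * (- (real k + 1) * s powr (- (real k + 1) - 1))) (at s)"
      by (intro DERIV_cmult has_real_derivative_powr s)
    moreover have "(-1)^k * fact k * (- (real k + 1) * s powr (- (real k + 1) - 1)) = D (Suc k) s"
      by (simp add: D_def algebra_simps)
    ultimately show ?thesis by (simp only: D_def[abs_def])
  qed
  have "smooth_fun (\<lambda>x. D 0 (q x))" by (rule smooth_fun_comp[of D q, OF D[OF assms(2)] assms(1)])
  moreover have "D 0 (q x) = 1 / q x" for x using assms(2)[of x] by (simp add: D_def powr_minus_divide)
  ultimately show ?thesis by simp
qed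

lemma L2_extend:
  fixes h :: "'a::euclidean_space \<Rightarrow> real"
  assumes h: "L2 (lebesgue_on K) h" and K: "K \<subseteq> U" "K \<in> sets lebesgue" "U \<in> sets lebesgue"
  shows "L2 (lebesgue_on U) (\<lambda>x. indicator K x * h x)"
  unfolding L2_def
proof (intro conjI)
  have "(\<lambda>x. if x \<in> K then h x else 0) \<in> borel_measurable lebesgue"
    by (rule borel_measurable_if[OF K(2), THEN iffD2, OF L2_measurable[OF h]])
  also have "(\<lambda>x. if x \<in> K then h x else 0) = (\<lambda>x. indicator K x * h x)" by (auto simp: indicator_def)
  finally show "(\<lambda>x. indicator K x * h x) \<in> borel_measurable (lebesgue_on U)" by (rule measurable_restrict_space1)
  have "integrable lebesgue (\<lambda>x. indicator K x *\<^sub>R (norm (h x))\<^sup>2)"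
    by (rule integrable_lebesgue_on_iff[OF K(2), THEN iffD1, OF L2_integrable[OF h]])
  also have "(\<lambda>x. indicator K x *\<^sub>R (norm (h x))\<^sup>2) = (\<lambda>x. indicator U x *\<^sub>R (norm (indicator K x * h x))\<^sup>2)"
  proof
    show "indicator K x *\<^sub>R (norm (h x))\<^sup>2 = indicator U x *\<^sub>R (norm (indicator K x * h x))\<^sup>2" for x
      using K(1) by (cases "x \<in> K") (auto simp: indicator_def)
  qed
  finally show "integrable (lebesgue_on U) (\<lambda>x. (norm (indicator K x * h x))\<^sup>2)"
    by (rule integrable_lebesgue_on_iff[OF K(3), THEN iffD2])
qed

lemma AE_lebesgue_on_subset:
  assumes "AE x in lebesgue_on K. P x" "K \<in> sets lebesgue" "U \<in> sets lebesgue"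
  shows "AE x in lebesgue_on U. x \<in> K \<longrightarrow> P x"
proof -
  have "AE x in lebesgue. x \<in> K \<longrightarrow> P x" using assms(1,2) by (subst (asm) AE_restrict_space_iff) auto
  then show ?thesis using assms(3) by (subst AE_restrict_space_iff) auto
qed

section \<open>The weighted equation and its equivalence with the original one\<close>

text \<open>The data in the form in which the estimates use them. \<open>m\<close> and
  \<open>Mx\<close> are lower and upper bounds of \<rho>, later its infimum and supremum over the
  closure of \<open>U\<close>; \<open>K1\<close> returns in the final estimates through
  \<open>Mx \<le> K1 * m\<close>.\<close>

locale elliptic =
  fixes U :: "(real^'n::finite) set" and A :: "real^'n \<Rightarrow> real^'n^'n" and H g\<rho> :: "real^'n \<Rightarrow> real^'n"
    and \<rho> c :: "real^'n \<Rightarrow> real" and lam M m Mx :: real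
  assumes dim: "CARD('n) \<ge> 3"
    and bounded_U: "bounded U" and open_U: "open U"
    and L2_H: "L2 (lebesgue_on U) H"
    and A_measurable: "\<And>i j. (\<lambda>x. A x $ i $ j) \<in> borel_measurable (lebesgue_on U)"
    and lam: "0 < lam" and M: "0 < M"
    and A_elliptic: "AE x in lebesgue_on U. (\<forall>\<xi>. lam * (norm \<xi>)\<^sup>2 \<le> (A x *v \<xi>) \<bullet> \<xi>) \<and> (\<forall>i j. \<bar>A x $ i $ j\<bar> \<le> M)"
    and \<rho>_cont: "continuous_on U \<rho>" and \<rho>_bounds: "\<And>x. x \<in> U \<Longrightarrow> m \<le> \<rho> x \<and> \<rho> x \<le> Mx" and m: "0 < m" "m \<le> Mx"
    and \<rho>_H12: "H12 U \<rho> g\<rho>"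
    and div_free: "\<And>\<phi>. test_fun U \<phi> \<Longrightarrow> (\<integral>x. (transpose (A x) *v g\<rho> x + \<rho> x *\<^sub>R H x) \<bullet> grad \<phi> x \<partial>lebesgue_on U) = 0"
    and c: "integrable (lebesgue_on U) c" "AE x in lebesgue_on U. 0 \<le> c x"
begin

definition F :: "real^'n \<Rightarrow> real^'n" where
  "F x = transpose (A x) *v g\<rho> x + \<rho> x *\<^sub>R H x"

text \<open>The integrand of the weighted form. It is kept as a function so that dominated
  convergence applies to it directly, and \<open>c x * u x\<close> stands together because the
  integrability assumption concerns this product.\<close>

definition E :: "(real^'n \<Rightarrow> real) \<Rightarrow> (real^'n \<Rightarrow> real^'n) \<Rightarrow> (real^'n \<Rightarrow> real) \<Rightarrow> real^'n \<Rightarrow> real" where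
  "E u g \<phi> x = \<rho> x * ((A x *v g x) \<bullet> grad \<phi> x) + (F x \<bullet> g x) * \<phi> x + c x * u x * (\<rho> x * \<phi> x)"

definition C\<^sub>A :: real where "C\<^sub>A = (real CARD('n))\<^sup>2 * M"

lemma U_sets: "U \<in> sets lebesgue"
  using open_U by (auto intro: borel_open)

lemma finite_measure_U: "finite_measure (lebesgue_on U)"
  by (rule finite_measure_lebesgue_on_bounded[OF bounded_U U_sets])

lemma A_bound: "AE x in lebesgue_on U. \<forall>v. norm (A x *v v) \<le> C\<^sub>A * norm v"
  using A_elliptic by eventually_elim (auto simp: C\<^sub>A_def intro: norm_matrix_vector_le)

lemma C_A_nonneg: "0 \<le> C\<^sub>A"
  using M by (simp add: C\<^sub>A_def)

lemma L2_A: "L2 (lebesgue_on U) g \<Longrightarrow> L2 (lebesgue_on U) (\<lambda>x. A x *v g x)"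
proof (rule L2_bound[OF L2_scaleR[of _ g "C\<^sub>A"]])
  assume g: "L2 (lebesgue_on U) g"
  show "(\<lambda>x. A x *v g x) \<in> borel_measurable (lebesgue_on U)"
    by (rule measurable_matrix_vector_mult[OF A_measurable L2_measurable[OF g]])
  show "AE x in lebesgue_on U. norm (A x *v g x) \<le> norm (C\<^sub>A *\<^sub>R g x)"
    using A_bound by eventually_elim (use C_A_nonneg in auto)
qed

lemma \<rho>_measurable: "\<rho> \<in> borel_measurable (lebesgue_on U)"
  using \<rho>_H12 by (auto simp: H12_def Lp_def)

lemma L2_g\<rho>: "L2 (lebesgue_on U) g\<rho>"
  using \<rho>_H12 by (auto simp: H12_def LpV_def L2_def)

lemma L2_bounded_mult:
  fixes f :: "real^'n \<Rightarrow> 'b::euclidean_space"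
  assumes "L2 (lebesgue_on U) f" "b \<in> borel_measurable (lebesgue_on U)" "AE x in lebesgue_on U. \<bar>b x\<bar> \<le> B"
  shows "L2 (lebesgue_on U) (\<lambda>x. b x *\<^sub>R f x)"
proof (rule L2_bound[OF L2_scaleR[of _ f "B"]])
  show "(\<lambda>x. b x *\<^sub>R f x) \<in> borel_measurable (lebesgue_on U)"
    by (rule borel_measurable_scaleR[OF assms(2) L2_measurable[OF assms(1)]])
  show "AE x in lebesgue_on U. norm (b x *\<^sub>R f x) \<le> norm (B *\<^sub>R f x)"
    using assms(3) by eventually_elim (auto intro!: mult_right_mono)
qed (rule assms(1))

lemma L2_F: "L2 (lebesgue_on U) F"
  unfolding F_def[abs_def]
proof (intro L2_add)
  show "L2 (lebesgue_on U) (\<lambda>x. transpose (A x) *v g\<rho> x)"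
  proof (rule L2_bound[OF L2_scaleR[of _ g\<rho> "C\<^sub>A"]])
    show "(\<lambda>x. transpose (A x) *v g\<rho> x) \<in> borel_measurable (lebesgue_on U)"
      using A_measurable by (intro measurable_matrix_vector_mult L2_measurable[OF L2_g\<rho>]) (simp add: transpose_def)
    show "AE x in lebesgue_on U. norm (transpose (A x) *v g\<rho> x) \<le> norm (C\<^sub>A *\<^sub>R g\<rho> x)"
      using A_bound by eventually_elim (use C_A_nonneg norm_transpose_le in auto)
  qed (rule L2_g\<rho>)
  show "L2 (lebesgue_on U) (\<lambda>x. \<rho> x *\<^sub>R H x)"
  proof (rule L2_bounded_mult[OF L2_H \<rho>_measurable])
    show "AE x in lebesgue_on U. \<bar>\<rho> x\<bar> \<le> Mx" using \<rho>_bounds m by (intro AE_I2) (fastforce simp: abs_le_iff)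
  qed
qed

lemma test_fun_measurable:
  assumes "test_fun U \<phi>"
  shows "\<phi> \<in> borel_measurable (lebesgue_on U)" "grad \<phi> \<in> borel_measurable (lebesgue_on U)"
  using test_fun_borel[OF assms] borel_measurable_lebesgue_onI by auto

lemma E_measurable:
  assumes "g \<in> borel_measurable (lebesgue_on U)" "(\<lambda>x. c x * u x) \<in> borel_measurable (lebesgue_on U)" "test_fun U \<phi>"
  shows "E u g \<phi> \<in> borel_measurable (lebesgue_on U)"
proof -
  note [measurable] = \<rho>_measurable assms(1,2) test_fun_measurable[OF assms(3)] L2_measurable[OF L2_F]
    measurable_matrix_vector_mult[OF A_measurable assms(1)]
  show ?thesis unfolding E_def[abs_def] by measurable
qed

lemma F_inner: "F x \<bullet> v = (A x *v v) \<bullet> g\<rho> x + \<rho> x * (H x \<bullet> v)"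
  unfolding F_def inner_add_left inner_scaleR_left transpose_vector_inner by (simp only: inner_commute[of "g\<rho> x"])

text \<open>With weak gradient \<open>g\<rho>\<close> for \<rho>, the product rule applied to \<phi>
  \<rho> produces a term with \<open>A\<close> and \<open>g\<rho>\<close>, which merges with the
  drift \<open>H\<close> into the field \<open>F\<close>.\<close>

lemma bform_integrand_eq:
  "(A x *v g x) \<bullet> (\<phi> x *\<^sub>R g\<rho> x + \<rho> x *\<^sub>R grad \<phi> x) + (H x \<bullet> g x) * (\<phi> x * \<rho> x) + c x * u x * (\<phi> x * \<rho> x) = E u g \<phi> x"
  unfolding E_def F_inner inner_add_right inner_scaleR_right by (simp only: distrib_right distrib_left ac_simps)

text \<open>As \<rho> is not smooth, \<phi> times its smooth approximations is used for testing.
  Everything takes place on the compact support of \<phi>, and the only delicate term is dominated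
  by the product of the L^2 functions |g| and \<open>h'\<close>.\<close>

lemma weak_form_times_\<rho>:
  assumes g: "L2 (lebesgue_on U) g" and cu: "integrable (lebesgue_on U) (\<lambda>x. c x * u x)"
    and f: "integrable (lebesgue_on U) f"
    and weak: "\<And>\<psi>. test_fun U \<psi> \<Longrightarrow> bform U A H c u g \<psi> = (\<integral>x. f x * \<psi> x \<partial>lebesgue_on U)"
    and \<phi>: "test_fun U \<phi>"
  shows "(\<integral>x. E u g \<phi> x \<partial>lebesgue_on U) = (\<integral>x. f x * (\<rho> x * \<phi> x) \<partial>lebesgue_on U)"
proof -
  let ?U = "lebesgue_on U"
  define K where "K = tsupport \<phi>"
  have K: "compact K" "K \<subseteq> U" using \<phi> by (auto simp: K_def test_fun_def)
  have Ks: "K \<in> sets lebesgue" by (rule fmeasurableD[OF lmeasurable_compact[OF K(1)]])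
  obtain B where B: "B > 0" "\<And>x. \<bar>\<phi> x\<bar> \<le> B" "\<And>x. norm (grad \<phi> x) \<le> B" using test_fun_bounded[OF \<phi>] by metis
  obtain q h where q: "\<And>k::nat. smooth_fun (q k)" "\<And>k x. 0 < q k x" "\<And>k x. x \<in> K \<Longrightarrow> m \<le> q k x \<and> q k x \<le> Mx + 1"
    "\<And>x. x \<in> K \<Longrightarrow> (\<lambda>k. q k x) \<longlonglongrightarrow> \<rho> x" and h: "L2 (lebesgue_on K) (h :: real^'n \<Rightarrow> real)"
    and gq: "AE x in lebesgue_on K. (\<lambda>k. grad (q k) x) \<longlonglongrightarrow> g\<rho> x" "AE x in lebesgue_on K. \<forall>k. norm (grad (q k) x) \<le> h x"
    by (rule smooth_approximation[OF bounded_U open_U K \<rho>_cont \<rho>_bounds m(1) \<rho>_H12]) blast+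
  \<comment> \<open>The majorant lives on \<open>K\<close>; extended by zero it can be paired with
    L^2 functions on \<open>U\<close>.\<close>
  define h' where "h' x = indicator K x * h x" for x
  have h': "L2 ?U h'" unfolding h'_def by (rule L2_extend[OF h K(2) Ks U_sets])
  note gq' = AE_lebesgue_on_subset[OF gq(1) Ks U_sets] AE_lebesgue_on_subset[OF gq(2) Ks U_sets]
  define \<psi> where "\<psi> k x = \<phi> x * q k x" for k x
  have \<psi>: "test_fun U (\<psi> k)" for k unfolding \<psi>_def[abs_def] by (rule test_fun_mult[OF \<phi> q(1)])
  have g\<psi>: "grad (\<psi> k) x = \<phi> x *\<^sub>R grad (q k) x + q k x *\<^sub>R grad \<phi> x" for k x
    unfolding \<psi>_def[abs_def] using test_funD(2)[OF \<phi>] smooth_fun_differentiable[OF q(1)] by (intro grad_mult)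
  have out: "\<phi> x = 0" "grad \<phi> x = 0" if "x \<notin> K" for x
    using that tsupportD grad_outside_tsupport by (auto simp: K_def)
  let ?I = "\<lambda>k x. (A x *v g x) \<bullet> grad (\<psi> k) x + (H x \<bullet> g x) * \<psi> k x + c x * u x * \<psi> k x"
  let ?w = "\<lambda>x. C\<^sub>A * B * (norm (g x) * norm (h' x)) + C\<^sub>A * ((Mx + 1) * B) * norm (g x) + B * (Mx + 1) * (norm (H x) * norm (g x)) + B * (Mx + 1) * \<bar>c x * u x\<bar>"
  note [measurable] = \<rho>_measurable L2_measurable[OF g] borel_measurable_integrable[OF cu] L2_measurable[OF L2_H]
    measurable_matrix_vector_mult[OF A_measurable L2_measurable[OF g]]
  have wi: "integrable ?U ?w"
    by (intro Bochner_Integration.integrable_add integrable_mult_right integrable_abs[OF cu]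
        L2_norm_mult_integrable[OF g h'] L2_norm_mult_integrable[OF L2_H g] integrable_norm[OF L2_imp_integrable[OF finite_measure_U g]])
  have lim: "(\<lambda>k. \<integral>x. ?I k x \<partial>?U) \<longlonglongrightarrow> (\<integral>x. E u g \<phi> x \<partial>?U)"
  proof (rule integral_dominated_convergence[OF _ _ wi])
    show "E u g \<phi> \<in> borel_measurable ?U" by (rule E_measurable[OF _ _ \<phi>]) measurable
    show "?I k \<in> borel_measurable ?U" for k
    proof -
      note [measurable] = test_fun_measurable[OF \<psi>]
      show ?thesis by measurable
    qed
    show "AE x in ?U. (\<lambda>k. ?I k x) \<longlonglongrightarrow> E u g \<phi> x"
      using gq'(1)
    proof eventually_elim
      case (elim x)
      show ?case
      proof (cases "x \<in> K")
        case True
        have "(\<lambda>k. ?I k x) \<longlonglongrightarrow> (A x *v g x) \<bullet> (\<phi> x *\<^sub>R g\<rho> x + \<rho> x *\<^sub>R grad \<phi> x) + (H x \<bullet> g x) * (\<phi> x * \<rho> x) + c x * u x * (\<phi> x * \<rho> x)"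
          unfolding g\<psi> \<psi>_def using elim True q(4)[OF True] by (intro tendsto_intros) auto
        then show ?thesis unfolding bform_integrand_eq .
      next
        case False
        then show ?thesis unfolding g\<psi> \<psi>_def E_def by (simp add: out)
      qed
    qed
    show "AE x in ?U. norm (?I k x) \<le> ?w x" for k
      using gq'(2) A_bound
    proof eventually_elim
      case (elim x)
      have CB: "0 \<le> Mx + 1" using m by linarith
      show ?case
      proof (cases "x \<in> K")
        case True
        have "norm (grad (q k) x) \<le> h x" using elim(1) True by blast
        also have "h x \<le> norm (h' x)" using True by (simp add: h'_def)
        finally have hx: "norm (grad (q k) x) \<le> norm (h' x)" .
        have qx: "\<bar>q k x\<bar> \<le> Mx + 1" using q(3)[OF True, of k] m(1) by simp
        have \<psi>x: "\<bar>\<psi> k x\<bar> \<le> B * (Mx + 1)" unfolding \<psi>_def abs_mult by (intro mult_mono B qx) (use B in auto)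
        have g\<psi>x: "norm (grad (\<psi> k) x) \<le> B * norm (h' x) + (Mx + 1) * B"
          unfolding g\<psi> by (rule order_trans[OF norm_triangle_ineq], unfold norm_scaleR, intro add_mono mult_mono B qx hx) (use B CB in auto)
        have "\<bar>(A x *v g x) \<bullet> grad (\<psi> k) x\<bar> \<le> (C\<^sub>A * norm (g x)) * (B * norm (h' x) + (Mx + 1) * B)"
          by (rule order_trans[OF Cauchy_Schwarz_ineq2], intro mult_mono g\<psi>x) (use elim(2) C_A_nonneg in auto)
        moreover have "\<bar>(H x \<bullet> g x) * \<psi> k x\<bar> \<le> (norm (H x) * norm (g x)) * (B * (Mx + 1))"
          unfolding abs_mult by (intro mult_mono Cauchy_Schwarz_ineq2 \<psi>x) auto
        moreover have "\<bar>c x * u x * \<psi> k x\<bar> \<le> \<bar>c x * u x\<bar> * (B * (Mx + 1))"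
          unfolding abs_mult[of "c x * u x"] by (intro mult_left_mono \<psi>x) auto
        ultimately have "norm (?I k x) \<le> (C\<^sub>A * norm (g x)) * (B * norm (h' x) + (Mx + 1) * B)
          + (norm (H x) * norm (g x)) * (B * (Mx + 1)) + \<bar>c x * u x\<bar> * (B * (Mx + 1))"
          unfolding real_norm_def by linarith
        also have "\<dots> = ?w x" by (simp add: algebra_simps)
        finally show ?thesis .
      next
        case False
        have "0 \<le> ?w x" using B C_A_nonneg CB m by (intro add_nonneg_nonneg mult_nonneg_nonneg) auto
        then show ?thesis unfolding g\<psi> \<psi>_def by (simp add: out[OF False])
      qed
    qed
  qed
  have lim2: "(\<lambda>k. \<integral>x. f x * \<psi> k x \<partial>?U) \<longlonglongrightarrow> (\<integral>x. f x * (\<rho> x * \<phi> x) \<partial>?U)"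
  proof (rule integral_dominated_convergence[where w="\<lambda>x. \<bar>f x\<bar> * (B * (Mx + 1))"])
    note [measurable] = borel_measurable_integrable[OF f] test_fun_measurable[OF \<phi>]
    show "(\<lambda>x. f x * (\<rho> x * \<phi> x)) \<in> borel_measurable ?U" by measurable
    show "(\<lambda>x. f x * \<psi> k x) \<in> borel_measurable ?U" for k
      using borel_measurable_times[OF borel_measurable_integrable[OF f] test_fun_measurable(1)[OF \<psi>]] .
    show "integrable ?U (\<lambda>x. \<bar>f x\<bar> * (B * (Mx + 1)))" by (intro integrable_mult_left integrable_abs[OF f])
    show "AE x in ?U. (\<lambda>k. f x * \<psi> k x) \<longlonglongrightarrow> f x * (\<rho> x * \<phi> x)"
    proof (rule AE_I2)
      fix x
      show "(\<lambda>k. f x * \<psi> k x) \<longlonglongrightarrow> f x * (\<rho> x * \<phi> x)"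
      proof (cases "x \<in> K")
        case True
        have "(\<lambda>k. f x * \<psi> k x) \<longlonglongrightarrow> f x * (\<phi> x * \<rho> x)" unfolding \<psi>_def by (intro tendsto_intros q(4) True)
        then show ?thesis by (simp add: mult.commute)
      qed (simp add: \<psi>_def out)
    qed
    show "AE x in ?U. norm (f x * \<psi> k x) \<le> \<bar>f x\<bar> * (B * (Mx + 1))" for k
    proof (rule AE_I2)
      fix x
      have "\<bar>\<psi> k x\<bar> \<le> B * (Mx + 1)"
      proof (cases "x \<in> K")
        case True
        then have "\<bar>q k x\<bar> \<le> Mx + 1" using q(3)[OF True, of k] m(1) by simp
        then show ?thesis unfolding \<psi>_def abs_mult by (intro mult_mono B) (use B in auto)
      next
        case False
        then show ?thesis using B m by (simp add: \<psi>_def out)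
      qed
      then show "norm (f x * \<psi> k x) \<le> \<bar>f x\<bar> * (B * (Mx + 1))" unfolding real_norm_def abs_mult by (intro mult_left_mono) auto
    qed
  qed
  have "(\<integral>x. ?I k x \<partial>?U) = (\<integral>x. f x * \<psi> k x \<partial>?U)" for k using weak[OF \<psi>] unfolding bform_def .
  then show ?thesis using LIMSEQ_unique[OF lim] lim2 by simp
qed

text \<open>The converse passage tests with \<phi> divided by the smooth approximations. Their lower
  bound \<open>m\<close> on the support of \<phi> controls both 1/q and the factor 1/q^2 that
  appears in the gradient.\<close>

lemma weak_form_div_\<rho>:
  assumes g: "L2 (lebesgue_on U) g" and cu: "integrable (lebesgue_on U) (\<lambda>x. c x * u x)"
    and f: "integrable (lebesgue_on U) f"
    and weak: "\<And>\<psi>. test_fun U \<psi> \<Longrightarrow> (\<integral>x. E u g \<psi> x \<partial>lebesgue_on U) = (\<integral>x. f x * (\<rho> x * \<psi> x) \<partial>lebesgue_on U)"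
    and \<phi>: "test_fun U \<phi>"
  shows "bform U A H c u g \<phi> = (\<integral>x. f x * \<phi> x \<partial>lebesgue_on U)"
proof -
  let ?U = "lebesgue_on U"
  define K where "K = tsupport \<phi>"
  have K: "compact K" "K \<subseteq> U" using \<phi> by (auto simp: K_def test_fun_def)
  have Ks: "K \<in> sets lebesgue" by (rule fmeasurableD[OF lmeasurable_compact[OF K(1)]])
  obtain B where B: "B > 0" "\<And>x. \<bar>\<phi> x\<bar> \<le> B" "\<And>x. norm (grad \<phi> x) \<le> B" using test_fun_bounded[OF \<phi>] by metis
  obtain q h where q: "\<And>k::nat. smooth_fun (q k)" "\<And>k x. 0 < q k x" "\<And>k x. x \<in> K \<Longrightarrow> m \<le> q k x \<and> q k x \<le> Mx + 1"
    "\<And>x. x \<in> K \<Longrightarrow> (\<lambda>k. q k x) \<longlonglongrightarrow> \<rho> x" and h: "L2 (lebesgue_on K) (h :: real^'n \<Rightarrow> real)"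
    and gq: "AE x in lebesgue_on K. (\<lambda>k. grad (q k) x) \<longlonglongrightarrow> g\<rho> x" "AE x in lebesgue_on K. \<forall>k. norm (grad (q k) x) \<le> h x"
    by (rule smooth_approximation[OF bounded_U open_U K \<rho>_cont \<rho>_bounds m(1) \<rho>_H12]) blast+
  define h' where "h' x = indicator K x * h x" for x
  have h': "L2 ?U h'" unfolding h'_def by (rule L2_extend[OF h K(2) Ks U_sets])
  note gq' = AE_lebesgue_on_subset[OF gq(1) Ks U_sets] AE_lebesgue_on_subset[OF gq(2) Ks U_sets]
  define \<psi> where "\<psi> k x = \<phi> x * (1 / q k x)" for k x
  have \<psi>: "test_fun U (\<psi> k)" for k unfolding \<psi>_def[abs_def] by (rule test_fun_mult[OF \<phi> smooth_fun_inverse[OF q(1,2)]])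
  have gi: "grad (\<lambda>x. 1 / q k x) x = (- (1 / (q k x)\<^sup>2)) *\<^sub>R grad (q k) x" for k x
  proof (rule grad_comp[where T="\<lambda>s. 1 / s"])
    show "((\<lambda>s. 1 / s) has_real_derivative - (1 / (q k x)\<^sup>2)) (at (q k x))"
      using q(2)[of k x] by (auto intro!: derivative_eq_intros simp: power2_eq_square)
  qed (rule smooth_fun_differentiable[OF q(1)])
  have g\<psi>: "grad (\<psi> k) x = (\<phi> x * - (1 / (q k x)\<^sup>2)) *\<^sub>R grad (q k) x + (1 / q k x) *\<^sub>R grad \<phi> x" for k x
  proof -
    have "grad (\<lambda>x. \<phi> x * (1 / q k x)) x = \<phi> x *\<^sub>R grad (\<lambda>x. 1 / q k x) x + (1 / q k x) *\<^sub>R grad \<phi> x"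
      by (rule grad_mult[OF test_funD(2)[OF \<phi>] smooth_fun_differentiable[OF smooth_fun_inverse[OF q(1,2)]]])
    then show ?thesis unfolding \<psi>_def[abs_def] gi by simp
  qed
  have out: "\<phi> x = 0" "grad \<phi> x = 0" if "x \<notin> K" for x
    using that tsupportD grad_outside_tsupport by (auto simp: K_def)
  let ?I = "\<lambda>x. (A x *v g x) \<bullet> grad \<phi> x + (H x \<bullet> g x) * \<phi> x + c x * u x * \<phi> x"
  let ?w = "\<lambda>x. Mx * C\<^sub>A * (B * (1 / m\<^sup>2)) * (norm (g x) * norm (h' x)) + Mx * C\<^sub>A * (1 / m * B) * norm (g x) + B * (1 / m) * (norm (F x) * norm (g x)) + Mx * (B * (1 / m)) * \<bar>c x * u x\<bar>"
  note [measurable] = \<rho>_measurable L2_measurable[OF g] borel_measurable_integrable[OF cu] L2_measurable[OF L2_H]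
    measurable_matrix_vector_mult[OF A_measurable L2_measurable[OF g]] test_fun_measurable[OF \<phi>]
  have wi: "integrable ?U ?w"
    by (intro Bochner_Integration.integrable_add integrable_mult_right integrable_abs[OF cu]
        L2_norm_mult_integrable[OF g h'] L2_norm_mult_integrable[OF L2_F g] integrable_norm[OF L2_imp_integrable[OF finite_measure_U g]])
  have iq: "\<bar>1 / q k x\<bar> \<le> 1 / m" "\<bar>1 / (q k x)\<^sup>2\<bar> \<le> 1 / m\<^sup>2" if "x \<in> K" for k x
    using q(3)[OF that, of k] m(1) by (auto intro!: frac_le power_mono)
  have \<psi>b: "\<bar>\<psi> k x\<bar> \<le> B * (1 / m)" for k x
  proof (cases "x \<in> K")
    case True
    show ?thesis unfolding \<psi>_def abs_mult by (intro mult_mono B iq True) (use B in auto)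
  qed (use B m in \<open>simp add: \<psi>_def out\<close>)
  have lim: "(\<lambda>k. \<integral>x. E u g (\<psi> k) x \<partial>?U) \<longlonglongrightarrow> (\<integral>x. ?I x \<partial>?U)"
  proof (rule integral_dominated_convergence[OF _ _ wi])
    show "E u g (\<psi> k) \<in> borel_measurable ?U" for k by (rule E_measurable[OF _ _ \<psi>]) measurable
    show "?I \<in> borel_measurable ?U" by measurable
    show "AE x in ?U. (\<lambda>k. E u g (\<psi> k) x) \<longlonglongrightarrow> ?I x"
      using gq'(1)
    proof eventually_elim
      case (elim x)
      show ?case
      proof (cases "x \<in> K")
        case True
        have \<rho>p: "\<rho> x > 0" using \<rho>_bounds[of x] m K(2) True by auto
        have "(\<lambda>k. E u g (\<psi> k) x) \<longlonglongrightarrow> \<rho> x * ((A x *v g x) \<bullet> ((\<phi> x * - (1 / (\<rho> x)\<^sup>2)) *\<^sub>R g\<rho> x + (1 / \<rho> x) *\<^sub>R grad \<phi> x))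
           + (F x \<bullet> g x) * (\<phi> x * (1 / \<rho> x)) + c x * u x * (\<rho> x * (\<phi> x * (1 / \<rho> x)))"
          unfolding E_def g\<psi> \<psi>_def using elim True q(4)[OF True] \<rho>p by (intro tendsto_intros) auto
        \<comment> \<open>Differentiating 1/\<rho> contributes a term with \<open>g\<rho>\<close>
          that cancels the \<open>A\<close>-transposed part of \<open>F\<close>, so the drift
          \<open>H\<close> alone remains.\<close>
        moreover have "\<rho> x * ((A x *v g x) \<bullet> ((\<phi> x * - (1 / (\<rho> x)\<^sup>2)) *\<^sub>R g\<rho> x + (1 / \<rho> x) *\<^sub>R grad \<phi> x))
           + (F x \<bullet> g x) * (\<phi> x * (1 / \<rho> x)) + c x * u x * (\<rho> x * (\<phi> x * (1 / \<rho> x))) = ?I x"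
        proof -
          note F_inner[of x "g x"]
          moreover have "(A x *v g x) \<bullet> ((\<phi> x * - (1 / (\<rho> x)\<^sup>2)) *\<^sub>R g\<rho> x + (1 / \<rho> x) *\<^sub>R grad \<phi> x)
            = (\<phi> x * - (1 / (\<rho> x)\<^sup>2)) * ((A x *v g x) \<bullet> g\<rho> x) + (1 / \<rho> x) * ((A x *v g x) \<bullet> grad \<phi> x)"
            by (simp only: inner_add_right inner_scaleR_right)
          ultimately show ?thesis using \<rho>p by (simp add: power2_eq_square field_simps)
        qed
        ultimately show ?thesis by simp
      next
        case False
        then show ?thesis unfolding g\<psi> \<psi>_def E_def by (simp add: out)
      qed
    qed
    show "AE x in ?U. norm (E u g (\<psi> k) x) \<le> ?w x" for k
      using gq'(2) A_bound
    proof eventually_elim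
      case (elim x)
      have CB: "0 \<le> Mx" using m by linarith
      show ?case
      proof (cases "x \<in> K")
        case True
        have "norm (grad (q k) x) \<le> h x" using elim(1) True by blast
        also have "h x \<le> norm (h' x)" using True by (simp add: h'_def)
        finally have hx: "norm (grad (q k) x) \<le> norm (h' x)" .
        have \<rho>x: "\<bar>\<rho> x\<bar> \<le> Mx" using \<rho>_bounds[of x] m K(2) True by auto
        have g\<psi>x: "norm (grad (\<psi> k) x) \<le> (B * (1 / m\<^sup>2)) * norm (h' x) + (1 / m) * B"
          unfolding g\<psi>
        proof (rule order_trans[OF norm_triangle_ineq], unfold norm_scaleR, intro add_mono)
          have "\<bar>\<phi> x * - (1 / (q k x)\<^sup>2)\<bar> = \<bar>\<phi> x\<bar> * \<bar>1 / (q k x)\<^sup>2\<bar>" by (simp add: abs_mult)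
          also have "\<dots> \<le> B * (1 / m\<^sup>2)" by (intro mult_mono B iq True) (use B in auto)
          finally show "\<bar>\<phi> x * - (1 / (q k x)\<^sup>2)\<bar> * norm (grad (q k) x) \<le> B * (1 / m\<^sup>2) * norm (h' x)"
            by (intro mult_mono hx) (use B in auto)
          show "\<bar>1 / q k x\<bar> * norm (grad \<phi> x) \<le> 1 / m * B" by (intro mult_mono B iq True) (use m in auto)
        qed
        have "\<bar>(A x *v g x) \<bullet> grad (\<psi> k) x\<bar> \<le> (C\<^sub>A * norm (g x)) * ((B * (1 / m\<^sup>2)) * norm (h' x) + (1 / m) * B)"
          by (rule order_trans[OF Cauchy_Schwarz_ineq2], intro mult_mono g\<psi>x) (use elim(2) C_A_nonneg in auto)
        then have "\<bar>\<rho> x * ((A x *v g x) \<bullet> grad (\<psi> k) x)\<bar> \<le> Mx * ((C\<^sub>A * norm (g x)) * ((B * (1 / m\<^sup>2)) * norm (h' x) + (1 / m) * B))"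
          unfolding abs_mult by (intro mult_mono \<rho>x) (use CB in auto)
        moreover have "\<bar>(F x \<bullet> g x) * \<psi> k x\<bar> \<le> (norm (F x) * norm (g x)) * (B * (1 / m))"
          unfolding abs_mult by (intro mult_mono Cauchy_Schwarz_ineq2 \<psi>b) auto
        moreover have "\<bar>c x * u x * (\<rho> x * \<psi> k x)\<bar> \<le> \<bar>c x * u x\<bar> * (Mx * (B * (1 / m)))"
          unfolding abs_mult[of "c x * u x"] abs_mult[of "\<rho> x"] by (intro mult_left_mono mult_mono \<psi>b \<rho>x) (use CB in auto)
        ultimately have "norm (E u g (\<psi> k) x) \<le> Mx * ((C\<^sub>A * norm (g x)) * ((B * (1 / m\<^sup>2)) * norm (h' x) + (1 / m) * B))
          + (norm (F x) * norm (g x)) * (B * (1 / m)) + \<bar>c x * u x\<bar> * (Mx * (B * (1 / m)))"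
          unfolding E_def real_norm_def by linarith
        also have "\<dots> = ?w x" by (simp add: algebra_simps)
        finally show ?thesis .
      next
        case False
        have "0 \<le> ?w x" using B C_A_nonneg CB m by (intro add_nonneg_nonneg mult_nonneg_nonneg) auto
        then show ?thesis unfolding E_def g\<psi> \<psi>_def by (simp add: out[OF False])
      qed
    qed
  qed
  have lim2: "(\<lambda>k. \<integral>x. f x * (\<rho> x * \<psi> k x) \<partial>?U) \<longlonglongrightarrow> (\<integral>x. f x * \<phi> x \<partial>?U)"
  proof (rule integral_dominated_convergence[where w="\<lambda>x. \<bar>f x\<bar> * (Mx * (B * (1 / m)))"])
    note [measurable] = borel_measurable_integrable[OF f] test_fun_measurable[OF \<psi>]
    show "(\<lambda>x. f x * \<phi> x) \<in> borel_measurable ?U" "(\<lambda>x. f x * (\<rho> x * \<psi> k x)) \<in> borel_measurable ?U" for k by measurable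
    show "integrable ?U (\<lambda>x. \<bar>f x\<bar> * (Mx * (B * (1 / m))))" by (intro integrable_mult_left integrable_abs[OF f])
    show "AE x in ?U. (\<lambda>k. f x * (\<rho> x * \<psi> k x)) \<longlonglongrightarrow> f x * \<phi> x"
    proof (rule AE_I2)
      fix x
      show "(\<lambda>k. f x * (\<rho> x * \<psi> k x)) \<longlonglongrightarrow> f x * \<phi> x"
      proof (cases "x \<in> K")
        case True
        have \<rho>p: "\<rho> x > 0" using \<rho>_bounds[of x] m K(2) True by auto
        have "(\<lambda>k. f x * (\<rho> x * \<psi> k x)) \<longlonglongrightarrow> f x * (\<rho> x * (\<phi> x * (1 / \<rho> x)))"
          unfolding \<psi>_def using \<rho>p by (intro tendsto_intros q(4) True) auto
        then show ?thesis using \<rho>p by simp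
      qed (simp add: \<psi>_def out)
    qed
    show "AE x in ?U. norm (f x * (\<rho> x * \<psi> k x)) \<le> \<bar>f x\<bar> * (Mx * (B * (1 / m)))" for k
    proof (rule AE_I2)
      fix x assume "x \<in> space ?U"
      then have "\<bar>\<rho> x\<bar> \<le> Mx" using \<rho>_bounds[of x] m by auto
      then show "norm (f x * (\<rho> x * \<psi> k x)) \<le> \<bar>f x\<bar> * (Mx * (B * (1 / m)))"
        unfolding real_norm_def abs_mult by (intro mult_left_mono mult_mono \<psi>b) (use m in auto)
    qed
  qed
  show ?thesis unfolding bform_def using LIMSEQ_unique[OF lim] lim2 weak[OF \<psi>] by simp
qed

end

section \<open>The energy inequality\<close>

lemma integral_Holder:
  fixes g :: "'i \<Rightarrow> 'a \<Rightarrow> real"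
  assumes I: "finite I" "I \<noteq> {}" and a: "\<And>i. i \<in> I \<Longrightarrow> 0 < a i" "(\<Sum>i\<in>I. a i) = 1"
    and g: "\<And>i. i \<in> I \<Longrightarrow> integrable M (g i)" "\<And>i x. i \<in> I \<Longrightarrow> 0 \<le> g i x"
  shows "integrable M (\<lambda>x. \<Prod>i\<in>I. g i x powr a i)"
    "(\<integral>x. (\<Prod>i\<in>I. g i x powr a i) \<partial>M) \<le> (\<Prod>i\<in>I. (\<integral>x. g i x \<partial>M) powr a i)"
proof -
  have gm: "g i \<in> borel_measurable M" if "i \<in> I" for i using g(1)[OF that] by auto
  have m: "(\<lambda>x. \<Prod>i\<in>I. g i x powr a i) \<in> borel_measurable M"
    using gm by (intro borel_measurable_prod powr_real_measurable) auto
  have nn: "0 \<le> (\<Prod>i\<in>I. g i x powr a i)" for x by (intro prod_nonneg) auto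
  have int0: "0 \<le> (\<integral>x. g i x \<partial>M)" if "i \<in> I" for i using g(2)[OF that] by (intro integral_nonneg_AE) auto
  have "(\<integral>\<^sup>+x. ennreal (\<Prod>i\<in>I. g i x powr a i) \<partial>M) = (\<integral>\<^sup>+x. (\<Prod>i\<in>I. epow (ennreal (g i x)) (a i)) \<partial>M)"
  proof (rule nn_integral_cong)
    fix x
    have "(\<Prod>i\<in>I. epow (ennreal (g i x)) (a i)) = (\<Prod>i\<in>I. ennreal (g i x powr a i))"
      using g(2) by (intro prod.cong) auto
    also have "\<dots> = ennreal (\<Prod>i\<in>I. g i x powr a i)" by (intro prod_ennreal) auto
    finally show "ennreal (\<Prod>i\<in>I. g i x powr a i) = (\<Prod>i\<in>I. epow (ennreal (g i x)) (a i))" ..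
  qed
  also have "\<dots> \<le> (\<Prod>i\<in>I. epow (\<integral>\<^sup>+x. ennreal (g i x) \<partial>M) (a i))"
    using gm by (intro nn_integral_Holder I a) auto
  also have "\<dots> = (\<Prod>i\<in>I. ennreal ((\<integral>x. g i x \<partial>M) powr a i))"
  proof (rule prod.cong[OF refl])
    fix i assume i: "i \<in> I"
    have "(\<integral>\<^sup>+x. ennreal (g i x) \<partial>M) = ennreal (\<integral>x. g i x \<partial>M)" using g i by (intro nn_integral_eq_integral) auto
    then show "epow (\<integral>\<^sup>+x. ennreal (g i x) \<partial>M) (a i) = ennreal ((\<integral>x. g i x \<partial>M) powr a i)" using int0[OF i] by simp
  qed
  also have "\<dots> = ennreal (\<Prod>i\<in>I. (\<integral>x. g i x \<partial>M) powr a i)" by (intro prod_ennreal) auto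
  finally have le: "(\<integral>\<^sup>+x. ennreal (\<Prod>i\<in>I. g i x powr a i) \<partial>M) \<le> ennreal (\<Prod>i\<in>I. (\<integral>x. g i x \<partial>M) powr a i)" .
  show i: "integrable M (\<lambda>x. \<Prod>i\<in>I. g i x powr a i)"
  proof (rule integrableI_nonneg[OF m])
    show "(\<integral>\<^sup>+x. ennreal (\<Prod>i\<in>I. g i x powr a i) \<partial>M) < \<infinity>" using le by (rule order_le_less_trans) simp
  qed (use nn in auto)
  have "(\<integral>\<^sup>+x. ennreal (\<Prod>i\<in>I. g i x powr a i) \<partial>M) = ennreal (\<integral>x. (\<Prod>i\<in>I. g i x powr a i) \<partial>M)"
    using i nn by (intro nn_integral_eq_integral) auto
  with le show "(\<integral>x. (\<Prod>i\<in>I. g i x powr a i) \<partial>M) \<le> (\<Prod>i\<in>I. (\<integral>x. g i x \<partial>M) powr a i)"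
    by (simp add: ennreal_le_iff prod_nonneg)
qed

lemma integral_Holder2:
  fixes f g :: "'a \<Rightarrow> real"
  assumes pq: "1 < p" "1 < q" "1 / p + 1 / q = 1" and m: "f \<in> borel_measurable M" "g \<in> borel_measurable M"
    and i: "integrable M (\<lambda>x. \<bar>f x\<bar> powr p)" "integrable M (\<lambda>x. \<bar>g x\<bar> powr q)"
  shows "integrable M (\<lambda>x. f x * g x)"
    "(\<integral>x. \<bar>f x * g x\<bar> \<partial>M) \<le> (\<integral>x. \<bar>f x\<bar> powr p \<partial>M) powr (1 / p) * (\<integral>x. \<bar>g x\<bar> powr q \<partial>M) powr (1 / q)"
proof -
  let ?a = "\<lambda>b. if b then 1 / p else 1 / q" and ?g = "\<lambda>b x. if b then \<bar>f x\<bar> powr p else \<bar>g x\<bar> powr q"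
  have eq: "(\<Prod>b\<in>UNIV. ?g b x powr ?a b) = \<bar>f x * g x\<bar>" for x
    using pq by (simp add: UNIV_bool powr_powr abs_mult mult.commute)
  have *: "integrable M (\<lambda>x. \<Prod>b\<in>UNIV. ?g b x powr ?a b)"
    "(\<integral>x. (\<Prod>b\<in>UNIV. ?g b x powr ?a b) \<partial>M) \<le> (\<Prod>b\<in>UNIV. (\<integral>x. ?g b x \<partial>M) powr ?a b)"
  proof -
    have a: "0 < ?a b" for b using pq by simp
    have s1: "(\<Sum>b\<in>UNIV. ?a b) = 1" using pq by (simp add: UNIV_bool add.commute)
    have ig: "integrable M (?g b)" for b by (cases b) (use i in simp_all)
    have g0: "0 \<le> ?g b x" for b x by simp
    show "integrable M (\<lambda>x. \<Prod>b\<in>UNIV. ?g b x powr ?a b)"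
      "(\<integral>x. (\<Prod>b\<in>UNIV. ?g b x powr ?a b) \<partial>M) \<le> (\<Prod>b\<in>UNIV. (\<integral>x. ?g b x \<partial>M) powr ?a b)"
      by (rule integral_Holder[where g="?g" and a="?a", OF finite UNIV_not_empty a s1 ig g0])+
  qed
  show "(\<integral>x. \<bar>f x * g x\<bar> \<partial>M) \<le> (\<integral>x. \<bar>f x\<bar> powr p \<partial>M) powr (1 / p) * (\<integral>x. \<bar>g x\<bar> powr q \<partial>M) powr (1 / q)"
    using *(2) unfolding eq by (simp add: UNIV_bool mult.commute)
  have "integrable M (\<lambda>x. \<bar>f x * g x\<bar>)" using *(1) unfolding eq .
  then show "integrable M (\<lambda>x. f x * g x)" using m by (simp add: integrable_abs_iff)
qed

text \<open>Provides the primitive of a truncation, with value zero at zero so that composing it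
  with a test function keeps the support compact.\<close>

lemma exists_antiderivative:
  fixes f :: "real \<Rightarrow> real"
  assumes "continuous_on UNIV f"
  obtains P where "\<And>s. (P has_real_derivative f s) (at s)" "P 0 = 0"
proof -
  define P where "P s = (LBINT y=0..s. f y)" for s :: real
  have "(P has_real_derivative f s) (at s)" for s
  proof -
    \<comment> \<open>The margin of one puts \<open>s\<close> into the interior of the interval,
      where the one-sided derivative of the fundamental theorem becomes two-sided.\<close>
    define a b where "a = min 0 s - 1" and "b = max 0 s + 1"
    have ab: "a \<le> 0" "0 \<le> b" "a < s" "s < b" by (auto simp: a_def b_def)
    have "((\<lambda>u. LBINT y=0..u. f y) has_vector_derivative f s) (at s within {a..b})"
      using interval_integral_FTC2[of a 0 b f s] ab continuous_on_subset[OF assms] by (simp add: zero_ereal_def)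
    then have "((\<lambda>u. LBINT y=0..u. f y) has_vector_derivative f s) (at s)"
      using ab by (subst (asm) at_within_interior) auto
    then show ?thesis unfolding P_def[abs_def] by (simp add: has_real_derivative_iff_has_vector_derivative)
  qed
  moreover have "P 0 = 0" by (simp add: P_def zero_ereal_def[symmetric])
  ultimately show ?thesis using that by blast
qed

lemma L2_pair:
  fixes f :: "'a \<Rightarrow> 'b::euclidean_space" and g :: "'a \<Rightarrow> 'c::euclidean_space"
  assumes "L2 M f" "L2 M g"
  shows "L2 M (\<lambda>x. (f x, g x))"
  using assms by (auto simp: L2_def norm_Pair)

lemma H012_L2:
  assumes "H012 U u g"
  shows "L2 (lebesgue_on U) u" "L2 (lebesgue_on U) g"
  using assms by (auto simp: H012_def H12_def Lp_def LpV_def L2_def)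

section \<open>Testing the weighted equation with truncations of the solution\<close>

context elliptic begin

lemma L2_bounded:
  fixes f :: "real^'n \<Rightarrow> 'b::euclidean_space"
  assumes "f \<in> borel_measurable (lebesgue_on U)" "\<And>x. norm (f x) \<le> B"
  shows "L2 (lebesgue_on U) f"
proof -
  interpret finite_measure "lebesgue_on U" by (rule finite_measure_U)
  have "norm (f x) \<le> norm B" for x using assms(2)[of x] by simp
  then have "AE x in lebesgue_on U. norm (f x) \<le> norm B" by simp
  moreover have "L2 (lebesgue_on U) (\<lambda>x. B)" by (simp add: L2_def)
  ultimately show ?thesis using L2_bound[of _ "\<lambda>x. B"] assms(1) by blast
qed

lemma L2_test_fun:
  assumes "test_fun U \<phi>"
  shows "L2 (lebesgue_on U) \<phi>" "L2 (lebesgue_on U) (grad \<phi>)"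
proof -
  obtain B where "B > 0" "\<And>x. \<bar>\<phi> x\<bar> \<le> B" "\<And>x. norm (grad \<phi> x) \<le> B" using test_fun_bounded[OF assms] by metis
  then show "L2 (lebesgue_on U) \<phi>" "L2 (lebesgue_on U) (grad \<phi>)"
    by (simp_all add: L2_bounded[where B=B] test_fun_measurable[OF assms])
qed

text \<open>Value and gradient are treated as one pair-valued L^2 function, so a single subsequence
  and a single majorant serve both.\<close>

lemma H012_dominated:
  assumes H: "H012 U u g"
  obtains \<phi> h where "\<And>k::nat. test_fun U (\<phi> k)" "L2 (lebesgue_on U) (h :: real^'n \<Rightarrow> real)"
    "AE x in lebesgue_on U. (\<lambda>k. \<phi> k x) \<longlonglongrightarrow> u x" "AE x in lebesgue_on U. (\<lambda>k. grad (\<phi> k) x) \<longlonglongrightarrow> g x"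
    "AE x in lebesgue_on U. \<forall>k. norm (grad (\<phi> k) x) \<le> h x"
proof -
  let ?U = "lebesgue_on U"
  obtain \<phi> where \<phi>: "\<And>k::nat. test_fun U (\<phi> k)" "(\<lambda>k. \<integral>x. (\<phi> k x - u x)\<^sup>2 \<partial>?U) \<longlonglongrightarrow> 0"
    "(\<lambda>k. \<integral>x. (norm (grad (\<phi> k) x - g x))\<^sup>2 \<partial>?U) \<longlonglongrightarrow> 0"
    using H unfolding H012_def by blast
  note ug = H012_L2[OF H]
  have eq: "(\<integral>x. (norm ((\<phi> k x, grad (\<phi> k) x) - (u x, g x)))\<^sup>2 \<partial>?U) = (\<integral>x. (\<phi> k x - u x)\<^sup>2 \<partial>?U) + (\<integral>x. (norm (grad (\<phi> k) x - g x))\<^sup>2 \<partial>?U)" for k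
    using L2_integrable[OF L2_diff[OF L2_test_fun(1)[OF \<phi>(1)] ug(1)]] L2_integrable[OF L2_diff[OF L2_test_fun(2)[OF \<phi>(1)] ug(2)]]
    by (simp add: norm_Pair)
  have lim: "(\<lambda>k. \<integral>x. (norm ((\<phi> k x, grad (\<phi> k) x) - (u x, g x)))\<^sup>2 \<partial>?U) \<longlonglongrightarrow> 0"
    unfolding eq using tendsto_add[OF \<phi>(2,3)] by simp
  obtain r h where r: "strict_mono (r :: nat \<Rightarrow> nat)" "L2 ?U (h :: real^'n \<Rightarrow> real)"
    "AE x in ?U. (\<lambda>k. (\<phi> (r k) x, grad (\<phi> (r k)) x)) \<longlonglongrightarrow> (u x, g x)" "AE x in ?U. \<forall>k. norm (\<phi> (r k) x, grad (\<phi> (r k)) x) \<le> h x"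
    by (rule L2_dominated_subsequence[OF L2_pair[OF L2_test_fun[OF \<phi>(1)]] L2_pair[OF ug] lim]) (rule that; assumption)
  show ?thesis
  proof (rule that[of "\<lambda>k. \<phi> (r k)" h])
    show "AE x in ?U. (\<lambda>k. \<phi> (r k) x) \<longlonglongrightarrow> u x" using r(3) by eventually_elim (drule tendsto_fst, simp)
    show "AE x in ?U. (\<lambda>k. grad (\<phi> (r k)) x) \<longlonglongrightarrow> g x" using r(3) by eventually_elim (drule tendsto_snd, simp)
    show "AE x in ?U. \<forall>k. norm (grad (\<phi> (r k)) x) \<le> h x"
      using r(4)
    proof eventually_elim
      case (elim x)
      show ?case
      proof
        fix k
        have "norm (grad (\<phi> (r k)) x) \<le> norm (\<phi> (r k) x, grad (\<phi> (r k)) x)"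
          by (rule norm_snd_le)
        then show "norm (grad (\<phi> (r k)) x) \<le> h x" using elim order_trans by blast
      qed
    qed
  qed (use \<phi> r in auto)
qed

text \<open>\<open>D 0\<close> is the truncation. The equation is tested with \<open>D 0\<close> of
  the approximating test functions and passed to the limit: the drift vanishes, the potential term
  has the good sign because \<open>s * D 0 s\<close> and \<open>c\<close> are nonnegative, and
  ellipticity bounds the integral of \<open>D 1 (u x)\<close> times the squared gradient. The
  Sobolev inequality for the truncated function completes the estimate.\<close>

lemma energy_inequality:
  assumes H: "H012 U u g" and cu: "integrable (lebesgue_on U) (\<lambda>x. c x * u x)"
    and f: "integrable (lebesgue_on U) f"
    and weak: "\<And>\<psi>. test_fun U \<psi> \<Longrightarrow> (\<integral>x. E u g \<psi> x \<partial>lebesgue_on U) = (\<integral>x. f x * (\<rho> x * \<psi> x) \<partial>lebesgue_on U)"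
    and D: "\<And>k s. (D k has_real_derivative D (Suc k) s) (at s)" "D 0 0 = 0"
    and D1: "\<And>s. 0 \<le> D 1 s \<and> D 1 s \<le> 1" and D0: "\<And>s. \<bar>D 0 s\<bar> \<le> N" "\<And>s. 0 \<le> s * D 0 s"
  defines "q \<equiv> 2 * real CARD('n) / (real CARD('n) - 2)" and "\<gamma> \<equiv> 2 * (real CARD('n) - 1) / (real CARD('n) - 2)"
  shows "((\<integral>x. \<bar>D 0 (u x)\<bar> powr q \<partial>lebesgue_on U) powr (1 / q))\<^sup>2
     \<le> \<gamma>\<^sup>2 * (Mx / (m * lam)) * (\<integral>x. \<bar>f x\<bar> * \<bar>D 0 (u x)\<bar> \<partial>lebesgue_on U)"
proof -
  let ?U = "lebesgue_on U"
  interpret U: finite_measure ?U by (rule finite_measure_U)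
  obtain \<phi> h where \<phi>: "\<And>k::nat. test_fun U (\<phi> k)" and h: "L2 ?U (h :: real^'n \<Rightarrow> real)"
    and lim_\<phi>: "AE x in ?U. (\<lambda>k. \<phi> k x) \<longlonglongrightarrow> u x" "AE x in ?U. (\<lambda>k. grad (\<phi> k) x) \<longlonglongrightarrow> g x"
    and dom: "AE x in ?U. \<forall>k. norm (grad (\<phi> k) x) \<le> h x"
    by (rule H012_dominated[OF H]) blast
  note u = H012_L2(1)[OF H] and g = H012_L2(2)[OF H]
  have Dc: "isCont (D k) s" for k s by (rule DERIV_isCont[OF D(1)])
  have Dcont: "continuous_on UNIV (D k)" for k using Dc by (simp add: continuous_on_eq_continuous_at)
  have Dm: "D k \<in> borel_measurable borel" for k by (rule borel_measurable_continuous_onI[OF Dcont])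
  have N: "0 \<le> N" using D0(1)[of 0] by linarith
  have Mx: "0 < Mx" using m by linarith
  have Du: "(\<lambda>x. D k (u x)) \<in> borel_measurable ?U" for k by (rule measurable_compose[OF L2_measurable[OF u] Dm])
  define T where "T k x = D 0 (\<phi> k x)" for k x
  have T: "test_fun U (T k)" for k unfolding T_def[abs_def] by (rule test_fun_comp[OF \<phi> D])
  have gT: "grad (T k) x = D 1 (\<phi> k x) *\<^sub>R grad (\<phi> k) x" for k x
    unfolding T_def[abs_def] using grad_comp[OF D(1) test_funD(2)[OF \<phi>]] by simp
  have Tb: "\<bar>T k x\<bar> \<le> N" for k x unfolding T_def by (rule D0)
  have D1b: "\<bar>D 1 s\<bar> \<le> 1" for s using D1[of s] by simp
  have \<rho>b: "AE x in ?U. 0 < \<rho> x \<and> \<rho> x \<le> Mx"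
  proof (rule AE_I2)
    fix x assume "x \<in> space ?U"
    then have "m \<le> \<rho> x \<and> \<rho> x \<le> Mx" using \<rho>_bounds[of x] by simp
    then show "0 < \<rho> x \<and> \<rho> x \<le> Mx" using m(1) by linarith
  qed
  obtain P where P: "\<And>s. (P has_real_derivative D 0 s) (at s)" "P 0 = 0" by (rule exists_antiderivative[OF Dcont]) blast
  \<comment> \<open>Prepending the primitive \<open>P\<close> to the sequence \<open>D\<close> gives
    the sequence of derivatives of \<open>P\<close>.\<close>
  have D': "(case_nat P D k has_real_derivative case_nat P D (Suc k) s) (at s)" for k s
    using P(1) D(1) by (cases k) auto
  have "case_nat P D 0 0 = 0" by (simp add: P(2))
  from test_fun_comp[where D="case_nat P D", OF \<phi> D' this]
  have "test_fun U (\<lambda>x. P (\<phi> k x))" for k by simp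
  moreover have "grad (\<lambda>x. P (\<phi> k x)) x = T k x *\<^sub>R grad (\<phi> k) x" for k x
    unfolding T_def using grad_comp[OF P(1) test_funD(2)[OF \<phi>]] .
  ultimately have drift0: "(\<integral>x. F x \<bullet> (T k x *\<^sub>R grad (\<phi> k) x) \<partial>?U) = 0" for k
    using div_free[of "\<lambda>x. P (\<phi> k x)"] unfolding F_def by simp
  note [measurable] = \<rho>_measurable L2_measurable[OF g] borel_measurable_integrable[OF cu] L2_measurable[OF L2_F]
    measurable_matrix_vector_mult[OF A_measurable L2_measurable[OF g]] Du borel_measurable_integrable[OF f]
  \<comment> \<open>The integral is zero for each approximating test function; boundedness of the
    truncation keeps the integrands below a product of two L^2 functions, so zero persists in the
    limit.\<close>
  have drift: "(\<integral>x. (F x \<bullet> g x) * D 0 (u x) \<partial>?U) = 0"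
  proof -
    have "(\<lambda>k. \<integral>x. F x \<bullet> (T k x *\<^sub>R grad (\<phi> k) x) \<partial>?U) \<longlonglongrightarrow> (\<integral>x. (F x \<bullet> g x) * D 0 (u x) \<partial>?U)"
    proof (rule integral_dominated_convergence[where w="\<lambda>x. N * (norm (F x) * norm (h x))"])
      show "(\<lambda>x. (F x \<bullet> g x) * D 0 (u x)) \<in> borel_measurable ?U" by measurable
      show "(\<lambda>x. F x \<bullet> (T k x *\<^sub>R grad (\<phi> k) x)) \<in> borel_measurable ?U" for k
      proof -
        note [measurable] = test_fun_measurable[OF \<phi>] test_fun_measurable[OF T]
        show ?thesis by measurable
      qed
      show "integrable ?U (\<lambda>x. N * (norm (F x) * norm (h x)))" by (intro integrable_mult_right L2_norm_mult_integrable L2_F h)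
      show "AE x in ?U. (\<lambda>k. F x \<bullet> (T k x *\<^sub>R grad (\<phi> k) x)) \<longlonglongrightarrow> (F x \<bullet> g x) * D 0 (u x)"
        using lim_\<phi>
      proof eventually_elim
        case (elim x)
        have "(\<lambda>k. F x \<bullet> (T k x *\<^sub>R grad (\<phi> k) x)) \<longlonglongrightarrow> F x \<bullet> (D 0 (u x) *\<^sub>R g x)"
          unfolding T_def using elim by (intro tendsto_intros isCont_tendsto_compose[OF Dc])
        then show ?case by (simp add: mult.commute)
      qed
      show "AE x in ?U. norm (F x \<bullet> (T k x *\<^sub>R grad (\<phi> k) x)) \<le> N * (norm (F x) * norm (h x))" for k
        using dom
      proof eventually_elim
        case (elim x)
        have "norm (F x \<bullet> (T k x *\<^sub>R grad (\<phi> k) x)) = \<bar>T k x\<bar> * \<bar>F x \<bullet> grad (\<phi> k) x\<bar>" by (simp add: abs_mult)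
        also have "\<dots> \<le> N * (norm (F x) * norm (grad (\<phi> k) x))" by (intro mult_mono Tb Cauchy_Schwarz_ineq2 N) auto
        also have "\<dots> \<le> N * (norm (F x) * norm (h x))" using elim[rule_format, of k] by (intro mult_left_mono N) auto
        finally show ?case .
      qed
    qed
    then show ?thesis unfolding drift0 using LIMSEQ_unique tendsto_const by blast
  qed
  let ?E = "\<lambda>x. \<rho> x * (D 1 (u x) * ((A x *v g x) \<bullet> g x)) + (F x \<bullet> g x) * D 0 (u x) + c x * u x * (\<rho> x * D 0 (u x))"
  have limE: "(\<lambda>k. \<integral>x. E u g (T k) x \<partial>?U) \<longlonglongrightarrow> (\<integral>x. ?E x \<partial>?U)"
  proof (rule integral_dominated_convergence[where w="\<lambda>x. Mx * C\<^sub>A * (norm (g x) * norm (h x)) + N * (norm (F x) * norm (g x)) + Mx * N * \<bar>c x * u x\<bar>"])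
    show "?E \<in> borel_measurable ?U" by measurable
    show "E u g (T k) \<in> borel_measurable ?U" for k by (rule E_measurable[OF _ _ T]) measurable
    show "integrable ?U (\<lambda>x. Mx * C\<^sub>A * (norm (g x) * norm (h x)) + N * (norm (F x) * norm (g x)) + Mx * N * \<bar>c x * u x\<bar>)"
      by (intro Bochner_Integration.integrable_add integrable_mult_right L2_norm_mult_integrable L2_F h g integrable_abs[OF cu])
    show "AE x in ?U. (\<lambda>k. E u g (T k) x) \<longlonglongrightarrow> ?E x"
      using lim_\<phi>
    proof eventually_elim
      case (elim x)
      have "(\<lambda>k. E u g (T k) x) \<longlonglongrightarrow> \<rho> x * ((A x *v g x) \<bullet> (D 1 (u x) *\<^sub>R g x)) + (F x \<bullet> g x) * D 0 (u x) + c x * u x * (\<rho> x * D 0 (u x))"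
        unfolding E_def gT unfolding T_def using elim by (intro tendsto_intros isCont_tendsto_compose[OF Dc])
      then show ?case by simp
    qed
    show "AE x in ?U. norm (E u g (T k) x) \<le> Mx * C\<^sub>A * (norm (g x) * norm (h x)) + N * (norm (F x) * norm (g x)) + Mx * N * \<bar>c x * u x\<bar>" for k
      using dom A_bound \<rho>b
    proof eventually_elim
      case (elim x)
      have "norm (grad (T k) x) \<le> norm (h x)"
      proof -
        have "norm (grad (T k) x) \<le> 1 * norm (grad (\<phi> k) x)" unfolding gT norm_scaleR by (intro mult_right_mono D1b) auto
        then show ?thesis using elim(1)[rule_format, of k] by simp
      qed
      then have "\<bar>(A x *v g x) \<bullet> grad (T k) x\<bar> \<le> (C\<^sub>A * norm (g x)) * norm (h x)"
        by (intro order_trans[OF Cauchy_Schwarz_ineq2] mult_mono) (use elim(2) C_A_nonneg in auto)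
      then have "\<bar>\<rho> x * ((A x *v g x) \<bullet> grad (T k) x)\<bar> \<le> Mx * ((C\<^sub>A * norm (g x)) * norm (h x))"
        unfolding abs_mult using elim(3) by (intro mult_mono) auto
      moreover have "\<bar>(F x \<bullet> g x) * T k x\<bar> \<le> (norm (F x) * norm (g x)) * N"
        unfolding abs_mult by (intro mult_mono Cauchy_Schwarz_ineq2 Tb) auto
      moreover have "\<bar>c x * u x * (\<rho> x * T k x)\<bar> \<le> \<bar>c x * u x\<bar> * (Mx * N)"
        unfolding abs_mult[of "c x * u x"] abs_mult[of "\<rho> x"] using elim(3) by (intro mult_left_mono mult_mono Tb) auto
      ultimately have "norm (E u g (T k) x) \<le> Mx * ((C\<^sub>A * norm (g x)) * norm (h x)) + (norm (F x) * norm (g x)) * N + \<bar>c x * u x\<bar> * (Mx * N)"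
        unfolding E_def real_norm_def by linarith
      then show ?case by (simp only: ac_simps)
    qed
  qed
  have limf: "(\<lambda>k. \<integral>x. f x * (\<rho> x * T k x) \<partial>?U) \<longlonglongrightarrow> (\<integral>x. f x * (\<rho> x * D 0 (u x)) \<partial>?U)"
  proof (rule integral_dominated_convergence[where w="\<lambda>x. (Mx * N) * \<bar>f x\<bar>"])
    show "(\<lambda>x. f x * (\<rho> x * D 0 (u x))) \<in> borel_measurable ?U" by measurable
    show "(\<lambda>x. f x * (\<rho> x * T k x)) \<in> borel_measurable ?U" for k
      using test_fun_measurable(1)[OF T] by measurable
    show "integrable ?U (\<lambda>x. (Mx * N) * \<bar>f x\<bar>)" by (intro integrable_mult_right integrable_abs[OF f])
    show "AE x in ?U. (\<lambda>k. f x * (\<rho> x * T k x)) \<longlonglongrightarrow> f x * (\<rho> x * D 0 (u x))"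
      using lim_\<phi>(1) by eventually_elim (unfold T_def, intro tendsto_intros isCont_tendsto_compose[OF Dc])
    show "AE x in ?U. norm (f x * (\<rho> x * T k x)) \<le> (Mx * N) * \<bar>f x\<bar>" for k
      using \<rho>b
    proof eventually_elim
      case (elim x)
      have "\<bar>\<rho> x\<bar> * \<bar>T k x\<bar> \<le> Mx * N" using elim by (intro mult_mono Tb) auto
      then show ?case unfolding real_norm_def abs_mult by (subst mult.commute, intro mult_right_mono) auto
    qed
  qed
  let ?D = "\<integral>x. D 1 (u x) * (norm (g x))\<^sup>2 \<partial>?U" and ?R = "\<integral>x. \<bar>f x\<bar> * \<bar>D 0 (u x)\<bar> \<partial>?U"
  have iD: "integrable ?U (\<lambda>x. D 1 (u x) * (norm (g x))\<^sup>2)"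
  proof (rule Bochner_Integration.integrable_bound[OF L2_integrable[OF g]])
    show "AE x in ?U. norm (D 1 (u x) * (norm (g x))\<^sup>2) \<le> norm ((norm (g x))\<^sup>2)"
      using D1 by (intro AE_I2) (auto simp: abs_mult intro!: mult_left_le_one_le)
  qed measurable
  have iF: "integrable ?U (\<lambda>x. (F x \<bullet> g x) * D 0 (u x))"
  proof (rule Bochner_Integration.integrable_bound[OF integrable_mult_left[OF L2_inner_integrable[OF L2_F g], of N]])
    show "AE x in ?U. norm ((F x \<bullet> g x) * D 0 (u x)) \<le> norm ((F x \<bullet> g x) * N)"
      using D0(1) N by (intro AE_I2) (auto simp: abs_mult intro!: mult_left_mono)
  qed measurable
  have iA: "integrable ?U (\<lambda>x. \<rho> x * (D 1 (u x) * ((A x *v g x) \<bullet> g x)))"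
  proof (rule Bochner_Integration.integrable_bound[OF integrable_mult_right[OF L2_inner_integrable[OF L2_A[OF g] g], of Mx]])
    show "AE x in ?U. norm (\<rho> x * (D 1 (u x) * ((A x *v g x) \<bullet> g x))) \<le> norm (Mx * ((A x *v g x) \<bullet> g x))"
      using \<rho>b
    proof eventually_elim
      case (elim x)
      have "\<bar>D 1 (u x)\<bar> * \<bar>(A x *v g x) \<bullet> g x\<bar> \<le> 1 * \<bar>(A x *v g x) \<bullet> g x\<bar>" by (intro mult_right_mono D1b) auto
      then show ?case unfolding real_norm_def abs_mult using elim by (intro mult_mono) auto
    qed
  qed measurable
  have ic: "integrable ?U (\<lambda>x. c x * u x * (\<rho> x * D 0 (u x)))"
  proof (rule Bochner_Integration.integrable_bound[OF integrable_mult_left[OF cu, of "Mx * N"]])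
    show "AE x in ?U. norm (c x * u x * (\<rho> x * D 0 (u x))) \<le> norm (c x * u x * (Mx * N))"
      using \<rho>b
    proof eventually_elim
      case (elim x)
      then show ?case unfolding real_norm_def abs_mult using Mx N D0(1)[of "u x"] by (intro mult_mono) auto
    qed
  qed measurable
  have if_: "integrable ?U (\<lambda>x. \<bar>f x\<bar> * \<bar>D 0 (u x)\<bar>)"
  proof (rule Bochner_Integration.integrable_bound[OF integrable_mult_left[OF f, of N]])
    show "AE x in ?U. norm (\<bar>f x\<bar> * \<bar>D 0 (u x)\<bar>) \<le> norm (f x * N)"
      using D0(1) N by (intro AE_I2) (auto simp: abs_mult intro!: mult_left_mono)
  qed measurable
  have "(\<integral>x. ?E x \<partial>?U) = (\<integral>x. f x * (\<rho> x * D 0 (u x)) \<partial>?U)"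
    using LIMSEQ_unique[OF limE] limf unfolding weak[OF T] by blast
  moreover have "(\<integral>x. ?E x \<partial>?U) = (\<integral>x. \<rho> x * (D 1 (u x) * ((A x *v g x) \<bullet> g x)) \<partial>?U) + (\<integral>x. c x * u x * (\<rho> x * D 0 (u x)) \<partial>?U)"
    using iA iF ic drift by simp
  moreover have "0 \<le> (\<integral>x. c x * u x * (\<rho> x * D 0 (u x)) \<partial>?U)"
  proof (rule integral_nonneg_AE)
    show "AE x in ?U. 0 \<le> c x * u x * (\<rho> x * D 0 (u x))"
      using \<rho>b c(2)
    proof eventually_elim
      case (elim x)
      have "0 \<le> (c x * \<rho> x) * (u x * D 0 (u x))" 
        by (rule mult_nonneg_nonneg[OF mult_nonneg_nonneg D0(2)]) (use elim in auto)
      then show ?case by (simp only: ac_simps)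
    qed
  qed
  moreover have "(\<integral>x. f x * (\<rho> x * D 0 (u x)) \<partial>?U) \<le> Mx * ?R"
  proof -
    have "(\<integral>x. f x * (\<rho> x * D 0 (u x)) \<partial>?U) \<le> (\<integral>x. Mx * (\<bar>f x\<bar> * \<bar>D 0 (u x)\<bar>) \<partial>?U)"
    proof (rule integral_mono_AE')
      show "integrable ?U (\<lambda>x. Mx * (\<bar>f x\<bar> * \<bar>D 0 (u x)\<bar>))" by (intro integrable_mult_right if_)
      show "AE x in ?U. 0 \<le> Mx * (\<bar>f x\<bar> * \<bar>D 0 (u x)\<bar>)" using Mx by (intro AE_I2) auto
      show "AE x in ?U. f x * (\<rho> x * D 0 (u x)) \<le> Mx * (\<bar>f x\<bar> * \<bar>D 0 (u x)\<bar>)"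
        using \<rho>b
      proof eventually_elim
        case (elim x)
        have "f x * (\<rho> x * D 0 (u x)) \<le> \<bar>f x * (\<rho> x * D 0 (u x))\<bar>" by (rule abs_ge_self)
        also have "\<dots> = \<bar>\<rho> x\<bar> * (\<bar>f x\<bar> * \<bar>D 0 (u x)\<bar>)" by (simp only: abs_mult ac_simps)
        also have "\<dots> \<le> Mx * (\<bar>f x\<bar> * \<bar>D 0 (u x)\<bar>)" using elim by (intro mult_right_mono) auto
        finally show ?case .
      qed
    qed
    then show ?thesis by simp
  qed
  moreover have "m * lam * ?D \<le> (\<integral>x. \<rho> x * (D 1 (u x) * ((A x *v g x) \<bullet> g x)) \<partial>?U)"
  proof -
    have "(\<integral>x. m * lam * (D 1 (u x) * (norm (g x))\<^sup>2) \<partial>?U) \<le> (\<integral>x. \<rho> x * (D 1 (u x) * ((A x *v g x) \<bullet> g x)) \<partial>?U)"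
    proof (rule integral_mono_AE[OF integrable_mult_right[OF iD] iA])
      show "AE x in ?U. m * lam * (D 1 (u x) * (norm (g x))\<^sup>2) \<le> \<rho> x * (D 1 (u x) * ((A x *v g x) \<bullet> g x))"
        using A_elliptic AE_space
      proof eventually_elim
        case (elim x)
        have r: "m \<le> \<rho> x" using elim(2) \<rho>_bounds[of x] by simp
        have "lam * (D 1 (u x) * (norm (g x))\<^sup>2) = D 1 (u x) * (lam * (norm (g x))\<^sup>2)" by simp
        also have "\<dots> \<le> D 1 (u x) * ((A x *v g x) \<bullet> g x)" using elim(1) D1[of "u x"] by (intro mult_left_mono) auto
        finally have s: "lam * (D 1 (u x) * (norm (g x))\<^sup>2) \<le> D 1 (u x) * ((A x *v g x) \<bullet> g x)" .
        moreover have "0 \<le> lam * (D 1 (u x) * (norm (g x))\<^sup>2)" using D1[of "u x"] lam by (intro mult_nonneg_nonneg) auto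
        ultimately have "m * (lam * (D 1 (u x) * (norm (g x))\<^sup>2)) \<le> \<rho> x * (D 1 (u x) * ((A x *v g x) \<bullet> g x))"
          using r m by (intro mult_mono[OF r s]) auto
        then show ?case by (simp only: mult.assoc)
      qed
    qed
    then show ?thesis by simp
  qed
  ultimately have ineq: "m * lam * ?D \<le> Mx * ?R" by linarith
  have q1: "1 / q = (real CARD('n) - 2) / (2 * real CARD('n))" by (simp add: q_def)
  have sob: "(\<integral>x. \<bar>D 0 (u x)\<bar> powr q \<partial>?U) powr (1 / q) \<le> \<gamma> * sqrt (\<integral>x. (D 1 (u x))\<^sup>2 * (norm (g x))\<^sup>2 \<partial>?U)"
  proof (rule LIMSEQ_le)
    have q0: "q > 0" using dim by (simp add: q_def)
    have "(\<lambda>k. \<integral>x. \<bar>T k x\<bar> powr q \<partial>?U) \<longlonglongrightarrow> (\<integral>x. \<bar>D 0 (u x)\<bar> powr q \<partial>?U)"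
    proof (rule integral_dominated_convergence[where w="\<lambda>x. N powr q"])
      show "(\<lambda>x. \<bar>D 0 (u x)\<bar> powr q) \<in> borel_measurable ?U" by measurable
      show "(\<lambda>x. \<bar>T k x\<bar> powr q) \<in> borel_measurable ?U" for k using test_fun_measurable(1)[OF T] by measurable
      show "AE x in ?U. (\<lambda>k. \<bar>T k x\<bar> powr q) \<longlonglongrightarrow> \<bar>D 0 (u x)\<bar> powr q"
        using lim_\<phi>(1)
      proof eventually_elim
        case (elim x)
        have "(\<lambda>k. \<bar>T k x\<bar>) \<longlonglongrightarrow> \<bar>D 0 (u x)\<bar>" unfolding T_def using elim by (intro tendsto_intros isCont_tendsto_compose[OF Dc])
        then show ?case using q0 by (intro tendsto_powr2 tendsto_const) auto
      qed
      show "AE x in ?U. norm (\<bar>T k x\<bar> powr q) \<le> N powr q" for k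
        using Tb q0 by (intro AE_I2) (auto intro!: powr_mono2)
    qed simp
    then show "(\<lambda>k. (\<integral>x. \<bar>T k x\<bar> powr q \<partial>?U) powr (1 / q)) \<longlonglongrightarrow> (\<integral>x. \<bar>D 0 (u x)\<bar> powr q \<partial>?U) powr (1 / q)"
      using q0 by (intro tendsto_powr2 tendsto_const) auto
    have "(\<lambda>k. \<integral>x. (norm (grad (T k) x))\<^sup>2 \<partial>?U) \<longlonglongrightarrow> (\<integral>x. (D 1 (u x))\<^sup>2 * (norm (g x))\<^sup>2 \<partial>?U)"
    proof (rule integral_dominated_convergence[where w="\<lambda>x. (norm (h x))\<^sup>2"])
      show "(\<lambda>x. (D 1 (u x))\<^sup>2 * (norm (g x))\<^sup>2) \<in> borel_measurable ?U" by measurable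
      show "(\<lambda>x. (norm (grad (T k) x))\<^sup>2) \<in> borel_measurable ?U" for k using test_fun_measurable(2)[OF T] by measurable
      show "integrable ?U (\<lambda>x. (norm (h x))\<^sup>2)" by (rule L2_integrable[OF h])
      show "AE x in ?U. (\<lambda>k. (norm (grad (T k) x))\<^sup>2) \<longlonglongrightarrow> (D 1 (u x))\<^sup>2 * (norm (g x))\<^sup>2"
        using lim_\<phi>
      proof eventually_elim
        case (elim x)
        have "(\<lambda>k. (norm (grad (T k) x))\<^sup>2) \<longlonglongrightarrow> (norm (D 1 (u x) *\<^sub>R g x))\<^sup>2"
          unfolding gT using elim by (intro tendsto_intros isCont_tendsto_compose[OF Dc])
        then show ?case by (simp add: power_mult_distrib)
      qed
      show "AE x in ?U. norm ((norm (grad (T k) x))\<^sup>2) \<le> (norm (h x))\<^sup>2" for k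
        using dom
      proof eventually_elim
        case (elim x)
        have "norm (grad (T k) x) \<le> 1 * norm (grad (\<phi> k) x)" unfolding gT norm_scaleR by (intro mult_right_mono D1b) auto
        then have "norm (grad (T k) x) \<le> norm (h x)" using elim[rule_format, of k] by simp
        then have "(norm (grad (T k) x))\<^sup>2 \<le> (norm (h x))\<^sup>2" by (intro power_mono) auto
        then show ?case by simp
      qed
    qed
    then show "(\<lambda>k. \<gamma> * sqrt (\<integral>x. (norm (grad (T k) x))\<^sup>2 \<partial>?U)) \<longlonglongrightarrow> \<gamma> * sqrt (\<integral>x. (D 1 (u x))\<^sup>2 * (norm (g x))\<^sup>2 \<partial>?U)"
      by (intro tendsto_mult_left tendsto_real_sqrt)
    show "\<exists>N. \<forall>k\<ge>N. (\<integral>x. \<bar>T k x\<bar> powr q \<partial>?U) powr (1 / q) \<le> \<gamma> * sqrt (\<integral>x. (norm (grad (T k) x))\<^sup>2 \<partial>?U)"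
      unfolding q1 unfolding q_def \<gamma>_def using sobolev_test_fun[OF dim T U_sets] by blast
  qed
  \<comment> \<open>The gradient of the truncated function carries the factor \<open>D 1\<close>
    squared, the energy only the first power; the bound \<open>D 1 \<le> 1\<close> reconciles
    them.\<close>
  have D2: "(\<integral>x. (D 1 (u x))\<^sup>2 * (norm (g x))\<^sup>2 \<partial>?U) \<le> ?D"
  proof (rule integral_mono_AE'[OF iD])
    have "(D 1 s)\<^sup>2 \<le> D 1 s" for s using D1[of s] by (simp add: power2_eq_square mult_left_le_one_le)
    then show "AE x in ?U. (D 1 (u x))\<^sup>2 * (norm (g x))\<^sup>2 \<le> D 1 (u x) * (norm (g x))\<^sup>2"
      by (intro AE_I2 mult_right_mono) auto
    show "AE x in ?U. 0 \<le> D 1 (u x) * (norm (g x))\<^sup>2" using D1 by (intro AE_I2 mult_nonneg_nonneg) auto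
  qed
  have "((\<integral>x. \<bar>D 0 (u x)\<bar> powr q \<partial>?U) powr (1 / q))\<^sup>2 \<le> (\<gamma> * sqrt (\<integral>x. (D 1 (u x))\<^sup>2 * (norm (g x))\<^sup>2 \<partial>?U))\<^sup>2"
    by (rule power_mono[OF sob]) simp
  also have "\<dots> = \<gamma>\<^sup>2 * (\<integral>x. (D 1 (u x))\<^sup>2 * (norm (g x))\<^sup>2 \<partial>?U)"
    by (simp add: power_mult_distrib integral_nonneg_AE)
  also have "\<dots> \<le> \<gamma>\<^sup>2 * ?D" by (intro mult_left_mono D2) simp
  also have "\<dots> \<le> \<gamma>\<^sup>2 * (Mx / (m * lam) * ?R)"
  proof (rule mult_left_mono)
    show "?D \<le> Mx / (m * lam) * ?R" using ineq m lam by (simp add: field_simps)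
  qed simp
  finally show ?thesis by (simp only: mult.assoc)
qed

end

section \<open>Existence\<close>

lemma compact_support_lborel:
  fixes f :: "'a::euclidean_space \<Rightarrow> real"
  assumes f: "continuous_on UNIV f" "compact K" "K \<subseteq> U" "U \<in> sets lebesgue" "\<And>x. x \<notin> K \<Longrightarrow> f x = 0"
  shows "integrable lborel f" "integrable (lebesgue_on U) f" "(\<integral>x. f x \<partial>lebesgue_on U) = (\<integral>x. f x \<partial>lborel)"
proof -
  have "integrable lborel (\<lambda>x. indicator K x *\<^sub>R f x)"
    using f by (intro borel_integrable_compact) (auto intro: continuous_on_subset)
  also have "(\<lambda>x. indicator K x *\<^sub>R f x) = f" using f(5) by (auto simp: indicator_def fun_eq_iff)
  finally show i: "integrable lborel f" .
  have fU: "(\<lambda>x. indicator U x *\<^sub>R f x) = f" using f(3,5) by (fastforce simp: indicator_def fun_eq_iff)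
  have i': "integrable lebesgue f" using i by (simp add: integrable_completion borel_measurable_integrable)
  then show "integrable (lebesgue_on U) f" unfolding integrable_lebesgue_on_iff[OF f(4)] fU .
  have "(\<integral>x. f x \<partial>lebesgue_on U) = (\<integral>x. f x \<partial>lebesgue)" unfolding integral_lebesgue_on_eq[OF f(4)] fU ..
  also have "\<dots> = (\<integral>x. f x \<partial>lborel)" using i by (simp add: integral_completion borel_measurable_integrable)
  finally show "(\<integral>x. f x \<partial>lebesgue_on U) = (\<integral>x. f x \<partial>lborel)" .
qed

text \<open>Translation invariance: the integral of a difference quotient is zero, and it differs
  from the integral of the partial derivative by the uniform quadratic remainder, which is of first
  order in the step.\<close>

lemma integral_dpart_eq_0:
  fixes \<phi> :: "real^'n::finite \<Rightarrow> real"
  assumes \<phi>: "test_fun U \<phi>" and U: "U \<in> sets lebesgue"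
  shows "(\<integral>x. dpart i \<phi> x \<partial>lebesgue_on U) = 0"
proof -
  have sm: "smooth_fun \<phi>" and K: "compact (tsupport \<phi>)" "tsupport \<phi> \<subseteq> U" using \<phi> by (auto simp: test_fun_def)
  obtain L where L: "L \<ge> 0" "\<And>z h. \<bar>\<phi> (z + h) - \<phi> z - grad \<phi> z \<bullet> h\<bar> \<le> L * (norm h)\<^sup>2"
    by (rule has_derivative_grad_remainder[OF sm K(1)]) blast
  obtain R where R: "\<And>x. x \<in> tsupport \<phi> \<Longrightarrow> norm x \<le> R" using compact_imp_bounded[OF K(1)] by (auto simp: bounded_iff)
  \<comment> \<open>A translate by at most one of the support still lies in this ball, so the
    remainder vanishes outside it.\<close>
  let ?B = "cball (0::real^'n) (R + 1)"
  let ?e = "axis i 1 :: real^'n"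
  have dz: "dpart i \<phi> y = 0" if "y \<notin> tsupport \<phi>" for y
    using grad_outside_tsupport[OF that] by (simp add: grad_def vec_eq_iff)
  note cd = continuous_on_smooth[OF smooth_fun_dpart[OF sm], of UNIV i]
  note d = compact_support_lborel[OF cd K U dz]
  have i0: "integrable lborel \<phi>" 
    by (rule compact_support_lborel(1)[OF continuous_on_smooth[OF sm] K U]) (rule tsupportD)
  define V where "V = measure lborel ?B"
  have bound: "\<bar>\<integral>x. dpart i \<phi> x \<partial>lborel\<bar> \<le> L * V * t" if t: "0 < t" "t \<le> 1" for t
  proof -
    let ?h = "t *\<^sub>R ?e"
    have nh: "norm ?h = t" using t by simp
    have tr: "(\<integral>x. \<phi> (x + ?h) \<partial>lborel) = (\<integral>x. \<phi> x \<partial>lborel)" "integrable lborel (\<lambda>x. \<phi> (x + ?h))"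
    proof -
      have m: "\<phi> \<in> borel_measurable borel" by (rule test_fun_borel(1)[OF \<phi>])
      have "(\<integral>x. \<phi> x \<partial>lborel) = (\<integral>x. \<phi> x \<partial>distr lborel borel ((+) ?h))" by (simp add: lborel_distr_plus)
      also have "\<dots> = (\<integral>x. \<phi> (?h + x) \<partial>lborel)" using m by (subst integral_distr) auto
      finally show "(\<integral>x. \<phi> (x + ?h) \<partial>lborel) = (\<integral>x. \<phi> x \<partial>lborel)" by (simp add: add.commute)
      have "integrable (distr lborel borel ((+) ?h)) \<phi>" using i0 by (simp add: lborel_distr_plus)
      then have "integrable lborel (\<lambda>x. \<phi> (?h + x))" using m by (subst (asm) integrable_distr_eq) auto
      then show "integrable lborel (\<lambda>x. \<phi> (x + ?h))" by (simp add: add.commute)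
    qed
    let ?r = "\<lambda>x. \<phi> (x + ?h) - \<phi> x - t * dpart i \<phi> x"
    have ri: "integrable lborel ?r" by (intro Bochner_Integration.integrable_diff tr i0 integrable_mult_right d(1))
    have "\<bar>?r x\<bar> \<le> L * t\<^sup>2 * indicator ?B x" for x
    proof (cases "x \<in> ?B")
      case True
      have "grad \<phi> x \<bullet> ?h = t * dpart i \<phi> x" by (simp add: inner_axis grad_def)
      then show ?thesis using L(2)[of x ?h] True by (simp only: nh indicator_simps mult_1_right)
    next
      case False
      then have x: "norm x > R + 1" by simp
      have "norm x \<le> norm (x + ?h) + t" using norm_triangle_ineq4[of "x + ?h" ?h] nh by simp
      then have "x + ?h \<notin> tsupport \<phi>" "x \<notin> tsupport \<phi>" using R[of "x + ?h"] R[of x] x t by auto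
      then show ?thesis using False by (simp add: tsupportD dz)
    qed
    then have rb: "norm (?r x) \<le> L * t\<^sup>2 * indicator ?B x" for x by (simp only: real_norm_def)
    have "emeasure lborel ?B < \<infinity>" by (intro emeasure_bounded_finite bounded_cball)
    then have iB: "integrable lborel (\<lambda>x. L * t\<^sup>2 * indicator ?B x)"
      by (intro integrable_mult_right integrable_real_indicator) auto
    have "\<bar>\<integral>x. ?r x \<partial>lborel\<bar> \<le> (\<integral>x. norm (?r x) \<partial>lborel)"
      using integral_norm_bound[of lborel ?r] by (simp only: real_norm_def)
    also have "\<dots> \<le> (\<integral>x. L * t\<^sup>2 * indicator ?B x \<partial>lborel)"
      by (rule integral_mono[OF integrable_norm[OF ri] iB rb])
    also have "\<dots> = L * t\<^sup>2 * V" by (simp add: V_def)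
    also have "(\<integral>x. ?r x \<partial>lborel) = - (t * (\<integral>x. dpart i \<phi> x \<partial>lborel))"
      using tr i0 d(1) by simp
    finally have "t * \<bar>\<integral>x. dpart i \<phi> x \<partial>lborel\<bar> \<le> t * (L * V * t)"
      using t by (simp add: abs_mult power2_eq_square ac_simps)
    then show ?thesis using t by (simp add: mult_le_cancel_left_pos)
  qed
  have "\<bar>\<integral>x. dpart i \<phi> x \<partial>lborel\<bar> \<le> 0"
  proof (rule LIMSEQ_le_const)
    have "(\<lambda>k. L * V * (1 / (real k + 1))) \<longlonglongrightarrow> L * V * 0"
      using LIMSEQ_inverse_real_of_nat by (intro tendsto_mult_left) (simp add: inverse_eq_divide add.commute)
    then show "(\<lambda>k. L * V * (1 / (real k + 1))) \<longlonglongrightarrow> 0" by simp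
    have "\<bar>\<integral>x. dpart i \<phi> x \<partial>lborel\<bar> \<le> L * V * (1 / (real k + 1))" for k by (rule bound) auto
    then show "\<exists>N. \<forall>k\<ge>N. \<bar>\<integral>x. dpart i \<phi> x \<partial>lborel\<bar> \<le> L * V * (1 / (real k + 1))" by blast
  qed
  then show ?thesis using d(3) by simp
qed

lemma test_fun_integration_by_parts:
  fixes \<phi> :: "real^'n::finite \<Rightarrow> real"
  assumes \<phi>: "test_fun U \<phi>" and \<psi>: "test_fun U \<psi>" and U: "U \<in> sets lebesgue"
  shows "(\<integral>x. \<phi> x * dpart i \<psi> x \<partial>lebesgue_on U) = - (\<integral>x. grad \<phi> x $ i * \<psi> x \<partial>lebesgue_on U)"
proof -
  have K: "compact (tsupport \<phi>)" "tsupport \<phi> \<subseteq> U" using \<phi> by (auto simp: test_fun_def)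
  have sm: "smooth_fun \<phi>" "smooth_fun \<psi>" using \<phi> \<psi> by (auto simp: test_fun_def)
  have eq: "dpart i (\<lambda>x. \<phi> x * \<psi> x) x = \<phi> x * dpart i \<psi> x + grad \<phi> x $ i * \<psi> x" for x
  proof -
    have "grad (\<lambda>x. \<phi> x * \<psi> x) x $ i = (\<phi> x *\<^sub>R grad \<psi> x + \<psi> x *\<^sub>R grad \<phi> x) $ i"
      by (simp only: grad_mult[OF test_funD(2)[OF \<phi>] test_funD(2)[OF \<psi>]])
    then show ?thesis by (simp add: grad_def)
  qed
  have dz: "dpart i \<phi> y = 0" if "y \<notin> tsupport \<phi>" for y
    using grad_outside_tsupport[OF that] by (simp add: grad_def vec_eq_iff)
  have i1: "integrable (lebesgue_on U) (\<lambda>x. \<phi> x * dpart i \<psi> x)"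
  proof (rule compact_support_lborel(2)[OF _ K U])
    show "continuous_on UNIV (\<lambda>x. \<phi> x * dpart i \<psi> x)"
      by (intro continuous_on_mult continuous_on_smooth sm smooth_fun_dpart)
  qed (simp add: tsupportD)
  have "continuous_on UNIV (\<lambda>x. dpart i \<phi> x * \<psi> x)"
    by (intro continuous_on_mult continuous_on_smooth sm smooth_fun_dpart)
  then have i2: "integrable (lebesgue_on U) (\<lambda>x. grad \<phi> x $ i * \<psi> x)"
    by (intro compact_support_lborel(2)[OF _ K U]) (auto simp: dz grad_def)
  have "(\<integral>x. \<phi> x * dpart i \<psi> x + grad \<phi> x $ i * \<psi> x \<partial>lebesgue_on U) = 0"
    using integral_dpart_eq_0[OF test_fun_mult[OF \<phi> sm(2)] U, of i] unfolding eq .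
  then show ?thesis using i1 i2 by simp
qed

section \<open>Sobolev and Poincare inequalities, and the application of Lions' theorem\<close>

context elliptic begin

text \<open>Fatou's lemma along an approximating sequence, in extended reals, because the
  integrability of |u|^q is part of what has to be shown: a nonintegrable function would have
  Bochner integral zero.\<close>

lemma sobolev_H012:
  assumes H: "H012 U u g"
  defines "q \<equiv> 2 * real CARD('n) / (real CARD('n) - 2)" and "\<gamma> \<equiv> 2 * (real CARD('n) - 1) / (real CARD('n) - 2)"
  shows "(\<integral>x. \<bar>u x\<bar> powr q \<partial>lebesgue_on U) powr (1 / q) \<le> \<gamma> * sqrt (\<integral>x. (norm (g x))\<^sup>2 \<partial>lebesgue_on U)"
proof -
  let ?U = "lebesgue_on U"
  have q: "q > 0" and \<gamma>: "\<gamma> > 0" and q1: "1 / q = (real CARD('n) - 2) / (2 * real CARD('n))"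
    using dim by (auto simp: q_def \<gamma>_def)
  obtain \<phi> h where \<phi>: "\<And>k::nat. test_fun U (\<phi> k)" and h: "L2 ?U (h :: real^'n \<Rightarrow> real)"
    and lim_\<phi>: "AE x in ?U. (\<lambda>k. \<phi> k x) \<longlonglongrightarrow> u x" "AE x in ?U. (\<lambda>k. grad (\<phi> k) x) \<longlonglongrightarrow> g x"
    and dom: "AE x in ?U. \<forall>k. norm (grad (\<phi> k) x) \<le> h x"
    by (rule H012_dominated[OF H]) blast
  note um = L2_measurable[OF H012_L2(1)[OF H]] and gm = L2_measurable[OF H012_L2(2)[OF H]]
  let ?G = "\<gamma> * sqrt (\<integral>x. (norm (g x))\<^sup>2 \<partial>?U)"
  have G0: "?G \<ge> 0" using \<gamma> by simp
  let ?I = "\<lambda>k. \<integral>x. \<bar>\<phi> k x\<bar> powr q \<partial>?U"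
  have sob: "?I k \<le> (\<gamma> * sqrt (\<integral>x. (norm (grad (\<phi> k) x))\<^sup>2 \<partial>?U)) powr q" for k
  proof -
    have "?I k powr (1 / q) \<le> \<gamma> * sqrt (\<integral>x. (norm (grad (\<phi> k) x))\<^sup>2 \<partial>?U)"
      unfolding q1 unfolding q_def \<gamma>_def by (rule sobolev_test_fun[OF dim \<phi> U_sets])
    then have "(?I k powr (1 / q)) powr q \<le> (\<gamma> * sqrt (\<integral>x. (norm (grad (\<phi> k) x))\<^sup>2 \<partial>?U)) powr q"
      using q by (intro powr_mono2) auto
    then show ?thesis using q by (simp add: powr_powr)
  qed
  have "(\<lambda>k. \<integral>x. (norm (grad (\<phi> k) x))\<^sup>2 \<partial>?U) \<longlonglongrightarrow> (\<integral>x. (norm (g x))\<^sup>2 \<partial>?U)"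
  proof (rule integral_dominated_convergence[where w="\<lambda>x. (norm (h x))\<^sup>2"])
    show "(\<lambda>x. (norm (g x))\<^sup>2) \<in> borel_measurable ?U" using gm by measurable
    show "(\<lambda>x. (norm (grad (\<phi> k) x))\<^sup>2) \<in> borel_measurable ?U" for k using test_fun_measurable(2)[OF \<phi>] by measurable
    show "integrable ?U (\<lambda>x. (norm (h x))\<^sup>2)" by (rule L2_integrable[OF h])
    show "AE x in ?U. (\<lambda>k. (norm (grad (\<phi> k) x))\<^sup>2) \<longlonglongrightarrow> (norm (g x))\<^sup>2"
      using lim_\<phi>(2) by eventually_elim (intro tendsto_intros)
    show "AE x in ?U. norm ((norm (grad (\<phi> k) x))\<^sup>2) \<le> (norm (h x))\<^sup>2" for k
      using dom
    proof eventually_elim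
      case (elim x)
      then have "norm (grad (\<phi> k) x) \<le> h x" by blast
      then have "norm (grad (\<phi> k) x) \<le> norm (h x)" by simp
      then have "(norm (grad (\<phi> k) x))\<^sup>2 \<le> (norm (h x))\<^sup>2" by (intro power_mono) auto
      then show ?case by simp
    qed
  qed
  then have "(\<lambda>k. (\<gamma> * sqrt (\<integral>x. (norm (grad (\<phi> k) x))\<^sup>2 \<partial>?U)) powr q) \<longlonglongrightarrow> ?G powr q"
    using q \<gamma> by (intro tendsto_powr2 tendsto_mult_left tendsto_real_sqrt tendsto_const) auto
  then have limG: "(\<lambda>k. ennreal ((\<gamma> * sqrt (\<integral>x. (norm (grad (\<phi> k) x))\<^sup>2 \<partial>?U)) powr q)) \<longlonglongrightarrow> ennreal (?G powr q)"
    by (rule tendsto_ennrealI)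
  have "(\<integral>\<^sup>+x. ennreal (\<bar>u x\<bar> powr q) \<partial>?U) = (\<integral>\<^sup>+x. liminf (\<lambda>k. ennreal (\<bar>\<phi> k x\<bar> powr q)) \<partial>?U)"
  proof (rule nn_integral_cong_AE)
    show "AE x in ?U. ennreal (\<bar>u x\<bar> powr q) = liminf (\<lambda>k. ennreal (\<bar>\<phi> k x\<bar> powr q))"
      using lim_\<phi>(1)
    proof eventually_elim
      case (elim x)
      have "(\<lambda>k. ennreal (\<bar>\<phi> k x\<bar> powr q)) \<longlonglongrightarrow> ennreal (\<bar>u x\<bar> powr q)"
        using elim q by (intro tendsto_ennrealI tendsto_powr2 tendsto_rabs tendsto_const) auto
      then show ?case by (intro lim_imp_Liminf[symmetric]) auto
    qed
  qed
  also have "\<dots> \<le> liminf (\<lambda>k. \<integral>\<^sup>+x. ennreal (\<bar>\<phi> k x\<bar> powr q) \<partial>?U)"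
    using test_fun_measurable(1)[OF \<phi>] by (intro nn_integral_liminf) measurable
  also have "\<dots> \<le> liminf (\<lambda>k. ennreal ((\<gamma> * sqrt (\<integral>x. (norm (grad (\<phi> k) x))\<^sup>2 \<partial>?U)) powr q))"
  proof (rule Liminf_mono[OF always_eventually], rule allI)
    fix k
    have K: "compact (tsupport (\<phi> k))" "tsupport (\<phi> k) \<subseteq> U" using \<phi>[of k] by (auto simp: test_fun_def)
    have "integrable ?U (\<lambda>x. \<bar>\<phi> k x\<bar> powr q)"
      using q by (intro compact_support_lborel(2)[OF _ K U_sets] continuous_on_powr' continuous_intros test_funD(3)[OF \<phi>]) (auto simp: tsupportD)
    then have "(\<integral>\<^sup>+x. ennreal (\<bar>\<phi> k x\<bar> powr q) \<partial>?U) = ennreal (?I k)" by (intro nn_integral_eq_integral) auto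
    then show "(\<integral>\<^sup>+x. ennreal (\<bar>\<phi> k x\<bar> powr q) \<partial>?U) \<le> ennreal ((\<gamma> * sqrt (\<integral>x. (norm (grad (\<phi> k) x))\<^sup>2 \<partial>?U)) powr q)"
      using sob[of k] by (simp add: ennreal_leI)
  qed
  also have "\<dots> = ennreal (?G powr q)" using limG by (intro lim_imp_Liminf) auto
  finally have le: "(\<integral>\<^sup>+x. ennreal (\<bar>u x\<bar> powr q) \<partial>?U) \<le> ennreal (?G powr q)" .
  have "integrable ?U (\<lambda>x. \<bar>u x\<bar> powr q)"
  proof (rule integrableI_nonneg)
    show "(\<integral>\<^sup>+x. ennreal (\<bar>u x\<bar> powr q) \<partial>?U) < \<infinity>" using le by (rule order_le_less_trans) simp
    show "(\<lambda>x. \<bar>u x\<bar> powr q) \<in> borel_measurable ?U" using um by measurable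
  qed simp
  then have "(\<integral>\<^sup>+x. ennreal (\<bar>u x\<bar> powr q) \<partial>?U) = ennreal (\<integral>x. \<bar>u x\<bar> powr q \<partial>?U)" by (intro nn_integral_eq_integral) auto
  then have "(\<integral>x. \<bar>u x\<bar> powr q \<partial>?U) \<le> ?G powr q" using le by (simp add: ennreal_le_iff)
  then have "(\<integral>x. \<bar>u x\<bar> powr q \<partial>?U) powr (1 / q) \<le> (?G powr q) powr (1 / q)" using q by (intro powr_mono2) auto
  also have "\<dots> = ?G" using q G0 by (simp add: powr_powr)
  finally show ?thesis .
qed

text \<open>Hoelder with exponents d/(d-2) and d/2 on the bounded set \<open>U\<close>, followed by
  the Sobolev inequality. It recovers convergence of the functions from convergence of their
  gradients.\<close>

lemma poincare_test_fun:
  obtains C where "C \<ge> 0" "\<And>\<phi>. test_fun U \<phi> \<Longrightarrow> (\<integral>x. (\<phi> x)\<^sup>2 \<partial>lebesgue_on U) \<le> C * (\<integral>x. (norm (grad \<phi> x))\<^sup>2 \<partial>lebesgue_on U)"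
proof -
  let ?U = "lebesgue_on U" and ?d = "real CARD('n)"
  interpret U: finite_measure ?U by (rule finite_measure_U)
  have d: "?d \<ge> 3" using dim by simp
  define \<gamma> where "\<gamma> = 2 * (?d - 1) / (?d - 2)"
  define V where "V = (\<integral>x. 1 \<partial>?U) powr (2 / ?d)"
  have "(\<integral>x. (\<phi> x)\<^sup>2 \<partial>?U) \<le> (\<gamma>\<^sup>2 * V) * (\<integral>x. (norm (grad \<phi> x))\<^sup>2 \<partial>?U)" if \<phi>: "test_fun U \<phi>" for \<phi>
  proof -
    let ?p = "?d / (?d - 2)" and ?q = "2 * ?d / (?d - 2)"
    have K: "compact (tsupport \<phi>)" "tsupport \<phi> \<subseteq> U" using \<phi> by (auto simp: test_fun_def)
    have e: "\<bar>(\<phi> x)\<^sup>2\<bar> powr ?p = \<bar>\<phi> x\<bar> powr ?q" for x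
    proof -
      have "\<bar>(\<phi> x)\<^sup>2\<bar> = \<bar>\<phi> x\<bar> powr 2" by (cases "\<phi> x = 0") (auto simp: powr_numeral)
      then have "\<bar>(\<phi> x)\<^sup>2\<bar> powr ?p = \<bar>\<phi> x\<bar> powr (2 * ?p)" by (simp only: powr_powr)
      then show ?thesis by simp
    qed
    have i: "integrable ?U (\<lambda>x. \<bar>\<phi> x\<bar> powr ?q)"
      using d by (intro compact_support_lborel(2)[OF _ K U_sets] continuous_on_powr' continuous_intros test_funD(3)[OF \<phi>]) (auto simp: tsupportD)
    have m: "(\<lambda>x. (\<phi> x)\<^sup>2) \<in> borel_measurable ?U" using test_fun_measurable(1)[OF \<phi>] by measurable
    have pq: "1 < ?p" "1 < ?d / 2" "1 / ?p + 1 / (?d / 2) = 1" using d by (auto simp: field_simps)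
    have "(\<integral>x. \<bar>(\<phi> x)\<^sup>2 * 1\<bar> \<partial>?U) \<le> (\<integral>x. \<bar>(\<phi> x)\<^sup>2\<bar> powr ?p \<partial>?U) powr (1 / ?p) * (\<integral>x. \<bar>1\<bar> powr (?d / 2) \<partial>?U) powr (1 / (?d / 2))"
      by (rule integral_Holder2(2)[OF pq m]) (use i e in auto)
    then have le: "(\<integral>x. (\<phi> x)\<^sup>2 \<partial>?U) \<le> (\<integral>x. \<bar>\<phi> x\<bar> powr ?q \<partial>?U) powr (1 / ?p) * V"
      unfolding e by (simp add: V_def)
    have "(\<integral>x. \<bar>\<phi> x\<bar> powr ?q \<partial>?U) powr (1 / ?p) = ((\<integral>x. \<bar>\<phi> x\<bar> powr ?q \<partial>?U) powr ((?d - 2) / (2 * ?d)))\<^sup>2"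
    proof -
      have "(X powr ((?d - 2) / (2 * ?d)))\<^sup>2 = X powr (1 / ?p)" if "X \<ge> 0" for X :: real
      proof -
        have "(X powr ((?d - 2) / (2 * ?d)))\<^sup>2 = X powr ((?d - 2) / (2 * ?d) + (?d - 2) / (2 * ?d))"
          by (simp only: power2_eq_square powr_add)
        also have "(?d - 2) / (2 * ?d) + (?d - 2) / (2 * ?d) = 1 / ?p" using d by (simp add: field_simps)
        finally show ?thesis .
      qed
      then show ?thesis by (simp add: integral_nonneg_AE)
    qed
    also have "\<dots> \<le> (\<gamma> * sqrt (\<integral>x. (norm (grad \<phi> x))\<^sup>2 \<partial>?U))\<^sup>2"
      unfolding \<gamma>_def by (rule power_mono[OF sobolev_test_fun[OF dim \<phi> U_sets]]) simp
    also have "\<dots> = \<gamma>\<^sup>2 * (\<integral>x. (norm (grad \<phi> x))\<^sup>2 \<partial>?U)" by (simp add: power_mult_distrib integral_nonneg_AE)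
    finally have "(\<integral>x. \<bar>\<phi> x\<bar> powr ?q \<partial>?U) powr (1 / ?p) * V \<le> \<gamma>\<^sup>2 * (\<integral>x. (norm (grad \<phi> x))\<^sup>2 \<partial>?U) * V"
      by (rule mult_right_mono) (simp add: V_def)
    then show ?thesis using le by (simp add: ac_simps)
  qed
  then show ?thesis by (intro that[of "\<gamma>\<^sup>2 * V"]) (auto simp: V_def)
qed


lemma L2_transpose_A:
  assumes g: "L2 (lebesgue_on U) g"
  shows "L2 (lebesgue_on U) (\<lambda>x. transpose (A x) *v g x)"
proof (rule L2_bound[OF L2_scaleR[OF g, of "C\<^sub>A"]])
  show "(\<lambda>x. transpose (A x) *v g x) \<in> borel_measurable (lebesgue_on U)"
    using A_measurable by (intro measurable_matrix_vector_mult L2_measurable[OF g]) (simp add: transpose_def)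
  show "AE x in lebesgue_on U. norm (transpose (A x) *v g x) \<le> norm (C\<^sub>A *\<^sub>R g x)"
    using A_bound
  proof eventually_elim
    case (elim x)
    then have "norm (transpose (A x) *v g x) \<le> C\<^sub>A * norm (g x)" by (intro norm_transpose_le) blast
    then show ?case using C_A_nonneg by simp
  qed
qed

lemma \<rho>_abs_bound: "AE x in lebesgue_on U. \<bar>\<rho> x\<bar> \<le> Mx"
proof (rule AE_I2)
  fix x assume "x \<in> space (lebesgue_on U)"
  then have "m \<le> \<rho> x \<and> \<rho> x \<le> Mx" using \<rho>_bounds[of x] by simp
  then show "\<bar>\<rho> x\<bar> \<le> Mx" using m(1) by linarith
qed

lemma test_fun_AE_bound:
  assumes "test_fun U \<phi>" obtains B where "AE x in lebesgue_on U. \<bar>\<phi> x\<bar> \<le> B"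
proof -
  obtain B where "\<And>x. \<bar>\<phi> x\<bar> \<le> B" using test_fun_bounded[OF assms] by metis
  then show ?thesis by (intro that[of B] AE_I2)
qed

lemma integrable_mult_\<rho>_test_fun:
  assumes f: "integrable (lebesgue_on U) f" and \<phi>: "test_fun U \<phi>"
  shows "integrable (lebesgue_on U) (\<lambda>x. f x * (\<rho> x * \<phi> x))"
proof -
  obtain B where B: "B > 0" "\<And>x. \<bar>\<phi> x\<bar> \<le> B" using test_fun_bounded[OF \<phi>] by metis
  show ?thesis
  proof (rule Bochner_Integration.integrable_bound[OF integrable_mult_left[OF f, of "Mx * B"]])
    note [measurable] = borel_measurable_integrable[OF f] \<rho>_measurable test_fun_measurable(1)[OF \<phi>]
    show "(\<lambda>x. f x * (\<rho> x * \<phi> x)) \<in> borel_measurable (lebesgue_on U)" by measurable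
    show "AE x in lebesgue_on U. norm (f x * (\<rho> x * \<phi> x)) \<le> norm (f x * (Mx * B))"
      using \<rho>_abs_bound
    proof eventually_elim
      case (elim x)
      have "\<bar>\<rho> x\<bar> * \<bar>\<phi> x\<bar> \<le> Mx * B" using elim B m by (intro mult_mono) auto
      then have "\<bar>f x\<bar> * (\<bar>\<rho> x\<bar> * \<bar>\<phi> x\<bar>) \<le> \<bar>f x\<bar> * (Mx * B)" by (rule mult_left_mono) simp
      moreover have "0 \<le> Mx * B" using m B by (intro mult_nonneg_nonneg) auto
      then have "norm (f x * (Mx * B)) = \<bar>f x\<bar> * (Mx * B)" by (simp only: real_norm_def abs_mult[of "f x"] abs_of_nonneg)
      moreover have "norm (f x * (\<rho> x * \<phi> x)) = \<bar>f x\<bar> * (\<bar>\<rho> x\<bar> * \<bar>\<phi> x\<bar>)" by (simp only: real_norm_def abs_mult)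
      ultimately show ?case by simp
    qed
  qed
qed

text \<open>The energy becomes an ordinary L^2 norm through \<open>w\<close>, which pairs the
  gradient with sqrt(c) times the function. Lions' theorem produces a limit pair; its first
  component is the gradient of the solution \<open>u\<close>, its second is identified as sqrt(c)
  u.\<close>

lemma existence:
  assumes f: "integrable (lebesgue_on U) f"
    and C: "\<And>\<phi>. test_fun U \<phi> \<Longrightarrow> (\<integral>x. f x * (\<rho> x * \<phi> x) \<partial>lebesgue_on U)\<^sup>2 \<le> C\<^sup>2 * (\<integral>x. (norm (grad \<phi> x))\<^sup>2 \<partial>lebesgue_on U)"
  obtains u g where "H012 U u g" "integrable (lebesgue_on U) (\<lambda>x. c x * u x)"
    "\<And>\<psi>. test_fun U \<psi> \<Longrightarrow> (\<integral>x. E u g \<psi> x \<partial>lebesgue_on U) = (\<integral>x. f x * (\<rho> x * \<psi> x) \<partial>lebesgue_on U)"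
    "(\<integral>x. (norm (g x))\<^sup>2 \<partial>lebesgue_on U) \<le> (C / (m * min lam 1))\<^sup>2"
proof -
  let ?U = "lebesgue_on U"
  \<comment> \<open>The absolute value makes \<open>s\<close> square to |c| everywhere; the sign of
    \<open>c\<close> is known only almost everywhere.\<close>
  define s where "s x = sqrt \<bar>c x\<bar>" for x
  have cm: "c \<in> borel_measurable ?U" using c(1) by (rule borel_measurable_integrable)
  have sm: "s \<in> borel_measurable ?U" unfolding s_def using cm by measurable
  have L2s: "L2 ?U s" unfolding L2_def using sm c(1) by (simp add: s_def)
  have s2: "AE x in ?U. s x * s x = c x" using c(2) by eventually_elim (simp add: s_def)
  define S where "S = {\<phi>. test_fun U \<phi>}"
  define comb where "comb a \<phi> b \<psi> = (\<lambda>x. a * \<phi> x + b * \<psi> x)" for a b :: real and \<phi> \<psi> :: "real^'n \<Rightarrow> real"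
  define w where "w \<phi> x = (grad \<phi> x, s x * \<phi> x)" for \<phi> x
  \<comment> \<open>All coefficients are moved to the test function, so that the inner product with
    \<open>(g x, s x * u x)\<close> is the integrand \<open>E\<close> wherever
    \<open>s x * s x = c x\<close>. \<open>F\<close> occurs only multiplied by a bounded function,
    which leaves \<open>G \<phi>\<close> in L^2.\<close>
  define G where "G \<phi> x = (\<rho> x *\<^sub>R (transpose (A x) *v grad \<phi> x) + \<phi> x *\<^sub>R F x, \<rho> x * (s x * \<phi> x))" for \<phi> x
  define \<alpha> where "\<alpha> = m * min lam 1"
  have \<alpha>: "\<alpha> > 0" using m lam by (simp add: \<alpha>_def)
  have L2s\<phi>: "L2 ?U (\<lambda>x. s x * \<phi> x)" if \<phi>: "test_fun U \<phi>" for \<phi>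
  proof -
    obtain B where B: "AE x in ?U. \<bar>\<phi> x\<bar> \<le> B" by (rule test_fun_AE_bound[OF \<phi>])
    have "L2 ?U (\<lambda>x. \<phi> x *\<^sub>R s x)" by (rule L2_bounded_mult[OF L2s test_fun_measurable(1)[OF \<phi>] B])
    then show ?thesis by (simp add: mult.commute)
  qed
  have w: "L2 ?U (w \<phi>)" if "\<phi> \<in> S" for \<phi>
    using that L2_pair[OF L2_test_fun(2) L2s\<phi>] unfolding w_def[abs_def] S_def by blast
  have L2\<phi>F: "L2 ?U (\<lambda>x. \<phi> x *\<^sub>R F x)" if \<phi>: "test_fun U \<phi>" for \<phi>
  proof -
    obtain B where B: "AE x in ?U. \<bar>\<phi> x\<bar> \<le> B" by (rule test_fun_AE_bound[OF \<phi>])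
    show ?thesis by (rule L2_bounded_mult[OF L2_F test_fun_measurable(1)[OF \<phi>] B])
  qed
  have G: "L2 ?U (G \<phi>)" if "\<phi> \<in> S" for \<phi>
  proof -
    have \<phi>: "test_fun U \<phi>" using that by (simp add: S_def)
    have "L2 ?U (\<lambda>x. \<rho> x *\<^sub>R (s x * \<phi> x))" by (rule L2_bounded_mult[OF L2s\<phi>[OF \<phi>] \<rho>_measurable \<rho>_abs_bound])
    then have 2: "L2 ?U (\<lambda>x. \<rho> x * (s x * \<phi> x))" by simp
    have 1: "L2 ?U (\<lambda>x. \<rho> x *\<^sub>R (transpose (A x) *v grad \<phi> x))"
      by (rule L2_bounded_mult[OF L2_transpose_A[OF L2_test_fun(2)[OF \<phi>]] \<rho>_measurable \<rho>_abs_bound])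
    show ?thesis unfolding G_def[abs_def] by (rule L2_pair[OF L2_add[OF 1 L2\<phi>F[OF \<phi>]] 2])
  qed
  have Sne: "S \<noteq> {}"
  proof -
    have "test_fun U (\<lambda>x. 0)" by (rule test_funI[of _ "{}"]) auto
    then show ?thesis by (auto simp: S_def)
  qed
  have Scomb: "comb a \<phi> b \<psi> \<in> S" if "\<phi> \<in> S" "\<psi> \<in> S" for a b \<phi> \<psi>
    using that test_fun_lincomb by (auto simp: S_def comb_def)
  have gcomb: "grad (comb a \<phi> b \<psi>) x = a *\<^sub>R grad \<phi> x + b *\<^sub>R grad \<psi> x" if "\<phi> \<in> S" "\<psi> \<in> S" for a b \<phi> \<psi> x
    unfolding comb_def using that by (intro grad_lincomb) (auto simp: S_def test_funD(2))
  have wlin: "w (comb a \<phi> b \<psi>) = (\<lambda>x. a *\<^sub>R w \<phi> x + b *\<^sub>R w \<psi> x)" if "\<phi> \<in> S" "\<psi> \<in> S" for a b \<phi> \<psi>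
    by (rule ext) (simp add: w_def gcomb[OF that], simp add: comb_def algebra_simps)
  have Glin: "G (comb a \<phi> b \<psi>) = (\<lambda>x. a *\<^sub>R G \<phi> x + b *\<^sub>R G \<psi> x)" if "\<phi> \<in> S" "\<psi> \<in> S" for a b \<phi> \<psi>
  proof (rule ext)
    fix x
    have "transpose (A x) *v (a *\<^sub>R grad \<phi> x + b *\<^sub>R grad \<psi> x) = a *\<^sub>R (transpose (A x) *v grad \<phi> x) + b *\<^sub>R (transpose (A x) *v grad \<psi> x)"
      by (simp only: matrix_vector_right_distrib matrix_vector_mult_scaleR)
    then have "fst (G (comb a \<phi> b \<psi>) x) = a *\<^sub>R fst (G \<phi> x) + b *\<^sub>R fst (G \<psi> x)"
      unfolding G_def gcomb[OF that] by (simp add: comb_def scaleR_add_left scaleR_add_right ac_simps)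
    moreover have "snd (G (comb a \<phi> b \<psi>) x) = a *\<^sub>R snd (G \<phi> x) + b *\<^sub>R snd (G \<psi> x)"
      unfolding G_def by (simp add: comb_def algebra_simps)
    ultimately show "G (comb a \<phi> b \<psi>) x = a *\<^sub>R G \<phi> x + b *\<^sub>R G \<psi> x" by (simp add: prod_eq_iff)
  qed
  define l where "l \<phi> = (\<integral>x. f x * (\<rho> x * \<phi> x) \<partial>?U)" for \<phi>
  have llin: "l (comb a \<phi> b \<psi>) = a * l \<phi> + b * l \<psi>" if "\<phi> \<in> S" "\<psi> \<in> S" for a b \<phi> \<psi>
  proof -
    have i: "integrable ?U (\<lambda>x. f x * (\<rho> x * \<phi> x))" "integrable ?U (\<lambda>x. f x * (\<rho> x * \<psi> x))"
      using that integrable_mult_\<rho>_test_fun[OF f] by (auto simp: S_def)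
    have "l (comb a \<phi> b \<psi>) = (\<integral>x. a * (f x * (\<rho> x * \<phi> x)) + b * (f x * (\<rho> x * \<psi> x)) \<partial>?U)"
      unfolding l_def comb_def by (intro Bochner_Integration.integral_cong refl) (simp add: algebra_simps)
    also have "\<dots> = a * l \<phi> + b * l \<psi>" unfolding l_def using i by simp
    finally show ?thesis .
  qed
  have nw: "(norm (w \<phi> x))\<^sup>2 = (norm (grad \<phi> x))\<^sup>2 + (s x * \<phi> x)\<^sup>2" for \<phi> x
    by (simp add: w_def norm_Pair)
  have lC: "(l \<phi>)\<^sup>2 \<le> C\<^sup>2 * (\<integral>x. (norm (w \<phi> x))\<^sup>2 \<partial>?U)" if "\<phi> \<in> S" for \<phi>
  proof -
    have \<phi>: "test_fun U \<phi>" using that by (simp add: S_def)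
    have "(\<integral>x. (norm (grad \<phi> x))\<^sup>2 \<partial>?U) \<le> (\<integral>x. (norm (w \<phi> x))\<^sup>2 \<partial>?U)"
      by (rule integral_mono[OF L2_integrable[OF L2_test_fun(2)[OF \<phi>]] L2_integrable[OF w[OF that]]]) (simp add: nw)
    then have "C\<^sup>2 * (\<integral>x. (norm (grad \<phi> x))\<^sup>2 \<partial>?U) \<le> C\<^sup>2 * (\<integral>x. (norm (w \<phi> x))\<^sup>2 \<partial>?U)" by (rule mult_left_mono) simp
    then show ?thesis using C[OF \<phi>] unfolding l_def by linarith
  qed
  have zG: "(v, s x * t) \<bullet> G \<psi> x = \<rho> x * ((A x *v v) \<bullet> grad \<psi> x) + (F x \<bullet> v) * \<psi> x + (s x * s x) * t * (\<rho> x * \<psi> x)" for v t \<psi> x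
  proof -
    have "v \<bullet> (transpose (A x) *v grad \<psi> x) = (A x *v v) \<bullet> grad \<psi> x"
      using transpose_vector_inner[of "A x" "grad \<psi> x" v] by (simp only: inner_commute)
    then show ?thesis unfolding G_def inner_Pair inner_add_right inner_scaleR_right
      by (simp add: inner_commute ac_simps)
  qed
  have coer: "\<alpha> * (\<integral>x. (norm (w \<phi> x))\<^sup>2 \<partial>?U) \<le> (\<integral>x. w \<phi> x \<bullet> G \<phi> x \<partial>?U)" if "\<phi> \<in> S" for \<phi>
  proof -
    have \<phi>: "test_fun U \<phi>" using that by (simp add: S_def)
    have Fi: "integrable ?U (\<lambda>x. (F x \<bullet> grad \<phi> x) * \<phi> x)"
      using L2_inner_integrable[OF L2\<phi>F[OF \<phi>] L2_test_fun(2)[OF \<phi>]] by (simp add: mult.commute)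
    \<comment> \<open>Twice the integrand is \<open>F\<close> against the gradient of \<phi>^2,
      again a test function.\<close>
    have F0: "(\<integral>x. (F x \<bullet> grad \<phi> x) * \<phi> x \<partial>?U) = 0"
    proof -
      have "test_fun U (\<lambda>x. \<phi> x * \<phi> x)" by (rule test_fun_mult[OF \<phi> test_funD(1)[OF \<phi>]])
      moreover have "grad (\<lambda>x. \<phi> x * \<phi> x) x = \<phi> x *\<^sub>R grad \<phi> x + \<phi> x *\<^sub>R grad \<phi> x" for x
        by (rule grad_mult[OF test_funD(2)[OF \<phi>] test_funD(2)[OF \<phi>]])
      ultimately have a: "(\<integral>x. F x \<bullet> (\<phi> x *\<^sub>R grad \<phi> x + \<phi> x *\<^sub>R grad \<phi> x) \<partial>?U) = 0"
        using div_free[of "\<lambda>x. \<phi> x * \<phi> x"] unfolding F_def by simp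
      have b: "F x \<bullet> (\<phi> x *\<^sub>R grad \<phi> x + \<phi> x *\<^sub>R grad \<phi> x) = 2 * ((F x \<bullet> grad \<phi> x) * \<phi> x)" for x
        unfolding inner_add_right inner_scaleR_right by simp
      show ?thesis using a unfolding b by simp
    qed
    have wG: "integrable ?U (\<lambda>x. w \<phi> x \<bullet> G \<phi> x)" by (rule L2_inner_integrable[OF w[OF that] G[OF that]])
    have "(\<integral>x. \<alpha> * (norm (w \<phi> x))\<^sup>2 \<partial>?U) \<le> (\<integral>x. w \<phi> x \<bullet> G \<phi> x - (F x \<bullet> grad \<phi> x) * \<phi> x \<partial>?U)"
    proof (rule integral_mono_AE)
      show "integrable ?U (\<lambda>x. \<alpha> * (norm (w \<phi> x))\<^sup>2)" by (intro integrable_mult_right L2_integrable w that)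
      show "integrable ?U (\<lambda>x. w \<phi> x \<bullet> G \<phi> x - (F x \<bullet> grad \<phi> x) * \<phi> x)" by (intro Bochner_Integration.integrable_diff wG Fi)
      show "AE x in ?U. \<alpha> * (norm (w \<phi> x))\<^sup>2 \<le> w \<phi> x \<bullet> G \<phi> x - (F x \<bullet> grad \<phi> x) * \<phi> x"
        using A_elliptic AE_space
      proof eventually_elim
        case (elim x)
        have r: "m \<le> \<rho> x" using elim(2) \<rho>_bounds[of x] by simp
        have "min lam 1 * (norm (grad \<phi> x))\<^sup>2 \<le> lam * (norm (grad \<phi> x))\<^sup>2" by (intro mult_right_mono) auto
        also have "\<dots> \<le> (A x *v grad \<phi> x) \<bullet> grad \<phi> x" using elim(1) by blast
        finally have a: "min lam 1 * (norm (grad \<phi> x))\<^sup>2 \<le> (A x *v grad \<phi> x) \<bullet> grad \<phi> x" .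
        have 1: "m * (min lam 1 * (norm (grad \<phi> x))\<^sup>2) \<le> \<rho> x * ((A x *v grad \<phi> x) \<bullet> grad \<phi> x)"
          by (rule mult_mono[OF r a]) (use r m lam in auto)
        have "min lam 1 * (s x * \<phi> x)\<^sup>2 \<le> 1 * (s x * \<phi> x)\<^sup>2" by (intro mult_right_mono) auto
        then have b: "min lam 1 * (s x * \<phi> x)\<^sup>2 \<le> (s x * \<phi> x)\<^sup>2" by simp
        have 2: "m * (min lam 1 * (s x * \<phi> x)\<^sup>2) \<le> \<rho> x * (s x * \<phi> x)\<^sup>2"
          by (rule mult_mono[OF r b]) (use r m lam in auto)
        have "w \<phi> x \<bullet> G \<phi> x - (F x \<bullet> grad \<phi> x) * \<phi> x = \<rho> x * ((A x *v grad \<phi> x) \<bullet> grad \<phi> x) + \<rho> x * (s x * \<phi> x)\<^sup>2"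
          unfolding w_def zG by (simp add: power2_eq_square ac_simps)
        moreover have "\<alpha> * (norm (w \<phi> x))\<^sup>2 = m * (min lam 1 * (norm (grad \<phi> x))\<^sup>2) + m * (min lam 1 * (s x * \<phi> x)\<^sup>2)"
          unfolding nw \<alpha>_def by (simp only: distrib_left mult.assoc)
        ultimately show ?case using 1 2 by linarith
      qed
    qed
    then show ?thesis using wG Fi F0 by simp
  qed
  obtain z fm where z: "L2 ?U z" and fm: "\<And>k. fm k \<in> S" and zlim: "(\<lambda>k. \<integral>x. (norm (w (fm k) x - z x))\<^sup>2 \<partial>?U) \<longlonglongrightarrow> 0"
    and zweak: "\<And>\<psi>. \<psi> \<in> S \<Longrightarrow> (\<integral>x. z x \<bullet> G \<psi> x \<partial>?U) = l \<psi>" and zb: "(\<integral>x. (norm (z x))\<^sup>2 \<partial>?U) \<le> (C / \<alpha>)\<^sup>2"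
    by (rule lions[where S=S and comb=comb and M="?U" and w=w and G=G and l=l and C=C and \<alpha>=\<alpha>,
          OF Sne Scomb w G wlin Glin llin lC \<alpha> coer]) ((assumption | rule that)+)
  have tf: "test_fun U (fm k)" for k using fm[of k] by (simp add: S_def)
  define g where "g x = fst (z x)" for x
  have nf: "norm (fst p) \<le> norm p" "norm (snd p) \<le> norm p" for p :: "(real^'n) \<times> real"
    using norm_fst_le[of "fst p" "snd p"] norm_snd_le[of "snd p" "fst p"] by simp_all
  have zm: "z \<in> borel_measurable ?U" by (rule L2_measurable[OF z])
  have g: "L2 ?U g"
  proof (rule L2_bound[OF z])
    have "(fst :: (real^'n) \<times> real \<Rightarrow> real^'n) \<in> borel_measurable borel"
      by (intro borel_measurable_continuous_onI continuous_on_fst continuous_on_id)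
    then show "g \<in> borel_measurable ?U" unfolding g_def[abs_def] by (rule measurable_compose[OF zm])
    show "AE x in ?U. norm (g x) \<le> norm (z x)" unfolding g_def by (intro AE_I2 nf)
  qed
  have gi: "integrable ?U (\<lambda>x. (norm (grad (fm k) x - g x))\<^sup>2)" for k
    by (intro L2_integrable L2_diff L2_test_fun tf g)
  have gle: "(\<integral>x. (norm (grad (fm k) x - g x))\<^sup>2 \<partial>?U) \<le> (\<integral>x. (norm (w (fm k) x - z x))\<^sup>2 \<partial>?U)" for k
  proof (rule integral_mono[OF gi L2_integrable[OF L2_diff[OF w[OF fm] z]]])
    fix x
    have "norm (grad (fm k) x - g x) \<le> norm (w (fm k) x - z x)"
      using norm_fst_le[of "grad (fm k) x - g x" "snd (w (fm k) x - z x)"] by (simp add: w_def g_def minus_prod_def)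
    then show "(norm (grad (fm k) x - g x))\<^sup>2 \<le> (norm (w (fm k) x - z x))\<^sup>2" by (intro power_mono) auto
  qed
  have glim: "(\<lambda>k. \<integral>x. (norm (grad (fm k) x - g x))\<^sup>2 \<partial>?U) \<longlonglongrightarrow> 0"
    by (rule Lim_null_comparison[OF always_eventually zlim]) (use gle in simp)
  \<comment> \<open>Lions' theorem gives convergence of gradients and of sqrt(c) times the
    functions; the functions themselves become a Cauchy sequence by Poincare's inequality.\<close>
  obtain Cp where Cp: "Cp \<ge> 0" "\<And>\<phi>. test_fun U \<phi> \<Longrightarrow> (\<integral>x. (\<phi> x)\<^sup>2 \<partial>?U) \<le> Cp * (\<integral>x. (norm (grad \<phi> x))\<^sup>2 \<partial>?U)"
    by (rule poincare_test_fun) blast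
  obtain u where u: "L2 ?U u" "(\<lambda>k. \<integral>x. (norm (fm k x - u x))\<^sup>2 \<partial>?U) \<longlonglongrightarrow> 0"
  proof (rule L2_complete[where f=fm and M="?U"])
    show "L2 ?U (fm k)" for k by (rule L2_test_fun(1)[OF tf])
    fix e :: real assume e: "e > 0"
    \<comment> \<open>The factor 4 comes from the squared triangle inequality for two gradients
      within \<open>e'\<close> of \<open>g\<close>; \<open>Cp + 1\<close> gives a strict inequality
      and covers \<open>Cp = 0\<close>.\<close>
    define e' where "e' = e / (4 * (Cp + 1))"
    have e': "e' > 0" using e Cp by (simp add: e'_def)
    obtain N where N: "\<And>k. k \<ge> N \<Longrightarrow> (\<integral>x. (norm (grad (fm k) x - g x))\<^sup>2 \<partial>?U) < e'"
      using order_tendstoD(2)[OF glim e'] by (auto simp: eventually_sequentially)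
    have "(\<integral>x. (norm (fm k x - fm j x))\<^sup>2 \<partial>?U) < e" if "k \<ge> N" "j \<ge> N" for k j
    proof -
      have cm: "comb 1 (fm k) (-1) (fm j) \<in> S" by (rule Scomb[OF fm fm])
      have "(\<integral>x. (norm (fm k x - fm j x))\<^sup>2 \<partial>?U) = (\<integral>x. (comb 1 (fm k) (-1) (fm j) x)\<^sup>2 \<partial>?U)" by (simp add: comb_def)
      also have "\<dots> \<le> Cp * (\<integral>x. (norm (grad (comb 1 (fm k) (-1) (fm j)) x))\<^sup>2 \<partial>?U)" using cm by (intro Cp) (simp add: S_def)
      also have "(\<integral>x. (norm (grad (comb 1 (fm k) (-1) (fm j)) x))\<^sup>2 \<partial>?U) = (\<integral>x. (norm (grad (fm k) x - grad (fm j) x))\<^sup>2 \<partial>?U)"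
        by (simp add: gcomb[OF fm fm])
      finally have 1: "(\<integral>x. (norm (fm k x - fm j x))\<^sup>2 \<partial>?U) \<le> Cp * (\<integral>x. (norm (grad (fm k) x - grad (fm j) x))\<^sup>2 \<partial>?U)" .
      have "(\<integral>x. (norm (grad (fm k) x - grad (fm j) x))\<^sup>2 \<partial>?U) \<le> 2 * (\<integral>x. (norm (grad (fm k) x - g x))\<^sup>2 \<partial>?U) + 2 * (\<integral>x. (norm (g x - grad (fm j) x))\<^sup>2 \<partial>?U)"
        by (intro L2_dist_sq_triangle L2_test_fun(2) tf g)
      also have "\<dots> \<le> 4 * e'" using N[OF that(1)] N[OF that(2)] by (simp add: norm_minus_commute)
      finally have "Cp * (\<integral>x. (norm (grad (fm k) x - grad (fm j) x))\<^sup>2 \<partial>?U) \<le> Cp * (4 * e')" by (rule mult_left_mono[OF _ Cp(1)])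
      also have "\<dots> < (Cp + 1) * (4 * e')" using e' by (intro mult_strict_right_mono) auto
      also have "\<dots> = e"
      proof -
        have "Cp + 1 \<noteq> 0" using Cp(1) by linarith
        then show ?thesis unfolding e'_def by (simp only: times_divide_eq_right mult.assoc[symmetric]) (simp add: mult.commute)
      qed
      finally show ?thesis using 1 by linarith
    qed
    then show "\<exists>N. \<forall>k\<ge>N. \<forall>j\<ge>N. (\<integral>x. (norm (fm k x - fm j x))\<^sup>2 \<partial>?U) < e" by blast
  qed blast
  \<comment> \<open>Convergence almost everywhere along one subsequence of the functions together
    with their images under \<open>w\<close> identifies the second component of the limit.\<close>
  have su: "AE x in ?U. snd (z x) = s x * u x"
  proof -
    have eq: "(\<integral>x. (norm ((fm k x, w (fm k) x) - (u x, z x)))\<^sup>2 \<partial>?U) = (\<integral>x. (norm (fm k x - u x))\<^sup>2 \<partial>?U) + (\<integral>x. (norm (w (fm k) x - z x))\<^sup>2 \<partial>?U)" for k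
      using L2_integrable[OF L2_diff[OF L2_test_fun(1)[OF tf] u(1)]] L2_integrable[OF L2_diff[OF w[OF fm] z]]
      by (simp add: norm_Pair)
    have lim: "(\<lambda>k. \<integral>x. (norm ((fm k x, w (fm k) x) - (u x, z x)))\<^sup>2 \<partial>?U) \<longlonglongrightarrow> 0"
      unfolding eq using tendsto_add[OF u(2) zlim] by simp
    obtain r where r: "AE x in ?U. (\<lambda>k. (fm (r k) x, w (fm (r k)) x)) \<longlonglongrightarrow> (u x, z x)"
      by (rule L2_dominated_subsequence[OF L2_pair[OF L2_test_fun(1)[OF tf] w[OF fm]] L2_pair[OF u(1) z] lim]) (rule that; assumption)
    show ?thesis using r
    proof eventually_elim
      case (elim x)
      have "(\<lambda>k. fm (r k) x) \<longlonglongrightarrow> u x" using tendsto_fst[OF elim] by simp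
      then have "(\<lambda>k. s x * fm (r k) x) \<longlonglongrightarrow> s x * u x" by (rule tendsto_mult_left)
      moreover have "(\<lambda>k. snd (w (fm (r k)) x)) \<longlonglongrightarrow> snd (z x)" using tendsto_snd[OF tendsto_snd[OF elim]] by simp
      ultimately show ?case unfolding w_def using LIMSEQ_unique by simp
    qed
  qed
  have L2su: "L2 ?U (\<lambda>x. s x * u x)"
  proof (rule L2_bound[OF z])
    show "(\<lambda>x. s x * u x) \<in> borel_measurable ?U" using sm L2_measurable[OF u(1)] by (rule borel_measurable_times)
    show "AE x in ?U. norm (s x * u x) \<le> norm (z x)"
      using su by eventually_elim (use nf(2) in metis)
  qed
  \<comment> \<open>The product is sqrt(c) times sqrt(c) u, both factors square-integrable: the
    first since \<open>c\<close> is integrable, the second by the energy bound.\<close>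
  have cu: "integrable ?U (\<lambda>x. c x * u x)"
  proof -
    have "integrable ?U (\<lambda>x. s x * (s x * u x))" by (rule L2_mult_integrable[OF L2s L2su])
    moreover have "AE x in ?U. s x * (s x * u x) = c x * u x" using s2 by eventually_elim (simp only: mult.assoc[symmetric])
    moreover have "(\<lambda>x. c x * u x) \<in> borel_measurable ?U" using cm L2_measurable[OF u(1)] by (rule borel_measurable_times)
    ultimately show ?thesis
      using integrable_cong_AE[of "\<lambda>x. s x * (s x * u x)" ?U "\<lambda>x. c x * u x"] borel_measurable_integrable by blast
  qed
  have weak: "(\<integral>x. E u g \<psi> x \<partial>?U) = (\<integral>x. f x * (\<rho> x * \<psi> x) \<partial>?U)" if \<psi>: "test_fun U \<psi>" for \<psi>
  proof -
    have "\<psi> \<in> S" using \<psi> by (simp add: S_def)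
    have "(\<integral>x. E u g \<psi> x \<partial>?U) = (\<integral>x. z x \<bullet> G \<psi> x \<partial>?U)"
    proof (rule integral_cong_AE)
      show "E u g \<psi> \<in> borel_measurable ?U"
        by (rule E_measurable[OF L2_measurable[OF g] borel_measurable_integrable[OF cu] \<psi>])
      show "(\<lambda>x. z x \<bullet> G \<psi> x) \<in> borel_measurable ?U"
        by (rule borel_measurable_integrable[OF L2_inner_integrable[OF z G[OF \<open>\<psi> \<in> S\<close>]]])
      show "AE x in ?U. E u g \<psi> x = z x \<bullet> G \<psi> x"
        using su s2
      proof eventually_elim
        case (elim x)
        have "z x = (g x, s x * u x)" using elim(1) by (simp add: g_def prod_eq_iff)
        then show ?case unfolding E_def using zG[of "g x" x "u x" \<psi>] elim(2) by simp
      qed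
    qed
    then show ?thesis using zweak[OF \<open>\<psi> \<in> S\<close>] unfolding l_def by simp
  qed
  have gb: "(\<integral>x. (norm (g x))\<^sup>2 \<partial>?U) \<le> (C / (m * min lam 1))\<^sup>2"
  proof -
    have "(\<integral>x. (norm (g x))\<^sup>2 \<partial>?U) \<le> (\<integral>x. (norm (z x))\<^sup>2 \<partial>?U)"
    proof (rule integral_mono[OF L2_integrable[OF g] L2_integrable[OF z]])
      show "(norm (g x))\<^sup>2 \<le> (norm (z x))\<^sup>2" for x
        unfolding g_def by (intro power_mono nf) auto
    qed
    then show ?thesis using zb unfolding \<alpha>_def by linarith
  qed
  have H12: "H12 U u g"
    unfolding H12_def
  proof (intro conjI allI impI)
    show "Lp U 2 u" using u(1) by (simp add: Lp_def L2_def)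
    show "LpV U 2 g" using g by (simp add: LpV_def L2_def)
    fix \<phi> i assume \<phi>: "test_fun U \<phi>"
    have d: "L2 ?U (dpart i \<phi>)"
    proof (rule L2_bound[OF L2_test_fun(2)[OF \<phi>]])
      show "dpart i \<phi> \<in> borel_measurable ?U"
        by (intro borel_measurable_lebesgue_onI borel_measurable_continuous_onI continuous_on_smooth smooth_fun_dpart test_funD(1)[OF \<phi>])
      show "AE x in ?U. norm (dpart i \<phi> x) \<le> norm (grad \<phi> x)"
      proof (rule AE_I2)
        show "norm (dpart i \<phi> x) \<le> norm (grad \<phi> x)" for x
          using component_le_norm_cart[of "grad \<phi> x" i] by (simp add: grad_def)
      qed
    qed
    have e: "L2 ?U (\<lambda>x. \<phi> x *\<^sub>R (axis i 1 :: real^'n))"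
    proof (rule L2_bound[OF L2_test_fun(1)[OF \<phi>]])
      show "(\<lambda>x. \<phi> x *\<^sub>R (axis i 1 :: real^'n)) \<in> borel_measurable ?U" using test_fun_measurable(1)[OF \<phi>] by measurable
    qed simp
    have "(\<lambda>k. \<integral>x. fm k x \<bullet> dpart i \<phi> x \<partial>?U) \<longlonglongrightarrow> (\<integral>x. u x \<bullet> dpart i \<phi> x \<partial>?U)"
      by (rule L2_inner_tendsto[OF L2_test_fun(1)[OF tf] u(1) d u(2)])
    moreover have "(\<lambda>k. - (\<integral>x. grad (fm k) x \<bullet> (\<phi> x *\<^sub>R axis i 1) \<partial>?U)) \<longlonglongrightarrow> - (\<integral>x. g x \<bullet> (\<phi> x *\<^sub>R axis i 1) \<partial>?U)"
      by (intro tendsto_minus L2_inner_tendsto[OF L2_test_fun(2)[OF tf] g e glim])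
    moreover have "(\<integral>x. fm k x \<bullet> dpart i \<phi> x \<partial>?U) = - (\<integral>x. grad (fm k) x \<bullet> (\<phi> x *\<^sub>R axis i 1) \<partial>?U)" for k
      using test_fun_integration_by_parts[OF tf \<phi> U_sets] by (simp add: inner_axis mult.commute)
    ultimately have "(\<integral>x. u x \<bullet> dpart i \<phi> x \<partial>?U) = - (\<integral>x. g x \<bullet> (\<phi> x *\<^sub>R axis i 1) \<partial>?U)"
      using LIMSEQ_unique by simp
    then show "(\<integral>x. u x * dpart i \<phi> x \<partial>?U) = - (\<integral>x. g x $ i * \<phi> x \<partial>?U)"
      by (simp add: inner_axis mult.commute)
  qed
  have "H012 U u g"
    unfolding H012_def
  proof (intro conjI exI[of _ fm] allI H12 tf glim)
    show "(\<lambda>k. \<integral>x. (fm k x - u x)\<^sup>2 \<partial>?U) \<longlonglongrightarrow> 0" using u(2) by simp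
  qed
  then show ?thesis using that cu weak gb by blast
qed

end

section \<open>Uniqueness and the sup bound\<close>

text \<open>The j-th derivative of a smooth substitute for truncating s - a between 0 and b - a: it
  vanishes for s \<le> a, stays below (b-a)/4, has slope between 0 and 1, and is at least (b-a)/(4e)
  for s \<ge> b. The factor 1/4 compensates the bound 4 on the derivative of exp(-1/t).\<close>

definition trunc_deriv :: "real \<Rightarrow> real \<Rightarrow> nat \<Rightarrow> real \<Rightarrow> real" where
  "trunc_deriv a b j s = (b - a) / 4 * (flat_deriv j ((s - a) / (b - a)) / (b - a) ^ j)"

lemma trunc_deriv:
  assumes "a < b"
  shows "(trunc_deriv a b j has_real_derivative trunc_deriv a b (Suc j) s) (at s)"
proof -
  have "((\<lambda>s. flat_deriv j ((s - a) / (b - a))) has_real_derivative flat_deriv (Suc j) ((s - a) / (b - a)) * (1 / (b - a))) (at s)"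
    by (rule DERIV_chain2[OF flat_deriv]) (use assms in \<open>auto intro!: derivative_eq_intros\<close>)
  then have "((\<lambda>s. (b - a) / 4 * (flat_deriv j ((s - a) / (b - a)) / (b - a) ^ j)) has_real_derivative
      (b - a) / 4 * (flat_deriv (Suc j) ((s - a) / (b - a)) * (1 / (b - a)) / (b - a) ^ j)) (at s)"
    by (intro DERIV_cmult DERIV_cdivide)
  moreover have "(b - a) / 4 * (flat_deriv (Suc j) ((s - a) / (b - a)) * (1 / (b - a)) / (b - a) ^ j) = trunc_deriv a b (Suc j) s"
    by (simp add: trunc_deriv_def)
  ultimately show ?thesis unfolding trunc_deriv_def[abs_def] by simp
qed

lemma trunc_0:
  assumes "a < b"
  shows "trunc_deriv a b 0 s = (if a < s then (b - a) / 4 * exp (- ((b - a) / (s - a))) else 0)"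
  using assms by (auto simp: trunc_deriv_def flat_deriv_0 zero_less_divide_iff)

lemma square_le_4_exp: "0 \<le> x \<Longrightarrow> x\<^sup>2 \<le> 4 * exp (x::real)"
proof -
  assume x: "0 \<le> x"
  have "x / 2 \<le> exp (x / 2)" using exp_ge_add_one_self[of "x / 2"] by linarith
  then have "(x / 2)\<^sup>2 \<le> (exp (x / 2))\<^sup>2" using x by (intro power_mono) auto
  also have "\<dots> = exp x" by (simp add: power2_eq_square flip: exp_add)
  finally show ?thesis by (simp add: power_divide)
qed

lemma trunc_1_bounds:
  assumes "a < b"
  shows "0 \<le> trunc_deriv a b 1 s \<and> trunc_deriv a b 1 s \<le> 1"
proof -
  have f1: "flat_deriv 1 t = (if t > 0 then (1 / t)\<^sup>2 * exp (- (1 / t)) else 0)" for t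
    by (simp add: flat_deriv_def flat_exp_def power2_eq_square)
  have fb: "0 \<le> flat_deriv 1 t \<and> flat_deriv 1 t \<le> 4" for t
  proof (cases "t > 0")
    case True
    have "(1 / t)\<^sup>2 * exp (- (1 / t)) \<le> 4 * exp (1 / t) * exp (- (1 / t))"
      using square_le_4_exp[of "1 / t"] True by (intro mult_right_mono) auto
    also have "\<dots> = 4" by (simp add: mult.assoc flip: exp_add)
    finally show ?thesis using True by (simp only: f1) simp
  next
    case False
    then show ?thesis by (simp only: f1) simp
  qed
  have "trunc_deriv a b 1 s = flat_deriv 1 ((s - a) / (b - a)) / 4"
  proof -
    have *: "x / 4 * (t / x ^ 1) = t / 4" if "x \<noteq> 0" for x t :: real using that by simp
    show ?thesis unfolding trunc_deriv_def by (rule *) (use assms in simp)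
  qed
  then show ?thesis using fb[of "(s - a) / (b - a)"] by linarith
qed

text \<open>Along the levels D (1 - 2^(-n)) the values of \<open>B\<close> decay at least like
  \<open>B0 * r ^ n\<close>. The spacing of the levels costs a factor of order 2^n, which the
  superlinear power \<beta> compensates; the condition on \<open>D\<close> is what the inductive
  step requires.\<close>

lemma stampacchia_iteration:
  fixes B :: "real \<Rightarrow> real"
  assumes step: "\<And>a b. 0 \<le> a \<Longrightarrow> a < b \<Longrightarrow> (b - a) * B b \<le> K * B a powr \<beta>"
    and B: "\<And>t. 0 \<le> B t" "B 0 \<le> B0" and \<beta>: "1 < \<beta>" and K: "0 \<le> K" and B0: "0 \<le> B0"
    and D: "0 < D" "2 * K * B0 powr (\<beta> - 1) * 2 powr (1 / (\<beta> - 1)) \<le> D"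
  shows "(\<lambda>n. B (D * (1 - (1/2)^n))) \<longlonglongrightarrow> 0"
proof -
  \<comment> \<open>The ratio is chosen such that r^(\<beta>-1) = 1/2, which cancels the 2^n coming
    from the level spacing.\<close>
  define r where "r = 2 powr (- (1 / (\<beta> - 1)))"
  have r: "0 < r" "r < 1" using \<beta> by (auto simp: r_def powr_less_one)
  have "- (1 / (\<beta> - 1)) * (\<beta> - 1) = -1" using \<beta> by simp
  then have rb: "r powr (\<beta> - 1) = 1/2" unfolding r_def powr_powr by (simp only: powr_minus powr_one_gt_zero_iff) simp
  have rr: "r * 2 powr (1 / (\<beta> - 1)) = 1" by (simp add: r_def powr_minus)
  define k where "k n = D * (1 - (1/2)^n)" for n :: nat
  have Dr: "2 * K * B0 powr (\<beta> - 1) \<le> D * r"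
  proof -
    have "2 * K * B0 powr (\<beta> - 1) = (2 * K * B0 powr (\<beta> - 1) * 2 powr (1 / (\<beta> - 1))) * r" using rr by (simp add: ac_simps)
    also have "\<dots> \<le> D * r" using r D by (intro mult_right_mono) auto
    finally show ?thesis .
  qed
  have claim: "B (k n) \<le> B0 * r ^ n" for n
  proof (induction n)
    case 0 then show ?case using B by (simp add: k_def)
  next
    case (Suc n)
    have k0: "0 \<le> k n" using D by (auto simp: k_def power_le_one)
    have kd: "k (Suc n) - k n = D / (2 * 2^n)" by (simp add: k_def algebra_simps power_one_over)
    then have klt: "k n < k (Suc n)" using D by (smt (verit) divide_pos_pos zero_less_power)
    have rn: "(r ^ n) powr (\<beta> - 1) = 1 / 2 ^ n"
    proof -
      have "(r ^ n) powr (\<beta> - 1) = (r powr (\<beta> - 1)) ^ n"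
        using r by (simp add: powr_powr mult.commute flip: powr_realpow)
      then show ?thesis using rb by (simp add: power_one_over)
    qed
    have "D / (2 * 2^n) * B (k (Suc n)) \<le> K * B (k n) powr \<beta>" using step[OF k0 klt] kd by simp
    also have "\<dots> \<le> K * (B0 * r ^ n) powr \<beta>" using Suc B \<beta> K by (intro mult_left_mono powr_mono2) auto
    also have "(B0 * r ^ n) powr \<beta> = (B0 * r ^ n) powr (\<beta> - 1) * (B0 * r ^ n)"
    proof (cases "B0 = 0")
      case False
      then have "0 < B0 * r ^ n" using B0 r by simp
      moreover have "(B0 * r ^ n) powr (\<beta> - 1 + 1) = (B0 * r ^ n) powr (\<beta> - 1) * (B0 * r ^ n) powr 1" by (rule powr_add)
      ultimately show ?thesis by simp
    qed simp
    also have "(B0 * r ^ n) powr (\<beta> - 1) = B0 powr (\<beta> - 1) * (1 / 2^n)"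
      using B0 r by (simp add: powr_mult rn)
    finally have "D / (2 * 2^n) * B (k (Suc n)) \<le> K * (B0 powr (\<beta> - 1) * (1 / 2^n) * (B0 * r ^ n))" .
    then have "2 * 2^n * (D / (2 * 2^n) * B (k (Suc n))) \<le> 2 * 2^n * (K * (B0 powr (\<beta> - 1) * (1 / 2^n) * (B0 * r ^ n)))"
      by (rule mult_left_mono) simp
    then have "D * B (k (Suc n)) \<le> (2 * K * B0 powr (\<beta> - 1)) * (B0 * r ^ n)" by (simp add: field_simps)
    also have "\<dots> \<le> (D * r) * (B0 * r ^ n)" using Dr B0 r by (intro mult_right_mono) auto
    also have "\<dots> = D * (B0 * r ^ Suc n)" by simp
    finally show ?case using D by (simp add: mult_le_cancel_left_pos)
  qed
  have "(\<lambda>n. B0 * r ^ n) \<longlonglongrightarrow> B0 * 0" using r by (intro tendsto_mult_left LIMSEQ_power_zero) auto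
  then have l0: "(\<lambda>n. B0 * r ^ n) \<longlonglongrightarrow> 0" by simp
  have "(\<lambda>n. B (k n)) \<longlonglongrightarrow> 0"
    by (rule Lim_null_comparison[OF always_eventually l0]) (use claim B in auto)
  then show ?thesis unfolding k_def .
qed

section \<open>Weak solutions, uniqueness and the bound on superlevel sets\<close>

context elliptic begin

lemma H012_minus:
  assumes "H012 U u g"
  shows "H012 U (\<lambda>x. - u x) (\<lambda>x. - g x)"
proof -
  obtain \<phi> where \<phi>: "\<And>k::nat. test_fun U (\<phi> k)" "(\<lambda>k. \<integral>x. (\<phi> k x - u x)\<^sup>2 \<partial>lebesgue_on U) \<longlonglongrightarrow> 0"
    "(\<lambda>k. \<integral>x. (norm (grad (\<phi> k) x - g x))\<^sup>2 \<partial>lebesgue_on U) \<longlonglongrightarrow> 0"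
    using assms unfolding H012_def by blast
  have t: "test_fun U (\<lambda>x. - \<phi> k x)" for k 
  proof -
    have "test_fun U (\<lambda>x. (-1) * \<phi> k x + 0 * \<phi> k x)" by (rule test_fun_lincomb[OF \<phi>(1) \<phi>(1)])
    then show ?thesis by simp
  qed
  have gr: "grad (\<lambda>x. - \<phi> k x) x = - grad (\<phi> k) x" for k x
  proof -
    have "grad (\<lambda>x. (-1) * \<phi> k x + 0 * \<phi> k x) x = (-1) *\<^sub>R grad (\<phi> k) x + 0 *\<^sub>R grad (\<phi> k) x"
      by (rule grad_lincomb[OF test_funD(2)[OF \<phi>(1)] test_funD(2)[OF \<phi>(1)]])
    then show ?thesis by simp
  qed
  have "(- \<phi> k x - - u x)\<^sup>2 = (\<phi> k x - u x)\<^sup>2" for k x by (simp add: power2_commute)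
  moreover have "norm (- grad (\<phi> k) x - - g x) = norm (grad (\<phi> k) x - g x)" for k x by (metis minus_diff_eq minus_diff_minus norm_minus_cancel)
  moreover have "H12 U (\<lambda>x. - u x) (\<lambda>x. - g x)"
    using assms unfolding H012_def H12_def by (auto simp: Lp_def LpV_def)
  ultimately show ?thesis unfolding H012_def using \<phi> t gr by (intro conjI exI[of _ "\<lambda>k x. - \<phi> k x"]) simp_all
qed

lemma E_minus: "E (\<lambda>x. - u x) (\<lambda>x. - g x) \<psi> x = - E u g \<psi> x"
proof -
  have "A x *v (- g x) = - (A x *v g x)" using matrix_vector_mult_scaleR[of "A x" "-1" "g x"] by simp
  then show ?thesis unfolding E_def by simp
qed

text \<open>Stated for the weighted form, on which all estimates rest, and including the
  integrability of \<open>c x * u x\<close>, which membership in \<open>H012\<close> does not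
  contain.\<close>

definition weak_sol :: "(real^'n \<Rightarrow> real) \<Rightarrow> (real^'n \<Rightarrow> real) \<Rightarrow> (real^'n \<Rightarrow> real^'n) \<Rightarrow> bool" where
  "weak_sol f u g \<longleftrightarrow> H012 U u g \<and> integrable (lebesgue_on U) (\<lambda>x. c x * u x) \<and>
    (\<forall>\<psi>. test_fun U \<psi> \<longrightarrow> (\<integral>x. E u g \<psi> x \<partial>lebesgue_on U) = (\<integral>x. f x * (\<rho> x * \<psi> x) \<partial>lebesgue_on U))"

lemma weak_sol_minus:
  assumes "weak_sol f u g"
  shows "weak_sol (\<lambda>x. - f x) (\<lambda>x. - u x) (\<lambda>x. - g x)"
  using assms H012_minus[of u g] unfolding weak_sol_def E_minus by simp

lemma level_estimate:
  assumes sol: "weak_sol f u g" and f: "integrable (lebesgue_on U) f" and ab: "0 \<le> a" "a < b"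
  defines "q \<equiv> 2 * real CARD('n) / (real CARD('n) - 2)" and "\<gamma> \<equiv> 2 * (real CARD('n) - 1) / (real CARD('n) - 2)"
  shows "((\<integral>x. \<bar>trunc_deriv a b 0 (u x)\<bar> powr q \<partial>lebesgue_on U) powr (1 / q))\<^sup>2
     \<le> \<gamma>\<^sup>2 * (Mx / (m * lam)) * (\<integral>x. \<bar>f x\<bar> * \<bar>trunc_deriv a b 0 (u x)\<bar> \<partial>lebesgue_on U)"
  unfolding q_def \<gamma>_def
proof (rule energy_inequality[where D="trunc_deriv a b" and N="(b - a) / 4"])
  show "trunc_deriv a b 0 0 = 0" "\<bar>trunc_deriv a b 0 s\<bar> \<le> (b - a) / 4" "0 \<le> s * trunc_deriv a b 0 s" for s
  proof -
    have "exp (- ((b - a) / (s - a))) \<le> 1" if "a < s" using that ab by simp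
    then have "(b - a) / 4 * exp (- ((b - a) / (s - a))) \<le> (b - a) / 4 * 1" if "a < s"
      using that ab by (intro mult_left_mono) auto
    then show "\<bar>trunc_deriv a b 0 s\<bar> \<le> (b - a) / 4" using ab by (simp add: trunc_0)
  qed (use ab in \<open>auto simp: trunc_0\<close>)
qed (use sol f trunc_deriv[OF ab(2)] trunc_1_bounds[OF ab(2)] in \<open>auto simp: weak_sol_def\<close>)

text \<open>Without a source the energy inequality for the truncation at level zero has right side
  zero, so the truncation, positive exactly where u > 0, vanishes almost everywhere.\<close>

lemma weak_sol_0_nonpos:
  assumes sol: "weak_sol (\<lambda>x. 0) u g"
  shows "AE x in lebesgue_on U. u x \<le> 0"
proof -
  let ?U = "lebesgue_on U" and ?q = "2 * real CARD('n) / (real CARD('n) - 2)"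
  interpret U: finite_measure ?U by (rule finite_measure_U)
  have q: "?q > 0" using dim by simp
  have um: "u \<in> borel_measurable ?U" using sol H012_L2(1) L2_measurable unfolding weak_sol_def by blast
  let ?y = "\<lambda>x. trunc_deriv 0 1 0 (u x)"
  have "((\<integral>x. \<bar>?y x\<bar> powr ?q \<partial>?U) powr (1 / ?q))\<^sup>2 \<le> 0"
    using level_estimate[OF sol, of 0 1] by simp
  then have "(\<integral>x. \<bar>?y x\<bar> powr ?q \<partial>?U) = 0" by (simp add: powr_eq_0_iff)
  moreover have "integrable ?U (\<lambda>x. \<bar>?y x\<bar> powr ?q)"
  proof (rule U.integrable_const_bound[of _ 1])
    have yb: "\<bar>?y x\<bar> \<le> 1" for x
    proof -
      have "exp (- (1 / u x)) \<le> 1" if "0 < u x" using that by simp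
      then have "exp (- (1 / u x)) \<le> 4" if "0 < u x" using that by (meson order_trans one_le_numeral)
      then show ?thesis by (simp add: trunc_0)
    qed
    have "\<bar>?y x\<bar> powr ?q \<le> 1 powr ?q" for x using yb q by (intro powr_mono2) auto
    then show "AE x in ?U. norm (\<bar>?y x\<bar> powr ?q) \<le> 1" by simp
    have "(\<lambda>s. trunc_deriv 0 1 0 s) \<in> borel_measurable borel"
      using DERIV_isCont[OF trunc_deriv[of 0 1 0]] by (intro borel_measurable_continuous_onI) (simp add: continuous_on_eq_continuous_at)
    from measurable_compose[OF um this] show "(\<lambda>x. \<bar>?y x\<bar> powr ?q) \<in> borel_measurable ?U" by measurable
  qed
  ultimately have "AE x in ?U. \<bar>?y x\<bar> powr ?q = 0" by (subst (asm) integral_nonneg_eq_0_iff_AE) auto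
  then show ?thesis
  proof eventually_elim
    case (elim x)
    then have "?y x = 0" by simp
    then show ?case by (cases "0 < u x") (simp_all add: trunc_0)
  qed
qed

lemma weak_sol_unique:
  assumes "weak_sol (\<lambda>x. 0) u g"
  shows "AE x in lebesgue_on U. u x = 0"
proof -
  have "weak_sol (\<lambda>x. 0) (\<lambda>x. - u x) (\<lambda>x. - g x)" using weak_sol_minus[OF assms] by simp
  from weak_sol_0_nonpos[OF this] have "AE x in lebesgue_on U. - u x \<le> 0" .
  with weak_sol_0_nonpos[OF assms] show ?thesis by eventually_elim simp
qed

text \<open>\<open>B t\<close> is the measure of the set where u > t, to the power 1/q. Hoelder for
  \<open>f\<close>, the truncation and the indicator of the level set bounds the norm of the
  truncation by a power of the measure at level \<open>a\<close>, while its lower bound above level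
  \<open>b\<close> gives \<open>B b\<close>. The result is Stampacchia's recursion with exponent
  \<beta>.\<close>

lemma sup_bound_above:
  assumes sol: "weak_sol f u g" and f: "integrable (lebesgue_on U) f"
    and p: "real CARD('n) / 2 < p" and fp: "integrable (lebesgue_on U) (\<lambda>x. \<bar>f x\<bar> powr p)"
    and KM: "Mx \<le> K1 * m"
  defines "q \<equiv> 2 * real CARD('n) / (real CARD('n) - 2)" and "\<gamma> \<equiv> 2 * (real CARD('n) - 1) / (real CARD('n) - 2)"
  defines "\<beta> \<equiv> q * (1 - 1 / p - 1 / q)" 
  assumes D: "0 < D" "2 * (4 * exp 1 * (\<gamma>\<^sup>2 * (K1 / lam)) * (\<integral>x. \<bar>f x\<bar> powr p \<partial>lebesgue_on U) powr (1 / p))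
      * (measure lebesgue U powr (1 / q)) powr (\<beta> - 1) * 2 powr (1 / (\<beta> - 1)) \<le> D"
  shows "AE x in lebesgue_on U. u x \<le> D"
proof -
  let ?U = "lebesgue_on U" and ?d = "real CARD('n)"
  interpret U: finite_measure ?U by (rule finite_measure_U)
  have d: "?d \<ge> 3" using dim by simp
  have q: "q > 2" using d by (simp add: q_def field_simps)
  have p1: "p > 1" using p d by simp
  define \<theta> where "\<theta> = 1 - 1 / p - 1 / q"
  have ip: "1 / p < 2 / ?d" using p d by (simp add: field_simps)
  have iq: "1 / q = 1/2 - 1 / ?d" using d by (simp add: q_def field_simps)
  \<comment> \<open>Here p > d/2 enters: since 1 - 2/q = 2/d, the claim is equivalent to 1/p < 2/d.
    It says that \<beta> = q \<theta> exceeds one.\<close>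
  have \<theta>q: "\<theta> > 1 / q" unfolding \<theta>_def using ip iq by linarith
  then have \<theta>: "\<theta> > 0" using q by (smt (verit) divide_pos_pos)
  have \<beta>1: "\<beta> > 1" using \<theta>q q unfolding \<beta>_def \<theta>_def[symmetric] by (simp add: divide_less_eq mult.commute)
  have um: "u \<in> borel_measurable ?U" using sol H012_L2(1) L2_measurable unfolding weak_sol_def by blast
  define N where "N = (\<integral>x. \<bar>f x\<bar> powr p \<partial>?U) powr (1 / p)"
  define \<Gamma> where "\<Gamma> = \<gamma>\<^sup>2 * (Mx / (m * lam))"
  have \<Gamma>: "0 \<le> \<Gamma>" "\<Gamma> \<le> \<gamma>\<^sup>2 * (K1 / lam)"
  proof -
    show "0 \<le> \<Gamma>" using m lam by (auto simp: \<Gamma>_def)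
    have "Mx / (m * lam) \<le> K1 / lam" using KM m lam by (simp add: field_simps)
    then show "\<Gamma> \<le> \<gamma>\<^sup>2 * (K1 / lam)" unfolding \<Gamma>_def by (intro mult_left_mono) auto
  qed
  define S where "S t = {x \<in> U. t < u x}" for t
  have Sm: "S t \<in> sets ?U" for t
  proof -
    have "{x \<in> space ?U. t < u x} \<in> sets ?U" using um by measurable
    then show ?thesis by (simp add: S_def)
  qed
  have iS: "integrable ?U (indicator (S t) :: real^'n \<Rightarrow> real)" for t
    by (rule integrable_real_indicator[OF Sm]) (simp add: top.not_eq_extremum[symmetric])
  have SU: "S t \<inter> U = S t" for t by (auto simp: S_def)
  define B where "B t = measure ?U (S t) powr (1 / q)" for t
  have step: "(b - a) * B b \<le> (4 * exp 1 * \<Gamma> * N) * B a powr \<beta>" if ab: "0 \<le> a" "a < b" for a b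
  proof -
    let ?y = "\<lambda>x. trunc_deriv a b 0 (u x)"
    have tm: "trunc_deriv a b 0 \<in> borel_measurable borel"
      using DERIV_isCont[OF trunc_deriv[OF ab(2), of 0]] by (intro borel_measurable_continuous_onI) (simp add: continuous_on_eq_continuous_at)
    have ym[measurable]: "?y \<in> borel_measurable ?U" by (rule measurable_compose[OF um tm])
    have yb: "\<bar>?y x\<bar> \<le> (b - a) / 4" for x
    proof -
      have "exp (- ((b - a) / (u x - a))) \<le> 1" if "a < u x" using that ab by simp
      then have "(b - a) / 4 * exp (- ((b - a) / (u x - a))) \<le> (b - a) / 4 * 1" if "a < u x"
        using that ab by (intro mult_left_mono) auto
      then show ?thesis using ab by (simp add: trunc_0)
    qed
    have yq: "integrable ?U (\<lambda>x. \<bar>?y x\<bar> powr q)"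
    proof (rule U.integrable_const_bound[of _ "((b - a) / 4) powr q"])
      show "AE x in ?U. norm (\<bar>?y x\<bar> powr q) \<le> ((b - a) / 4) powr q" using yb q by (intro AE_I2) (auto intro!: powr_mono2)
    qed measurable
    define Y where "Y = (\<integral>x. \<bar>?y x\<bar> powr q \<partial>?U) powr (1 / q)"
    have Y0: "Y \<ge> 0" by (simp add: Y_def)
    have 1: "Y\<^sup>2 \<le> \<Gamma> * (\<integral>x. \<bar>f x\<bar> * \<bar>?y x\<bar> \<partial>?U)"
      using level_estimate[OF sol f ab] unfolding Y_def \<Gamma>_def q_def \<gamma>_def .
    have 2: "(\<integral>x. \<bar>f x\<bar> * \<bar>?y x\<bar> \<partial>?U) \<le> N * Y * measure ?U (S a) powr \<theta>"
    proof -
      \<comment> \<open>Three-factor Hoelder with exponents 1/p, 1/q and \<theta>. The indicator may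
        be inserted because the truncation vanishes where u \<le> a.\<close>
      define G :: "nat \<Rightarrow> real^'n \<Rightarrow> real" where
        "G i = (if i = 0 then (\<lambda>x. \<bar>f x\<bar> powr p) else if i = 1 then (\<lambda>x. \<bar>?y x\<bar> powr q) else indicator (S a))" for i
      define e :: "nat \<Rightarrow> real" where "e i = (if i = 0 then 1 / p else if i = 1 then 1 / q else \<theta>)" for i
      have I3: "{..<3::nat} = {0, 1, 2}" by auto
      have e0: "0 < e i" for i using p1 q \<theta> by (simp add: e_def)
      have e1: "(\<Sum>i\<in>{..<3}. e i) = 1" unfolding I3 by (simp add: e_def \<theta>_def)
      have Gi: "integrable ?U (G i)" for i using fp yq iS[of a] unfolding G_def by simp
      have G0: "0 \<le> G i x" for i x by (simp add: G_def)
      have eq: "(\<Prod>i\<in>{..<3}. G i x powr e i) = \<bar>f x\<bar> * \<bar>?y x\<bar>" if x: "x \<in> U" for x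
      proof -
        have "(\<Prod>i\<in>{..<3}. G i x powr e i) = (\<bar>f x\<bar> powr p) powr (1 / p) * ((\<bar>?y x\<bar> powr q) powr (1 / q) * indicator (S a) x powr \<theta>)"
          unfolding I3 by (simp add: G_def e_def)
        also have "(\<bar>f x\<bar> powr p) powr (1 / p) = \<bar>f x\<bar>" using p1 by (simp add: powr_powr)
        also have "(\<bar>?y x\<bar> powr q) powr (1 / q) = \<bar>?y x\<bar>" using q by (simp add: powr_powr)
        also have "\<bar>?y x\<bar> * indicator (S a) x powr \<theta> = \<bar>?y x\<bar>"
          using x ab by (cases "a < u x") (auto simp: S_def trunc_0)
        finally show ?thesis .
      qed
      have "(\<integral>x. \<bar>f x\<bar> * \<bar>?y x\<bar> \<partial>?U) = (\<integral>x. (\<Prod>i\<in>{..<3}. G i x powr e i) \<partial>?U)"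
        by (rule Bochner_Integration.integral_cong) (auto simp: eq)
      also have "\<dots> \<le> (\<Prod>i\<in>{..<3}. (\<integral>x. G i x \<partial>?U) powr e i)"
        by (rule integral_Holder(2)[OF _ _ e0 e1 Gi G0]) (simp_all add: I3)
      also have "\<dots> = N * Y * measure ?U (S a) powr \<theta>"
        unfolding I3 N_def Y_def using Sm[of a] by (simp add: G_def e_def SU)
      finally show ?thesis .
    qed
    have 3: "Y \<le> \<Gamma> * N * measure ?U (S a) powr \<theta>"
    proof (cases "Y = 0")
      case True
      then show ?thesis using \<Gamma> by (simp add: N_def)
    next
      case False
      have "Y * Y \<le> \<Gamma> * (N * Y * measure ?U (S a) powr \<theta>)"
        using 1 mult_left_mono[OF 2 \<Gamma>(1)] by (simp add: power2_eq_square)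
      also have "\<dots> = (\<Gamma> * N * measure ?U (S a) powr \<theta>) * Y" by simp
      finally show ?thesis by (rule mult_right_le_imp_le) (use False Y0 in auto)
    qed
    \<comment> \<open>The truncation at u = b equals (b-a)/4 times exp(-1), and it is increasing, so
      \<kappa> bounds it from below where u > b.\<close>
    define \<kappa> where "\<kappa> = (b - a) / (4 * exp 1)"
    have 4: "\<kappa> * B b \<le> Y"
    proof -
      have k0: "\<kappa> \<ge> 0" using ab by (simp add: \<kappa>_def)
      have yk: "\<kappa> \<le> \<bar>?y x\<bar>" if "x \<in> S b" for x
      proof -
        have "b < u x" using that by (simp add: S_def)
        then have "(b - a) / (u x - a) \<le> 1" using ab by simp
        then have "exp (- 1) \<le> exp (- ((b - a) / (u x - a)))" by simp
        then have "(b - a) / 4 * exp (- 1) \<le> (b - a) / 4 * exp (- ((b - a) / (u x - a)))" using ab by (intro mult_left_mono) auto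
        moreover have "(b - a) / 4 * exp (- 1) = \<kappa>" by (simp add: \<kappa>_def exp_minus inverse_eq_divide)
        moreover have "?y x = (b - a) / 4 * exp (- ((b - a) / (u x - a)))"
          using \<open>b < u x\<close> ab by (simp add: trunc_0)
        ultimately show ?thesis using abs_ge_self[of "?y x"] by linarith
      qed
      have "\<kappa> powr q * measure ?U (S b) = (\<integral>x. \<kappa> powr q * indicator (S b) x \<partial>?U)" using Sm[of b] by (simp add: SU)
      also have "\<dots> \<le> (\<integral>x. \<bar>?y x\<bar> powr q \<partial>?U)"
      proof (rule integral_mono[OF _ yq])
        show "integrable ?U (\<lambda>x. \<kappa> powr q * indicator (S b) x)" by (intro integrable_mult_right iS)
        show "\<kappa> powr q * indicator (S b) x \<le> \<bar>?y x\<bar> powr q" for x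
          using powr_mono2[OF _ k0 yk[of x], of q] q by (cases "x \<in> S b") auto
      qed
      finally have "(\<kappa> powr q * measure ?U (S b)) powr (1 / q) \<le> Y" unfolding Y_def using q by (intro powr_mono2) auto
      moreover have "(\<kappa> powr q * measure ?U (S b)) powr (1 / q) = \<kappa> * B b"
      proof -
        have "(\<kappa> powr q) powr (1 / q) = \<kappa>" using k0 q by (simp add: powr_powr)
        then show ?thesis unfolding B_def by (simp add: powr_mult)
      qed
      ultimately show ?thesis by simp
    qed
    have Bb: "B a powr \<beta> = measure ?U (S a) powr \<theta>"
      unfolding B_def \<beta>_def \<theta>_def[symmetric] using q by (simp add: powr_powr)
    have "4 * exp 1 * \<kappa> = b - a" by (simp add: \<kappa>_def)
    then have "(b - a) * B b = 4 * exp 1 * (\<kappa> * B b)" by (simp only: mult.assoc[symmetric])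
    also have "\<dots> \<le> 4 * exp 1 * (\<Gamma> * N * measure ?U (S a) powr \<theta>)" using 3 4 by (intro mult_left_mono) auto
    finally show ?thesis unfolding Bb by (simp only: mult.assoc)
  qed
  define B0 where "B0 = measure lebesgue U powr (1 / q)"
  have mU: "measure ?U (S t) \<le> measure lebesgue U" for t
  proof -
    have "measure ?U (S t) \<le> measure ?U (space ?U)" by (rule U.bounded_measure)
    also have "\<dots> = measure lebesgue U" using U_sets by (simp add: measure_restrict_space)
    finally show ?thesis .
  qed
  have D': "2 * (4 * exp 1 * \<Gamma> * N) * B0 powr (\<beta> - 1) * 2 powr (1 / (\<beta> - 1)) \<le> D"
  proof -
    have "4 * exp 1 * \<Gamma> * N \<le> 4 * exp 1 * (\<gamma>\<^sup>2 * (K1 / lam)) * N"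
      by (intro mult_right_mono mult_left_mono \<Gamma>) (auto simp: N_def)
    then have "2 * (4 * exp 1 * \<Gamma> * N) \<le> 2 * (4 * exp 1 * (\<gamma>\<^sup>2 * (K1 / lam)) * N)" by (rule mult_left_mono) simp
    then have "2 * (4 * exp 1 * \<Gamma> * N) * B0 powr (\<beta> - 1) * 2 powr (1 / (\<beta> - 1))
      \<le> 2 * (4 * exp 1 * (\<gamma>\<^sup>2 * (K1 / lam)) * N) * B0 powr (\<beta> - 1) * 2 powr (1 / (\<beta> - 1))"
      by (rule mult_right_mono[OF mult_right_mono]) auto
    then show ?thesis using D(2) unfolding N_def B0_def by linarith
  qed
  have "(\<lambda>n. B (D * (1 - (1/2)^n))) \<longlonglongrightarrow> 0"
  proof (rule stampacchia_iteration[OF step _ _ \<beta>1 _ _ D(1) D'])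
    show "B 0 \<le> B0" unfolding B_def B0_def using mU[of 0] q by (intro powr_mono2) auto
  qed (use \<Gamma> in \<open>auto simp: B_def B0_def N_def\<close>)
  \<comment> \<open>The level \<open>D\<close> lies above all iteration levels, so its superlevel
    set is contained in all of theirs and has measure zero in the limit.\<close>
  moreover have "B D \<le> B (D * (1 - (1/2)^n))" for n
  proof -
    have "D * (1 - (1/2)^n) \<le> D * 1" using D(1) by (intro mult_left_mono) auto
    then have "S D \<subseteq> S (D * (1 - (1/2)^n))" unfolding S_def by auto
    then have "measure ?U (S D) \<le> measure ?U (S (D * (1 - (1/2)^n)))" by (intro U.finite_measure_mono Sm)
    then show ?thesis unfolding B_def using q by (intro powr_mono2) auto
  qed
  ultimately have "B D \<le> 0" by (intro LIMSEQ_le_const) blast+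
  moreover have "B D \<ge> 0" by (simp add: B_def)
  ultimately have "B D = 0" by (rule antisym)
  then have "measure ?U (S D) = 0" unfolding B_def by simp
  then have "S D \<in> null_sets ?U" using Sm[of D] by (simp add: null_sets_def U.emeasure_eq_measure)
  then have "AE x in ?U. x \<notin> S D" by (rule AE_not_in)
  then show ?thesis using AE_space by eventually_elim (auto simp: S_def)
qed

end

section \<open>Inclusions between Lebesgue spaces, and the two norm estimates\<close>

lemma powr_le_one_plus:
  fixes x :: real
  assumes "0 \<le> x" "0 \<le> p" "p \<le> q"
  shows "x powr p \<le> 1 + x powr q"
proof (cases "x \<le> 1")
  case True
  have "x powr p \<le> 1 powr p" using assms True by (intro powr_mono2) auto
  then have "x powr p \<le> 1" by simp
  moreover have "0 \<le> x powr q" by simp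
  ultimately show ?thesis by linarith
next
  case False
  then have "x powr p \<le> x powr q" using assms by (intro powr_mono) auto
  then show ?thesis by simp
qed

text \<open>On a finite measure space the pointwise bound x^p \<le> 1 + x^q suffices.\<close>

lemma Lp_mono:
  assumes "finite_measure (lebesgue_on U)" "Lp U q f" "0 \<le> p" "p \<le> q"
  shows "Lp U p f"
proof -
  interpret finite_measure "lebesgue_on U" by fact
  have m: "f \<in> borel_measurable (lebesgue_on U)" and i: "integrable (lebesgue_on U) (\<lambda>x. \<bar>f x\<bar> powr q)"
    using assms(2) by (auto simp: Lp_def)
  have "integrable (lebesgue_on U) (\<lambda>x. \<bar>f x\<bar> powr p)"
  proof (rule Bochner_Integration.integrable_bound)
    show "integrable (lebesgue_on U) (\<lambda>x. 1 + \<bar>f x\<bar> powr q)" using i by simp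
    show "AE x in lebesgue_on U. norm (\<bar>f x\<bar> powr p) \<le> norm (1 + \<bar>f x\<bar> powr q)"
      using powr_le_one_plus[OF abs_ge_zero assms(3,4)] by (intro AE_I2) simp
  qed (use m in measurable)
  then show ?thesis using m by (simp add: Lp_def)
qed

lemma Lp_imp_integrable:
  assumes "finite_measure (lebesgue_on U)" "Lp U p f" "1 \<le> p"
  shows "integrable (lebesgue_on U) f"
proof -
  have "Lp U 1 f" using Lp_mono[OF assms(1,2)] assms(3) by simp
  then have "f \<in> borel_measurable (lebesgue_on U)" "integrable (lebesgue_on U) (\<lambda>x. \<bar>f x\<bar>)" by (auto simp: Lp_def)
  then show ?thesis by (simp add: integrable_abs_iff)
qed

context elliptic begin

text \<open>The exponents 2d/(d+2) and 2d/(d-2) are conjugate, so Hoelder and Sobolev bound the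
  functional by \<open>Mx * \<gamma> * N\<close> times the gradient norm. Dividing by the coercivity
  constant \<open>m * min lam 1\<close> leaves the ratio \<open>Mx / m\<close>, which
  \<open>K1\<close> bounds.\<close>

lemma solution_Lp:
  fixes f :: "real^'n \<Rightarrow> real"
  assumes f: "Lp U (2 * real CARD('n) / (real CARD('n) + 2)) f" and KM: "Mx \<le> K1 * m"
  defines "\<gamma> \<equiv> 2 * (real CARD('n) - 1) / (real CARD('n) - 2)"
  defines "N \<equiv> Lp_norm U (2 * real CARD('n) / (real CARD('n) + 2)) f"
  obtains u g where "weak_sol f u g" "\<And>\<psi>. test_fun U \<psi> \<Longrightarrow> bform U A H c u g \<psi> = (\<integral>x. f x * \<psi> x \<partial>lebesgue_on U)"
    "LpV_norm U 2 g \<le> K1 * \<gamma> / min lam 1 * N"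
    "Lp_norm U (2 * real CARD('n) / (real CARD('n) - 2)) u \<le> \<gamma> * (K1 * \<gamma> / min lam 1 * N)"
proof -
  let ?U = "lebesgue_on U" and ?d = "real CARD('n)"
  let ?p = "2 * ?d / (?d + 2)" and ?q = "2 * ?d / (?d - 2)"
  have d: "?d \<ge> 3" using dim by simp
  have pq: "1 < ?p" "1 < ?q" "1 / ?p + 1 / ?q = 1" using d by (auto simp: field_simps)
  have \<gamma>: "\<gamma> > 0" using d by (simp add: \<gamma>_def)
  have N0: "N \<ge> 0" by (simp add: N_def Lp_norm_def)
  have Mx: "Mx > 0" using m by linarith
  have fi: "integrable ?U f" by (rule Lp_imp_integrable[OF finite_measure_U f]) (use pq in simp)
  have fm: "f \<in> borel_measurable ?U" and fp: "integrable ?U (\<lambda>x. \<bar>f x\<bar> powr ?p)" using f by (auto simp: Lp_def)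
  have bound: "(\<integral>x. f x * (\<rho> x * \<phi> x) \<partial>?U)\<^sup>2 \<le> (Mx * \<gamma> * N)\<^sup>2 * (\<integral>x. (norm (grad \<phi> x))\<^sup>2 \<partial>?U)" if \<phi>: "test_fun U \<phi>" for \<phi>
  proof -
    have K: "compact (tsupport \<phi>)" "tsupport \<phi> \<subseteq> U" using \<phi> by (auto simp: test_fun_def)
    have \<phi>q: "integrable ?U (\<lambda>x. \<bar>\<phi> x\<bar> powr ?q)"
      using d by (intro compact_support_lborel(2)[OF _ K U_sets] continuous_on_powr' continuous_intros test_funD(3)[OF \<phi>]) (auto simp: tsupportD)
    note Ho = integral_Holder2[OF pq fm test_fun_measurable(1)[OF \<phi>] fp \<phi>q]
    have q1: "1 / ?q = (?d - 2) / (2 * ?d)" by simp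
    have "\<bar>\<integral>x. f x * (\<rho> x * \<phi> x) \<partial>?U\<bar> \<le> (\<integral>x. \<bar>f x * (\<rho> x * \<phi> x)\<bar> \<partial>?U)"
      using integral_norm_bound[of ?U "\<lambda>x. f x * (\<rho> x * \<phi> x)"] by (simp only: real_norm_def)
    also have "\<dots> \<le> (\<integral>x. Mx * \<bar>f x * \<phi> x\<bar> \<partial>?U)"
    proof (rule integral_mono_AE)
      show "integrable ?U (\<lambda>x. \<bar>f x * (\<rho> x * \<phi> x)\<bar>)" by (intro integrable_abs integrable_mult_\<rho>_test_fun fi \<phi>)
      show "integrable ?U (\<lambda>x. Mx * \<bar>f x * \<phi> x\<bar>)" by (intro integrable_mult_right integrable_abs Ho(1))
      show "AE x in ?U. \<bar>f x * (\<rho> x * \<phi> x)\<bar> \<le> Mx * \<bar>f x * \<phi> x\<bar>"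
        using \<rho>_abs_bound
      proof eventually_elim
        case (elim x)
        have "\<bar>f x * (\<rho> x * \<phi> x)\<bar> = \<bar>\<rho> x\<bar> * \<bar>f x * \<phi> x\<bar>" by (simp only: abs_mult ac_simps)
        then show ?case using mult_right_mono[OF elim, of "\<bar>f x * \<phi> x\<bar>"] by simp
      qed
    qed
    also have "\<dots> = Mx * (\<integral>x. \<bar>f x * \<phi> x\<bar> \<partial>?U)" by simp
    also have "\<dots> \<le> Mx * (N * (\<gamma> * sqrt (\<integral>x. (norm (grad \<phi> x))\<^sup>2 \<partial>?U)))"
    proof (rule mult_left_mono)
      have "(\<integral>x. \<bar>f x * \<phi> x\<bar> \<partial>?U) \<le> N * (\<integral>x. \<bar>\<phi> x\<bar> powr ?q \<partial>?U) powr (1 / ?q)"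
        using Ho(2) unfolding N_def Lp_norm_def .
      also have "\<dots> \<le> N * (\<gamma> * sqrt (\<integral>x. (norm (grad \<phi> x))\<^sup>2 \<partial>?U))"
        unfolding q1 \<gamma>_def by (intro mult_left_mono sobolev_test_fun[OF dim \<phi> U_sets] N0)
      finally show "(\<integral>x. \<bar>f x * \<phi> x\<bar> \<partial>?U) \<le> N * (\<gamma> * sqrt (\<integral>x. (norm (grad \<phi> x))\<^sup>2 \<partial>?U))" .
    qed (use Mx in simp)
    also have "\<dots> = (Mx * \<gamma> * N) * sqrt (\<integral>x. (norm (grad \<phi> x))\<^sup>2 \<partial>?U)" by (simp only: ac_simps)
    finally have "\<bar>\<integral>x. f x * (\<rho> x * \<phi> x) \<partial>?U\<bar>\<^sup>2 \<le> ((Mx * \<gamma> * N) * sqrt (\<integral>x. (norm (grad \<phi> x))\<^sup>2 \<partial>?U))\<^sup>2"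
      by (rule power_mono) simp
    moreover have "(sqrt (\<integral>x. (norm (grad \<phi> x))\<^sup>2 \<partial>?U))\<^sup>2 = (\<integral>x. (norm (grad \<phi> x))\<^sup>2 \<partial>?U)" by simp
    ultimately show ?thesis by (simp only: power2_abs power_mult_distrib)
  qed
  obtain u g where ug: "H012 U u g" "integrable ?U (\<lambda>x. c x * u x)"
    "\<And>\<psi>. test_fun U \<psi> \<Longrightarrow> (\<integral>x. E u g \<psi> x \<partial>?U) = (\<integral>x. f x * (\<rho> x * \<psi> x) \<partial>?U)"
    "(\<integral>x. (norm (g x))\<^sup>2 \<partial>?U) \<le> ((Mx * \<gamma> * N) / (m * min lam 1))\<^sup>2"
    by (rule existence[OF fi bound]) ((assumption | rule that)+)
  have gn: "LpV_norm U 2 g = sqrt (\<integral>x. (norm (g x))\<^sup>2 \<partial>?U)"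
    unfolding LpV_norm_def by (simp add: powr_half_sqrt)
  have "sqrt (\<integral>x. (norm (g x))\<^sup>2 \<partial>?U) \<le> (Mx * \<gamma> * N) / (m * min lam 1)"
    using ug(4) Mx \<gamma> N0 m lam by (intro real_le_lsqrt) auto
  also have "\<dots> = (\<gamma> * N / min lam 1) * (Mx / m)" by (simp add: ac_simps)
  also have "\<dots> \<le> (\<gamma> * N / min lam 1) * K1"
    using KM m \<gamma> N0 lam by (intro mult_left_mono) (auto simp: pos_divide_le_eq)
  also have "\<dots> = K1 * \<gamma> / min lam 1 * N" by simp
  finally have g: "sqrt (\<integral>x. (norm (g x))\<^sup>2 \<partial>?U) \<le> K1 * \<gamma> / min lam 1 * N" .
  show ?thesis
  proof (rule that[of u g])
    show "weak_sol f u g" using ug unfolding weak_sol_def by blast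
    show "bform U A H c u g \<psi> = (\<integral>x. f x * \<psi> x \<partial>?U)" if "test_fun U \<psi>" for \<psi>
      by (rule weak_form_div_\<rho>[OF H012_L2(2)[OF ug(1)] ug(2) fi ug(3) that])
    show "LpV_norm U 2 g \<le> K1 * \<gamma> / min lam 1 * N" using g gn by simp
    have "Lp_norm U ?q u \<le> \<gamma> * sqrt (\<integral>x. (norm (g x))\<^sup>2 \<partial>?U)"
      unfolding Lp_norm_def \<gamma>_def by (rule sobolev_H012[OF ug(1)])
    also have "\<dots> \<le> \<gamma> * (K1 * \<gamma> / min lam 1 * N)" using g \<gamma> by (intro mult_left_mono) auto
    finally show "Lp_norm U ?q u \<le> \<gamma> * (K1 * \<gamma> / min lam 1 * N)" .
  qed
qed

text \<open>The one-sided bound is applied to \<open>u\<close> and to \<open>- u\<close>, which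
  solves the equation with \<open>- f\<close>.\<close>

lemma sup_bound:
  assumes sol: "weak_sol f u g" and p: "real CARD('n) / 2 < p" and f: "Lp U p f" and KM: "Mx \<le> K1 * m"
  defines "q \<equiv> 2 * real CARD('n) / (real CARD('n) - 2)" and "\<gamma> \<equiv> 2 * (real CARD('n) - 1) / (real CARD('n) - 2)"
  defines "\<beta> \<equiv> q * (1 - 1 / p - 1 / q)"
  defines "C \<equiv> 2 * (4 * exp 1 * (\<gamma>\<^sup>2 * (K1 / lam))) * (measure lebesgue U powr (1 / q)) powr (\<beta> - 1) * 2 powr (1 / (\<beta> - 1))"
  shows "Linf U u" "Linf_norm U u \<le> C * Lp_norm U p f"
proof -
  let ?U = "lebesgue_on U"
  have p1: "1 \<le> p" using p dim by simp
  have fi: "integrable ?U f" by (rule Lp_imp_integrable[OF finite_measure_U f p1])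
  have fp: "integrable ?U (\<lambda>x. \<bar>f x\<bar> powr p)" using f by (simp add: Lp_def)
  let ?N = "Lp_norm U p f"
  have K1: "0 \<le> K1" using KM m by (smt (verit) mult_less_0_iff)
  have C0: "0 \<le> C * ?N" unfolding C_def Lp_norm_def using K1 lam by (intro mult_nonneg_nonneg) auto
  \<comment> \<open>The iteration needs a strictly positive level, whereas \<open>C * ?N\<close> may
    be zero; the slack \<open>e\<close> is removed at the end.\<close>
  have AEb: "AE x in ?U. \<bar>u x\<bar> \<le> C * ?N + e" if e: "e > 0" for e
  proof -
    have D: "0 < C * ?N + e" using C0 e by linarith
    have D2: "2 * (4 * exp 1 * (\<gamma>\<^sup>2 * (K1 / lam)) * (\<integral>x. \<bar>f x\<bar> powr p \<partial>?U) powr (1 / p))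
      * (measure lebesgue U powr (1 / q)) powr (\<beta> - 1) * 2 powr (1 / (\<beta> - 1)) \<le> C * ?N + e"
    proof -
      have "2 * (4 * exp 1 * (\<gamma>\<^sup>2 * (K1 / lam)) * (\<integral>x. \<bar>f x\<bar> powr p \<partial>?U) powr (1 / p))
        * (measure lebesgue U powr (1 / q)) powr (\<beta> - 1) * 2 powr (1 / (\<beta> - 1)) = C * ?N"
        unfolding C_def Lp_norm_def by (simp only: ac_simps)
      then show ?thesis using e by linarith
    qed
    have "AE x in ?U. u x \<le> C * ?N + e"
      by (rule sup_bound_above[OF sol fi p fp KM D, folded q_def \<gamma>_def, folded \<beta>_def]) (rule D2)
    moreover have "AE x in ?U. - u x \<le> C * ?N + e"
    proof (rule sup_bound_above[OF weak_sol_minus[OF sol] _ p _ KM D, folded q_def \<gamma>_def, folded \<beta>_def])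
      show "integrable ?U (\<lambda>x. - f x)" using fi by simp
      show "integrable ?U (\<lambda>x. \<bar>- f x\<bar> powr p)" using fp by simp
      show "2 * (4 * exp 1 * (\<gamma>\<^sup>2 * (K1 / lam)) * (\<integral>x. \<bar>- f x\<bar> powr p \<partial>?U) powr (1 / p))
        * (measure lebesgue U powr (1 / q)) powr (\<beta> - 1) * 2 powr (1 / (\<beta> - 1)) \<le> C * ?N + e" using D2 by simp
    qed
    ultimately show ?thesis by eventually_elim linarith
  qed
  have um: "u \<in> borel_measurable ?U" using sol H012_L2(1) L2_measurable unfolding weak_sol_def by blast
  show "Linf U u" unfolding Linf_def using um AEb[of 1] by auto
  have "Linf_norm U u \<le> C * ?N + e" if e: "e > 0" for e
    unfolding Linf_norm_def
  proof (rule cInf_lower)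
    show "C * ?N + e \<in> {C. 0 \<le> C \<and> (AE x in ?U. \<bar>u x\<bar> \<le> C)}" using AEb[OF e] C0 e by simp
    show "bdd_below {C. 0 \<le> C \<and> (AE x in ?U. \<bar>u x\<bar> \<le> C)}" by (rule bdd_belowI[of _ 0]) simp
  qed
  then show "Linf_norm U u \<le> C * ?N" by (rule field_le_epsilon)
qed

end

section \<open>From the assumptions to the final estimates\<close>

lemma elliptic_of_Y2:
  fixes U :: "(real^'n::finite) set"
  assumes Y: "Y2 U A H p lam M" and R: "rho_K1 U A H \<rho> K1" and c: "Lp U 1 c" "AE x in lebesgue_on U. c x \<ge> 0"
  obtains g\<rho> m Mx where "elliptic U A H g\<rho> \<rho> c lam M m Mx" "Mx \<le> K1 * m" "K1 \<ge> 1"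
proof -
  have dim: "CARD('n) \<ge> 3" and bU: "bounded U" and oU: "open U" and p: "real CARD('n) < p" and H: "LpV U p H"
    and Am: "\<And>i j. (\<lambda>x. A x $ i $ j) \<in> borel_measurable lebesgue" and M: "M > 0" and lam: "lam > 0"
    and Ae: "AE x in lebesgue. (\<forall>\<xi>. (A x *v \<xi>) \<bullet> \<xi> \<ge> lam * (norm \<xi>)\<^sup>2) \<and> (\<forall>i j. \<bar>A x $ i $ j\<bar> \<le> M)"
    using Y unfolding Y2_def by auto
  have Us: "U \<in> sets lebesgue" using oU by (auto intro: borel_open)
  have fm: "finite_measure (lebesgue_on U)" by (rule finite_measure_lebesgue_on_bounded[OF bU Us])
  define m where "m = Inf (\<rho> ` closure U)"
  define Mx where "Mx = Sup (\<rho> ` closure U)"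
  have K1: "K1 \<ge> 1" and cont: "continuous_on (closure U) \<rho>" and b: "1 \<le> Mx" "Mx \<le> K1 * m" "K1 * m \<le> K1"
    using R unfolding rho_K1_def m_def Mx_def by auto
  obtain g\<rho> where g\<rho>: "H12 U \<rho> g\<rho>"
    "\<And>\<phi>. test_fun U \<phi> \<Longrightarrow> (\<integral>x. (transpose (A x) *v g\<rho> x + \<rho> x *\<^sub>R H x) \<bullet> grad \<phi> x \<partial>lebesgue_on U) = 0"
    using R unfolding rho_K1_def by blast
  have comp: "compact (\<rho> ` closure U)"
    using bU cont by (intro compact_continuous_image) (auto simp: compact_closure)
  \<comment> \<open>Positivity of the infimum is read off from
    \<open>1 \<le> Mx \<le> K1 * m\<close>.\<close>
  have m0: "0 < m"
  proof -
    have "0 < K1 * m" using b by linarith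
    then show ?thesis using K1 by (simp add: zero_less_mult_iff)
  qed
  have m1: "m \<le> 1"
  proof -
    have "K1 * m \<le> K1 * 1" using b by simp
    then show ?thesis using K1 by (simp add: mult_le_cancel_left)
  qed
  have bd: "m \<le> \<rho> x \<and> \<rho> x \<le> Mx" if "x \<in> U" for x
  proof -
    have x: "\<rho> x \<in> \<rho> ` closure U" using that closure_subset[of U] by blast
    have bb: "bounded (\<rho> ` closure U)" by (rule compact_imp_bounded[OF comp])
    show ?thesis unfolding m_def Mx_def
      using cInf_lower[OF x bounded_imp_bdd_below[OF bb]] cSup_upper[OF x bounded_imp_bdd_above[OF bb]] by blast
  qed
  have H2: "L2 (lebesgue_on U) H"
  proof -
    interpret finite_measure "lebesgue_on U" by (rule fm)
    have Hm: "H \<in> borel_measurable (lebesgue_on U)" and Hi: "integrable (lebesgue_on U) (\<lambda>x. norm (H x) powr p)"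
      using H by (auto simp: LpV_def)
    have "integrable (lebesgue_on U) (\<lambda>x. (norm (H x))\<^sup>2)"
    proof (rule Bochner_Integration.integrable_bound)
      show "integrable (lebesgue_on U) (\<lambda>x. 1 + norm (H x) powr p)" using Hi by simp
      have "(norm (H x))\<^sup>2 \<le> 1 + norm (H x) powr p" for x
        using powr_le_one_plus[of "norm (H x)" 2 p] p dim by simp
      then show "AE x in lebesgue_on U. norm ((norm (H x))\<^sup>2) \<le> norm (1 + norm (H x) powr p)" by (intro AE_I2) simp
    qed (use Hm in measurable)
    then show ?thesis using Hm by (simp add: L2_def)
  qed
  have "elliptic U A H g\<rho> \<rho> c lam M m Mx"
  proof
    show "(\<lambda>x. A x $ i $ j) \<in> borel_measurable (lebesgue_on U)" for i j by (rule measurable_restrict_space1[OF Am])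
    show "AE x in lebesgue_on U. (\<forall>\<xi>. lam * (norm \<xi>)\<^sup>2 \<le> (A x *v \<xi>) \<bullet> \<xi>) \<and> (\<forall>i j. \<bar>A x $ i $ j\<bar> \<le> M)"
      using Ae Us by (subst AE_restrict_space_iff) auto
    show "continuous_on U \<rho>" by (rule continuous_on_subset[OF cont closure_subset])
    show "integrable (lebesgue_on U) c" using c(1) by (rule Lp_imp_integrable[OF fm]) simp
    show "m \<le> Mx" using m1 b by linarith
  qed (fact dim bU oU H2 lam M bd m0 g\<rho> c)+
  then show ?thesis using that b K1 by blast
qed

theorem mainTheorem11:
  assumes "CARD('n::finite) \<ge> 3"
  shows "\<exists>Ct :: real \<Rightarrow> real \<Rightarrow> real \<Rightarrow> real. \<exists>C2 :: real \<Rightarrow> real \<Rightarrow> real \<Rightarrow> real \<Rightarrow> real \<Rightarrow> real.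
   (\<forall>lam M K1. Ct lam M K1 > 0) \<and> (\<forall>lam M ph mU K1. C2 lam M ph mU K1 > 0) \<and>
   (\<forall>(U :: (real^'n) set) A H p lam M \<rho> K1 (c :: real^'n \<Rightarrow> real).
     Y2 U A H p lam M \<and> rho_K1 U A H \<rho> K1 \<and> Lp U 1 c \<and> (AE x in lebesgue_on U. c x \<ge> 0) \<longrightarrow>
     (let d = real CARD('n); C1 = 2 * (d - 1) / (d - 2) * Ct lam M K1 in
      (\<forall>v g. H012 U v g \<and> integrable (lebesgue_on U) (\<lambda>x. c x * v x) \<and>
             (\<forall>\<psi>. test_fun U \<psi> \<longrightarrow> bform U A H c v g \<psi> = 0)
          \<longrightarrow> (AE x in lebesgue_on U. v x = 0)) \<and>
      (\<forall>f. Lp U (2 * d / (d + 2)) c \<and> Lp U (2 * d / (d + 2)) f \<longrightarrow>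
          (\<exists>u g. H012 U u g \<and>
             (\<forall>\<psi>. test_fun U \<psi> \<longrightarrow> bform U A H c u g \<psi> = (\<integral>x. f x * \<psi> x \<partial>lebesgue_on U)) \<and>
             LpV_norm U 2 g \<le> Ct lam M K1 * Lp_norm U (2 * d / (d + 2)) f \<and>
             Lp_norm U (2 * d / (d - 2)) u \<le> C1 * Lp_norm U (2 * d / (d + 2)) f)) \<and>
      (\<forall>f ph. d < ph \<and> Lp U (ph * d / (d + ph)) f \<longrightarrow>
          (\<exists>u g. H012 U u g \<and> Linf U u \<and>
             (\<forall>\<psi>. test_fun U \<psi> \<longrightarrow> bform U A H c u g \<psi> = (\<integral>x. f x * \<psi> x \<partial>lebesgue_on U)) \<and>
             LpV_norm U 2 g \<le> Ct lam M K1 * Lp_norm U (2 * d / (d + 2)) f \<and>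
             Lp_norm U (2 * d / (d - 2)) u \<le> C1 * Lp_norm U (2 * d / (d + 2)) f \<and>
             Linf_norm U u \<le> C2 lam M ph (measure lebesgue U) K1 * Lp_norm U (ph * d / (d + ph)) f))))"
proof -
  define d where "d = real CARD('n)"
  define \<gamma> where "\<gamma> = 2 * (d - 1) / (d - 2)"
  define q where "q = 2 * d / (d - 2)"
  define \<beta> where "\<beta> ph = q * (1 - 1 / (ph * d / (d + ph)) - 1 / q)" for ph
  \<comment> \<open>The constants are fixed before the data and must be positive for all real
    arguments; the maximum with one ensures this and only weakens the estimates.\<close>
  define Ct :: "real \<Rightarrow> real \<Rightarrow> real \<Rightarrow> real" where "Ct lam M K1 = max 1 (K1 * \<gamma> / min lam 1)" for lam M K1
  define C2' :: "real \<Rightarrow> real \<Rightarrow> real \<Rightarrow> real \<Rightarrow> real" where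
    "C2' lam ph mU K1 = 2 * (4 * exp 1 * (\<gamma>\<^sup>2 * (K1 / lam))) * (mU powr (1 / q)) powr (\<beta> ph - 1) * 2 powr (1 / (\<beta> ph - 1))" for lam ph mU K1
  define C2 :: "real \<Rightarrow> real \<Rightarrow> real \<Rightarrow> real \<Rightarrow> real \<Rightarrow> real" where "C2 lam M ph mU K1 = max 1 (C2' lam ph mU K1)" for lam M ph mU K1
  have d3: "d \<ge> 3" using assms by (simp add: d_def)
  have \<gamma>0: "\<gamma> > 0" using d3 by (simp add: \<gamma>_def)
  have main: "(\<forall>v g. H012 U v g \<and> integrable (lebesgue_on U) (\<lambda>x. c x * v x) \<and>
             (\<forall>\<psi>. test_fun U \<psi> \<longrightarrow> bform U A H c v g \<psi> = 0)
          \<longrightarrow> (AE x in lebesgue_on U. v x = 0)) \<and>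
      (\<forall>f. Lp U (2 * d / (d + 2)) c \<and> Lp U (2 * d / (d + 2)) f \<longrightarrow>
          (\<exists>u g. H012 U u g \<and>
             (\<forall>\<psi>. test_fun U \<psi> \<longrightarrow> bform U A H c u g \<psi> = (\<integral>x. f x * \<psi> x \<partial>lebesgue_on U)) \<and>
             LpV_norm U 2 g \<le> Ct lam M K1 * Lp_norm U (2 * d / (d + 2)) f \<and>
             Lp_norm U (2 * d / (d - 2)) u \<le> \<gamma> * Ct lam M K1 * Lp_norm U (2 * d / (d + 2)) f)) \<and>
      (\<forall>f ph. d < ph \<and> Lp U (ph * d / (d + ph)) f \<longrightarrow>
          (\<exists>u g. H012 U u g \<and> Linf U u \<and>
             (\<forall>\<psi>. test_fun U \<psi> \<longrightarrow> bform U A H c u g \<psi> = (\<integral>x. f x * \<psi> x \<partial>lebesgue_on U)) \<and>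
             LpV_norm U 2 g \<le> Ct lam M K1 * Lp_norm U (2 * d / (d + 2)) f \<and>
             Lp_norm U (2 * d / (d - 2)) u \<le> \<gamma> * Ct lam M K1 * Lp_norm U (2 * d / (d + 2)) f \<and>
             Linf_norm U u \<le> C2 lam M ph (measure lebesgue U) K1 * Lp_norm U (ph * d / (d + ph)) f))"
    if Y: "Y2 U A H p lam M" and R: "rho_K1 U A H \<rho> K1" and c: "Lp U 1 c" "AE x in lebesgue_on U. c x \<ge> 0"
    for U :: "(real^'n) set" and A H p lam M \<rho> K1 and c :: "real^'n \<Rightarrow> real"
  proof -
    obtain g\<rho> m Mx where el: "elliptic U A H g\<rho> \<rho> c lam M m Mx" and KM: "Mx \<le> K1 * m" and K1: "K1 \<ge> 1"
      by (rule elliptic_of_Y2[OF Y R c])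
    interpret elliptic U A H g\<rho> \<rho> c lam M m Mx by (rule el)
    have sol: "\<exists>u g. weak_sol f u g \<and> (\<forall>\<psi>. test_fun U \<psi> \<longrightarrow> bform U A H c u g \<psi> = (\<integral>x. f x * \<psi> x \<partial>lebesgue_on U)) \<and>
        LpV_norm U 2 g \<le> Ct lam M K1 * Lp_norm U (2 * d / (d + 2)) f \<and>
        Lp_norm U (2 * d / (d - 2)) u \<le> \<gamma> * Ct lam M K1 * Lp_norm U (2 * d / (d + 2)) f"
      if f: "Lp U (2 * d / (d + 2)) f" for f
    proof -
      let ?N = "Lp_norm U (2 * d / (d + 2)) f"
      have N0: "?N \<ge> 0" by (simp add: Lp_norm_def)
      have le: "K1 * \<gamma> / min lam 1 * ?N \<le> Ct lam M K1 * ?N" unfolding Ct_def by (intro mult_right_mono N0) simp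
      obtain u g where ug: "weak_sol f u g" "\<And>\<psi>. test_fun U \<psi> \<Longrightarrow> bform U A H c u g \<psi> = (\<integral>x. f x * \<psi> x \<partial>lebesgue_on U)"
        "LpV_norm U 2 g \<le> K1 * \<gamma> / min lam 1 * ?N" "Lp_norm U (2 * d / (d - 2)) u \<le> \<gamma> * (K1 * \<gamma> / min lam 1 * ?N)"
        by (rule solution_Lp[OF f[unfolded d_def] KM, folded d_def, folded \<gamma>_def]) ((assumption | rule that)+)
      have "\<gamma> * (K1 * \<gamma> / min lam 1 * ?N) \<le> \<gamma> * (Ct lam M K1 * ?N)" using le \<gamma>0 by (intro mult_left_mono) auto
      then have "Lp_norm U (2 * d / (d - 2)) u \<le> \<gamma> * Ct lam M K1 * ?N" using ug(4) by (simp only: mult.assoc)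
      moreover have "LpV_norm U 2 g \<le> Ct lam M K1 * ?N" using ug(3) le by linarith
      ultimately show ?thesis using ug(1,2) by blast
    qed
    show ?thesis
    proof (intro conjI allI impI; (elim conjE)?)
      fix v g assume v: "H012 U v g" "integrable (lebesgue_on U) (\<lambda>x. c x * v x)"
        "\<forall>\<psi>. test_fun U \<psi> \<longrightarrow> bform U A H c v g \<psi> = 0"
      have i0: "integrable (lebesgue_on U) (\<lambda>x. 0::real)" by simp
      have w: "bform U A H c v g \<psi> = (\<integral>x. 0 * \<psi> x \<partial>lebesgue_on U)" if "test_fun U \<psi>" for \<psi> using v(3) that by simp
      have "weak_sol (\<lambda>x. 0) v g"
        unfolding weak_sol_def using v weak_form_times_\<rho>[OF H012_L2(2)[OF v(1)] v(2) i0 w] by blast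
      then show "AE x in lebesgue_on U. v x = 0" by (rule weak_sol_unique)
    next
      fix f assume "Lp U (2 * d / (d + 2)) f"
      from sol[OF this] show "\<exists>u g. H012 U u g \<and>
             (\<forall>\<psi>. test_fun U \<psi> \<longrightarrow> bform U A H c u g \<psi> = (\<integral>x. f x * \<psi> x \<partial>lebesgue_on U)) \<and>
             LpV_norm U 2 g \<le> Ct lam M K1 * Lp_norm U (2 * d / (d + 2)) f \<and>
             Lp_norm U (2 * d / (d - 2)) u \<le> \<gamma> * Ct lam M K1 * Lp_norm U (2 * d / (d + 2)) f"
        unfolding weak_sol_def by blast
    next
      fix f ph assume ph: "d < ph" and f: "Lp U (ph * d / (d + ph)) f"
      let ?p = "ph * d / (d + ph)"
      \<comment> \<open>Equivalent to \<open>d < ph\<close>: this is where the assumption on the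
        integrability of \<open>f\<close> meets the threshold of the sup bound.\<close>
      have p: "d / 2 < ?p" using ph d3 by (simp add: field_simps)
      have "2 * d / (d + 2) \<le> d / 2" using d3 by (simp add: field_simps)
      then have "2 * d / (d + 2) \<le> ?p" using p by linarith
      \<comment> \<open>By inclusion of Lebesgue spaces on the bounded set \<open>U\<close>, the
        solution from the energy estimate is available and only its sup bound remains to be
        added.\<close>
      then have f2: "Lp U (2 * d / (d + 2)) f" using d3 by (intro Lp_mono[OF finite_measure_U f]) auto
      from sol[OF f2] obtain u g where ug: "weak_sol f u g" "\<forall>\<psi>. test_fun U \<psi> \<longrightarrow> bform U A H c u g \<psi> = (\<integral>x. f x * \<psi> x \<partial>lebesgue_on U)"
        "LpV_norm U 2 g \<le> Ct lam M K1 * Lp_norm U (2 * d / (d + 2)) f"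
        "Lp_norm U (2 * d / (d - 2)) u \<le> \<gamma> * Ct lam M K1 * Lp_norm U (2 * d / (d + 2)) f" by blast
      note sb = sup_bound[OF ug(1) p[unfolded d_def] f[unfolded d_def] KM]
      have "Linf_norm U u \<le> C2' lam ph (measure lebesgue U) K1 * Lp_norm U ?p f"
        using sb(2) unfolding C2'_def \<beta>_def q_def \<gamma>_def d_def .
      also have "\<dots> \<le> C2 lam M ph (measure lebesgue U) K1 * Lp_norm U ?p f"
        unfolding C2_def by (intro mult_right_mono) (auto simp: Lp_norm_def)
      finally have "Linf_norm U u \<le> C2 lam M ph (measure lebesgue U) K1 * Lp_norm U ?p f" .
      then show "\<exists>u g. H012 U u g \<and> Linf U u \<and>
             (\<forall>\<psi>. test_fun U \<psi> \<longrightarrow> bform U A H c u g \<psi> = (\<integral>x. f x * \<psi> x \<partial>lebesgue_on U)) \<and>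
             LpV_norm U 2 g \<le> Ct lam M K1 * Lp_norm U (2 * d / (d + 2)) f \<and>
             Lp_norm U (2 * d / (d - 2)) u \<le> \<gamma> * Ct lam M K1 * Lp_norm U (2 * d / (d + 2)) f \<and>
             Linf_norm U u \<le> C2 lam M ph (measure lebesgue U) K1 * Lp_norm U ?p f"
        using ug sb(1) unfolding weak_sol_def by blast
    qed
  qed
  show ?thesis
  proof (intro exI[of _ Ct] exI[of _ C2] conjI allI impI)
    show "0 < Ct lam M K1" "0 < C2 lam M ph mU K1" for lam M ph mU K1 by (simp_all add: Ct_def C2_def)
  next
    fix U :: "(real^'n) set" and A H p lam M \<rho> K1 and c :: "real^'n \<Rightarrow> real"
    assume a: "Y2 U A H p lam M \<and> rho_K1 U A H \<rho> K1 \<and> Lp U 1 c \<and> (AE x in lebesgue_on U. 0 \<le> c x)"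
    note main[of U A H p lam M \<rho> K1 c, unfolded \<gamma>_def d_def]
    then show "let d = real CARD('n); C1 = 2 * (d - 1) / (d - 2) * Ct lam M K1 in
      (\<forall>v g. H012 U v g \<and> integrable (lebesgue_on U) (\<lambda>x. c x * v x) \<and>
             (\<forall>\<psi>. test_fun U \<psi> \<longrightarrow> bform U A H c v g \<psi> = 0)
          \<longrightarrow> (AE x in lebesgue_on U. v x = 0)) \<and>
      (\<forall>f. Lp U (2 * d / (d + 2)) c \<and> Lp U (2 * d / (d + 2)) f \<longrightarrow>
          (\<exists>u g. H012 U u g \<and>
             (\<forall>\<psi>. test_fun U \<psi> \<longrightarrow> bform U A H c u g \<psi> = (\<integral>x. f x * \<psi> x \<partial>lebesgue_on U)) \<and>
             LpV_norm U 2 g \<le> Ct lam M K1 * Lp_norm U (2 * d / (d + 2)) f \<and>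
             Lp_norm U (2 * d / (d - 2)) u \<le> C1 * Lp_norm U (2 * d / (d + 2)) f)) \<and>
      (\<forall>f ph. d < ph \<and> Lp U (ph * d / (d + ph)) f \<longrightarrow>
          (\<exists>u g. H012 U u g \<and> Linf U u \<and>
             (\<forall>\<psi>. test_fun U \<psi> \<longrightarrow> bform U A H c u g \<psi> = (\<integral>x. f x * \<psi> x \<partial>lebesgue_on U)) \<and>
             LpV_norm U 2 g \<le> Ct lam M K1 * Lp_norm U (2 * d / (d + 2)) f \<and>
             Lp_norm U (2 * d / (d - 2)) u \<le> C1 * Lp_norm U (2 * d / (d + 2)) f \<and>
             Linf_norm U u \<le> C2 lam M ph (measure lebesgue U) K1 * Lp_norm U (ph * d / (d + ph)) f))"
      using a unfolding Let_def by blast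
  qed
qed

end
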